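(* Let $\boldsymbol{\hat\rho}_{S_0}=|\psi_{S_0}\rangle\langle\psi_{S_0}|$ be a pure state on $L^2(\mathbb R)$ and let $\boldsymbol{\hat\rho}^{E,0}=|\psi_{E,0}\rangle\langle\psi_{E,0}|$ be a pure state on $\mathscr H_E$. Fix $t>0$ and a PVM $\{\mathbf{\hat P}_{\Delta_{i,t}}\}_i$ on the system, and let $\boldsymbol{\hat\rho}_t=\mathscr U_t\big(\mathscr E_t(\boldsymbol{\hat\rho}_{S_0})\otimes\boldsymbol{\hat\rho}^{E,0}\big)$. Then $$\min_{PVM}\frac12\Big\|\sum_i\big(\mathbf{\hat P}_{\Delta_{i,t}}\otimes\mathbb I\big)\boldsymbol{\hat\rho}_t\big(\mathbf{\hat P}_{\Delta_{i,t}}\otimes\mathbb I\big)-\frac1{\mathscr N(t)}\sum_i\big(\mathbf{\hat P}_{\Delta_{i,t}}\otimes\mathbf{\hat P}^{E,t}_i\big)\boldsymbol{\hat\rho}_t\big(\mathbf{\hat P}_{\Delta_{i,t}}\otimes\mathbf{\hat P}^{E,t}_i\big)\Big\|_1$$ $$\le 4\min_{PVM}\sqrt{\sum_i\bar p_i(t)\Big(1-\mathrm{Tr}\big\{\mathbf{\hat P}^{E,t}_i\,\Lambda_{i,t}\big(|\psi_{E,0}\rangle\langle\psi_{E,0}|\big)\,\mathbf{\hat P}^{E,t}_i\big\}\Big)},$$ where both minima are over all PVMs $\{\mathbf{\hat P}^{E,t}_i\}_i$ on $\mathscr H_E$ and $$\Lambda_{i,t}(\boldsymbol{\hat\rho}):=\int_{\mathbb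 R}|\psi_{S_{i,t}}(x)|^2\,e^{-it\gamma x\mathbf{\hat B}}\,\boldsymbol{\hat\rho}\,e^{it\gamma x\mathbf{\hat B}}\,dx .$$
   Context: Setting. $\mathscr H_S=L^2(\mathbb R)$; $\mathbf{\hat X}$ is the position operator on it (multiplication by $x$). $\mathscr H_E,\mathscr H_{E'}$ are Hilbert spaces with self-adjoint operators $\mathbf{\hat B},\mathbf{\hat B}'$ respectively; $\gamma,\gamma'\in\mathbb R$; $\boldsymbol{\hat\rho}^{E',0}$ is a density operator on $\mathscr H_{E'}$. $\|\cdot\|_1$ is the trace norm. Bra-ket integrals $\int\int K(x,y)|x\rangle\langle y|\,dx\,dy$ denote the integral operator on $L^2(\mathbb R)$ with kernel $K(x,y)$; $\langle x|\boldsymbol{\hat\sigma}|y\rangle$ denotes the kernel of $\boldsymbol{\hat\sigma}$. Maps. $\mathscr U_t(\mathbf{\hat A}):=e^{-it\gamma\mathbf{\hat X}\otimes\mathbf{\hat B}}\mathbf{\hat A}\,e^{it\gamma\mathbf{\hat X}\otimes\mathbf{\hat B}}$. The decoherence map is $\mathscr E_t(\boldsymbol{\hat\sigma}):=\int\int\langle x|\boldsymbol{\hat\sigma}|y\rangle\,\Gamma(t,x,y)\,|x\rangle\langle y|\,dx\,dy$ with $\Gamma(t,x,y):=\mathrm{Tr}\{e^{-it\gamma'(x-y)\mathbf{\hat B}'}\boldsymbol{\hat\rho}^{E',0}\}$; equivalently $\mathscr E_t(\boldsymbol{\hat\sigma})=\mathrm{Tr}_{E'}\{e^{-it\gamma'\mathbf{\hat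 X}\otimes\mathbf{\hat B}'}(\boldsymbol{\hat\sigma}\otimes\boldsymbol{\hat\rho}^{E',0})e^{it\gamma'\mathbf{\hat X}\otimes\mathbf{\hat B}'}\}$. System PVM. $\{\Delta_{i,t}\}_i$ is a countable partition of $\mathbb R$ into measurable sets and $\mathbf{\hat P}_{\Delta_{i,t}}:=\chi_{\Delta_{i,t}}(\mathbf{\hat X})$ (multiplication by the indicator function). Conditional states. $\bar p_i(t):=\int_{\Delta_{i,t}}|\psi_{S_0}(x)|^2dx$ and $\psi_{S_{i,t}}(x):=\mathbb 1_{\Delta_{i,t}}(x)\psi_{S_0}(x)/\sqrt{\bar p_i(t)}$; terms with $\bar p_i(t)=0$ are omitted (counted as zero). Environment PVM. A PVM $\{\mathbf{\hat P}^{E,t}_i\}_i$ on $\mathscr H_E$ is a family of mutually orthogonal orthogonal projections, indexed by the same set as $\{\Delta_{i,t}\}_i$, summing (strongly) to $\mathbb I$. $\mathscr N(t)$ is the trace of $\sum_i(\mathbf{\hat P}_{\Delta_{i,t}}\otimes\mathbf{\hat P}^{E,t}_i)\boldsymbol{\hat\rho}_t(\mathbf{\hat P}_{\Delta_{i,t}}\otimes\mathbf{\hat P}^{E,t}_i)$; on the left-hand side only PVMs with $\mathscr N(t)>0$ are considered. $\min_{PVM}$ is understood as an infimum. *)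

theory Defs
  imports "HOL-Analysis.Analysis"
begin

section \<open>Complex Hilbert spaces\<close>

text \<open>The inner product is conjugate-linear in its first argument.  Norm and topology are those
  of the underlying real inner product space.\<close>

class complex_inner = real_inner +
  fixes scaleC :: "complex \<Rightarrow> 'a \<Rightarrow> 'a"  (infixr \<open>*\<^sub>C\<close> 75)
    and cinner :: "'a \<Rightarrow> 'a \<Rightarrow> complex"
  assumes scaleC_add_right: "c *\<^sub>C (x + y) = c *\<^sub>C x + c *\<^sub>C y"
    and scaleC_add_left: "(c + d) *\<^sub>C x = c *\<^sub>C x + d *\<^sub>C x"
    and scaleC_scaleC: "c *\<^sub>C (d *\<^sub>C x) = (c * d) *\<^sub>C x"
    and scaleC_of_real: "complex_of_real r *\<^sub>C x = r *\<^sub>R x"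
    and cinner_commute: "cinner x y = cnj (cinner y x)"
    and cinner_add_right: "cinner x (y + z) = cinner x y + cinner x z"
    and cinner_scaleC_right: "cinner x (c *\<^sub>C y) = c * cinner x y"
    and Re_cinner: "Re (cinner x y) = inner x y"

class chilbert_space = complex_inner + complete_space


section \<open>The space $L^2(\mathbb{R})$\<close>

definition square_integrable :: "(real \<Rightarrow> complex) \<Rightarrow> bool" where
  "square_integrable f \<longleftrightarrow>
     f \<in> borel_measurable lebesgue \<and> integrable lebesgue (\<lambda>x. (cmod (f x))\<^sup>2)"

definition l2_rel :: "(real \<Rightarrow> complex) \<Rightarrow> (real \<Rightarrow> complex) \<Rightarrow> bool" where
  "l2_rel f g \<longleftrightarrow> square_integrable f \<and> square_integrable g \<and> (AE x in lebesgue. f x = g x)"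

lemma square_integrable_0: "square_integrable (\<lambda>x. 0)"
  by (simp add: square_integrable_def)

lemma square_integrable_add:
  assumes "square_integrable f" "square_integrable g"
  shows "square_integrable (\<lambda>x. f x + g x)"
proof -
  have m: "f \<in> borel_measurable lebesgue" "g \<in> borel_measurable lebesgue"
    using assms by (auto simp: square_integrable_def)
  have "integrable lebesgue (\<lambda>x. (cmod (f x + g x))\<^sup>2)"
  proof (rule Bochner_Integration.integrable_bound)
    show "integrable lebesgue (\<lambda>x. 2 * (cmod (f x))\<^sup>2 + 2 * (cmod (g x))\<^sup>2)"
      using assms by (auto simp: square_integrable_def)
    show "(\<lambda>x. (cmod (f x + g x))\<^sup>2) \<in> borel_measurable lebesgue"
      using m by measurable
    have "(cmod (f x + g x))\<^sup>2 \<le> 2 * (cmod (f x))\<^sup>2 + 2 * (cmod (g x))\<^sup>2" for x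
    proof -
      have "(cmod (f x + g x))\<^sup>2 \<le> (cmod (f x) + cmod (g x))\<^sup>2"
        by (intro power_mono norm_triangle_ineq) auto
      also have "\<dots> \<le> 2 * (cmod (f x))\<^sup>2 + 2 * (cmod (g x))\<^sup>2"
        using sum_squares_bound[of "cmod (f x)" "cmod (g x)"] by (simp add: power2_sum)
      finally show ?thesis .
    qed
    then show "AE x in lebesgue. norm ((cmod (f x + g x))\<^sup>2)
        \<le> norm (2 * (cmod (f x))\<^sup>2 + 2 * (cmod (g x))\<^sup>2)"
      by simp
  qed
  then show ?thesis using m by (simp add: square_integrable_def)
qed

lemma square_integrable_cmult:
  assumes "square_integrable f"
  shows "square_integrable (\<lambda>x. c * f x)"
  using assms by (auto simp: square_integrable_def norm_mult power_mult_distrib)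

lemma square_integrable_diff:
  assumes "square_integrable f" "square_integrable g"
  shows "square_integrable (\<lambda>x. f x - g x)"
  using square_integrable_add[OF assms(1) square_integrable_cmult[OF assms(2), of "-1"]] by simp

lemma square_integrable_mult:
  assumes "square_integrable f" "square_integrable g"
  shows "integrable lebesgue (\<lambda>x. cnj (f x) * g x)"
proof (rule Bochner_Integration.integrable_bound)
  have m: "f \<in> borel_measurable lebesgue" "g \<in> borel_measurable lebesgue"
    using assms by (auto simp: square_integrable_def)
  have [measurable]: "cnj \<in> borel_measurable borel"
    by (intro borel_measurable_continuous_onI continuous_intros)
  show "(\<lambda>x. cnj (f x) * g x) \<in> borel_measurable lebesgue"
    using m by measurable
  show "integrable lebesgue (\<lambda>x. (cmod (f x))\<^sup>2 + (cmod (g x))\<^sup>2)"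
    using assms by (auto simp: square_integrable_def)
  have "cmod (f x) * cmod (g x) \<le> (cmod (f x))\<^sup>2 + (cmod (g x))\<^sup>2" for x
  proof -
    have "0 \<le> cmod (f x) * cmod (g x)" by simp
    then show ?thesis using sum_squares_bound[of "cmod (f x)" "cmod (g x)"] by linarith
  qed
  then show "AE x in lebesgue. norm (cnj (f x) * g x) \<le> norm ((cmod (f x))\<^sup>2 + (cmod (g x))\<^sup>2)"
    by (simp add: norm_mult)
qed

quotient_type l2 = "real \<Rightarrow> complex" / partial: l2_rel
  morphisms l2_fun l2_of
proof (rule part_equivpI)
  show "\<exists>f. l2_rel f f"
    using square_integrable_0 by (auto simp: l2_rel_def)
  show "symp l2_rel"
    by (auto simp: symp_def l2_rel_def)
  show "transp l2_rel"
    unfolding transp_def l2_rel_def by auto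
qed

text \<open>\<open>l2_fun f\<close> is a chosen representative of the class \<open>f\<close>; \<open>l2_of g\<close> is the class of \<open>g\<close>,
  meaningful for square-integrable \<open>g\<close> only.\<close>

lemma l2_fun_square_integrable: "square_integrable (l2_fun f)"
  using Quotient_rep_reflp[OF Quotient_l2, of f] by (simp add: l2_rel_def)

lemma l2_fun_measurable [measurable]: "l2_fun f \<in> borel_measurable lebesgue"
  using l2_fun_square_integrable[of f] by (simp add: square_integrable_def)

lemma l2_of_l2_fun: "l2_of (l2_fun f) = f"
  using Quotient_abs_rep[OF Quotient_l2, of f] by (simp add:)

lemma l2_of_eq_iff:
  assumes "square_integrable f" "square_integrable g"
  shows "l2_of f = l2_of g \<longleftrightarrow> (AE x in lebesgue. f x = g x)"
  using Quotient_rel[OF Quotient_l2, of f g] assms by (simp add: l2_rel_def)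

lemma l2_fun_l2_of:
  assumes "square_integrable f"
  shows "AE x in lebesgue. l2_fun (l2_of f) x = f x"
  using l2_of_eq_iff[OF l2_fun_square_integrable assms, of "l2_of f"] by (simp add: l2_of_l2_fun)

lemma l2_eq_iff: "f = g \<longleftrightarrow> (AE x in lebesgue. l2_fun f x = l2_fun g x)"
  using l2_of_eq_iff[OF l2_fun_square_integrable l2_fun_square_integrable, of f g]
  by (simp add: l2_of_l2_fun)

instantiation l2 :: complex_inner
begin

definition zero_l2 :: l2 where "zero_l2 = l2_of (\<lambda>x. 0)"
definition plus_l2 :: "l2 \<Rightarrow> l2 \<Rightarrow> l2" where "plus_l2 f g = l2_of (\<lambda>x. l2_fun f x + l2_fun g x)"
definition minus_l2 :: "l2 \<Rightarrow> l2 \<Rightarrow> l2" where "minus_l2 f g = l2_of (\<lambda>x. l2_fun f x - l2_fun g x)"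
definition uminus_l2 :: "l2 \<Rightarrow> l2" where "uminus_l2 f = l2_of (\<lambda>x. - l2_fun f x)"
definition scaleC_l2 :: "complex \<Rightarrow> l2 \<Rightarrow> l2" where "scaleC_l2 c f = l2_of (\<lambda>x. c * l2_fun f x)"
definition scaleR_l2 :: "real \<Rightarrow> l2 \<Rightarrow> l2" where
  "scaleR_l2 r f = l2_of (\<lambda>x. complex_of_real r * l2_fun f x)"
definition cinner_l2 :: "l2 \<Rightarrow> l2 \<Rightarrow> complex" where
  "cinner_l2 f g = (\<integral>x. cnj (l2_fun f x) * l2_fun g x \<partial>lebesgue)"
definition inner_l2 :: "l2 \<Rightarrow> l2 \<Rightarrow> real" where "inner_l2 f g = Re (cinner f g)"
definition norm_l2 :: "l2 \<Rightarrow> real" where "norm_l2 f = sqrt (inner f f)"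
definition sgn_l2 :: "l2 \<Rightarrow> l2" where "sgn_l2 f = inverse (norm f) *\<^sub>R f"
definition dist_l2 :: "l2 \<Rightarrow> l2 \<Rightarrow> real" where "dist_l2 f g = norm (f - g)"
definition uniformity_l2 :: "(l2 \<times> l2) filter" where
  "uniformity_l2 = (INF e\<in>{0<..}. principal {(f, g). dist f g < e})"
definition open_l2 :: "l2 set \<Rightarrow> bool" where
  "open_l2 S \<longleftrightarrow> (\<forall>f\<in>S. eventually (\<lambda>(f', g). f' = f \<longrightarrow> g \<in> S) uniformity)"

lemma l2_fun_zero: "AE x in lebesgue. l2_fun 0 x = 0"
  unfolding zero_l2_def by (rule l2_fun_l2_of[OF square_integrable_0])

lemma l2_fun_plus: "AE x in lebesgue. l2_fun (f + g) x = l2_fun f x + l2_fun g x"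
  unfolding plus_l2_def
  by (rule l2_fun_l2_of[OF square_integrable_add[OF l2_fun_square_integrable l2_fun_square_integrable]])

lemma l2_fun_minus: "AE x in lebesgue. l2_fun (f - g) x = l2_fun f x - l2_fun g x"
  unfolding minus_l2_def
  by (rule l2_fun_l2_of[OF square_integrable_diff[OF l2_fun_square_integrable l2_fun_square_integrable]])

lemma l2_fun_uminus: "AE x in lebesgue. l2_fun (- f) x = - l2_fun f x"
  unfolding uminus_l2_def
  using l2_fun_l2_of[OF square_integrable_cmult[OF l2_fun_square_integrable, of "-1" f]] by simp

lemma l2_fun_scaleC: "AE x in lebesgue. l2_fun (c *\<^sub>C f) x = c * l2_fun f x"
  unfolding scaleC_l2_def
  by (rule l2_fun_l2_of[OF square_integrable_cmult[OF l2_fun_square_integrable]])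

lemma l2_fun_scaleR: "AE x in lebesgue. l2_fun (r *\<^sub>R f) x = complex_of_real r * l2_fun f x"
  unfolding scaleR_l2_def
  by (rule l2_fun_l2_of[OF square_integrable_cmult[OF l2_fun_square_integrable]])

lemma cinner_l2_integrable: "integrable lebesgue (\<lambda>x. cnj (l2_fun f x) * l2_fun g x)"
  by (rule square_integrable_mult[OF l2_fun_square_integrable l2_fun_square_integrable])

lemma cinner_l2_cong:
  assumes "square_integrable g'" "AE x in lebesgue. l2_fun g x = g' x"
  shows "cinner f g = (\<integral>x. cnj (l2_fun f x) * g' x \<partial>lebesgue)"
  unfolding cinner_l2_def
proof (rule integral_cong_AE)
  show "(\<lambda>x. cnj (l2_fun f x) * l2_fun g x) \<in> borel_measurable lebesgue"
    using cinner_l2_integrable by (rule borel_measurable_integrable)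
  show "(\<lambda>x. cnj (l2_fun f x) * g' x) \<in> borel_measurable lebesgue"
    using square_integrable_mult[OF l2_fun_square_integrable assms(1)]
    by (rule borel_measurable_integrable)
  show "AE x in lebesgue. cnj (l2_fun f x) * l2_fun g x = cnj (l2_fun f x) * g' x"
    using assms(2) by eventually_elim simp
qed

lemma cinner_l2_self: "cinner f f = complex_of_real (\<integral>x. (cmod (l2_fun f x))\<^sup>2 \<partial>lebesgue)"
proof -
  have "cinner f f = (\<integral>x. complex_of_real ((cmod (l2_fun f x))\<^sup>2) \<partial>lebesgue)"
    unfolding cinner_l2_def by (simp add: mult.commute[of "cnj _"] flip: complex_norm_square)
  then show ?thesis by (simp only: integral_complex_of_real)
qed

lemma inner_l2_self: "inner f f = (\<integral>x. (cmod (l2_fun f x))\<^sup>2 \<partial>lebesgue)" for f :: l2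
  by (simp add: inner_l2_def cinner_l2_self)

lemma cinner_l2_commute: "cinner f g = cnj (cinner g f)" for f g :: l2
proof -
  have "cnj (cinner g f) = (\<integral>x. cnj (cnj (l2_fun g x) * l2_fun f x) \<partial>lebesgue)"
    unfolding cinner_l2_def by (rule sym, rule Bochner_Integration.integral_cnj)
  then show ?thesis by (simp add: cinner_l2_def mult.commute)
qed

lemma cinner_l2_add_right: "cinner f (g + h) = cinner f g + cinner f h" for f g h :: l2
proof -
  have "cinner f (g + h) = (\<integral>x. cnj (l2_fun f x) * (l2_fun g x + l2_fun h x) \<partial>lebesgue)"
    by (rule cinner_l2_cong)
      (auto intro: square_integrable_add l2_fun_square_integrable l2_fun_plus)
  also have "\<dots> = cinner f g + cinner f h"
    unfolding cinner_l2_def by (simp add: distrib_left cinner_l2_integrable)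
  finally show ?thesis .
qed

lemma cinner_l2_scaleC_right: "cinner f (c *\<^sub>C g) = c * cinner f g" for f g :: l2
proof -
  have "cinner f (c *\<^sub>C g) = (\<integral>x. cnj (l2_fun f x) * (c * l2_fun g x) \<partial>lebesgue)"
    by (rule cinner_l2_cong)
      (auto intro: square_integrable_cmult l2_fun_square_integrable l2_fun_scaleC)
  also have "\<dots> = (\<integral>x. c * (cnj (l2_fun f x) * l2_fun g x) \<partial>lebesgue)"
    by (simp add: algebra_simps)
  also have "\<dots> = c * cinner f g"
    unfolding cinner_l2_def by simp
  finally show ?thesis .
qed

lemma scaleC_of_real_l2: "complex_of_real r *\<^sub>C f = r *\<^sub>R f" for f :: l2
  by (simp add: scaleC_l2_def scaleR_l2_def)

lemma l2_add_assoc: "(f + g) + h = f + (g + h)" for f g h :: l2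
  unfolding l2_eq_iff
  using l2_fun_plus[of "f + g" h] l2_fun_plus[of f g] l2_fun_plus[of f "g + h"] l2_fun_plus[of g h]
  by eventually_elim simp

lemma l2_scaleC_add_right: "c *\<^sub>C (f + g) = c *\<^sub>C f + c *\<^sub>C g" for f g :: l2
  unfolding l2_eq_iff
  using l2_fun_scaleC[of c "f + g"] l2_fun_plus[of f g] l2_fun_plus[of "c *\<^sub>C f" "c *\<^sub>C g"]
    l2_fun_scaleC[of c f] l2_fun_scaleC[of c g]
  by eventually_elim (simp add: algebra_simps)

lemma l2_scaleC_add_left: "(c + d) *\<^sub>C f = c *\<^sub>C f + d *\<^sub>C f" for f :: l2
  unfolding l2_eq_iff
  using l2_fun_scaleC[of "c + d" f] l2_fun_plus[of "c *\<^sub>C f" "d *\<^sub>C f"]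
    l2_fun_scaleC[of c f] l2_fun_scaleC[of d f]
  by eventually_elim (simp add: algebra_simps)

lemma l2_scaleC_scaleC: "c *\<^sub>C (d *\<^sub>C f) = (c * d) *\<^sub>C f" for f :: l2
  unfolding l2_eq_iff
  using l2_fun_scaleC[of c "d *\<^sub>C f"] l2_fun_scaleC[of d f] l2_fun_scaleC[of "c * d" f]
  by eventually_elim (simp add: algebra_simps)

instance
proof
  fix f g h :: l2 and r s :: real and c d :: complex and S :: "l2 set"
  show "f + g + h = f + (g + h)" by (rule l2_add_assoc)
  show "f + g = g + f" by (simp add: plus_l2_def add.commute)
  show "0 + f = f"
    unfolding l2_eq_iff using l2_fun_plus[of 0 f] l2_fun_zero by eventually_elim simp
  show "- f + f = 0"
    unfolding l2_eq_iff using l2_fun_plus[of "- f" f] l2_fun_uminus[of f] l2_fun_zero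
    by eventually_elim simp
  show "f - g = f + - g"
    unfolding l2_eq_iff
    using l2_fun_minus[of f g] l2_fun_uminus[of g] l2_fun_plus[of f "- g"]
    by eventually_elim simp
  show "r *\<^sub>R (f + g) = r *\<^sub>R f + r *\<^sub>R g"
    by (simp flip: scaleC_of_real_l2 add: l2_scaleC_add_right)
  show "(r + s) *\<^sub>R f = r *\<^sub>R f + s *\<^sub>R f"
    by (simp flip: scaleC_of_real_l2 add: l2_scaleC_add_left)
  show "r *\<^sub>R s *\<^sub>R f = (r * s) *\<^sub>R f"
    by (simp flip: scaleC_of_real_l2 add: l2_scaleC_scaleC)
  show "1 *\<^sub>R f = f"
    by (simp add: scaleR_l2_def l2_of_l2_fun)
  show "sgn f = inverse (norm f) *\<^sub>R f" by (simp add: sgn_l2_def)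
  show "dist f g = norm (f - g)" by (simp add: dist_l2_def)
  show "uniformity = (INF e\<in>{0<..}. principal {(x::l2, y). dist x y < e})"
    by (rule uniformity_l2_def)
  show "open S = (\<forall>x\<in>S. \<forall>\<^sub>F (x', y) in uniformity. x' = x \<longrightarrow> y \<in> S)"
    by (rule open_l2_def)
  show "inner f g = inner g f"
    unfolding inner_l2_def by (subst cinner_l2_commute) simp
  show "inner (f + g) h = inner f h + inner g h"
    unfolding inner_l2_def
    by (subst (1 2 3) cinner_l2_commute) (simp add: cinner_l2_add_right)
  show "inner (r *\<^sub>R f) g = r * inner f g"
    unfolding inner_l2_def scaleC_of_real_l2[symmetric]
    by (subst (1 2) cinner_l2_commute) (simp add: cinner_l2_scaleC_right)
  show "0 \<le> inner f f" by (simp add: inner_l2_self)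
  have "integrable lebesgue (\<lambda>x. (cmod (l2_fun f x))\<^sup>2)"
    using l2_fun_square_integrable[of f] by (simp add: square_integrable_def)
  then have "inner f f = 0 \<longleftrightarrow> (AE x in lebesgue. (cmod (l2_fun f x))\<^sup>2 = 0)"
    unfolding inner_l2_self by (intro integral_nonneg_eq_0_iff_AE) auto
  also have "\<dots> \<longleftrightarrow> (AE x in lebesgue. l2_fun f x = l2_fun 0 x)"
  proof -
    have "AE x in lebesgue. ((cmod (l2_fun f x))\<^sup>2 = 0) = (l2_fun f x = l2_fun 0 x)"
      using l2_fun_zero by eventually_elim simp
    then show ?thesis by (auto elim: AE_mp)
  qed
  also have "\<dots> \<longleftrightarrow> f = 0" by (simp add: l2_eq_iff)
  finally show "inner f f = 0 \<longleftrightarrow> f = 0" .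
  show "norm f = sqrt (inner f f)" by (rule norm_l2_def)
  show "c *\<^sub>C (f + g) = c *\<^sub>C f + c *\<^sub>C g" by (rule l2_scaleC_add_right)
  show "(c + d) *\<^sub>C f = c *\<^sub>C f + d *\<^sub>C f" by (rule l2_scaleC_add_left)
  show "c *\<^sub>C d *\<^sub>C f = (c * d) *\<^sub>C f" by (rule l2_scaleC_scaleC)
  show "complex_of_real r *\<^sub>C f = r *\<^sub>R f" by (rule scaleC_of_real_l2)
  show "cinner f g = cnj (cinner g f)" by (rule cinner_l2_commute)
  show "cinner f (g + h) = cinner f g + cinner f h" by (rule cinner_l2_add_right)
  show "cinner f (c *\<^sub>C g) = c * cinner f g" by (rule cinner_l2_scaleC_right)
  show "Re (cinner f g) = inner f g" by (simp add: inner_l2_def)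
qed

end

lemma norm_l2_power2: "(norm f)\<^sup>2 = (\<integral>x. (cmod (l2_fun f x))\<^sup>2 \<partial>lebesgue)" for f :: l2
  by (simp add: power2_norm_eq_inner inner_l2_self)

lemma nn_integral_l2: "(\<integral>\<^sup>+x. ennreal ((cmod (l2_fun f x))\<^sup>2) \<partial>lebesgue) = ennreal ((norm f)\<^sup>2)"
  unfolding norm_l2_power2
  by (rule nn_integral_eq_integral)
    (use l2_fun_square_integrable[of f] in \<open>auto simp: square_integrable_def\<close>)

lemma ennreal_le_suminf: "f k \<le> suminf f" for f :: "nat \<Rightarrow> ennreal"
  using sum_le_suminf[of f "{k}"] by simp

instance l2 :: chilbert_space
proof
  fix X :: "nat \<Rightarrow> l2"
  assume X: "Cauchy X"
  have "\<forall>k. \<exists>N. \<forall>m\<ge>N. \<forall>n\<ge>N. dist (X m) (X n) < (1/4) ^ k"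
    using X by (auto simp: Cauchy_def)
  then obtain N where N: "\<And>k m n. m \<ge> N k \<Longrightarrow> n \<ge> N k \<Longrightarrow> dist (X m) (X n) < (1/4) ^ k"
    by metis
  define r where "r k = k + (\<Sum>j\<le>k. N j)" for k
  have rN: "r k \<ge> N k" for k
    unfolding r_def by (simp add: trans_le_add2 member_le_sum)
  have rk: "r k \<ge> k" for k by (simp add: r_def)
  have r_Suc: "r (Suc k) \<ge> N k" for k
    using rN[of k] by (simp add: r_def)
  define D where "D k = X (r (Suc k)) - X (r k)" for k
  have D: "norm (D k) \<le> (1/4) ^ k" for k
    using N[OF r_Suc rN, of k] by (simp add: D_def dist_norm)
  define u where "u n = l2_fun (X (r n))" for n
  have [measurable]: "u n \<in> borel_measurable lebesgue" for n
    by (simp add: u_def)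
  have u_diff: "AE x in lebesgue. \<forall>k. l2_fun (D k) x = u (Suc k) x - u k x"
    unfolding AE_all_countable D_def u_def by (auto intro: l2_fun_minus)

  have "(\<integral>\<^sup>+x. (\<Sum>k. ennreal (4 ^ k * (cmod (l2_fun (D k) x))\<^sup>2)) \<partial>lebesgue)
      = (\<Sum>k. \<integral>\<^sup>+x. ennreal (4 ^ k * (cmod (l2_fun (D k) x))\<^sup>2) \<partial>lebesgue)"
    by (rule nn_integral_suminf) measurable
  also have "\<dots> = (\<Sum>k. ennreal (4 ^ k * (norm (D k))\<^sup>2))"
    by (simp add: ennreal_mult nn_integral_cmult nn_integral_l2)
  also have "\<dots> \<le> (\<Sum>k. ennreal ((1/4) ^ k))"
  proof (intro suminf_le allI summableI ennreal_leI)
    fix k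
    have "4 ^ k * (norm (D k))\<^sup>2 \<le> 4 ^ k * ((1/4) ^ k)\<^sup>2"
      by (intro mult_left_mono power_mono D) auto
    also have "\<dots> = (1/4) ^ k"
      by (simp add: power2_eq_square power_divide)
    finally show "4 ^ k * (norm (D k))\<^sup>2 \<le> (1/4) ^ k" .
  qed
  also have "\<dots> = ennreal (\<Sum>k. (1/4) ^ k)"
    by (intro suminf_ennreal2 summable_geometric) auto
  also have "\<dots> < \<infinity>" by simp
  finally have fin: "(\<integral>\<^sup>+x. (\<Sum>k. ennreal (4 ^ k * (cmod (l2_fun (D k) x))\<^sup>2)) \<partial>lebesgue) \<noteq> \<infinity>"
    by (rule less_imp_neq)
  have "AE x in lebesgue. (\<Sum>k. ennreal (4 ^ k * (cmod (l2_fun (D k) x))\<^sup>2)) \<noteq> \<infinity>"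
    by (rule nn_integral_PInf_AE[OF _ fin]) measurable
  then have conv: "AE x in lebesgue. convergent (\<lambda>n. u n x)"
    using u_diff
  proof eventually_elim
    fix x
    assume fin: "(\<Sum>k. ennreal (4 ^ k * (cmod (l2_fun (D k) x))\<^sup>2)) \<noteq> \<infinity>"
      and eq: "\<forall>k. l2_fun (D k) x = u (Suc k) x - u k x"
    then obtain C where C: "(\<Sum>k. ennreal (4 ^ k * (cmod (l2_fun (D k) x))\<^sup>2)) = ennreal C" "C \<ge> 0"
      by (cases "\<Sum>k. ennreal (4 ^ k * (cmod (l2_fun (D k) x))\<^sup>2)" rule: ennreal_cases)
        (auto simp only: infinity_ennreal_def)
    have bound: "norm (l2_fun (D k) x) \<le> sqrt C * (1/2) ^ k" for k
    proof -
      have two: "((2::real) ^ k)\<^sup>2 = 4 ^ k"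
        by (simp add: power2_eq_square flip: power_mult_distrib)
      have "ennreal (4 ^ k * (cmod (l2_fun (D k) x))\<^sup>2) \<le> ennreal C"
        unfolding C(1)[symmetric] by (rule ennreal_le_suminf)
      then have "(2 ^ k * cmod (l2_fun (D k) x))\<^sup>2 \<le> C"
        using C(2) two by (simp add: power_mult_distrib)
      then have "2 ^ k * cmod (l2_fun (D k) x) \<le> sqrt C"
        by (rule real_le_rsqrt)
      then show ?thesis by (simp add: field_simps power_divide)
    qed
    have "summable (\<lambda>k. l2_fun (D k) x)"
      by (rule summable_comparison_test'[OF _ bound]) (auto intro!: summable_mult summable_geometric)
    then have "convergent (\<lambda>n. u 0 x + (\<Sum>k<n. u (Suc k) x - u k x))"
      using eq by (auto simp: summable_iff_convergent intro!: convergent_add convergent_const)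
    moreover have "u 0 x + (\<Sum>k<n. u (Suc k) x - u k x) = u n x" for n
      using sum_lessThan_telescope[of "\<lambda>k. u k x" n] by simp
    ultimately show "convergent (\<lambda>n. u n x)" by (simp only:)
  qed

  define F where "F x = lim (\<lambda>n. u n x)" for x
  have F_meas [measurable]: "F \<in> borel_measurable lebesgue"
    unfolding F_def by measurable
  have F: "AE x in lebesgue. (\<lambda>n. u n x) \<longlonglongrightarrow> F x"
    using conv by eventually_elim (simp add: F_def convergent_LIMSEQ_iff)
  have key: "(\<integral>\<^sup>+x. ennreal ((cmod (F x - l2_fun (X m) x))\<^sup>2) \<partial>lebesgue) \<le> ennreal (e\<^sup>2)"
    if e: "e > 0" and M: "\<And>m n. m \<ge> M \<Longrightarrow> n \<ge> M \<Longrightarrow> dist (X m) (X n) < e" and "m \<ge> M"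
    for e M m
  proof -
    have "(\<integral>\<^sup>+x. ennreal ((cmod (F x - l2_fun (X m) x))\<^sup>2) \<partial>lebesgue)
        = (\<integral>\<^sup>+x. liminf (\<lambda>n. ennreal ((cmod (u n x - l2_fun (X m) x))\<^sup>2)) \<partial>lebesgue)"
      using F
      by (intro nn_integral_cong_AE)
        (auto elim!: eventually_mono
          intro!: lim_imp_Liminf[symmetric] tendsto_intros)
    also have "\<dots> \<le> liminf (\<lambda>n. \<integral>\<^sup>+x. ennreal ((cmod (u n x - l2_fun (X m) x))\<^sup>2) \<partial>lebesgue)"
      by (rule nn_integral_liminf) measurable
    also have "\<dots> = liminf (\<lambda>n. ennreal ((norm (X (r n) - X m))\<^sup>2))"
    proof -
      have "(\<integral>\<^sup>+x. ennreal ((cmod (u n x - l2_fun (X m) x))\<^sup>2) \<partial>lebesgue)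
          = ennreal ((norm (X (r n) - X m))\<^sup>2)" for n
        unfolding nn_integral_l2[symmetric]
        using l2_fun_minus[of "X (r n)" "X m"]
        by (intro nn_integral_cong_AE) (auto simp: u_def elim!: eventually_mono)
      then show ?thesis by simp
    qed
    also have "\<dots> \<le> ennreal (e\<^sup>2)"
    proof (rule Liminf_le)
      have "ennreal ((norm (X (r n) - X m))\<^sup>2) \<le> ennreal (e\<^sup>2)" if "n \<ge> M" for n
        using M[of "r n" m] rk[of n] that \<open>m \<ge> M\<close>
        by (intro ennreal_leI power_mono) (auto simp: dist_norm)
      then show "\<forall>\<^sub>F n in sequentially. ennreal ((norm (X (r n) - X m))\<^sup>2) \<le> ennreal (e\<^sup>2)"
        unfolding eventually_sequentially by blast
    qed simp
    finally show ?thesis .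
  qed

  have sq_diff: "square_integrable (\<lambda>x. F x - l2_fun (X m) x)"
    if "(\<integral>\<^sup>+x. ennreal ((cmod (F x - l2_fun (X m) x))\<^sup>2) \<partial>lebesgue) \<le> ennreal c" for m c
    unfolding square_integrable_def
  proof
    show "integrable lebesgue (\<lambda>x. (cmod (F x - l2_fun (X m) x))\<^sup>2)"
      using that by (intro integrableI_nonneg) (auto intro: le_less_trans)
  qed measurable
  obtain M1 where "\<And>m n. m \<ge> M1 \<Longrightarrow> n \<ge> M1 \<Longrightarrow> dist (X m) (X n) < 1"
    using X by (metis Cauchy_def zero_less_one)
  then have "square_integrable (\<lambda>x. F x - l2_fun (X M1) x)"
    by (intro sq_diff[OF key[of 1 M1]]) auto
  then have sqF: "square_integrable F"
    using square_integrable_add[OF _ l2_fun_square_integrable[of "X M1"]] by fastforce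

  have "X \<longlonglongrightarrow> l2_of F"
  proof (rule metric_LIMSEQ_I)
    fix e :: real
    assume "e > 0"
    then obtain M where M: "\<And>m n. m \<ge> M \<Longrightarrow> n \<ge> M \<Longrightarrow> dist (X m) (X n) < e / 2"
      using X by (metis Cauchy_def half_gt_zero)
    have "dist (X m) (l2_of F) < e" if "m \<ge> M" for m
    proof -
      have "ennreal ((norm (l2_of F - X m))\<^sup>2)
          = (\<integral>\<^sup>+x. ennreal ((cmod (F x - l2_fun (X m) x))\<^sup>2) \<partial>lebesgue)"
        unfolding nn_integral_l2[symmetric]
      proof (rule nn_integral_cong_AE)
        show "AE x in lebesgue. ennreal ((cmod (l2_fun (l2_of F - X m) x))\<^sup>2)
            = ennreal ((cmod (F x - l2_fun (X m) x))\<^sup>2)"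
          using l2_fun_minus[of "l2_of F" "X m"] l2_fun_l2_of[OF sqF]
          by eventually_elim simp
      qed
      also have "\<dots> \<le> ennreal ((e / 2)\<^sup>2)"
        using \<open>e > 0\<close> M that by (intro key) auto
      finally have "(norm (l2_of F - X m))\<^sup>2 \<le> (e / 2)\<^sup>2"
        by simp
      then have "norm (l2_of F - X m) \<le> e / 2"
        by (rule power2_le_imp_le) (use \<open>e > 0\<close> in simp)
      then show ?thesis
        using \<open>e > 0\<close> by (simp add: dist_norm norm_minus_commute)
    qed
    then show "\<exists>no. \<forall>n\<ge>no. dist (X n) (l2_of F) < e" by blast
  qed
  then show "convergent X" by (rule convergentI)
qed


section \<open>Bounded operators, trace and trace norm\<close>

definition bounded_clinear :: "('a::complex_inner \<Rightarrow> 'b::complex_inner) \<Rightarrow> bool" where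
  "bounded_clinear T \<longleftrightarrow> bounded_linear T \<and> (\<forall>c x. T (c *\<^sub>C x) = c *\<^sub>C T x)"

definition cadjoint :: "('a::complex_inner \<Rightarrow> 'a) \<Rightarrow> 'a \<Rightarrow> 'a" where
  "cadjoint T = (THE S. bounded_clinear S \<and> (\<forall>x y. cinner (S x) y = cinner x (T y)))"

definition positive_op :: "('a::complex_inner \<Rightarrow> 'a) \<Rightarrow> bool" where
  "positive_op T \<longleftrightarrow>
     bounded_clinear T \<and> (\<forall>x. Im (cinner x (T x)) = 0 \<and> 0 \<le> Re (cinner x (T x)))"

definition abs_op :: "('a::complex_inner \<Rightarrow> 'a) \<Rightarrow> 'a \<Rightarrow> 'a" where
  "abs_op T = (THE S. positive_op S \<and> S \<circ> S = cadjoint T \<circ> T)"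

definition orthonormal_basis :: "'a::complex_inner set \<Rightarrow> bool" where
  "orthonormal_basis E \<longleftrightarrow>
     (\<forall>e\<in>E. \<forall>e'\<in>E. cinner e e' = (if e = e' then 1 else 0)) \<and>
     (\<forall>x. (\<forall>e\<in>E. cinner e x = 0) \<longrightarrow> x = 0)"

text \<open>The traces below do not depend on the choice of the basis.  Hilbert spaces need not be
  separable, so the sums range over a possibly uncountable basis.\<close>

definition some_basis :: "'a::complex_inner set" where
  "some_basis = (SOME E. orthonormal_basis E)"

definition trace_norm :: "('a::complex_inner \<Rightarrow> 'a) \<Rightarrow> ennreal" where
  "trace_norm T = (\<Sum>\<^sub>\<infinity>e\<in>some_basis. ennreal (Re (cinner e (abs_op T e))))"

definition trace_class :: "('a::complex_inner \<Rightarrow> 'a) \<Rightarrow> bool" where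
  "trace_class T \<longleftrightarrow> bounded_clinear T \<and> trace_norm T < \<infinity>"

definition op_trace :: "('a::complex_inner \<Rightarrow> 'a) \<Rightarrow> complex" where
  "op_trace T = (\<Sum>\<^sub>\<infinity>e\<in>some_basis. cinner e (T e))"

definition density_operator :: "('a::complex_inner \<Rightarrow> 'a) \<Rightarrow> bool" where
  "density_operator \<rho> \<longleftrightarrow> positive_op \<rho> \<and> trace_class \<rho> \<and> op_trace \<rho> = 1"

definition ketbra :: "'a::complex_inner \<Rightarrow> 'a \<Rightarrow> 'a \<Rightarrow> 'a" where
  "ketbra \<psi> \<phi> = (\<lambda>v. cinner \<phi> v *\<^sub>C \<psi>)"

definition projection_op :: "('a::complex_inner \<Rightarrow> 'a) \<Rightarrow> bool" where
  "projection_op P \<longleftrightarrow>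
     bounded_clinear P \<and> P \<circ> P = P \<and> (\<forall>x y. cinner (P x) y = cinner x (P y))"

definition pvm :: "'i set \<Rightarrow> ('i \<Rightarrow> 'a::complex_inner \<Rightarrow> 'a) \<Rightarrow> bool" where
  "pvm I P \<longleftrightarrow>
     (\<forall>i\<in>I. projection_op (P i)) \<and>
     (\<forall>i\<in>I. \<forall>j\<in>I. i \<noteq> j \<longrightarrow> (\<forall>x. P i (P j x) = 0)) \<and>
     (\<forall>x. ((\<lambda>i. P i x) has_sum x) I)"

text \<open>$\sum_{i\in I} Q_i \rho Q_i$, the sum being taken in the strong operator topology.\<close>

definition pinching :: "'i set \<Rightarrow> ('i \<Rightarrow> 'a::complex_inner \<Rightarrow> 'a) \<Rightarrow> ('a \<Rightarrow> 'a) \<Rightarrow> 'a \<Rightarrow> 'a" where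
  "pinching I Q \<rho> = (\<lambda>v. \<Sum>\<^sub>\<infinity>i\<in>I. Q i (\<rho> (Q i v)))"


section \<open>Self-adjoint operators and their unitary groups\<close>

text \<open>An unbounded operator is represented by its graph.\<close>

definition adjoint_graph :: "('a::complex_inner \<times> 'a) set \<Rightarrow> ('a \<times> 'a) set" where
  "adjoint_graph A = {(x, y). \<forall>(u, v)\<in>A. cinner x v = cinner y u}"

text \<open>Equality with the adjoint of a densely defined operator already makes the relation \<open>A\<close> linear,
  single-valued and closed.\<close>

definition self_adjoint :: "('a::complex_inner \<times> 'a) set \<Rightarrow> bool" where
  "self_adjoint A \<longleftrightarrow> closure (Domain A) = UNIV \<and> adjoint_graph A = A"

definition unitary_op :: "('a::complex_inner \<Rightarrow> 'a) \<Rightarrow> bool" where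
  "unitary_op V \<longleftrightarrow> bounded_clinear V \<and> surj V \<and> (\<forall>x y. cinner (V x) (V y) = cinner x y)"

definition unitary_group :: "(real \<Rightarrow> 'a::complex_inner \<Rightarrow> 'a) \<Rightarrow> bool" where
  "unitary_group U \<longleftrightarrow>
     (\<forall>s. unitary_op (U s)) \<and> (\<forall>s r. U (s + r) = U s \<circ> U r) \<and>
     (\<forall>x. continuous_on UNIV (\<lambda>s. U s x))"

definition generator :: "(real \<Rightarrow> 'a::complex_inner \<Rightarrow> 'a) \<Rightarrow> ('a \<times> 'a) set" where
  "generator U = {(x, y). ((\<lambda>s. U s x) has_vector_derivative \<i> *\<^sub>C y) (at 0)}"

text \<open>\<open>exp_i A s\<close> is $e^{isA}$ for self-adjoint \<open>A\<close>: the strongly continuous one-parameter unitary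
  group which Stone's theorem associates with \<open>A\<close>.\<close>

definition exp_i :: "('a::complex_inner \<times> 'a) set \<Rightarrow> real \<Rightarrow> 'a \<Rightarrow> 'a" where
  "exp_i A = (THE U. unitary_group U \<and> generator U = A)"


section \<open>Tensor products\<close>

text \<open>A Hilbert space \<open>'c\<close> with a bilinear map as below is a model of the Hilbert space tensor
  product of \<open>'a\<close> and \<open>'b\<close>; any two models are unitarily equivalent by a unitary that preserves
  simple tensors.  Simple tensors are closed under complex scaling, so the real linear span used
  here is the complex one.\<close>

definition hilbert_tensor ::
    "('a::complex_inner \<Rightarrow> 'b::complex_inner \<Rightarrow> 'c::complex_inner) \<Rightarrow> bool" where
  "hilbert_tensor ten \<longleftrightarrow>
     (\<forall>x x' y. ten (x + x') y = ten x y + ten x' y) \<and>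
     (\<forall>x y y'. ten x (y + y') = ten x y + ten x y') \<and>
     (\<forall>c x y. ten (c *\<^sub>C x) y = c *\<^sub>C ten x y) \<and>
     (\<forall>c x y. ten x (c *\<^sub>C y) = c *\<^sub>C ten x y) \<and>
     (\<forall>x x' y y'. cinner (ten x y) (ten x' y') = cinner x x' * cinner y y') \<and>
     closure (span {ten x y |x y. True}) = UNIV"

definition tensor_op ::
    "('a::complex_inner \<Rightarrow> 'b::complex_inner \<Rightarrow> 'c::complex_inner) \<Rightarrow>
     ('a \<Rightarrow> 'a) \<Rightarrow> ('b \<Rightarrow> 'b) \<Rightarrow> 'c \<Rightarrow> 'c" where
  "tensor_op ten S T = (THE C. bounded_clinear C \<and> (\<forall>x y. C (ten x y) = ten (S x) (T y)))"

text \<open>For unbounded operators: the closure of the operator defined on the algebraic tensor product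
  of the domains.\<close>

definition tensor_graph ::
    "('a::complex_inner \<Rightarrow> 'b::complex_inner \<Rightarrow> 'c::complex_inner) \<Rightarrow>
     ('a \<times> 'a) set \<Rightarrow> ('b \<times> 'b) set \<Rightarrow> ('c \<times> 'c) set" where
  "tensor_graph ten A B =
     closure (span {(ten x y, ten x' y') |x x' y y'. (x, x') \<in> A \<and> (y, y') \<in> B})"


section \<open>The model\<close>

definition position_op :: "(l2 \<times> l2) set" where
  "position_op = {(f, g). AE x in lebesgue. l2_fun g x = complex_of_real x * l2_fun f x}"

definition position_proj :: "real set \<Rightarrow> l2 \<Rightarrow> l2" where
  "position_proj \<Delta> f = l2_of (\<lambda>x. indicator \<Delta> x * l2_fun f x)"

definition evolution ::
    "(l2 \<Rightarrow> 'e::complex_inner \<Rightarrow> 'k::complex_inner) \<Rightarrow> real \<Rightarrow> ('e \<times> 'e) set \<Rightarrow> real \<Rightarrow>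
     ('k \<Rightarrow> 'k) \<Rightarrow> 'k \<Rightarrow> 'k" where
  "evolution ten \<gamma> B t \<sigma> =
     exp_i (tensor_graph ten position_op B) (- (t * \<gamma>)) \<circ> \<sigma> \<circ>
     exp_i (tensor_graph ten position_op B) (t * \<gamma>)"

definition is_kernel :: "(l2 \<Rightarrow> l2) \<Rightarrow> (real \<Rightarrow> real \<Rightarrow> complex) \<Rightarrow> bool" where
  "is_kernel \<sigma> k \<longleftrightarrow>
     (\<lambda>(x, y). k x y) \<in> borel_measurable (lebesgue \<Otimes>\<^sub>M lebesgue) \<and>
     integrable (lebesgue \<Otimes>\<^sub>M lebesgue) (\<lambda>(x, y). (cmod (k x y))\<^sup>2) \<and>
     (\<forall>f. AE x in lebesgue. l2_fun (\<sigma> f) x = (\<integral>y. k x y * l2_fun f y \<partial>lebesgue))"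

text \<open>The kernel $\langle x|\sigma|y\rangle$ is determined up to null sets of the plane.\<close>

definition kernel_of :: "(l2 \<Rightarrow> l2) \<Rightarrow> real \<Rightarrow> real \<Rightarrow> complex" where
  "kernel_of \<sigma> = (SOME k. is_kernel \<sigma> k)"

definition integral_op :: "(real \<Rightarrow> real \<Rightarrow> complex) \<Rightarrow> l2 \<Rightarrow> l2" where
  "integral_op k f = l2_of (\<lambda>x. \<integral>y. k x y * l2_fun f y \<partial>lebesgue)"

definition decoherence_factor ::
    "real \<Rightarrow> ('e::complex_inner \<times> 'e) set \<Rightarrow> ('e \<Rightarrow> 'e) \<Rightarrow> real \<Rightarrow> real \<Rightarrow> real \<Rightarrow> complex" where
  "decoherence_factor \<gamma>' B' \<rho>' t x y = op_trace (exp_i B' (- (t * \<gamma>' * (x - y))) \<circ> \<rho>')"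

definition decoherence_map ::
    "real \<Rightarrow> ('e::complex_inner \<times> 'e) set \<Rightarrow> ('e \<Rightarrow> 'e) \<Rightarrow> real \<Rightarrow> (l2 \<Rightarrow> l2) \<Rightarrow> l2 \<Rightarrow> l2" where
  "decoherence_map \<gamma>' B' \<rho>' t \<sigma> =
     integral_op (\<lambda>x y. kernel_of \<sigma> x y * decoherence_factor \<gamma>' B' \<rho>' t x y)"

definition total_state ::
    "(l2 \<Rightarrow> 'e::complex_inner \<Rightarrow> 'k::complex_inner) \<Rightarrow> real \<Rightarrow> ('e \<times> 'e) set \<Rightarrow>
     real \<Rightarrow> ('f::complex_inner \<times> 'f) set \<Rightarrow> ('f \<Rightarrow> 'f) \<Rightarrow>
     (l2 \<Rightarrow> l2) \<Rightarrow> ('e \<Rightarrow> 'e) \<Rightarrow> real \<Rightarrow> 'k \<Rightarrow> 'k" where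
  "total_state ten \<gamma> B \<gamma>' B' \<rho>' \<rho>S \<rho>E t =
     evolution ten \<gamma> B t (tensor_op ten (decoherence_map \<gamma>' B' \<rho>' t \<rho>S) \<rho>E)"

definition outcome_prob :: "l2 \<Rightarrow> real set \<Rightarrow> real" where
  "outcome_prob \<psi> \<Delta> = (LINT x:\<Delta>|lebesgue. (cmod (l2_fun \<psi> x))\<^sup>2)"

definition cond_state :: "l2 \<Rightarrow> real set \<Rightarrow> l2" where
  "cond_state \<psi> \<Delta> = l2_of (\<lambda>x. indicator \<Delta> x * l2_fun \<psi> x / sqrt (outcome_prob \<psi> \<Delta>))"

text \<open>$\int_{\mathbb{R}} |\phi(x)|^2 e^{-it\gamma xB} \rho\, e^{it\gamma xB}\,dx$ for a wave function
  \<open>\<phi>\<close>, as a weak operator integral (the Bochner integral of the library is restricted to separable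
  spaces).\<close>

definition env_channel ::
    "real \<Rightarrow> ('e::complex_inner \<times> 'e) set \<Rightarrow> real \<Rightarrow> l2 \<Rightarrow> ('e \<Rightarrow> 'e) \<Rightarrow> 'e \<Rightarrow> 'e" where
  "env_channel \<gamma> B t \<phi> \<rho> =
     (THE L. bounded_clinear L \<and>
        (\<forall>u v. cinner u (L v) =
           (\<integral>x. complex_of_real ((cmod (l2_fun \<phi> x))\<^sup>2) *
               cinner u (exp_i B (- (t * \<gamma> * x)) (\<rho> (exp_i B (t * \<gamma> * x) v))) \<partial>lebesgue)))"

text \<open>The unnormalised post-measurement state of $\mathscr{H}_S\otimes\mathscr{H}_E$ for the joint
  measurement with projections $P_{\Delta_i}\otimes P_i$.\<close>

definition joint_post_state ::
    "(l2 \<Rightarrow> 'e::complex_inner \<Rightarrow> 'k::complex_inner) \<Rightarrow> 'i set \<Rightarrow> ('i \<Rightarrow> real set) \<Rightarrow>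
     ('i \<Rightarrow> 'e \<Rightarrow> 'e) \<Rightarrow> ('k \<Rightarrow> 'k) \<Rightarrow> 'k \<Rightarrow> 'k" where
  "joint_post_state ten I \<Delta> P \<rho> = pinching I (\<lambda>i. tensor_op ten (position_proj (\<Delta> i)) (P i)) \<rho>"

definition post_norm ::
    "(l2 \<Rightarrow> 'e::complex_inner \<Rightarrow> 'k::complex_inner) \<Rightarrow> 'i set \<Rightarrow> ('i \<Rightarrow> real set) \<Rightarrow>
     ('i \<Rightarrow> 'e \<Rightarrow> 'e) \<Rightarrow> ('k \<Rightarrow> 'k) \<Rightarrow> real" where
  "post_norm ten I \<Delta> P \<rho> = Re (op_trace (joint_post_state ten I \<Delta> P \<rho>))"

end

theory Submission
  imports Defs
begin

text \<open>The decoherence factor is a countable sum $\Gamma(x,y) = \sum_k c_k(x)\,\overline{c_k(y)}$, which turns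
  the decohered pure state into the ensemble of the vectors $c_k \psi_S$.  The coupling
  $W = e^{-it\gamma X \otimes B}$ acts fibrewise over the position variable, so the joint state is the
  ensemble of the waves $x \mapsto c_k(x) \psi_S(x)\, w(x)$ with $w(x) = e^{-it\gamma x B}\psi_E$.  Restricting
  them to $\Delta_i$ gives an ensemble for the first state of the theorem, and applying also $P_i$ to $w(x)$
  one for the second; the two differ by total weight
  $1 - N = \sum_i \int_{\Delta_i} |\psi_S(x)|^2 (1 - \|P_i w(x)\|^2)\,dx$, which is the radicand on the right.
  A gentle-measurement estimate bounds the trace norm by $3\sqrt{1 - N}$, for each PVM with $N > 0$;
  one with $N = 0$ has the largest possible right-hand side.\<close>

section \<open>Geometry of complex Hilbert spaces\<close>

text \<open>The exponentials are definite descriptions: \<open>exp_i A\<close> is the unitary group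
  with generator \<open>A\<close>, and for the coupling \<open>A\<close> is the closure of an
  operator on algebraic tensors. Writing down the fibrewise group is therefore not enough; Stone's
  theorem and the essential self-adjointness of the coupling must be available before the group can
  be identified. Both are drawn from resolvents of self-adjoint operators. The spaces may be
  non-separable, so vector-valued wave functions enter as expansions over a basis of the
  environment. Continuity of the environment curve makes all but countably many coefficients vanish,
  and sums and integrals can be exchanged. The trace norm is only bounded from above, through a
  contraction \<open>V\<close> with \<open>V T\<close> = |T|. Both states are sums of |a><a| over
  the same pairs of an outcome and an ensemble label, so they are compared vector by vector. The 3
  counts three rank-one terms, each of cost at most sqrt(1 - N); with the factor 1/2 this gives 3/2
  < 4.\<close>

instance chilbert_space \<subseteq> banach ..

lemma cinner_add_left: "cinner (x + y) z = cinner x z + cinner y z"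
  by (metis cinner_commute cinner_add_right complex_cnj_add)

lemma cinner_scaleC_left: "cinner (c *\<^sub>C x) y = cnj c * cinner x y"
  by (metis cinner_commute cinner_scaleC_right complex_cnj_mult)

lemma cinner_scaleR_right: "cinner x (r *\<^sub>R y) = complex_of_real r * cinner x y"
  by (metis cinner_scaleC_right scaleC_of_real)

lemma cinner_scaleR_left: "cinner (r *\<^sub>R x) y = complex_of_real r * cinner x y"
  by (metis cinner_scaleC_left scaleC_of_real complex_cnj_complex_of_real)

lemma scaleC_one [simp]: "1 *\<^sub>C x = x"
  using scaleC_of_real[of 1 x] by simp

lemma scaleC_zero_left [simp]: "0 *\<^sub>C x = 0"
  using scaleC_of_real[of 0 x] by simp

lemma scaleC_minus1: "(-1) *\<^sub>C x = - x"
  using scaleC_of_real[of "-1" x] by simp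

lemma scaleC_zero_right [simp]: "c *\<^sub>C 0 = 0"
  using scaleC_add_right[of c 0 0] by simp

lemma scaleC_minus_right [simp]: "c *\<^sub>C (- x) = - (c *\<^sub>C x)"
  by (metis add_eq_0_iff add.right_inverse scaleC_add_right scaleC_zero_right)

lemma scaleC_minus_left [simp]: "(- c) *\<^sub>C x = - (c *\<^sub>C x)"
  by (metis add_eq_0_iff add.right_inverse scaleC_add_left scaleC_zero_left)

lemma scaleC_diff_right: "c *\<^sub>C (x - y) = c *\<^sub>C x - c *\<^sub>C y"
  using scaleC_add_right[of c x "- y"] by simp

lemma scaleC_scaleR: "c *\<^sub>C (r *\<^sub>R x) = r *\<^sub>R (c *\<^sub>C x)"
  by (metis scaleC_of_real scaleC_scaleC mult.commute)

lemma scaleR_scaleC: "(r *\<^sub>R c) *\<^sub>C x = r *\<^sub>R (c *\<^sub>C x)"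
  by (simp add: scaleR_conv_of_real scaleC_of_real flip: scaleC_scaleC)

lemma cinner_zero_left [simp]: "cinner 0 y = 0"
  using cinner_add_left[of 0 0 y] by simp

lemma cinner_zero_right [simp]: "cinner x 0 = 0"
  using cinner_add_right[of x 0 0] by simp

lemma cinner_minus_left [simp]: "cinner (- x) y = - cinner x y"
  using cinner_scaleC_left[of "-1" x y] by (simp add: scaleC_minus1)

lemma cinner_minus_right [simp]: "cinner x (- y) = - cinner x y"
  using cinner_scaleC_right[of x "-1" y] by (simp add: scaleC_minus1)

lemma cinner_diff_left: "cinner (x - y) z = cinner x z - cinner y z"
  using cinner_add_left[of x "- y" z] by simp

lemma cinner_diff_right: "cinner x (y - z) = cinner x y - cinner x z"
  using cinner_add_right[of x y "- z"] by simp

lemma cinner_sum_right: "cinner x (sum f A) = (\<Sum>a\<in>A. cinner x (f a))"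
  by (induction A rule: infinite_finite_induct) (auto simp: cinner_add_right)

lemma cinner_self: "cinner x x = complex_of_real ((norm x)\<^sup>2)"
proof -
  have "Im (cinner x x) = 0"
    by (metis cinner_commute Reals_cnj_iff complex_is_Real_iff)
  then show ?thesis
    by (simp add: complex_eq_iff Re_cinner power2_norm_eq_inner)
qed

lemma norm_scaleC: "norm (c *\<^sub>C x) = cmod c * norm x"
proof -
  have "complex_of_real ((norm (c *\<^sub>C x))\<^sup>2) = complex_of_real ((cmod c * norm x)\<^sup>2)"
    unfolding cinner_self[symmetric] cinner_scaleC_left cinner_scaleC_right
    by (simp add: cinner_self power_mult_distrib complex_norm_square mult.commute del: of_real_power
        flip: mult.assoc)
  then show ?thesis
    by (metis norm_ge_zero of_real_eq_iff power2_eq_imp_eq mult_nonneg_nonneg)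
qed

lemma cinner_eq_zero_iff: "cinner x x = 0 \<longleftrightarrow> x = 0"
  by (simp add: cinner_self)

lemma cmod_cinner_le: "cmod (cinner x y) \<le> norm x * norm y"
proof (cases "cinner x y = 0")
  case False
  \<comment> \<open>The phase \<open>c\<close> rotates the inner product onto the nonnegative reals,
    where the real Cauchy-Schwarz inequality applies.\<close>
  define c where "c = cnj (cinner x y) / cmod (cinner x y)"
  have "cmod c = 1" using False by (simp add: c_def norm_divide)
  have "c * cinner x y = complex_of_real (cmod (cinner x y))"
    using False complex_norm_square[of "cinner x y"]
    by (simp add: c_def field_simps power2_eq_square)
  then have "cmod (cinner x y) = Re (cinner x (c *\<^sub>C y))"
    by (simp add: cinner_scaleC_right)
  also have "\<dots> \<le> norm x * norm (c *\<^sub>C y)"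
    unfolding Re_cinner by (rule norm_cauchy_schwarz)
  finally show ?thesis by (simp add: norm_scaleC \<open>cmod c = 1\<close>)
qed simp

lemma bounded_bilinear_cinner: "bounded_bilinear cinner"
  by unfold_locales
    (auto simp: cinner_add_left cinner_add_right cinner_scaleR_left cinner_scaleR_right scaleR_conv_of_real
      intro!: exI[of _ 1] cmod_cinner_le)

lemma bounded_bilinear_scaleC: "bounded_bilinear scaleC"
  by unfold_locales
    (auto simp: scaleC_add_left scaleC_add_right scaleC_scaleR norm_scaleC scaleR_scaleC
      intro!: exI[of _ 1])

lemmas cinner_bl_left = bounded_bilinear.bounded_linear_left[OF bounded_bilinear_cinner]
lemmas cinner_bl_right = bounded_bilinear.bounded_linear_right[OF bounded_bilinear_cinner]
lemmas scaleC_bl_right = bounded_bilinear.bounded_linear_right[OF bounded_bilinear_scaleC]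

lemmas tendsto_cinner [tendsto_intros] = bounded_bilinear.tendsto[OF bounded_bilinear_cinner]
lemmas continuous_on_cinner [continuous_intros] = bounded_bilinear.continuous_on[OF bounded_bilinear_cinner]
lemmas tendsto_scaleC [tendsto_intros] = bounded_bilinear.tendsto[OF bounded_bilinear_scaleC]
lemmas continuous_on_scaleC [continuous_intros] = bounded_bilinear.continuous_on[OF bounded_bilinear_scaleC]

lemma has_sum_cinner_right: "(f has_sum s) A \<Longrightarrow> ((\<lambda>i. cinner x (f i)) has_sum cinner x s) A"
  by (rule has_sum_bounded_linear[OF cinner_bl_right])

lemma has_sum_cinner_left: "(f has_sum s) A \<Longrightarrow> ((\<lambda>i. cinner (f i) x) has_sum cinner s x) A"
  by (rule has_sum_bounded_linear[OF cinner_bl_left])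

lemma cinner_right_eqI: "(\<And>z. cinner z x = cinner z y) \<Longrightarrow> x = y"
  by (metis cinner_diff_right cinner_eq_zero_iff eq_iff_diff_eq_0)

lemma norm_diff_power2_cinner:
  "(norm (x - y))\<^sup>2 = (norm x)\<^sup>2 + (norm y)\<^sup>2 - 2 * Re (cinner x y)"
  by (simp add: power2_norm_eq_inner Re_cinner inner_diff_left inner_diff_right inner_commute)

section \<open>Bounded complex-linear operators\<close>

lemma bounded_clinearI:
  assumes "\<And>x y. T (x + y) = T x + T y" "\<And>c x. T (c *\<^sub>C x) = c *\<^sub>C T x"
    and "\<And>x. norm (T x) \<le> K * norm x"
  shows "bounded_clinear T"
  unfolding bounded_clinear_def
proof (intro conjI allI bounded_linear_intro)
  show "T (r *\<^sub>R x) = r *\<^sub>R T x" for r x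
    using assms(2)[of "complex_of_real r" x] by (simp add: scaleC_of_real)
  show "norm (T x) \<le> norm x * K" for x using assms(3)[of x] by (simp add: mult.commute)
qed (use assms in auto)

lemma bounded_clinear_bl: "bounded_clinear T \<Longrightarrow> bounded_linear T"
  by (simp add: bounded_clinear_def)

lemma bounded_clinear_add: "bounded_clinear T \<Longrightarrow> T (x + y) = T x + T y"
  using linear_add bounded_clinear_bl bounded_linear.linear by blast

lemma bounded_clinear_diff: "bounded_clinear T \<Longrightarrow> T (x - y) = T x - T y"
  using linear_diff bounded_clinear_bl bounded_linear.linear by blast

lemma bounded_clinear_zero: "bounded_clinear T \<Longrightarrow> T 0 = 0"
  using linear_0 bounded_clinear_bl bounded_linear.linear by blast

lemma bounded_clinear_scaleC: "bounded_clinear T \<Longrightarrow> T (c *\<^sub>C x) = c *\<^sub>C T x"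
  by (simp add: bounded_clinear_def)

lemma bounded_clinear_scaleR: "bounded_clinear T \<Longrightarrow> T (r *\<^sub>R x) = r *\<^sub>R T x"
  using linear_scale bounded_clinear_bl bounded_linear.linear by blast

lemma bounded_clinear_continuous_on: "bounded_clinear T \<Longrightarrow> continuous_on S T"
  by (simp add: bounded_clinear_bl linear_continuous_on)

lemma bounded_clinear_tendsto: "bounded_clinear T \<Longrightarrow> (f \<longlongrightarrow> l) F \<Longrightarrow> ((\<lambda>x. T (f x)) \<longlongrightarrow> T l) F"
  using bounded_clinear_bl bounded_linear.tendsto by blast

lemma bounded_clinear_has_sum: "bounded_clinear T \<Longrightarrow> (f has_sum s) A \<Longrightarrow> ((\<lambda>i. T (f i)) has_sum T s) A"
  using bounded_clinear_bl has_sum_bounded_linear by blast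

lemma bounded_clinear_comp: "bounded_clinear S \<Longrightarrow> bounded_clinear T \<Longrightarrow> bounded_clinear (\<lambda>x. S (T x))"
  unfolding bounded_clinear_def by (auto intro: bounded_linear_compose)

lemma bounded_clinear_plus: "bounded_clinear S \<Longrightarrow> bounded_clinear T \<Longrightarrow> bounded_clinear (\<lambda>x. S x + T x)"
  unfolding bounded_clinear_def by (auto intro: bounded_linear_add simp: scaleC_add_right)

lemma bounded_clinear_minus: "bounded_clinear S \<Longrightarrow> bounded_clinear T \<Longrightarrow> bounded_clinear (\<lambda>x. S x - T x)"
  unfolding bounded_clinear_def by (auto intro: bounded_linear_sub simp: scaleC_diff_right)

lemma bounded_clinear_cmult: "bounded_clinear T \<Longrightarrow> bounded_clinear (\<lambda>x. c *\<^sub>C T x)"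
  unfolding bounded_clinear_def
  by (auto intro: bounded_linear_compose[OF scaleC_bl_right] simp: scaleC_scaleC mult.commute)

lemma bounded_clinear_rmult: "bounded_clinear T \<Longrightarrow> bounded_clinear (\<lambda>x. r *\<^sub>R T x)"
  using bounded_clinear_cmult[of T "complex_of_real r"] by (simp add: scaleC_of_real)

lemma bounded_clinear_id: "bounded_clinear (\<lambda>x. x)"
  by (rule bounded_clinearI[where K = 1]) auto

lemma bounded_clinear_0: "bounded_clinear (\<lambda>x. 0)"
  by (rule bounded_clinearI[where K = 0]) auto

text \<open>Polarisation: the norms determine the real part of the inner product, and passing from
  \<open>y\<close> to \<open>\<i> *\<^sub>C y\<close> gives the imaginary part.\<close>

lemma isometry_cinner:
  assumes U: "bounded_clinear U" and n: "\<And>x. norm (U x) = norm x"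
  shows "cinner (U x) (U y) = cinner x y"
proof -
  have re: "Re (cinner (U x) (U y)) = Re (cinner x y)" for x y
    using norm_diff_power2_cinner[of "U x" "U y"] norm_diff_power2_cinner[of x y] n[of "x - y"]
    by (simp add: bounded_clinear_diff[OF U] n)
  have "Im (cinner u v) = - Re (cinner u (\<i> *\<^sub>C v))" for u v :: 'b
    by (simp add: cinner_scaleC_right)
  moreover have "Im (cinner u v) = - Re (cinner u (\<i> *\<^sub>C v))" for u v :: 'a
    by (simp add: cinner_scaleC_right)
  ultimately show ?thesis
    using re[of x y] re[of x "\<i> *\<^sub>C y"] by (simp add: complex_eq_iff bounded_clinear_scaleC[OF U])
qed

section \<open>Orthonormal families, projections and the Riesz representation\<close>

definition orthonormal :: "'a::complex_inner set \<Rightarrow> bool" where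
  "orthonormal E \<longleftrightarrow> (\<forall>e\<in>E. \<forall>e'\<in>E. cinner e e' = (if e = e' then 1 else 0))"

definition csubspace :: "'a::complex_inner set \<Rightarrow> bool" where
  "csubspace M \<longleftrightarrow> subspace M \<and> (\<forall>c. \<forall>x\<in>M. c *\<^sub>C x \<in> M)"

lemma norm_sum_orthogonal:
  assumes "finite F" "\<And>i j. i \<in> F \<Longrightarrow> j \<in> F \<Longrightarrow> i \<noteq> j \<Longrightarrow> cinner (x i) (x j) = 0"
  shows "(norm (sum x F))\<^sup>2 = (\<Sum>i\<in>F. (norm (x i))\<^sup>2)"
  using assms
proof (induction F rule: finite_induct)
  case (insert a F)
  have "cinner (x a) (sum x F) = 0"
    unfolding cinner_sum_right using insert by (intro sum.neutral) auto
  then have "inner (x a) (sum x F) = 0" by (metis Re_cinner zero_complex.sel(1))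
  moreover have "(norm (sum x F))\<^sup>2 = (\<Sum>i\<in>F. (norm (x i))\<^sup>2)"
    using insert by blast
  ultimately show ?case
    using insert by (simp add: power2_norm_eq_inner inner_add_left inner_add_right inner_commute)
qed simp

text \<open>By Pythagoras the squared distance between two nested partial sums is a difference of
  partial sums of the real series, so the net of finite partial sums is Cauchy. The index set may be
  uncountable, which is why completeness is used for filters and not for sequences.\<close>

lemma summable_on_orthogonal:
  fixes x :: "'i \<Rightarrow> 'a::chilbert_space"
  assumes orth: "\<And>i j. i \<in> I \<Longrightarrow> j \<in> I \<Longrightarrow> i \<noteq> j \<Longrightarrow> cinner (x i) (x j) = 0"
    and "(\<lambda>i. (norm (x i))\<^sup>2) summable_on I"
  shows "x summable_on I"
proof -
  obtain L where "((\<lambda>i. (norm (x i))\<^sup>2) has_sum L) I"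
    using assms(2) by (auto simp: summable_on_def)
  then have lim: "(sum (\<lambda>i. (norm (x i))\<^sup>2) \<longlongrightarrow> L) (finite_subsets_at_top I)"
    by (simp only: has_sum_def)
  have "\<exists>P. eventually P (finite_subsets_at_top I) \<and>
              (\<forall>F F'. P F \<and> P F' \<longrightarrow> dist (sum x F) (sum x F') < e)" if "e > 0" for e
  proof -
    \<comment> \<open>The tolerance is used twice, for \<open>F\<close> and for \<open>X\<close>,
      and 2 (e/4)^2 \<le> (e/2)^2.\<close>
    have "\<forall>\<^sub>F F in finite_subsets_at_top I. dist (sum (\<lambda>i. (norm (x i))\<^sup>2) F) L < (e/4)\<^sup>2"
      using lim that unfolding tendsto_iff by simp
    then obtain X where X: "finite X" "X \<subseteq> I"
      and XF: "\<forall>F. finite F \<and> X \<subseteq> F \<and> F \<subseteq> I \<longrightarrow> dist (sum (\<lambda>i. (norm (x i))\<^sup>2) F) L < (e/4)\<^sup>2"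
      unfolding eventually_finite_subsets_at_top by blast
    define P where "P F \<longleftrightarrow> finite F \<and> X \<subseteq> F \<and> F \<subseteq> I" for F
    have near: "dist (sum x F) (sum x X) < e / 2" if "P F" for F
    proof -
      have F: "finite F" "X \<subseteq> F" "F \<subseteq> I" using that by (auto simp: P_def)
      have "(dist (sum x F) (sum x X))\<^sup>2 = (norm (sum x (F - X)))\<^sup>2"
        unfolding dist_norm using F by (subst sum_diff) auto
      also have "\<dots> = (\<Sum>i\<in>F - X. (norm (x i))\<^sup>2)"
        using F X by (intro norm_sum_orthogonal orth) auto
      also have "\<dots> = (\<Sum>i\<in>F. (norm (x i))\<^sup>2) - (\<Sum>i\<in>X. (norm (x i))\<^sup>2)"
        using F by (intro sum_diff) auto
      also have "\<dots> < 2 * (e/4)\<^sup>2"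
        using XF[rule_format, of F] XF[rule_format, of X] F X unfolding dist_real_def by auto
      also have "\<dots> \<le> (e/2)\<^sup>2" by (simp add: power2_eq_square)
      finally show ?thesis using \<open>e > 0\<close> by (metis half_gt_zero less_le power2_less_imp_less)
    qed
    have "eventually P (finite_subsets_at_top I)"
      unfolding eventually_finite_subsets_at_top P_def using X by blast
    moreover have "dist (sum x F) (sum x F') < e" if "P F" "P F'" for F F'
      using near[OF that(1)] near[OF that(2)] dist_triangle_half_l by (metis dist_commute)
    ultimately show ?thesis by blast
  qed
  then have "cauchy_filter (filtermap (sum x) (finite_subsets_at_top I))"
    by (simp add: cauchy_filter_metric_filtermap)
  moreover have "complete (UNIV::'a set)"
    by (meson Cauchy_convergent UNIV_I complete_def convergent_def)
  ultimately obtain L' where "(sum x \<longlongrightarrow> L') (finite_subsets_at_top I)"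
    using complete_uniform[where S = UNIV] by (force simp: filterlim_def)
  then show ?thesis
    using summable_on_def has_sum_def by blast
qed

lemma bessel_finite:
  assumes "orthonormal E" "finite E"
  shows "(\<Sum>e\<in>E. (cmod (cinner e x))\<^sup>2) \<le> (norm x)\<^sup>2"
proof -
  define y where "y = (\<Sum>e\<in>E. cinner e x *\<^sub>C e)"
  define s where "s = (\<Sum>e\<in>E. (cmod (cinner e x))\<^sup>2)"
  have n: "norm e = 1" if "e \<in> E" for e
    using assms(1) that cinner_self[of e] unfolding orthonormal_def
    by (metis norm_ge_zero of_real_eq_1_iff power2_eq_1_iff less_eq_real_def not_one_le_zero neg_0_le_iff_le)
  have "cinner x y = complex_of_real s"
    unfolding y_def s_def cinner_sum_right cinner_scaleC_right of_real_sum
    by (intro sum.cong refl) (metis cinner_commute complex_norm_square of_real_power)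
  moreover have "(norm y)\<^sup>2 = s"
    unfolding y_def s_def
    using assms n by (subst norm_sum_orthogonal)
      (auto simp: cinner_scaleC_left cinner_scaleC_right orthonormal_def norm_scaleC)
  ultimately have "(norm (x - y))\<^sup>2 = (norm x)\<^sup>2 - s"
    by (simp add: norm_diff_power2_cinner)
  then show ?thesis unfolding s_def[symmetric] by (metis diff_ge_0_iff_ge zero_le_power2)
qed

lemma orthonormal_subset: "orthonormal E \<Longrightarrow> F \<subseteq> E \<Longrightarrow> orthonormal F"
  unfolding orthonormal_def by blast

lemma bessel_summable:
  assumes "orthonormal E"
  shows "(\<lambda>e. (cmod (cinner e x))\<^sup>2) summable_on E"
proof (rule nonneg_bdd_above_summable_on)
  show "bdd_above (sum (\<lambda>e. (cmod (cinner e x))\<^sup>2) ` {F. F \<subseteq> E \<and> finite F})"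
    by (rule bdd_aboveI2[where M = "(norm x)\<^sup>2"])
      (auto intro: bessel_finite orthonormal_subset[OF assms])
qed simp

lemma orthonormal_norm: "orthonormal E \<Longrightarrow> e \<in> E \<Longrightarrow> norm e = 1"
  unfolding orthonormal_def using cinner_self[of e]
  by (metis norm_ge_zero of_real_eq_1_iff power2_eq_1_iff less_eq_real_def not_one_le_zero neg_0_le_iff_le)

text \<open>Zorn's lemma, relative to a complex subspace: the whole space yields
  \<open>some_basis\<close>, a closed subspace yields the projection onto it. A vector of
  \<open>M\<close> orthogonal to a maximal family could be normalised and added.\<close>

lemma maximal_orthonormal:
  assumes M: "csubspace M"
  shows "\<exists>E\<subseteq>M. orthonormal E \<and> (\<forall>x\<in>M. (\<forall>e\<in>E. cinner e x = 0) \<longrightarrow> x = 0)"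
proof -
  let ?A = "{E. E \<subseteq> M \<and> orthonormal E}"
  have "\<Union>C \<in> ?A" if C: "subset.chain ?A C" for C
  proof -
    have "cinner e e' = (if e = e' then 1 else 0)" if "e \<in> X" "X \<in> C" "e' \<in> Y" "Y \<in> C" for e e' X Y
    proof -
      have "X \<subseteq> Y \<or> Y \<subseteq> X" using C that unfolding subset.chain_def by blast
      moreover have "orthonormal X" "orthonormal Y" using C that unfolding subset.chain_def by auto
      ultimately show ?thesis using that unfolding orthonormal_def by blast
    qed
    then have "orthonormal (\<Union>C)" unfolding orthonormal_def by (metis UnionE)
    moreover have "\<Union>C \<subseteq> M" using C unfolding subset.chain_def by blast
    ultimately show ?thesis by simp
  qed
  then have "\<exists>E\<in>?A. \<forall>X\<in>?A. E \<subseteq> X \<longrightarrow> X = E"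
    by (rule subset_Zorn')
  then obtain E where E: "E \<subseteq> M" "orthonormal E"
    and max: "\<And>X. X \<subseteq> M \<Longrightarrow> orthonormal X \<Longrightarrow> E \<subseteq> X \<Longrightarrow> X = E"
    by auto
  moreover have "x = 0" if x: "x \<in> M" "\<forall>e\<in>E. cinner e x = 0" for x
  proof (rule ccontr)
    assume "x \<noteq> 0"
    define u where "u = (1 / norm x) *\<^sub>R x"
    have "norm u = 1" using \<open>x \<noteq> 0\<close> by (simp add: u_def)
    then have u: "cinner u u = 1" by (simp add: cinner_self)
    have uM: "u \<in> M" using M x(1) by (simp add: u_def csubspace_def subspace_scale)
    have z: "cinner e u = 0" "cinner u e = 0" if "e \<in> E" for e
      using bspec[OF x(2) that] cinner_commute[of u e] by (simp_all add: u_def cinner_scaleR_right)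
    have "orthonormal (insert u E)"
      using E(2) u z unfolding orthonormal_def by (metis insert_iff)
    then have "insert u E = E"
      using E(1) uM by (intro max) auto
    then have "cinner u u = 0" using z by blast
    with u show False by simp
  qed
  ultimately show ?thesis by (intro exI[of _ E]) blast
qed

lemma closed_has_sum_mem:
  fixes x :: "'i \<Rightarrow> 'a::real_normed_vector"
  assumes "closed M" "subspace M" "(x has_sum s) I" "\<And>i. i \<in> I \<Longrightarrow> x i \<in> M"
  shows "s \<in> M"
proof (rule Lim_in_closed_set[OF assms(1)])
  show "(sum x \<longlongrightarrow> s) (finite_subsets_at_top I)" using assms(3) by (simp add: has_sum_def)
  show "\<forall>\<^sub>F F in finite_subsets_at_top I. sum x F \<in> M"
    by (rule eventually_finite_subsets_at_top_weakI) (use assms in \<open>auto intro: subspace_sum\<close>)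
qed simp

lemma orthonormal_expansion_summable:
  fixes E :: "'a::chilbert_space set"
  assumes "orthonormal E" "(\<lambda>e. (cmod (a e))\<^sup>2) summable_on E"
  shows "(\<lambda>e. a e *\<^sub>C e) summable_on E"
proof (rule summable_on_orthogonal)
  show "cinner (a i *\<^sub>C i) (a j *\<^sub>C j) = 0" if "i \<in> E" "j \<in> E" "i \<noteq> j" for i j
    using assms(1) that by (simp add: cinner_scaleC_left cinner_scaleC_right orthonormal_def)
  have "(\<lambda>i. (norm (a i *\<^sub>C i))\<^sup>2) summable_on E \<longleftrightarrow> (\<lambda>e. (cmod (a e))\<^sup>2) summable_on E"
    by (rule summable_on_cong) (simp add: norm_scaleC orthonormal_norm[OF assms(1)])
  with assms(2) show "(\<lambda>i. (norm (a i *\<^sub>C i))\<^sup>2) summable_on E" by simp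
qed

lemma orthonormal_coefficient:
  assumes "orthonormal E" "((\<lambda>e. a e *\<^sub>C e) has_sum y) E" "e \<in> E"
  shows "cinner e y = a e"
proof -
  have "((\<lambda>e'. cinner e (a e' *\<^sub>C e')) has_sum cinner e y) E"
    by (rule has_sum_cinner_right) fact
  moreover have "((\<lambda>e'. cinner e (a e' *\<^sub>C e')) has_sum a e) E"
    by (rule has_sum_finite_neutralI[of "{e}"])
      (use assms in \<open>auto simp: cinner_scaleC_right orthonormal_def\<close>)
  ultimately show ?thesis by (rule has_sum_unique)
qed

text \<open>The projection of \<open>x\<close> is its expansion in a maximal orthonormal subset of
  \<open>M\<close>. Maximality makes every \<open>m\<close> in \<open>M\<close> equal to its own
  expansion, so orthogonality of the remainder to \<open>E\<close> passes to all of
  \<open>M\<close>.\<close>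

lemma closed_csubspace_projection:
  fixes M :: "'a::chilbert_space set"
  assumes "closed M" "csubspace M"
  shows "\<exists>p\<in>M. \<forall>m\<in>M. cinner m (x - p) = 0"
proof -
  obtain E where E: "E \<subseteq> M" "orthonormal E"
      and max: "\<forall>x\<in>M. (\<forall>e\<in>E. cinner e x = 0) \<longrightarrow> x = 0"
    using maximal_orthonormal[OF assms(2)] by blast
  have ex: "\<exists>p\<in>M. ((\<lambda>e. cinner e x *\<^sub>C e) has_sum p) E \<and> (\<forall>e\<in>E. cinner e (x - p) = 0)" for x
  proof -
    obtain p where p: "((\<lambda>e. cinner e x *\<^sub>C e) has_sum p) E"
      using orthonormal_expansion_summable[OF E(2) bessel_summable[OF E(2)], of x]
      unfolding summable_on_def by blast
    have "p \<in> M"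
      using assms(2) E(1) unfolding csubspace_def
      by (intro closed_has_sum_mem[OF assms(1) _ p]) blast+
    moreover have "cinner e (x - p) = 0" if "e \<in> E" for e
      using orthonormal_coefficient[OF E(2) p that] by (simp add: cinner_diff_right)
    ultimately show ?thesis using p by blast
  qed
  obtain p where p: "p \<in> M" "\<forall>e\<in>E. cinner e (x - p) = 0"
    using ex by blast
  have "cinner m (x - p) = 0" if "m \<in> M" for m
  proof -
    obtain q where q: "q \<in> M" "((\<lambda>e. cinner e m *\<^sub>C e) has_sum q) E" "\<forall>e\<in>E. cinner e (m - q) = 0"
      using ex by blast
    have "m - q = 0"
    proof -
      have "m - q \<in> M" using q(1) that assms(2) by (simp add: csubspace_def subspace_diff)
      with q(3) max show ?thesis by blast
    qed
    then have "((\<lambda>e. cinner (cinner e m *\<^sub>C e) (x - p)) has_sum cinner m (x - p)) E"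
      using q(2) by (intro has_sum_cinner_left) simp
    moreover have "((\<lambda>e. cinner (cinner e m *\<^sub>C e) (x - p)) has_sum 0) E"
      by (rule has_sum_0) (use p in \<open>simp add: cinner_scaleC_left\<close>)
    ultimately show ?thesis by (rule has_sum_unique)
  qed
  with p(1) show ?thesis by blast
qed

lemma subspace_closure:
  fixes M :: "'a::real_normed_vector set"
  assumes "subspace M"
  shows "subspace (closure M)"
  unfolding subspace_def
proof (intro conjI allI ballI)
  show "0 \<in> closure M" using subspace_0[OF assms] closure_subset by blast
next
  fix x y assume xy: "x \<in> closure M" "y \<in> closure M"
  obtain f g where "\<forall>n. f n \<in> M" "f \<longlonglongrightarrow> x" "\<forall>n. g n \<in> M" "g \<longlonglongrightarrow> y"
    using xy unfolding closure_sequential by blast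
  then show "x + y \<in> closure M"
    unfolding closure_sequential
    by (intro exI[of _ "\<lambda>n. f n + g n"]) (auto intro: tendsto_add subspace_add assms)
next
  fix r x assume x: "x \<in> closure M"
  obtain f where "\<forall>n. f n \<in> M" "f \<longlonglongrightarrow> x"
    using x unfolding closure_sequential by blast
  then show "r *\<^sub>R x \<in> closure M"
    unfolding closure_sequential
    by (intro exI[of _ "\<lambda>n. r *\<^sub>R f n"]) (auto intro: tendsto_intros subspace_scale assms)
qed

lemma csubspace_closure:
  assumes "csubspace M"
  shows "csubspace (closure M)"
proof -
  have "c *\<^sub>C x \<in> closure M" if x: "x \<in> closure M" for c x
  proof -
    obtain f where "\<And>n. f n \<in> M" "f \<longlonglongrightarrow> x"
      using x unfolding closure_sequential by blast
    then have "\<And>n. c *\<^sub>C f n \<in> M" "(\<lambda>n. c *\<^sub>C f n) \<longlonglongrightarrow> c *\<^sub>C x"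
      using assms by (auto simp: csubspace_def intro: tendsto_intros)
    then show ?thesis unfolding closure_sequential by (auto intro!: exI[of _ "\<lambda>n. c *\<^sub>C f n"])
  qed
  then show ?thesis using assms by (auto simp: csubspace_def subspace_closure)
qed

lemma csubspace_denseI:
  fixes M :: "'a::chilbert_space set"
  assumes "csubspace M" "\<And>x. (\<And>m. m \<in> M \<Longrightarrow> cinner m x = 0) \<Longrightarrow> x = 0"
  shows "closure M = UNIV"
proof -
  have "x \<in> closure M" for x
  proof -
    obtain p where p: "p \<in> closure M" "\<forall>m\<in>closure M. cinner m (x - p) = 0"
      using closed_csubspace_projection[OF closed_closure csubspace_closure[OF assms(1)]] by blast
    have "cinner m (x - p) = 0" if "m \<in> M" for m
      using p(2) closure_subset that by blast
    then have "x - p = 0" by (rule assms(2))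
    with p(1) show ?thesis by simp
  qed
  then show ?thesis by blast
qed

text \<open>A basis is by definition a maximal orthonormal family, so existence is immediate from
  Zorn's lemma; completeness enters with the expansion below.\<close>

lemma orthonormal_basis_some: "orthonormal_basis (some_basis :: 'a::complex_inner set)"
proof -
  obtain E :: "'a set" where "orthonormal E" "\<And>x. (\<forall>e\<in>E. cinner e x = 0) \<Longrightarrow> x = 0"
    using maximal_orthonormal[of "UNIV :: 'a set"] unfolding csubspace_def by auto
  then have "orthonormal_basis E"
    unfolding orthonormal_basis_def orthonormal_def by blast
  then show ?thesis unfolding some_basis_def by (rule someI)
qed

lemma orthonormal_some_basis: "orthonormal some_basis"
  using orthonormal_basis_some unfolding orthonormal_basis_def orthonormal_def by blast

lemma basis_expansion: "((\<lambda>e. cinner e x *\<^sub>C e) has_sum x) some_basis" for x :: "'a::chilbert_space"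
proof -
  obtain p where p: "((\<lambda>e. cinner e x *\<^sub>C e) has_sum p) some_basis"
    using orthonormal_expansion_summable[OF orthonormal_some_basis bessel_summable[OF orthonormal_some_basis]]
    unfolding summable_on_def by blast
  have "\<forall>e\<in>some_basis. cinner e (x - p) = 0"
    using orthonormal_coefficient[OF orthonormal_some_basis p] by (simp add: cinner_diff_right)
  then have "x - p = 0" using orthonormal_basis_some unfolding orthonormal_basis_def by blast
  with p show ?thesis by simp
qed

lemma parseval:
  "((\<lambda>e. cinner x e * cinner e y) has_sum cinner x y) some_basis" for x :: "'a::chilbert_space"
  using has_sum_cinner_right[OF basis_expansion[of y], of x]
  by (simp add: cinner_scaleC_right mult.commute)

lemma parseval_norm:
  "((\<lambda>e. (cmod (cinner e x))\<^sup>2) has_sum (norm x)\<^sup>2) some_basis" for x :: "'a::chilbert_space"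
proof -
  have "cinner x e * cinner e x = complex_of_real ((cmod (cinner e x))\<^sup>2)" for e
    by (metis cinner_commute complex_norm_square mult.commute)
  then have "((\<lambda>e. complex_of_real ((cmod (cinner e x))\<^sup>2)) has_sum complex_of_real ((norm x)\<^sup>2)) some_basis"
    using parseval[of x x] by (simp add: cinner_self)
  then show ?thesis unfolding has_sum_of_real_iff .
qed

text \<open>The representing vector has the conjugates of the values \<open>f e\<close> as
  coefficients. They are square summable: on the partial sum \<open>y\<close> over a finite set the
  functional takes the value |y|^2, so |y| is at most the bound \<open>K\<close>.\<close>

lemma riesz_representation:
  fixes f :: "'a::chilbert_space \<Rightarrow> complex"
  assumes f: "bounded_linear f" "\<And>c x. f (c *\<^sub>C x) = c * f x"
  shows "\<exists>y. \<forall>x. f x = cinner y x"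
proof -
  obtain K where K: "\<And>x. cmod (f x) \<le> norm x * K" "K \<ge> 0"
    using bounded_linear.nonneg_bounded[OF f(1)] by blast
  have "(\<lambda>e. (cmod (cnj (f e)))\<^sup>2) summable_on some_basis"
  proof (rule nonneg_bdd_above_summable_on)
    have "(\<Sum>e\<in>F. (cmod (cnj (f e)))\<^sup>2) \<le> K\<^sup>2" if F: "F \<subseteq> some_basis" "finite F" for F
    proof -
      define y where "y = (\<Sum>e\<in>F. cnj (f e) *\<^sub>C e)"
      have on: "orthonormal F" using orthonormal_subset[OF orthonormal_some_basis F(1)] .
      have s: "(norm y)\<^sup>2 = (\<Sum>e\<in>F. (cmod (cnj (f e)))\<^sup>2)"
        unfolding y_def using on F(2)
        by (subst norm_sum_orthogonal)
          (auto simp: cinner_scaleC_left cinner_scaleC_right orthonormal_def norm_scaleC orthonormal_norm[OF on])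
      have "f y = complex_of_real (\<Sum>e\<in>F. (cmod (cnj (f e)))\<^sup>2)"
        unfolding y_def by (simp add: linear_sum bounded_linear.linear[OF f(1)] f(2) mult.commute[of "cnj _"] flip: complex_norm_square)
      then have "cmod (f y) = (norm y)\<^sup>2" using s by (metis norm_of_real abs_of_nonneg zero_le_power2)
      then have "norm y * norm y \<le> norm y * K" using K(1)[of y] by (simp add: power2_eq_square)
      then have "norm y \<le> K" using K(2) by (cases "norm y = 0") (auto simp: mult_le_cancel_left)
      then show ?thesis unfolding s[symmetric] by (intro power_mono) auto
    qed
    then show "bdd_above (sum (\<lambda>e. (cmod (cnj (f e)))\<^sup>2) ` {F. F \<subseteq> some_basis \<and> finite F})"
      by (intro bdd_aboveI2[where M = "K\<^sup>2"]) auto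
  qed simp
  then obtain y where y: "((\<lambda>e. cnj (f e) *\<^sub>C e) has_sum y) some_basis"
    using orthonormal_expansion_summable[OF orthonormal_some_basis, of "\<lambda>e. cnj (f e)"]
    unfolding summable_on_def by blast
  have "f x = cinner y x" for x
  proof -
    have "((\<lambda>e. f (cinner e x *\<^sub>C e)) has_sum f x) some_basis"
      by (rule has_sum_bounded_linear[OF f(1) basis_expansion])
    moreover have "((\<lambda>e. f (cinner e x *\<^sub>C e)) has_sum cinner y x) some_basis"
      using has_sum_cinner_left[OF y, of x] by (simp add: f(2) cinner_scaleC_left mult.commute)
    ultimately show ?thesis by (rule has_sum_unique)
  qed
  then show ?thesis by blast
qed

text \<open>The Riesz representation in the first argument, for each fixed \<open>v\<close>. It
  provides the operator behind the weak integral in \<open>env_channel\<close>.\<close>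

lemma sesquilinear_operator:
  fixes b :: "'a::chilbert_space \<Rightarrow> 'a \<Rightarrow> complex"
  assumes left: "\<And>u u' v. b (u + u') v = b u v + b u' v" "\<And>c u v. b (c *\<^sub>C u) v = cnj c * b u v"
    and right: "\<And>u v v'. b u (v + v') = b u v + b u v'" "\<And>c u v. b u (c *\<^sub>C v) = c * b u v"
    and bound: "\<And>u v. cmod (b u v) \<le> K * norm u * norm v"
  shows "\<exists>L. bounded_clinear L \<and> (\<forall>u v. cinner u (L v) = b u v)"
proof -
  have "\<exists>y. \<forall>u. cinner u y = b u v" for v
  proof -
    define f where "f u = cnj (b u v)" for u
    have "bounded_linear f"
    proof (rule bounded_linear_intro)
      show "f (r *\<^sub>R x) = r *\<^sub>R f x" for r x
        using left(2)[of "complex_of_real r" x v]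
        by (simp add: f_def scaleC_of_real scaleR_conv_of_real)
      show "norm (f x) \<le> norm x * (K * norm v)" for x
        using bound[of x v] by (simp add: f_def algebra_simps)
    qed (simp add: f_def left)
    moreover have "f (c *\<^sub>C x) = c * f x" for c x by (simp add: f_def left)
    ultimately obtain y where "\<forall>x. f x = cinner y x"
      using riesz_representation[of f] by blast
    then have "cinner u y = b u v" for u
      by (metis cinner_commute complex_cnj_cnj f_def)
    then show ?thesis by blast
  qed
  then obtain L where L: "\<And>u v. cinner u (L v) = b u v" by metis
  have "bounded_clinear L"
  proof (rule bounded_clinearI)
    show "L (x + y) = L x + L y" for x y
      by (rule cinner_right_eqI) (simp add: L right cinner_add_right)
    show "L (c *\<^sub>C x) = c *\<^sub>C L x" for c x
      by (rule cinner_right_eqI) (simp add: L right cinner_scaleC_right)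
    \<comment> \<open>The sign of \<open>K\<close> is not prescribed, hence the absolute
      value.\<close>
    show "norm (L x) \<le> \<bar>K\<bar> * norm x" for x
    proof -
      have "(norm (L x))\<^sup>2 = cmod (cinner (L x) (L x))" by (simp add: cinner_self norm_power)
      also have "\<dots> \<le> K * norm (L x) * norm x" unfolding L by (rule bound)
      also have "\<dots> \<le> \<bar>K\<bar> * norm (L x) * norm x" by (intro mult_right_mono) auto
      finally have "norm (L x) * norm (L x) \<le> norm (L x) * (\<bar>K\<bar> * norm x)"
        by (simp add: power2_eq_square algebra_simps)
      then show ?thesis by (cases "L x = 0") (auto simp: mult_le_cancel_left)
    qed
  qed
  with L show ?thesis by blast
qed

text \<open>The contraction is the closure of the relation, precomposed with the projection onto its
  domain.\<close>

lemma contraction_extension: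
  fixes S :: "('a::chilbert_space \<times> 'b::chilbert_space) set"
  assumes S: "subspace S" "\<And>c x y. (x, y) \<in> S \<Longrightarrow> (c *\<^sub>C x, c *\<^sub>C y) \<in> S"
    and iso: "\<And>x y. (x, y) \<in> S \<Longrightarrow> norm y = norm x"
  shows "\<exists>V. bounded_clinear V \<and> (\<forall>x. norm (V x) \<le> norm x) \<and> (\<forall>(x, y)\<in>S. V x = y) \<and>
    (closure (fst ` S) = UNIV \<longrightarrow> (\<forall>x. norm (V x) = norm x))"
proof -
  define G where "G = closure S"
  define M where "M = fst ` G"
  have subG: "subspace G" unfolding G_def by (rule subspace_closure[OF S(1)])
  have seq: "\<exists>f. (\<forall>n. f n \<in> S) \<and> (\<lambda>n. fst (f n)) \<longlonglongrightarrow> x \<and> (\<lambda>n. snd (f n)) \<longlonglongrightarrow> y" if "(x, y) \<in> G" for x y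
    using that unfolding G_def closure_sequential by (metis fst_conv snd_conv tendsto_fst tendsto_snd)
  have limG: "(x, y) \<in> G"
    if "\<And>n. f n \<in> G" "(\<lambda>n. fst (f n)) \<longlonglongrightarrow> x" "(\<lambda>n. snd (f n)) \<longlonglongrightarrow> y" for f x y
  proof -
    have "f \<longlonglongrightarrow> (x, y)" using tendsto_Pair[OF that(2,3)] by simp
    then show ?thesis using that(1) unfolding G_def by (meson closed_closure closed_sequentially)
  qed
  have isoG: "norm y = norm x" if "(x, y) \<in> G" for x y
  proof -
    obtain f where f: "\<And>n. f n \<in> S" "(\<lambda>n. fst (f n)) \<longlonglongrightarrow> x" "(\<lambda>n. snd (f n)) \<longlonglongrightarrow> y"
      using seq[OF \<open>(x, y) \<in> G\<close>] by blast
    have "norm (snd (f n)) = norm (fst (f n))" for n using iso f(1) by (metis prod.collapse)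
    then show ?thesis
      using tendsto_norm[OF f(2)] tendsto_norm[OF f(3)] LIMSEQ_unique by simp
  qed
  have scG: "(c *\<^sub>C x, c *\<^sub>C y) \<in> G" if "(x, y) \<in> G" for c x y
  proof -
    obtain f where f: "\<And>n. f n \<in> S" "(\<lambda>n. fst (f n)) \<longlonglongrightarrow> x" "(\<lambda>n. snd (f n)) \<longlonglongrightarrow> y"
      using seq[OF \<open>(x, y) \<in> G\<close>] by blast
    have "(c *\<^sub>C fst (f n), c *\<^sub>C snd (f n)) \<in> G" for n
      using S(2)[of "fst (f n)" "snd (f n)" c] f(1)[of n] closure_subset unfolding G_def by auto
    then show ?thesis
      by (rule limG[of "\<lambda>n. (c *\<^sub>C fst (f n), c *\<^sub>C snd (f n))"]) (auto intro!: tendsto_intros f)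
  qed
  \<comment> \<open>The relation is isometric, so a pair (0, y - y') in it has second component
    0.\<close>
  have uniq: "y = y'" if "(x, y) \<in> G" "(x, y') \<in> G" for x y y'
    using isoG[of 0 "y - y'"] subspace_diff[OF subG that] by simp
  have subM: "csubspace M"
    unfolding csubspace_def M_def
  proof (intro conjI allI ballI)
    show "subspace (fst ` G)" by (rule linear_subspace_image[OF _ subG]) (simp add: linear_fst)
    show "c *\<^sub>C x \<in> fst ` G" if "x \<in> fst ` G" for c x
      using that scG by force
  qed
  have closedM: "closed M"
  proof (rule closed_sequential_limits[THEN iffD2], intro allI impI)
    fix f x assume "(\<forall>n. f n \<in> M) \<and> f \<longlonglongrightarrow> x"
    then have "\<forall>n. \<exists>y. (f n, y) \<in> G" and fx: "f \<longlonglongrightarrow> x" unfolding M_def by force+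
    then obtain g where g: "\<And>n. (f n, g n) \<in> G" by metis
    have "dist (g m) (g n) = dist (f m) (f n)" for m n
      unfolding dist_norm by (rule isoG) (use subspace_diff[OF subG g g, of m n] in simp)
    moreover have "Cauchy f" using fx LIMSEQ_imp_Cauchy by blast
    ultimately have "Cauchy g" unfolding Cauchy_def by simp
    then obtain y where "g \<longlonglongrightarrow> y" using Cauchy_convergent convergent_def by blast
    then have "(x, y) \<in> G" using limG[of "\<lambda>n. (f n, g n)" x y] g fx by simp
    then show "x \<in> M" unfolding M_def by (rule image_eqI[rotated]) simp
  qed
  have ex: "\<exists>p y. (p, y) \<in> G \<and> (\<forall>m\<in>M. cinner m (x - p) = 0)" for x
  proof -
    obtain q where q: "q \<in> M" "\<forall>m\<in>M. cinner m (x - q) = 0"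
      using closed_csubspace_projection[OF closedM subM] by blast
    then obtain y where "(q, y) \<in> G" unfolding M_def by auto
    with q(2) show ?thesis by blast
  qed
  then obtain p V where pV: "\<And>x. (p x, V x) \<in> G" "\<And>x m. m \<in> M \<Longrightarrow> cinner m (x - p x) = 0" by metis
  \<comment> \<open>Membership in \<open>G\<close> together with orthogonality of the remainder
    determines the pair; additivity, homogeneity and the prescribed values of \<open>V\<close> are
    all read off from this.\<close>
  have char: "p x = q \<and> V x = y" if "(q, y) \<in> G" "\<And>m. m \<in> M \<Longrightarrow> cinner m (x - q) = 0" for x q y
  proof -
    have "(p x - q, V x - y) \<in> G" using subspace_diff[OF subG pV(1) that(1)] by simp
    then have "p x - q \<in> M" unfolding M_def by (rule image_eqI[rotated]) simp
    then have "cinner (p x - q) (x - q) = 0" "cinner (p x - q) (x - p x) = 0"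
      using that(2) pV(2) by blast+
    then have "cinner (p x - q) ((x - q) - (x - p x)) = 0"
      by (simp only: cinner_diff_right[of _ "x - q" "x - p x"] diff_self)
    then have "cinner (p x - q) (p x - q) = 0" by simp
    then have "p x = q" by (simp add: cinner_eq_zero_iff)
    then show ?thesis using uniq[OF that(1), of "V x"] pV(1)[of x] by metis
  qed
  have pyth: "norm (p x) \<le> norm x" for x
  proof -
    have "p x \<in> M" using pV(1)[of x] unfolding M_def by (rule image_eqI[rotated]) simp
    then have "cinner (p x) (x - p x) = 0" by (rule pV(2))
    then have "inner (p x) (x - p x) = 0" by (metis Re_cinner zero_complex.sel(1))
    then have "(norm x)\<^sup>2 = (norm (p x))\<^sup>2 + (norm (x - p x))\<^sup>2"
      by (simp add: power2_norm_eq_inner inner_diff_left inner_diff_right inner_commute)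
    then show ?thesis by (metis abs_le_square_iff abs_norm_cancel le_add_same_cancel1 zero_le_power2)
  qed
  have bd: "norm (V x) \<le> norm x" for x
    using isoG[OF pV(1), of x] pyth[of x] by simp
  have bc: "bounded_clinear V"
  proof (rule bounded_clinearI[where K = 1])
    show "V (x + y) = V x + V y" for x y
    proof -
      have "(p x + p y, V x + V y) \<in> G" using subspace_add[OF subG pV(1) pV(1)] by simp
      moreover have "cinner m (x + y - (p x + p y)) = 0" if "m \<in> M" for m
        using pV(2)[OF that, of x] pV(2)[OF that, of y] by (simp add: cinner_diff_right cinner_add_right)
      ultimately show ?thesis using char[of "p x + p y" "V x + V y" "x + y"] by simp
    qed
    show "V (c *\<^sub>C x) = c *\<^sub>C V x" for c x
    proof -
      have "cinner m (c *\<^sub>C x - c *\<^sub>C p x) = 0" if "m \<in> M" for m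
        using pV(2)[OF that, of x] by (simp add: cinner_scaleC_right cinner_diff_right)
      then show ?thesis using char[OF scG[OF pV(1)], of "c *\<^sub>C x" c x] by simp
    qed
  qed (use bd in simp)
  have ext: "V x = y" if "(x, y) \<in> S" for x y
  proof -
    have "(x, y) \<in> G" using that closure_subset unfolding G_def by blast
    then show ?thesis using char[of x y x] by simp
  qed
  have "norm (V x) = norm x" if "closure (fst ` S) = UNIV" for x
  proof -
    have "fst ` S \<subseteq> M" unfolding M_def G_def using closure_subset by blast
    then have "M = UNIV" using that closure_minimal[OF _ closedM] by blast
    then have "cinner (x - p x) (x - p x) = 0" by (intro pV(2)) simp
    then have "x = p x" by (simp add: cinner_eq_zero_iff)
    then show ?thesis using isoG[OF pV(1), of x] by simp
  qed
  with bc bd ext show ?thesis by (intro exI[of _ V]) auto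
qed

text \<open>Equal Gram matrices make the span of the pairs (a g, b g) an isometric relation. The
  polar contraction, the tensor products of reflections and the fibrewise evolution all arise from
  this one construction.\<close>

lemma contraction_from_gram:
  fixes a :: "'g \<Rightarrow> 'a::chilbert_space" and b :: "'g \<Rightarrow> 'b::chilbert_space"
  assumes gram: "\<And>g h. cinner (a g) (a h) = cinner (b g) (b h)"
    and sc: "\<And>c g. \<exists>h. a h = c *\<^sub>C a g \<and> b h = c *\<^sub>C b g"
  shows "\<exists>V. bounded_clinear V \<and> (\<forall>x. norm (V x) \<le> norm x) \<and> (\<forall>g. V (a g) = b g) \<and>
    (closure (span (range a)) = UNIV \<longrightarrow> (\<forall>x. norm (V x) = norm x))"
proof -
  define S where "S = span (range (\<lambda>g. (a g, b g)))"
  have gr: "cinner (a g) (fst p) = cinner (b g) (snd p)" if "p \<in> S" for g p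
    using that unfolding S_def
    by (induction rule: span_induct_alt) (auto simp: cinner_add_right cinner_scaleR_right gram)
  have *: "cinner (fst q) (fst p) = cinner (snd q) (snd p)" if "p \<in> S" "q \<in> S" for p q
    using that(2) gr[OF that(1)] unfolding S_def
    by (induction rule: span_induct_alt) (auto simp: cinner_add_left cinner_scaleR_left)
  have iso: "norm y = norm x" if "(x, y) \<in> S" for x y
    using *[OF that that] by (metis cinner_self fst_conv norm_ge_zero of_real_eq_iff power2_eq_imp_eq snd_conv)
  have scale: "(c *\<^sub>C fst p, c *\<^sub>C snd p) \<in> S" if "p \<in> S" for c p
    using that unfolding S_def
  proof (induction rule: span_induct_alt)
    case base then show ?case by (metis fst_zero snd_zero scaleC_zero_right span_zero zero_prod_def)
  next
    case (step r x y)
    obtain g where g: "x = (a g, b g)" using step(1) by blast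
    obtain h where h: "a h = c *\<^sub>C fst x" "b h = c *\<^sub>C snd x" using sc[of c g] g by auto
    have "r *\<^sub>R (a h, b h) + (c *\<^sub>C fst y, c *\<^sub>C snd y) \<in> span (range (\<lambda>g. (a g, b g)))"
      by (intro span_add span_scale span_base step) auto
    then show ?case by (simp add: h scaleC_add_right scaleC_scaleR)
  qed
  have fstS: "fst ` S = span (range a)"
    unfolding S_def by (subst linear_span_image[symmetric]) (auto simp: linear_fst image_image)
  have "\<exists>V. bounded_clinear V \<and> (\<forall>x. norm (V x) \<le> norm x) \<and> (\<forall>(x, y)\<in>S. V x = y) \<and>
    (closure (fst ` S) = UNIV \<longrightarrow> (\<forall>x. norm (V x) = norm x))"
  proof (rule contraction_extension)
    show "subspace S" by (simp add: S_def)
    show "(c *\<^sub>C x, c *\<^sub>C y) \<in> S" if "(x, y) \<in> S" for c x y using scale[OF that] by simp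
  qed (rule iso)
  then obtain V where V: "bounded_clinear V" "\<forall>x. norm (V x) \<le> norm x" "\<forall>(x, y)\<in>S. V x = y"
    "closure (fst ` S) = UNIV \<longrightarrow> (\<forall>x. norm (V x) = norm x)"
    by blast
  have "(a g, b g) \<in> S" for g by (simp add: S_def span_base)
  then have "V (a g) = b g" for g using V(3) by fastforce
  with V(1,2,4) show ?thesis unfolding fstS by blast
qed

section \<open>Square roots, absolute values and trace norms\<close>

text \<open>Polarisation: the quadratic form is real at x + y and at x + i y.\<close>

lemma positive_op_selfadjoint:
  assumes "positive_op R"
  shows "cinner (R x) y = cinner x (R y)"
proof -
  have bc: "bounded_clinear R" and im: "\<And>x. Im (cinner x (R x)) = 0"
    using assms by (auto simp: positive_op_def)
  have 1: "Im (cinner x (R y)) + Im (cinner y (R x)) = 0"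
    using im[of "x + y"] im[of x] im[of y]
    by (simp add: bounded_clinear_add[OF bc] cinner_add_left cinner_add_right)
  have 2: "Re (cinner x (R y)) - Re (cinner y (R x)) = 0"
    using im[of "x + \<i> *\<^sub>C y"] im[of x] im[of y]
    by (simp add: bounded_clinear_add[OF bc] bounded_clinear_scaleC[OF bc] cinner_add_left
      cinner_add_right cinner_scaleC_left cinner_scaleC_right)
  have "cinner (R x) y = cnj (cinner y (R x))" by (rule cinner_commute)
  also have "\<dots> = cinner x (R y)" using 1 2 by (simp add: complex_eq_iff)
  finally show ?thesis .
qed

text \<open>Positivity at x - R x / K, where \<open>K\<close> is an operator bound of
  \<open>R\<close>. The estimate shows that \<open>R x\<close> vanishes where the form does, and it
  makes 1 - R / K a contraction.\<close>

lemma positive_op_norm_bound: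
  assumes R: "positive_op R"
  obtains K where "K > 0" "\<And>x. (norm (R x))\<^sup>2 \<le> K * Re (cinner x (R x))"
proof -
  have bc: "bounded_clinear R" using R by (simp add: positive_op_def)
  obtain K where K: "K > 0" "\<And>x. norm (R x) \<le> norm x * K"
    using bounded_linear.pos_bounded[OF bounded_clinear_bl[OF bc]] by blast
  have "(norm (R x))\<^sup>2 \<le> K * Re (cinner x (R x))" for x
  proof -
    define u where "u = R x"
    have "0 \<le> Re (cinner (x - (1/K) *\<^sub>R u) (R (x - (1/K) *\<^sub>R u)))"
      using R by (simp add: positive_op_def)
    also have "\<dots> = Re (cinner x u) - 2 / K * (norm u)\<^sup>2 + 1 / K\<^sup>2 * Re (cinner u (R u))"
    proof -
      have "cinner x (R u) = cinner u u"
        using positive_op_selfadjoint[OF R, of x u] by (simp add: u_def)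
      then show ?thesis
        using K(1)
        by (simp add: bounded_clinear_diff[OF bc] bounded_clinear_scaleR[OF bc] cinner_diff_left
          cinner_diff_right cinner_scaleR_left cinner_scaleR_right cinner_self power2_eq_square
          field_simps flip: u_def)
    qed
    also have "Re (cinner u (R u)) \<le> K * (norm u)\<^sup>2"
    proof -
      have "Re (cinner u (R u)) \<le> norm u * norm (R u)" unfolding Re_cinner by (rule norm_cauchy_schwarz)
      also have "\<dots> \<le> norm u * (norm u * K)" by (intro mult_left_mono K) simp
      finally show ?thesis by (simp add: power2_eq_square mult_ac)
    qed
    finally have "0 \<le> Re (cinner x u) - 2 / K * (norm u)\<^sup>2 + 1 / K\<^sup>2 * (K * (norm u)\<^sup>2)"
      by (simp add: divide_right_mono)
    then show ?thesis using K(1) by (simp add: u_def field_simps power2_eq_square)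
  qed
  with K(1) that show ?thesis by blast
qed

text \<open>The iteration $Y_{n+1} = (Z + Y_n^2)/2$ converges in norm for every contraction \<open>Z\<close>, since the
  increments are dominated by those of the scalar iteration with $Z = 1$; its limit \<open>Y\<close> gives
  $(1 - Y)^2 = 1 - Z$.\<close>

lemma contraction_quadratic_fixpoint:
  fixes Z :: "'a::chilbert_space \<Rightarrow>\<^sub>L 'a"
  assumes Z: "norm Z \<le> 1"
  obtains L where "norm L \<le> 1" "L = (1/2) *\<^sub>R (Z + (L o\<^sub>L L))"
    "\<And>P. closed P \<Longrightarrow> 0 \<in> P \<Longrightarrow> (\<And>Y. Y \<in> P \<Longrightarrow> (1/2) *\<^sub>R (Z + (Y o\<^sub>L Y)) \<in> P) \<Longrightarrow> L \<in> P"
proof -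
  define g where "g Y = (1/2) *\<^sub>R (Z + (Y o\<^sub>L Y))" for Y :: "'a \<Rightarrow>\<^sub>L 'a"
  define Y where "Y n = (g ^^ n) 0" for n
  define y :: "nat \<Rightarrow> real" where "y n = ((\<lambda>t. (1 + t\<^sup>2) / 2) ^^ n) 0" for n
  have Y0: "Y 0 = 0" and YS: "Y (Suc n) = (1/2) *\<^sub>R (Z + (Y n o\<^sub>L Y n))" for n
    by (simp_all add: Y_def g_def)
  have y0: "y 0 = 0" and yS: "y (Suc n) = (1 + (y n)\<^sup>2) / 2" for n
    by (simp_all add: y_def)
  have y01: "0 \<le> y n \<and> y n \<le> 1" for n
  proof (induction n)
    case (Suc n)
    then have "(y n)\<^sup>2 \<le> 1" by (simp add: power_le_one)
    then show ?case by (simp add: yS)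
  qed (simp add: y0)
  have ymono: "y n \<le> y (Suc n)" for n
  proof -
    have "0 \<le> (1 - y n)\<^sup>2" by simp
    then show ?thesis by (simp add: yS power2_eq_square algebra_simps)
  qed
  have commZ: "Z o\<^sub>L Y n = Y n o\<^sub>L Z" for n
  proof (induction n)
    case (Suc n)
    then have "Z (Y n x) = Y n (Z x)" for x by (metis blinfun_apply_blinfun_compose)
    then show ?case by (intro blinfun_eqI)
      (simp add: YS blinfun.add_left blinfun.add_right blinfun.scaleR_left blinfun.scaleR_right)
  qed (simp add: Y0)
  have comm: "Y m (Y n x) = Y n (Y m x)" for m n x
  proof (induction m arbitrary: x)
    case (Suc m)
    have "Z (Y n x) = Y n (Z x)" using commZ[of n] by (metis blinfun_apply_blinfun_compose)
    then show ?case
      by (simp add: YS blinfun.add_left blinfun.add_right blinfun.scaleR_left blinfun.scaleR_right Suc)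
  qed (simp add: Y0 blinfun.zero_right)
  have nY: "norm (Y n) \<le> y n" for n
  proof (induction n)
    case (Suc n)
    have "norm (Y (Suc n)) \<le> (1/2) * (norm Z + norm (Y n o\<^sub>L Y n))"
      unfolding YS norm_scaleR using norm_triangle_ineq[of Z "Y n o\<^sub>L Y n"] by simp
    also have "\<dots> \<le> (1/2) * (1 + norm (Y n) * norm (Y n))"
      using Z norm_blinfun_compose[of "Y n" "Y n"] by simp
    also have "\<dots> \<le> (1/2) * (1 + y n * y n)"
      using Suc y01[of n] by (simp add: mult_mono)
    finally show ?case by (simp add: yS power2_eq_square)
  qed (simp add: Y0 y0)
  have inc: "norm (Y (Suc n) - Y n) \<le> y (Suc n) - y n" for n
  proof (induction n)
    case 0 show ?case using nY[of 1] by (simp add: Y0 y0)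
  next
    case (Suc n)
    \<comment> \<open>The difference of the two squares factors because the iterates
      commute.\<close>
    have "Y (Suc (Suc n)) - Y (Suc n) = (1/2) *\<^sub>R ((Y (Suc n) + Y n) o\<^sub>L (Y (Suc n) - Y n))"
      by (intro blinfun_eqI)
        (simp add: YS[of "Suc n"] YS[of n, THEN arg_cong, of "\<lambda>t. _ - t"] comm[of n "Suc n"] blinfun.add_left blinfun.add_right
          blinfun.diff_left blinfun.diff_right blinfun.scaleR_left blinfun.scaleR_right algebra_simps)
    then have "norm (Y (Suc (Suc n)) - Y (Suc n))
        \<le> (1/2) * (norm (Y (Suc n) + Y n) * norm (Y (Suc n) - Y n))"
      using norm_blinfun_compose[of "Y (Suc n) + Y n" "Y (Suc n) - Y n"] by simp
    also have "\<dots> \<le> (1/2) * ((y (Suc n) + y n) * (y (Suc n) - y n))"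
      using Suc nY[of "Suc n"] nY[of n] y01[of n] y01[of "Suc n"]
      by (intro mult_left_mono mult_mono norm_triangle_mono) auto
    also have "\<dots> = y (Suc (Suc n)) - y (Suc n)"
      by (simp add: yS[of "Suc n"] yS[of n, THEN arg_cong, of "\<lambda>t. _ - t"] power2_eq_square algebra_simps)
    finally show ?case .
  qed
  have "convergent y"
    using y01 ymono by (intro Bseq_mono_convergent BseqI'[of _ 1]) (auto simp: incseq_SucI monoD abs_le_iff intro: incseq_SucI[THEN monoD])
  then have "summable (\<lambda>n. y (Suc n) - y n)"
    using telescope_summable by (auto simp: convergent_def)
  then have "summable (\<lambda>n. Y (Suc n) - Y n)"
    by (rule summable_comparison_test') (rule inc)
  then have "convergent (\<lambda>n. \<Sum>k<n. Y (Suc k) - Y k)" by (simp add: summable_iff_convergent)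
  then have "convergent Y" unfolding sum_lessThan_telescope by (simp add: Y0)
  then obtain L where L: "Y \<longlonglongrightarrow> L" by (auto simp: convergent_def)
  show ?thesis
  proof
    show "norm L \<le> 1"
      using nY y01 by (intro LIMSEQ_le_const2[OF tendsto_norm[OF L]]) (meson order_trans)
    have "(\<lambda>n. Y (Suc n)) \<longlonglongrightarrow> (1/2) *\<^sub>R (Z + (L o\<^sub>L L))"
      unfolding YS by (intro tendsto_intros L bounded_bilinear.tendsto[OF bounded_bilinear_blinfun_compose])
    then show "L = (1/2) *\<^sub>R (Z + (L o\<^sub>L L))"
      using LIMSEQ_Suc[OF L] LIMSEQ_unique by blast
    \<comment> \<open>An induction principle for the limit: every closed property that holds at 0
      and survives the iteration holds for \<open>L\<close>. Self-adjointness, complex linearity and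
      commutation reach the square root in this way.\<close>
    show "L \<in> P" if P: "closed P" "0 \<in> P" "\<And>Y. Y \<in> P \<Longrightarrow> (1/2) *\<^sub>R (Z + (Y o\<^sub>L Y)) \<in> P" for P
    proof -
      have "Y n \<in> P" for n by (induction n) (auto simp: Y0 YS P)
      then show ?thesis using L closed_sequentially[OF P(1)] by blast
    qed
  qed
qed

text \<open>With Z = 1 - R / K the fixed point \<open>L\<close> satisfies (1 - L)^2 = R / K, so S =
  sqrt K (1 - L) is a root; it is positive because \<open>L\<close> is a self-adjoint contraction.
  Commutation with everything that commutes with \<open>R\<close> is recorded because uniqueness of
  the root rests on it.\<close>

lemma positive_sqrt_exists:
  fixes R :: "'a::chilbert_space \<Rightarrow> 'a"
  assumes R: "positive_op R"
  shows "\<exists>S. positive_op S \<and> (\<forall>x. S (S x) = R x) \<and>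
    (\<forall>C. bounded_clinear C \<and> (\<forall>x. C (R x) = R (C x)) \<longrightarrow> (\<forall>x. C (S x) = S (C x)))"
proof -
  have bc: "bounded_clinear R" using R by (simp add: positive_op_def)
  obtain K where K: "K > 0" and KR: "\<And>x. (norm (R x))\<^sup>2 \<le> K * Re (cinner x (R x))"
    using positive_op_norm_bound[OF R] by blast
  define z where "z x = x - (1/K) *\<^sub>R R x" for x
  have bz: "bounded_clinear z"
    unfolding z_def by (intro bounded_clinear_minus bounded_clinear_id bounded_clinear_rmult bc)
  have nz: "norm (z x) \<le> norm x" for x
  proof -
    have "(norm (z x))\<^sup>2 = (norm x)\<^sup>2 + (norm (R x))\<^sup>2 / K\<^sup>2 - 2 / K * Re (cinner x (R x))"
      unfolding z_def norm_diff_power2_cinner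
      using K by (simp add: cinner_scaleR_right power_mult_distrib power_divide)
    also have "(norm (R x))\<^sup>2 / K\<^sup>2 \<le> (K * Re (cinner x (R x))) / K\<^sup>2"
      by (intro divide_right_mono KR) simp
    also have "\<dots> = Re (cinner x (R x)) / K" using K by (simp add: power2_eq_square)
    finally have "(norm (z x))\<^sup>2 \<le> (norm x)\<^sup>2 - Re (cinner x (R x)) / K" by simp
    also have "\<dots> \<le> (norm x)\<^sup>2" using K R by (simp add: positive_op_def)
    finally show ?thesis by (rule power2_le_imp_le) simp
  qed
  define Z where "Z = Blinfun z"
  have Zz: "blinfun_apply Z = z"
    unfolding Z_def by (rule bounded_linear_Blinfun_apply) (rule bounded_clinear_bl[OF bz])
  have "norm Z \<le> 1"
    by (rule norm_blinfun_bound) (auto simp: Zz nz)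
  then obtain L where L: "norm L \<le> 1" "L = (1/2) *\<^sub>R (Z + (L o\<^sub>L L))"
    and P: "\<And>P. closed P \<Longrightarrow> 0 \<in> P \<Longrightarrow> (\<And>Y. Y \<in> P \<Longrightarrow> (1/2) *\<^sub>R (Z + (Y o\<^sub>L Y)) \<in> P) \<Longrightarrow> L \<in> P"
    using contraction_quadratic_fixpoint[of Z] by blast
  have zsa: "cinner (z x) y = cinner x (z y)" for x y
    by (simp add: z_def cinner_diff_left cinner_diff_right cinner_scaleR_left cinner_scaleR_right
      positive_op_selfadjoint[OF R])
  have Lsa: "cinner (L x) y = cinner x (L y)" for x y
  proof -
    have "L \<in> {Y. \<forall>x y. cinner (blinfun_apply Y x) y = cinner x (blinfun_apply Y y)}"
    proof (rule P)
      show "closed {Y. \<forall>x y. cinner (blinfun_apply Y x) y = cinner x (blinfun_apply Y y)}"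
        by (intro closed_Collect_all closed_Collect_eq continuous_intros)
    qed (auto simp: blinfun.add_left blinfun.scaleR_left Zz zsa cinner_add_left cinner_add_right
        cinner_scaleR_left cinner_scaleR_right)
    then show ?thesis by blast
  qed
  have Lsc: "L (c *\<^sub>C x) = c *\<^sub>C L x" for c x
  proof -
    have "L \<in> {Y. \<forall>c x. blinfun_apply Y (c *\<^sub>C x) = c *\<^sub>C blinfun_apply Y x}"
    proof (rule P)
      show "closed {Y. \<forall>c x. blinfun_apply Y (c *\<^sub>C x) = c *\<^sub>C (blinfun_apply Y x :: 'a)}"
        by (intro closed_Collect_all closed_Collect_eq continuous_intros)
    qed (auto simp: blinfun.add_left blinfun.scaleR_left Zz scaleC_add_right scaleC_scaleR
        bounded_clinear_scaleC[OF bz])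
    then show ?thesis by blast
  qed
  have Lcomm: "C (L x) = L (C x)" if C: "bounded_clinear C" "\<And>x. C (R x) = R (C x)" for C x
  proof -
    have Cz: "C (z x) = z (C x)" for x
      by (simp add: z_def bounded_clinear_diff[OF C(1)] bounded_clinear_scaleR[OF C(1)] C(2))
    have "L \<in> {Y. \<forall>x. C (blinfun_apply Y x) = blinfun_apply Y (C x)}"
    proof (rule P)
      show "closed {Y. \<forall>x. C (blinfun_apply Y x) = blinfun_apply Y (C x)}"
        by (intro closed_Collect_all closed_Collect_eq continuous_intros
          continuous_on_compose2[OF bounded_clinear_continuous_on[OF C(1), of UNIV]]) auto
    qed (auto simp: blinfun.add_left blinfun.scaleR_left Zz Cz bounded_clinear_add[OF C(1)]
        bounded_clinear_scaleR[OF C(1)] bounded_clinear_zero[OF C(1)])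
    then show ?thesis by blast
  qed
  have LL: "L (L x) = 2 *\<^sub>R L x - z x" for x
  proof -
    have "L x = (1/2) *\<^sub>R (z x + L (L x))"
      using arg_cong[OF L(2), of "\<lambda>Y. blinfun_apply Y x"]
      by (simp add: blinfun.add_left blinfun.scaleR_left Zz)
    then have "2 *\<^sub>R L x = z x + L (L x)" by (metis scaleR_half_double scaleR_2 scaleR_add_right)
    then show ?thesis by simp
  qed
  define S where "S x = sqrt K *\<^sub>R (x - L x)" for x
  have bL: "bounded_clinear (blinfun_apply L)"
    by (simp add: bounded_clinear_def Lsc blinfun.bounded_linear_right)
  have bS: "bounded_clinear S"
    unfolding S_def by (intro bounded_clinear_minus bounded_clinear_id bounded_clinear_rmult bL)
  have SS: "S (S x) = R x" for x
  proof -
    have "S (S x) = K *\<^sub>R (x - 2 *\<^sub>R L x + L (L x))"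
      using K by (simp add: S_def blinfun.diff_right blinfun.scaleR_right scaleR_2 algebra_simps)
    also have "\<dots> = R x" using K by (simp add: LL z_def)
    finally show ?thesis .
  qed
  have pos: "positive_op S"
    unfolding positive_op_def
  proof (intro conjI allI bS)
    fix x
    have "Im (cinner x (L x)) = 0"
      using Lsa[of x x] cinner_commute[of x "L x"] by (metis complex_is_Real_iff Reals_cnj_iff)
    then show "Im (cinner x (S x)) = 0"
      by (simp add: S_def cinner_scaleR_right cinner_diff_right cinner_self)
    have "Re (cinner x (L x)) \<le> norm x * norm (L x)" unfolding Re_cinner by (rule norm_cauchy_schwarz)
    also have "\<dots> \<le> norm x * (norm L * norm x)" by (intro mult_left_mono norm_blinfun) simp
    also have "\<dots> \<le> norm x * (1 * norm x)" using L(1) by (intro mult_left_mono mult_right_mono) auto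
    finally show "0 \<le> Re (cinner x (S x))"
      using K by (simp add: S_def cinner_scaleR_right cinner_diff_right cinner_self power2_eq_square)
  qed
  have "C (S x) = S (C x)" if "bounded_clinear C" "\<forall>x. C (R x) = R (C x)" for C x
    using that by (simp add: S_def bounded_clinear_diff bounded_clinear_scaleR Lcomm)
  with pos SS show ?thesis by blast
qed

lemma positive_op_eq_zero:
  assumes R: "positive_op R" and "Re (cinner y (R y)) = 0"
  shows "R y = 0"
proof -
  obtain K where "\<And>x. (norm (R x))\<^sup>2 \<le> K * Re (cinner x (R x))"
    using positive_op_norm_bound[OF R] by blast
  from this[of y] assms(2) show ?thesis by simp
qed

text \<open>Any positive root \<open>U\<close> commutes with the common square, hence with the
  constructed root \<open>T\<close>. For y = U x - T x this gives (U + T) y = 0, so both forms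
  vanish at \<open>y\<close>, hence U y = T y = 0 and <y, y> = <x, (U - T) y> = 0.\<close>

lemma positive_sqrt_unique:
  fixes S S' :: "'a::chilbert_space \<Rightarrow> 'a"
  assumes S: "positive_op S" and S': "positive_op S'" and eq: "\<And>x. S (S x) = S' (S' x)"
  shows "S = S'"
proof -
  have bS: "bounded_clinear S" and bS': "bounded_clinear S'"
    using S S' by (auto simp: positive_op_def)
  have R: "positive_op (\<lambda>x. S (S x))"
    unfolding positive_op_def
  proof (intro conjI allI)
    show "bounded_clinear (\<lambda>x. S (S x))" by (rule bounded_clinear_comp[OF bS bS])
    fix x
    have "cinner x (S (S x)) = cinner (S x) (S x)" by (simp add: positive_op_selfadjoint[OF S])
    then show "Im (cinner x (S (S x))) = 0" "0 \<le> Re (cinner x (S (S x)))" by (simp_all add: cinner_self)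
  qed
  obtain T where T: "positive_op T" "\<forall>x. T (T x) = S (S x)"
    "\<forall>C. bounded_clinear C \<and> (\<forall>x. C (S (S x)) = S (S (C x))) \<longrightarrow> (\<forall>x. C (T x) = T (C x))"
    using positive_sqrt_exists[OF R] by blast
  have "U = T" if U: "positive_op U" "\<And>x. U (U x) = S (S x)" for U
  proof
    fix x
    have bU: "bounded_clinear U" and bT: "bounded_clinear T"
      using U(1) T(1) by (auto simp: positive_op_def)
    have UT: "U (T x) = T (U x)" for x
      using T(3) bU U(2) by metis
    define y where "y = U x - T x"
    have "U y + T y = 0"
      by (simp add: y_def bounded_clinear_diff[OF bU] bounded_clinear_diff[OF bT] UT U(2) T(2))
    then have "Re (cinner y (U y)) + Re (cinner y (T y)) = 0"
      by (metis cinner_add_right cinner_zero_right plus_complex.sel(1) zero_complex.sel(1))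
    moreover have "Re (cinner y (U y)) \<ge> 0" "Re (cinner y (T y)) \<ge> 0"
      using U(1) T(1) by (auto simp: positive_op_def)
    ultimately have "Re (cinner y (U y)) = 0" "Re (cinner y (T y)) = 0" by linarith+
    then have "U y = 0" "T y = 0" using positive_op_eq_zero U(1) T(1) by blast+
    then have "cinner y y = 0"
      using positive_op_selfadjoint[OF U(1), of x y] positive_op_selfadjoint[OF T(1), of x y]
      by (simp add: y_def cinner_diff_left)
    then show "U x = T x" by (simp add: cinner_eq_zero_iff y_def)
  qed
  from this[of S] this[of S'] S S' eq show ?thesis by simp
qed

section \<open>The absolute value of a self-adjoint operator and its trace norm\<close>

lemma cadjoint_eqI:
  fixes T S :: "'a::chilbert_space \<Rightarrow> 'a"
  assumes "bounded_clinear S" "\<And>x y. cinner (S x) y = cinner x (T y)"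
  shows "cadjoint T = S"
  unfolding cadjoint_def
proof (rule the_equality)
  fix S' assume "bounded_clinear S' \<and> (\<forall>x y. cinner (S' x) y = cinner x (T y))"
  then have "cinner (S' x - S x) (S' x - S x) = 0" for x
    by (subst cinner_diff_left) (simp add: assms(2))
  then show "S' = S" by (auto simp: cinner_eq_zero_iff)
qed (use assms in auto)

text \<open>For a self-adjoint operator the adjoint is \<open>T\<close> itself, so |T| is the
  positive root of T T. The uniqueness results resolve the two definite descriptions hidden in
  \<open>abs_op\<close>. Differences of states are of this kind.\<close>

lemma abs_op_selfadjoint:
  fixes T :: "'a::chilbert_space \<Rightarrow> 'a"
  assumes T: "bounded_clinear T" "\<And>x y. cinner (T x) y = cinner x (T y)"
  shows "positive_op (abs_op T) \<and> (\<forall>x. abs_op T (abs_op T x) = T (T x))"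
proof -
  have R: "positive_op (\<lambda>x. T (T x))"
    unfolding positive_op_def
  proof (intro conjI allI)
    show "bounded_clinear (\<lambda>x. T (T x))" by (rule bounded_clinear_comp[OF T(1) T(1)])
    fix x
    have "cinner x (T (T x)) = cinner (T x) (T x)" by (simp add: T(2))
    then show "Im (cinner x (T (T x))) = 0" "0 \<le> Re (cinner x (T (T x)))" by (simp_all add: cinner_self)
  qed
  obtain S where S: "positive_op S" "\<forall>x. S (S x) = T (T x)"
    using positive_sqrt_exists[OF R] by blast
  have "abs_op T = S"
    unfolding abs_op_def cadjoint_eqI[OF T]
  proof (rule the_equality)
    show "positive_op S \<and> S \<circ> S = T \<circ> T" using S by auto
    show "S' = S" if "positive_op S' \<and> S' \<circ> S' = T \<circ> T" for S'
      using that S by (intro positive_sqrt_unique) (auto simp: fun_eq_iff)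
  qed
  with S show ?thesis by simp
qed

text \<open>Half of the polar decomposition, read from \<open>T\<close> to |T|: the vectors T g and
  |T| g have the same Gram matrix <g, T T h>.\<close>

lemma abs_op_polar:
  fixes T :: "'a::chilbert_space \<Rightarrow> 'a"
  assumes T: "bounded_clinear T" "\<And>x y. cinner (T x) y = cinner x (T y)"
  shows "\<exists>V. bounded_clinear V \<and> (\<forall>x. norm (V x) \<le> norm x) \<and> (\<forall>x. V (T x) = abs_op T x)"
proof -
  note A = abs_op_selfadjoint[OF T]
  have bA: "bounded_clinear (abs_op T)" using A by (simp add: positive_op_def)
  have "cinner (T g) (T h) = cinner (abs_op T g) (abs_op T h)" for g h
    using A by (simp add: T(2) positive_op_selfadjoint)
  moreover have "\<exists>h. T h = c *\<^sub>C T g \<and> abs_op T h = c *\<^sub>C abs_op T g" for c g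
    by (intro exI[of _ "c *\<^sub>C g"]) (simp add: bounded_clinear_scaleC[OF T(1)] bounded_clinear_scaleC[OF bA])
  ultimately show ?thesis using contraction_from_gram[of T "abs_op T"] by blast
qed

text \<open>The trace norm is a supremum of finite sums of <e, |T| e>, and |T| = V T for some
  contraction \<open>V\<close>. A bound that is uniform in contractions and finite subsets of the
  basis therefore suffices, and it can be proved without knowing |T|.\<close>

lemma trace_norm_le:
  fixes T :: "'a::chilbert_space \<Rightarrow> 'a"
  assumes T: "bounded_clinear T" "\<And>x y. cinner (T x) y = cinner x (T y)"
    and bound: "\<And>V F. bounded_clinear V \<Longrightarrow> (\<And>x. norm (V x) \<le> norm x) \<Longrightarrow> finite F \<Longrightarrow>
      F \<subseteq> some_basis \<Longrightarrow> (\<Sum>e\<in>F. cmod (cinner e (V (T e)))) \<le> c"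
  shows "trace_norm T \<le> ennreal c"
proof -
  obtain V where V: "bounded_clinear V" "\<And>x. norm (V x) \<le> norm x" "\<And>x. V (T x) = abs_op T x"
    using abs_op_polar[OF T] by blast
  have pos: "0 \<le> Re (cinner e (abs_op T e))" for e
    using abs_op_selfadjoint[OF T] by (simp add: positive_op_def)
  have "trace_norm T = (SUP F\<in>{F. finite F \<and> F \<subseteq> some_basis}. \<Sum>e\<in>F. ennreal (Re (cinner e (abs_op T e))))"
    unfolding trace_norm_def by (rule nonneg_infsum_complete) simp
  also have "\<dots> \<le> ennreal c"
  proof (rule SUP_least)
    fix F :: "'a set" assume F: "F \<in> {F. finite F \<and> F \<subseteq> some_basis}"
    have "(\<Sum>e\<in>F. ennreal (Re (cinner e (abs_op T e)))) = ennreal (\<Sum>e\<in>F. Re (cinner e (abs_op T e)))"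
      by (rule sum_ennreal) (rule pos)
    also have "\<dots> \<le> ennreal (\<Sum>e\<in>F. cmod (cinner e (V (T e))))"
      by (intro ennreal_leI sum_mono) (simp add: V(3) complex_Re_le_cmod)
    also have "\<dots> \<le> ennreal c"
      using F by (intro ennreal_leI bound V) auto
    finally show "(\<Sum>e\<in>F. ennreal (Re (cinner e (abs_op T e)))) \<le> ennreal c" .
  qed
  finally show ?thesis .
qed

section \<open>Sums of rank-one operators and their traces\<close>

lemma rank_one_partial_trace:
  assumes "orthonormal F" "finite F"
  shows "(\<Sum>e\<in>F. cmod (cinner b e * cinner e a)) \<le> norm a * norm b"
proof -
  have "(\<Sum>e\<in>F. cmod (cinner b e * cinner e a)) = (\<Sum>e\<in>F. \<bar>cmod (cinner e b)\<bar> * \<bar>cmod (cinner e a)\<bar>)"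
    by (intro sum.cong refl) (metis abs_norm_cancel cinner_commute complex_mod_cnj norm_mult)
  also have "\<dots> \<le> L2_set (\<lambda>e. cmod (cinner e b)) F * L2_set (\<lambda>e. cmod (cinner e a)) F"
    by (rule L2_set_mult_ineq)
  also have "\<dots> \<le> norm b * norm a"
    unfolding L2_set_def
    by (intro mult_mono real_le_lsqrt bessel_finite[OF assms]) (auto simp: sum_nonneg)
  finally show ?thesis by (simp add: mult.commute)
qed

text \<open>For finitely many \<open>k\<close> this is the rank-one estimate applied to V (a k) and
  b k. As \<open>F\<close> is finite, the bound passes to the limit over finite subsets of
  \<open>K\<close>.\<close>

lemma nuclear_partial_trace:
  fixes T :: "'a::chilbert_space \<Rightarrow> 'a"
  assumes T: "\<And>v. ((\<lambda>k. cinner (b k) v *\<^sub>C a k) has_sum T v) K"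
    and ab: "((\<lambda>k. norm (a k) * norm (b k)) has_sum c) K"
    and V: "bounded_clinear V" "\<And>x. norm (V x) \<le> norm x"
    and F: "finite F" "F \<subseteq> some_basis"
  shows "(\<Sum>e\<in>F. cmod (cinner e (V (T e)))) \<le> c"
proof (rule tendsto_upperbound)
  define f where "f e k = cinner (b k) e * cinner e (V (a k))" for e k
  have "((\<lambda>k. f e k) has_sum cinner e (V (T e))) K" for e
    using has_sum_cinner_right[OF bounded_clinear_has_sum[OF V(1) T], of e e]
    by (simp add: f_def bounded_clinear_scaleC[OF V(1)] cinner_scaleC_right)
  then show "((\<lambda>G. \<Sum>e\<in>F. cmod (sum (f e) G)) \<longlongrightarrow> (\<Sum>e\<in>F. cmod (cinner e (V (T e))))) (finite_subsets_at_top K)"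
    unfolding has_sum_def by (intro tendsto_sum tendsto_norm)
  have "(\<Sum>e\<in>F. cmod (sum (f e) G)) \<le> c" if G: "finite G" "G \<subseteq> K" for G
  proof -
    have "(\<Sum>e\<in>F. cmod (sum (f e) G)) \<le> (\<Sum>e\<in>F. \<Sum>k\<in>G. cmod (f e k))"
      by (intro sum_mono norm_sum)
    also have "\<dots> = (\<Sum>k\<in>G. \<Sum>e\<in>F. cmod (f e k))" by (rule sum.swap)
    also have "\<dots> \<le> (\<Sum>k\<in>G. norm (V (a k)) * norm (b k))"
      unfolding f_def using orthonormal_subset[OF orthonormal_some_basis F(2)] F(1)
      by (intro sum_mono rank_one_partial_trace)
    also have "\<dots> \<le> (\<Sum>k\<in>G. norm (a k) * norm (b k))"
      by (intro sum_mono mult_right_mono V) simp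
    also have "\<dots> \<le> c"
      by (rule finite_sum_le_has_sum[OF ab]) (use G in auto)
    finally show ?thesis .
  qed
  then show "\<forall>\<^sub>F G in finite_subsets_at_top K. (\<Sum>e\<in>F. cmod (sum (f e) G)) \<le> c"
    by (intro eventually_finite_subsets_at_top_weakI)
qed simp

text \<open>Fubini for the family <b k, e><e, a k>, which the rank-one estimate makes absolutely
  summable over pairs: summing over \<open>k\<close> first gives <e, T e>, summing over
  \<open>e\<close> first gives <b k, a k> by Parseval.\<close>

lemma nuclear_trace:
  fixes T :: "'a::chilbert_space \<Rightarrow> 'a"
  assumes T: "\<And>v. ((\<lambda>k. cinner (b k) v *\<^sub>C a k) has_sum T v) K"
    and ab: "(\<lambda>k. norm (a k) * norm (b k)) summable_on K"
  shows "((\<lambda>k. cinner (b k) (a k)) has_sum op_trace T) K"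
proof -
  define f :: "'a \<times> _ \<Rightarrow> complex" where "f = (\<lambda>(e, k). cinner (b k) e * cinner e (a k))"
  have "(\<lambda>p. norm (f p)) summable_on some_basis \<times> K"
  proof (rule nonneg_bdd_above_summable_on)
    have "(\<Sum>p\<in>H. norm (f p)) \<le> (\<Sum>\<^sub>\<infinity>k\<in>K. norm (a k) * norm (b k))"
      if H: "H \<subseteq> some_basis \<times> K" "finite H" for H
    proof -
      have fin: "finite (fst ` H)" "finite (snd ` H)" using H by auto
      have on: "orthonormal (fst ` H)" using H by (intro orthonormal_subset[OF orthonormal_some_basis]) auto
      have "(\<Sum>p\<in>H. norm (f p)) \<le> (\<Sum>p\<in>fst ` H \<times> snd ` H. norm (f p))"
        using fin by (intro sum_mono2) force+
      also have "\<dots> = (\<Sum>k\<in>snd ` H. \<Sum>e\<in>fst ` H. cmod (cinner (b k) e * cinner e (a k)))"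
        unfolding f_def by (subst sum.swap) (simp add: sum.cartesian_product case_prod_unfold)
      also have "\<dots> \<le> (\<Sum>k\<in>snd ` H. norm (a k) * norm (b k))"
        by (intro sum_mono rank_one_partial_trace on fin)
      also have "\<dots> \<le> (\<Sum>\<^sub>\<infinity>k\<in>K. norm (a k) * norm (b k))"
        using H fin by (intro finite_sum_le_infsum ab) auto
      finally show ?thesis .
    qed
    then show "bdd_above (sum (\<lambda>p. norm (f p)) ` {H. H \<subseteq> some_basis \<times> K \<and> finite H})"
      by (intro bdd_aboveI2) auto
  qed simp
  then obtain s where s: "(f has_sum s) (some_basis \<times> K)"
    using abs_summable_summable summable_on_def by metis
  have "((\<lambda>e. cinner e (T e)) has_sum s) some_basis"
  proof (rule has_sum_SigmaD[OF s])
    show "((\<lambda>k. f (e, k)) has_sum cinner e (T e)) K" for e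
      using has_sum_cinner_right[OF T, of e e] by (simp add: f_def cinner_scaleC_right)
  qed
  then have "op_trace T = s" unfolding op_trace_def by (rule infsumI)
  moreover have "((\<lambda>k. cinner (b k) (a k)) has_sum s) K"
  proof (rule has_sum_SigmaD)
    show "((\<lambda>(k, e). f (e, k)) has_sum s) (K \<times> some_basis)" using s has_sum_swap by blast
    show "((\<lambda>e. (\<lambda>(k, e). f (e, k)) (k, e)) has_sum cinner (b k) (a k)) some_basis" for k
      using parseval[of "b k" "a k"] by (simp add: f_def)
  qed
  ultimately show ?thesis by simp
qed

section \<open>Stone's theorem\<close>

lemma Cauchy_dist_le:
  assumes "Cauchy X" "\<And>m n. dist (Y m) (Y n) \<le> dist (X m) (X n)"
  shows "Cauchy Y"
proof (rule metric_CauchyI)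
  fix e :: real assume "e > 0"
  then obtain N where N: "\<forall>m\<ge>N. \<forall>n\<ge>N. dist (X m) (X n) < e"
    using metric_CauchyD[OF assms(1)] by blast
  then have "\<forall>m\<ge>N. \<forall>n\<ge>N. dist (Y m) (Y n) < e"
    using le_less_trans[OF assms(2)] by blast
  then show "\<exists>M. \<forall>m\<ge>M. \<forall>n\<ge>M. dist (Y m) (Y n) < e" by blast
qed

text \<open>The class of unital normed algebras, in which the exponential function lives, requires
  $\|1\| = 1$ and hence excludes the operators on a trivial space.  Adjoining a unit avoids this.\<close>

typedef (overloaded) ('a::real_normed_vector) uop = "UNIV :: (real \<times> ('a \<Rightarrow>\<^sub>L 'a)) set"
  morphisms rep_uop Uop ..

lemma rep_Uop [simp]: "rep_uop (Uop p) = p"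
  by (simp add: Uop_inverse)

lemma uop_eqI: "fst (rep_uop x) = fst (rep_uop y) \<Longrightarrow> snd (rep_uop x) = snd (rep_uop y) \<Longrightarrow> x = y"
  by (metis prod.collapse rep_uop_inverse)

instantiation uop :: (real_normed_vector) real_normed_algebra_1
begin

definition "0 = Uop (0, 0)"
definition "1 = Uop (1, 0)"
definition "x + y = Uop (rep_uop x + rep_uop y)"
definition "x - y = Uop (rep_uop x - rep_uop y)"
definition "- x = Uop (- rep_uop x)" for x :: "'a uop"
definition "r *\<^sub>R x = Uop (r *\<^sub>R rep_uop x)" for x :: "'a uop"
text \<open>A pair (a, A) stands for a 1 + A with a formal unit 1; this is the expanded product of
  two such sums.\<close>

definition "x * y = Uop (fst (rep_uop x) * fst (rep_uop y),
   fst (rep_uop x) *\<^sub>R snd (rep_uop y) + fst (rep_uop y) *\<^sub>R snd (rep_uop x) +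
   (snd (rep_uop x) o\<^sub>L snd (rep_uop y)))"
definition "norm x = \<bar>fst (rep_uop x)\<bar> + norm (snd (rep_uop x))" for x :: "'a uop"
definition "sgn x = inverse (norm x) *\<^sub>R x" for x :: "'a uop"
definition "dist x y = norm (x - y)" for x y :: "'a uop"
definition "uniformity = (INF e\<in>{0<..}. principal {(f :: 'a uop, g). dist f g < e})"
definition "open S \<longleftrightarrow> (\<forall>f\<in>S. eventually (\<lambda>(f', g). f' = f \<longrightarrow> g \<in> S) uniformity)" for S :: "'a uop set"

lemmas uop_defs = zero_uop_def one_uop_def plus_uop_def minus_uop_def uminus_uop_def scaleR_uop_def
  times_uop_def norm_uop_def

instance
proof
  fix x y z :: "'a uop" and r s :: real and S :: "'a uop set"
  show "x * y * z = x * (y * z)"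
    by (rule uop_eqI)
      (auto simp: uop_defs algebra_simps intro!: blinfun_eqI simp: blinfun.add_left blinfun.add_right
        blinfun.scaleR_left blinfun.scaleR_right)
  show "(x + y) * z = x * z + y * z"
    by (rule uop_eqI)
      (auto simp: uop_defs algebra_simps intro!: blinfun_eqI simp: blinfun.add_left blinfun.add_right
        blinfun.scaleR_left blinfun.scaleR_right)
  show "x * (y + z) = x * y + x * z"
    by (rule uop_eqI)
      (auto simp: uop_defs algebra_simps intro!: blinfun_eqI simp: blinfun.add_left blinfun.add_right
        blinfun.scaleR_left blinfun.scaleR_right)
  show "r *\<^sub>R x * y = r *\<^sub>R (x * y)"
    by (rule uop_eqI)
      (auto simp: uop_defs algebra_simps intro!: blinfun_eqI simp: blinfun.add_left blinfun.add_right
        blinfun.scaleR_left blinfun.scaleR_right)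
  show "x * r *\<^sub>R y = r *\<^sub>R (x * y)"
    by (rule uop_eqI)
      (auto simp: uop_defs algebra_simps intro!: blinfun_eqI simp: blinfun.add_left blinfun.add_right
        blinfun.scaleR_left blinfun.scaleR_right)
  show "1 * x = x"
    by (rule uop_eqI) (auto simp: uop_defs intro!: blinfun_eqI)
  show "x * 1 = x"
    by (rule uop_eqI) (auto simp: uop_defs intro!: blinfun_eqI)
  show "norm (x * y) \<le> norm x * norm y"
  proof -
    obtain a A where x: "rep_uop x = (a, A)" by (cases "rep_uop x")
    obtain b B where y: "rep_uop y = (b, B)" by (cases "rep_uop y")
    have "norm (a *\<^sub>R B + b *\<^sub>R A + (A o\<^sub>L B)) \<le> \<bar>a\<bar> * norm B + \<bar>b\<bar> * norm A + norm A * norm B"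
      by (intro norm_triangle_le add_mono norm_blinfun_compose) auto
    then show ?thesis
      by (simp add: uop_defs x y algebra_simps abs_mult)
  qed
  show "x + y + z = x + (y + z)" by (rule uop_eqI) (auto simp: uop_defs)
  show "x + y = y + x" by (rule uop_eqI) (auto simp: uop_defs)
  show "0 + x = x" by (rule uop_eqI) (auto simp: uop_defs)
  show "- x + x = 0" by (rule uop_eqI) (auto simp: uop_defs)
  show "x - y = x + - y" by (rule uop_eqI) (auto simp: uop_defs)
  show "r *\<^sub>R (x + y) = r *\<^sub>R x + r *\<^sub>R y" by (rule uop_eqI) (auto simp: uop_defs algebra_simps)
  show "(r + s) *\<^sub>R x = r *\<^sub>R x + s *\<^sub>R x" by (rule uop_eqI) (auto simp: uop_defs algebra_simps)
  show "r *\<^sub>R s *\<^sub>R x = (r * s) *\<^sub>R x" by (rule uop_eqI) (auto simp: uop_defs)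
  show "1 *\<^sub>R x = x" by (rule uop_eqI) (auto simp: uop_defs)
  show "(0 :: 'a uop) \<noteq> 1" by (metis fst_conv one_uop_def rep_Uop zero_neq_one zero_uop_def)
  show "norm (1 :: 'a uop) = 1" by (simp add: uop_defs)
  have "x = 0 \<longleftrightarrow> rep_uop x = (0, 0)" by (metis rep_Uop rep_uop_inverse zero_uop_def)
  then show "norm x = 0 \<longleftrightarrow> x = 0"
    by (cases "rep_uop x") (simp add: norm_uop_def add_nonneg_eq_0_iff)
  show "norm (x + y) \<le> norm x + norm y"
    using norm_triangle_ineq[of "snd (rep_uop x)" "snd (rep_uop y)"]
      abs_triangle_ineq[of "fst (rep_uop x)" "fst (rep_uop y)"]
    by (simp add: uop_defs)
  show "norm (r *\<^sub>R x) = \<bar>r\<bar> * norm x" by (simp add: uop_defs algebra_simps abs_mult)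
  show "sgn x = inverse (norm x) *\<^sub>R x" by (rule sgn_uop_def)
  show "dist x y = norm (x - y)" by (rule dist_uop_def)
  show "uniformity = (INF e\<in>{0<..}. principal {(x :: 'a uop, y). dist x y < e})"
    by (rule uniformity_uop_def)
  show "open S = (\<forall>x\<in>S. \<forall>\<^sub>F (x', y) in uniformity. x' = x \<longrightarrow> y \<in> S)"
    by (rule open_uop_def)
qed

end

instance uop :: (banach) banach
proof
  fix X :: "nat \<Rightarrow> 'a uop" assume X: "Cauchy X"
  have d: "dist (X m) (X n) = dist (fst (rep_uop (X m))) (fst (rep_uop (X n))) +
      dist (snd (rep_uop (X m))) (snd (rep_uop (X n)))" for m n
    by (simp add: dist_uop_def uop_defs dist_norm)
  have le: "dist (fst (rep_uop (X m))) (fst (rep_uop (X n))) \<le> dist (X m) (X n)"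
    "dist (snd (rep_uop (X m))) (snd (rep_uop (X n))) \<le> dist (X m) (X n)" for m n
    unfolding d by simp_all
  have "Cauchy (\<lambda>n. fst (rep_uop (X n)))" "Cauchy (\<lambda>n. snd (rep_uop (X n)))"
    by (rule Cauchy_dist_le[OF X], rule le)+
  then have "convergent (\<lambda>n. fst (rep_uop (X n)))" "convergent (\<lambda>n. snd (rep_uop (X n)))"
    by (simp_all add: Cauchy_convergent)
  then obtain a A where a: "(\<lambda>n. fst (rep_uop (X n))) \<longlonglongrightarrow> a" and A: "(\<lambda>n. snd (rep_uop (X n))) \<longlonglongrightarrow> A"
    unfolding convergent_def by blast
  have "(\<lambda>n. dist (fst (rep_uop (X n))) a + dist (snd (rep_uop (X n))) A) \<longlonglongrightarrow> 0 + 0"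
    by (rule tendsto_add[OF tendsto_dist_iff[THEN iffD1, OF a] tendsto_dist_iff[THEN iffD1, OF A]])
  moreover have "dist (X n) (Uop (a, A)) = dist (fst (rep_uop (X n))) a + dist (snd (rep_uop (X n))) A" for n
    by (simp add: dist_uop_def uop_defs dist_norm)
  ultimately have "X \<longlonglongrightarrow> Uop (a, A)" by (subst tendsto_dist_iff) simp
  then show "convergent X" by (rule convergentI)
qed

section \<open>Exponentials of bounded operators\<close>

definition uact :: "'a::real_normed_vector uop \<Rightarrow> 'a \<Rightarrow> 'a" where
  "uact x v = fst (rep_uop x) *\<^sub>R v + snd (rep_uop x) v"

lemma uact_mult: "uact (x * y) v = uact x (uact y v)"
  by (simp add: uact_def uop_defs blinfun.add_left blinfun.add_right blinfun.scaleR_left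
    blinfun.scaleR_right algebra_simps)

lemma uact_one [simp]: "uact 1 v = v"
  by (simp add: uact_def uop_defs)

lemma bounded_bilinear_uact: "bounded_bilinear uact"
proof
  show "uact (x + x') v = uact x v + uact x' v" for x x' :: "'a uop" and v
    by (simp add: uact_def uop_defs blinfun.add_left algebra_simps)
  show "uact x (v + v') = uact x v + uact x v'" for x :: "'a uop" and v v'
    by (simp add: uact_def blinfun.add_right algebra_simps)
  show "uact (r *\<^sub>R x) v = r *\<^sub>R uact x v" for r and x :: "'a uop" and v
    by (simp add: uact_def uop_defs blinfun.scaleR_left algebra_simps)
  show "uact x (r *\<^sub>R v) = r *\<^sub>R uact x v" for r and x :: "'a uop" and v
    by (simp add: uact_def blinfun.scaleR_right algebra_simps)
  have "norm (uact x v) \<le> norm v * norm x * 1" for x :: "'a uop" and v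
  proof -
    have "norm (uact x v) \<le> \<bar>fst (rep_uop x)\<bar> * norm v + norm (snd (rep_uop x)) * norm v"
      unfolding uact_def by (intro norm_triangle_le add_mono norm_blinfun) auto
    then show ?thesis by (simp add: norm_uop_def algebra_simps)
  qed
  then show "\<exists>K. \<forall>(x :: 'a uop) v. norm (uact x v) \<le> norm x * norm v * K"
    by (metis mult.commute mult.left_commute mult_1_right)
qed

definition uemb :: "('a::real_normed_vector \<Rightarrow> 'a) \<Rightarrow> 'a uop" where
  "uemb A = Uop (0, Blinfun A)"

definition opexp :: "('a::banach \<Rightarrow> 'a) \<Rightarrow> real \<Rightarrow> 'a \<Rightarrow> 'a" where
  "opexp A s v = uact (exp (s *\<^sub>R uemb A)) v"

lemma uact_uemb: "bounded_linear A \<Longrightarrow> uact (uemb A) v = A v"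
  by (simp add: uact_def uemb_def bounded_linear_Blinfun_apply)

lemma uemb_add:
  assumes "bounded_linear A" "bounded_linear C"
  shows "uemb (\<lambda>v. A v + C v) = uemb A + uemb C"
  by (rule uop_eqI)
    (auto simp: uemb_def uop_defs blinfun.add_left bounded_linear_Blinfun_apply bounded_linear_add assms
      intro!: blinfun_eqI)

lemma uemb_commute:
  assumes "bounded_linear A" "bounded_linear C" "\<And>v. A (C v) = C (A v)"
  shows "uemb A * uemb C = uemb C * uemb A"
  by (rule uop_eqI)
    (auto simp: uemb_def uop_defs bounded_linear_Blinfun_apply assms intro!: blinfun_eqI)

lemma opexp_add:
  assumes "bounded_linear A" "bounded_linear C" "\<And>v. A (C v) = C (A v)"
  shows "opexp (\<lambda>v. A v + C v) s v = opexp A s (opexp C s v)"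
proof -
  have "(s *\<^sub>R uemb A) * (s *\<^sub>R uemb C) = (s *\<^sub>R uemb C) * (s *\<^sub>R uemb A)"
    by (simp add: uemb_commute[OF assms])
  from exp_add_commuting[OF this] show ?thesis
    by (simp add: opexp_def uemb_add[OF assms(1,2)] scaleR_add_right uact_mult)
qed

lemma opexp_zero [simp]: "opexp A 0 v = v"
  by (simp add: opexp_def)

lemma opexp_plus: "opexp A (s + r) v = opexp A s (opexp A r v)"
proof -
  have "(s *\<^sub>R uemb A) * (r *\<^sub>R uemb A) = (r *\<^sub>R uemb A) * (s *\<^sub>R uemb A)" by simp
  from exp_add_commuting[OF this] show ?thesis
    by (simp add: opexp_def scaleR_add_left uact_mult)
qed

lemma opexp_minus:
  assumes "bounded_linear A"
  shows "opexp A (- s) v = opexp (\<lambda>v. - A v) s v"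
proof -
  have "uemb (\<lambda>v. - A v) = - uemb A"
    by (rule uop_eqI)
      (auto simp: uemb_def uop_defs blinfun.minus_left bounded_linear_Blinfun_apply
        bounded_linear_minus assms intro!: blinfun_eqI)
  then show ?thesis by (simp add: opexp_def)
qed

text \<open>The difference \<open>h\<close> of the two sides is bounded linear in the algebra
  element and vanishes on all powers, hence on the exponential series. \<open>C\<close> is
  real-linear, so that multiplication by a complex scalar is an instance; this is how the
  exponential becomes complex linear.\<close>

lemma opexp_commute:
  assumes A: "bounded_linear A" and C: "bounded_linear C" and comm: "\<And>v. C (A v) = A (C v)"
  shows "C (opexp A s v) = opexp A s (C v)"
proof -
  interpret bounded_bilinear uact by (rule bounded_bilinear_uact)
  have pow: "C (uact (uemb A ^ n) v) = uact (uemb A ^ n) (C v)" for n v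
    by (induction n arbitrary: v) (auto simp: uact_mult uact_uemb[OF A] comm)
  define h where "h x = C (uact x v) - uact x (C v)" for x
  have h: "bounded_linear h"
    unfolding h_def by (intro bounded_linear_sub bounded_linear_left bounded_linear_compose[OF C])
  have "h ((s *\<^sub>R uemb A) ^ n /\<^sub>R fact n) = 0" for n
    using bounded_linear.linear[OF C]
    by (simp add: h_def scaleR_power linear_scale scaleR_left pow flip: power_mult_distrib)
  then have "(\<lambda>n. 0) sums h (exp (s *\<^sub>R uemb A))"
    using bounded_linear.sums[OF h exp_converges[of "s *\<^sub>R uemb A"]] by simp
  then have "h (exp (s *\<^sub>R uemb A)) = 0" using sums_unique2[OF sums_zero] by metis
  then show ?thesis by (simp add: h_def opexp_def)
qed

lemma opexp_bounded_linear: "bounded_linear (opexp A s)"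
  unfolding opexp_def[abs_def] by (rule bounded_bilinear.bounded_linear_right[OF bounded_bilinear_uact])

lemma opexp_bounded_clinear:
  assumes "bounded_clinear A"
  shows "bounded_clinear (opexp A s)"
  unfolding bounded_clinear_def
  using opexp_commute[OF bounded_clinear_bl[OF assms] scaleC_bl_right] opexp_bounded_linear
  by (metis assms bounded_clinear_scaleC)

lemma opexp_derivative:
  assumes "bounded_linear A"
  shows "((\<lambda>s. opexp A s v) has_vector_derivative opexp A s (A v)) (at s within S)"
proof -
  interpret bounded_bilinear uact by (rule bounded_bilinear_uact)
  show ?thesis
    using bounded_linear.has_vector_derivative[OF bounded_linear_left
        exp_scaleR_has_vector_derivative_right[of "uemb A" s S], of v]
    by (simp add: opexp_def uact_mult uact_uemb[OF assms])
qed

text \<open>The derivative of the squared norm is twice the inner product of A z with z for z =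
  \<open>opexp A s v\<close>, which skewness makes zero.\<close>

lemma opexp_isometry:
  fixes A :: "'a::chilbert_space \<Rightarrow> 'a"
  assumes A: "bounded_linear A" and skew: "\<And>v. inner (A v) v = 0"
  shows "norm (opexp A s v) = norm v"
proof -
  have "((\<lambda>s. inner (opexp A s v) (opexp A s v)) has_vector_derivative 0) (at s within UNIV)" for s
  proof -
    have "((\<lambda>s. inner (opexp A s v) (opexp A s v)) has_vector_derivative
        (inner (opexp A s v) (opexp A s (A v)) + inner (opexp A s (A v)) (opexp A s v))) (at s within UNIV)"
      by (intro bounded_bilinear.has_vector_derivative[OF bounded_bilinear_inner] opexp_derivative A)
    moreover have "opexp A s (A v) = A (opexp A s v)"
      by (rule opexp_commute[symmetric]) (auto intro: A)
    moreover have "inner (opexp A s v) (A (opexp A s v)) = 0"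
      using skew by (simp add: inner_commute)
    ultimately show ?thesis by (simp add: skew)
  qed
  then obtain c where "\<And>s. s \<in> UNIV \<Longrightarrow> inner (opexp A s v) (opexp A s v) = c"
    using has_vector_derivative_zero_constant[of UNIV "\<lambda>s. inner (opexp A s v) (opexp A s v)"] by auto
  from this[of s] this[of 0] show ?thesis by (simp add: norm_eq_sqrt_inner)
qed

lemma norm_diff_le_derivative_bound:
  fixes f :: "real \<Rightarrow> 'a::real_normed_vector"
  assumes "\<And>r. (f has_vector_derivative f' r) (at r)" "\<And>r. norm (f' r) \<le> K"
  shows "norm (f s - f 0) \<le> \<bar>s\<bar> * K"
proof -
  have "norm (f s - f 0) \<le> K * norm (s - 0)"
  proof (rule differentiable_bound[of UNIV f "\<lambda>r h. h *\<^sub>R f' r"])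
    show "(f has_derivative (\<lambda>h. h *\<^sub>R f' r)) (at r within UNIV)" for r
      using assms(1)[of r] by (simp add: has_vector_derivative_def)
    show "onorm (\<lambda>h. h *\<^sub>R f' r) \<le> K" for r
      by (rule onorm_le) (use mult_left_mono[OF assms(2)[of r] abs_ge_zero] in \<open>simp add: mult.commute\<close>)
  qed auto
  then show ?thesis by (simp add: mult.commute)
qed

lemma opexp_near_id:
  fixes A :: "'a::chilbert_space \<Rightarrow> 'a"
  assumes A: "bounded_linear A" and skew: "\<And>v. inner (A v) v = 0"
  shows "norm (opexp A s v - v) \<le> \<bar>s\<bar> * norm (A v)"
  using norm_diff_le_derivative_bound[of "\<lambda>s. opexp A s v" "\<lambda>s. opexp A s (A v)" "norm (A v)" s]
    opexp_derivative[OF A] opexp_isometry[OF A skew] by simp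

lemma opexp_diff_bound:
  fixes A C :: "'a::chilbert_space \<Rightarrow> 'a"
  assumes A: "bounded_linear A" and skewA: "\<And>v. inner (A v) v = 0"
    and C: "bounded_linear C" and skewC: "\<And>v. inner (C v) v = 0"
    and comm: "\<And>v. A (C v) = C (A v)"
  shows "norm (opexp A s v - opexp C s v) \<le> \<bar>s\<bar> * norm (A v - C v)"
proof -
  have C': "bounded_linear (\<lambda>v. - C v)" by (rule bounded_linear_minus[OF C])
  have inv: "opexp C s (opexp (\<lambda>v. - C v) s w) = w" for w
    using opexp_plus[of C s "- s" w] by (simp add: opexp_minus[OF C])
  have "opexp (\<lambda>v. - C v + A v) s v = opexp (\<lambda>v. - C v) s (opexp A s v)"
    by (rule opexp_add[OF C' A]) (simp add: comm linear_neg[OF bounded_linear.linear[OF A]])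
  then have "opexp A s v = opexp C s (opexp (\<lambda>v. - C v + A v) s v)" by (simp only: inv)
  then have "opexp A s v - opexp C s v = opexp C s (opexp (\<lambda>v. - C v + A v) s v - v)"
    by (simp add: linear_diff bounded_linear.linear[OF opexp_bounded_linear])
  then have "norm (opexp A s v - opexp C s v) = norm (opexp (\<lambda>v. - C v + A v) s v - v)"
    by (simp add: opexp_isometry[OF C skewC])
  also have "\<dots> \<le> \<bar>s\<bar> * norm (- C v + A v)"
    by (rule opexp_near_id) (auto intro: bounded_linear_sub A C simp: inner_diff_left skewA skewC)
  finally show ?thesis by simp
qed

section \<open>Self-adjoint relations and their resolvents\<close>

lemma self_adjoint_symmetric:
  "self_adjoint B \<Longrightarrow> (x, y) \<in> B \<Longrightarrow> (u, v) \<in> B \<Longrightarrow> cinner x v = cinner y u"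
  unfolding self_adjoint_def adjoint_graph_def by blast

text \<open>Being paired correctly with every element of the graph is already membership. Linearity
  of the relation is deduced from this test.\<close>

lemma self_adjoint_mem:
  "self_adjoint B \<Longrightarrow> (\<And>u v. (u, v) \<in> B \<Longrightarrow> cinner x v = cinner y u) \<Longrightarrow> (x, y) \<in> B"
  unfolding self_adjoint_def adjoint_graph_def by blast

lemma self_adjoint_add:
  assumes B: "self_adjoint B" and xy: "(x, y) \<in> B" "(x', y') \<in> B"
  shows "(x + x', y + y') \<in> B"
proof (rule self_adjoint_mem[OF B])
  fix u v assume uv: "(u, v) \<in> B"
  show "cinner (x + x') v = cinner (y + y') u"
    using self_adjoint_symmetric[OF B xy(1) uv] self_adjoint_symmetric[OF B xy(2) uv]
    by (simp add: cinner_add_left)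
qed

lemma self_adjoint_scaleC:
  assumes B: "self_adjoint B" and xy: "(x, y) \<in> B"
  shows "(c *\<^sub>C x, c *\<^sub>C y) \<in> B"
proof (rule self_adjoint_mem[OF B])
  fix u v assume uv: "(u, v) \<in> B"
  show "cinner (c *\<^sub>C x) v = cinner (c *\<^sub>C y) u"
    using self_adjoint_symmetric[OF B xy uv] by (simp add: cinner_scaleC_left)
qed

lemma self_adjoint_diff:
  "self_adjoint B \<Longrightarrow> (x, y) \<in> B \<Longrightarrow> (x', y') \<in> B \<Longrightarrow> (x - x', y - y') \<in> B"
  using self_adjoint_add[of B x y "- x'" "- y'"] self_adjoint_scaleC[of B x' y' "-1"]
  by (simp add: scaleC_minus1)

lemma self_adjoint_zero: "self_adjoint B \<Longrightarrow> (0, 0) \<in> B"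
  by (rule self_adjoint_mem) auto

lemma adjoint_graph_closed:
  assumes "\<And>n. (f n, g n) \<in> adjoint_graph B" "f \<longlonglongrightarrow> x" "g \<longlonglongrightarrow> y"
  shows "(x, y) \<in> adjoint_graph B"
proof -
  have "cinner x v = cinner y u" if uv: "(u, v) \<in> B" for u v
  proof (rule LIMSEQ_unique)
    show "(\<lambda>n. cinner (f n) v) \<longlonglongrightarrow> cinner x v" by (intro tendsto_intros assms)
    have "cinner (f n) v = cinner (g n) u" for n
      using assms(1)[of n] uv unfolding adjoint_graph_def by blast
    then show "(\<lambda>n. cinner (f n) v) \<longlonglongrightarrow> cinner y u" by (simp, intro tendsto_intros assms)
  qed
  then show ?thesis unfolding adjoint_graph_def by blast
qed

text \<open>A real <x, y> makes \<open>x\<close> and i l y orthogonal in the real inner product. The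
  identity is responsible for injectivity, contractivity and closed range in all resolvent
  arguments.\<close>

lemma symmetric_pythagoras:
  assumes "cinner x y = cinner y x"
  shows "(norm (x - (\<i> * complex_of_real l) *\<^sub>C y))\<^sup>2 = (norm x)\<^sup>2 + l\<^sup>2 * (norm y)\<^sup>2"
proof -
  have "Im (cinner x y) = 0"
    using assms cinner_commute[of x y] by (metis complex_is_Real_iff Reals_cnj_iff)
  then show ?thesis
    unfolding norm_diff_power2_cinner by (simp add: cinner_scaleC_right norm_scaleC norm_mult power_mult_distrib)
qed

text \<open>The range of 1 - i l B is dense, because a vector orthogonal to it would be an
  eigenvector of \<open>B\<close> with an imaginary eigenvalue, and closed, because the Pythagorean
  identity makes preimages of a Cauchy sequence Cauchy.\<close>

lemma resolvent_exists:
  fixes B :: "('a::chilbert_space \<times> 'a) set"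
  assumes B: "self_adjoint B" and l: "l \<noteq> 0"
  shows "\<exists>x y. (x, y) \<in> B \<and> x - (\<i> * complex_of_real l) *\<^sub>C y = v"
proof -
  let ?c = "\<i> * complex_of_real l"
  define M where "M = {x - ?c *\<^sub>C y |x y. (x, y) \<in> B}"
  have sub: "csubspace M"
    unfolding csubspace_def subspace_def
  proof (intro conjI allI ballI)
    show "0 \<in> M" unfolding M_def using self_adjoint_zero[OF B] by (intro CollectI exI[of _ 0]) simp
  next
    fix p q assume "p \<in> M" "q \<in> M"
    then obtain x y u v where xy: "(x, y) \<in> B" "(u, v) \<in> B" "p = x - ?c *\<^sub>C y" "q = u - ?c *\<^sub>C v"
      unfolding M_def by blast
    have "p + q = (x + u) - ?c *\<^sub>C (y + v)" by (simp add: xy scaleC_add_right)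
    then show "p + q \<in> M" unfolding M_def using self_adjoint_add[OF B xy(1,2)] by blast
  next
    fix c p assume "p \<in> M"
    then obtain x y where p: "(x, y) \<in> B" "p = x - ?c *\<^sub>C y" unfolding M_def by blast
    have "c *\<^sub>C p = c *\<^sub>C x - ?c *\<^sub>C (c *\<^sub>C y)"
      by (simp add: p(2) scaleC_diff_right scaleC_scaleC mult.commute)
    then show "c *\<^sub>C p \<in> M" using self_adjoint_scaleC[OF B p(1), of c] unfolding M_def by blast
  next
    fix r :: real and p assume "p \<in> M"
    then obtain x y where p: "(x, y) \<in> B" "p = x - ?c *\<^sub>C y" unfolding M_def by blast
    have "r *\<^sub>R p = complex_of_real r *\<^sub>C x - ?c *\<^sub>C (complex_of_real r *\<^sub>C y)"
      by (simp add: p(2) scaleR_diff_right scaleC_of_real scaleC_scaleR)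
    then show "r *\<^sub>R p \<in> M" using self_adjoint_scaleC[OF B p(1), of "complex_of_real r"] unfolding M_def by blast
  qed
  have "closure M = UNIV"
  proof (rule csubspace_denseI[OF sub])
    fix \<eta> assume orth: "\<And>m. m \<in> M \<Longrightarrow> cinner m \<eta> = 0"
    \<comment> \<open>Orthogonality to the range says that \<eta> lies in the domain of the adjoint
      with image (i / l) \<eta>.\<close>
    define \<zeta> where "\<zeta> = (\<i> / complex_of_real l) *\<^sub>C \<eta>"
    have "(\<eta>, \<zeta>) \<in> B"
    proof (rule self_adjoint_mem[OF B])
      fix u v assume "(u, v) \<in> B"
      then have "cinner (u - ?c *\<^sub>C v) \<eta> = 0" by (intro orth) (auto simp: M_def)
      then have "cinner u \<eta> = - ?c * cinner v \<eta>"
        by (simp add: cinner_diff_left cinner_scaleC_left eq_neg_iff_add_eq_0)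
      then have "cnj (cinner u \<eta>) = ?c * cnj (cinner v \<eta>)" by simp
      then have "cinner \<eta> u = ?c * cinner \<eta> v" by (metis cinner_commute)
      then show "cinner \<eta> v = cinner \<zeta> u" using l by (simp add: \<zeta>_def cinner_scaleC_left)
    qed
    then have "cinner \<eta> \<zeta> = cinner \<zeta> \<eta>" using self_adjoint_symmetric[OF B] by blast
    then have "(\<i> / complex_of_real l) * cinner \<eta> \<eta> = - (\<i> / complex_of_real l) * cinner \<eta> \<eta>"
      by (simp add: \<zeta>_def cinner_scaleC_left cinner_scaleC_right)
    then show "\<eta> = 0" using l by (simp add: cinner_eq_zero_iff)
  qed
  moreover have "closed M"
  proof (rule closed_sequential_limits[THEN iffD2], intro allI impI)
    fix p v assume pv: "(\<forall>n. p n \<in> M) \<and> p \<longlonglongrightarrow> v"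
    have "\<forall>n. \<exists>x y. (x, y) \<in> B \<and> p n = x - ?c *\<^sub>C y" using pv unfolding M_def by blast
    then obtain f g where fg: "\<And>n. (f n, g n) \<in> B" "\<And>n. p n = f n - ?c *\<^sub>C g n" by metis
    have d: "(norm (p m - p n))\<^sup>2 = (norm (f m - f n))\<^sup>2 + l\<^sup>2 * (norm (g m - g n))\<^sup>2" for m n
    proof -
      have "(f m - f n, g m - g n) \<in> B" by (rule self_adjoint_diff[OF B fg(1) fg(1)])
      then have "cinner (f m - f n) (g m - g n) = cinner (g m - g n) (f m - f n)"
        using self_adjoint_symmetric[OF B] by blast
      from symmetric_pythagoras[OF this, of l] show ?thesis
        by (simp add: fg(2) scaleC_diff_right algebra_simps)
    qed
    have cp: "Cauchy p" using pv LIMSEQ_imp_Cauchy by blast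
    have "Cauchy f"
    proof (rule Cauchy_dist_le[OF cp])
      show "dist (f m) (f n) \<le> dist (p m) (p n)" for m n
        unfolding dist_norm by (rule power2_le_imp_le) (auto simp: d)
    qed
    then obtain x where x: "f \<longlonglongrightarrow> x" using Cauchy_convergent convergent_def by blast
    have "(\<lambda>n. (1 / ?c) *\<^sub>C (f n - p n)) \<longlonglongrightarrow> (1 / ?c) *\<^sub>C (x - v)"
      using pv by (intro tendsto_intros x) auto
    moreover have "(1 / ?c) *\<^sub>C (f n - p n) = g n" for n
      using l by (simp add: fg(2) scaleC_scaleC)
    ultimately have g: "g \<longlonglongrightarrow> (1 / ?c) *\<^sub>C (x - v)" by simp
    have "(x, (1 / ?c) *\<^sub>C (x - v)) \<in> B"
      using adjoint_graph_closed[of f g B, OF _ x g] fg(1) B unfolding self_adjoint_def by simp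
    moreover have "x - ?c *\<^sub>C ((1 / ?c) *\<^sub>C (x - v)) = v"
      using l by (simp add: scaleC_scaleC)
    ultimately show "v \<in> M" unfolding M_def by force
  qed
  ultimately have "v \<in> M" by auto
  then show ?thesis unfolding M_def by blast
qed

lemma dense_approx:
  fixes D :: "'a::metric_space set"
  assumes "closure D = UNIV" "e > 0"
  shows "\<exists>x\<in>D. dist v x < e"
proof -
  have "v \<in> closure D" using assms by simp
  then show ?thesis using assms(2) closure_approachable[of v D] by (simp add: dist_commute)
qed

text \<open>The e/3 argument. The filter is arbitrary, since both sequences and limits s
  \<rightarrow> 0 of a group occur.\<close>

lemma contractions_tendsto:
  fixes T :: "'i \<Rightarrow> 'a::real_normed_vector \<Rightarrow> 'a"
  assumes lin: "\<And>n. linear (T n)" "linear T'" and contr: "\<And>n x. norm (T n x) \<le> norm x" "\<And>x. norm (T' x) \<le> norm x"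
    and D: "closure D = UNIV" "\<And>x. x \<in> D \<Longrightarrow> ((\<lambda>n. T n x) \<longlongrightarrow> T' x) F"
  shows "((\<lambda>n. T n x) \<longlongrightarrow> T' x) F"
proof (rule tendstoI)
  fix e :: real assume e: "e > 0"
  then obtain z where z: "z \<in> D" "dist x z < e / 3" using dense_approx[OF D(1), of "e/3"] by auto
  have "\<forall>\<^sub>F n in F. dist (T n z) (T' z) < e / 3"
    using tendstoD[OF D(2)[OF z(1)], of "e/3"] e by auto
  then show "\<forall>\<^sub>F n in F. dist (T n x) (T' x) < e"
  proof eventually_elim
    case (elim n)
    have "dist (T n x) (T n z) \<le> dist x z" "dist (T' z) (T' x) \<le> dist x z"
      using contr(1)[of n "x - z"] contr(2)[of "z - x"] lin
      by (auto simp: dist_norm linear_diff norm_minus_commute)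
    moreover have "dist (T n x) (T' x) \<le> dist (T n x) (T n z) + (dist (T n z) (T' z) + dist (T' z) (T' x))"
      by (meson add_left_mono dist_triangle order_trans)
    ultimately show ?case using elim z(2) by linarith
  qed
qed

lemma contractions_Cauchy:
  fixes T :: "nat \<Rightarrow> 'a::real_normed_vector \<Rightarrow> 'a"
  assumes lin: "\<And>n. linear (T n)" and contr: "\<And>n x. norm (T n x) \<le> norm x"
    and D: "closure D = UNIV" "\<And>x. x \<in> D \<Longrightarrow> Cauchy (\<lambda>n. T n x)"
  shows "Cauchy (\<lambda>n. T n x)"
proof (rule metric_CauchyI)
  fix e :: real assume e: "e > 0"
  then obtain z where z: "z \<in> D" "dist x z < e / 3" using dense_approx[OF D(1), of "e/3"] by auto
  obtain N where N: "\<And>m n. m \<ge> N \<Longrightarrow> n \<ge> N \<Longrightarrow> dist (T m z) (T n z) < e / 3"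
    using metric_CauchyD[OF D(2)[OF z(1)], of "e/3"] e by auto
  have "dist (T m x) (T n x) < e" if "m \<ge> N" "n \<ge> N" for m n
  proof -
    have "dist (T m x) (T m z) \<le> dist x z" "dist (T n z) (T n x) \<le> dist x z"
      using contr[of m "x - z"] contr[of n "z - x"] lin
      by (auto simp: dist_norm linear_diff norm_minus_commute)
    moreover have "dist (T m x) (T n x) \<le> dist (T m x) (T m z) + (dist (T m z) (T n z) + dist (T n z) (T n x))"
      by (meson add_left_mono dist_triangle order_trans)
    ultimately show ?thesis using N[OF that] z(2) by linarith
  qed
  then show "\<exists>M. \<forall>m\<ge>M. \<forall>n\<ge>M. dist (T m x) (T n x) < e" by blast
qed

section \<open>Unitary groups and their generators\<close>

lemma unitary_group_simps:
  assumes "unitary_group U"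
  shows "bounded_clinear (U s)" "surj (U s)" "cinner (U s x) (U s y) = cinner x y"
    "U (s + r) x = U s (U r x)" "continuous_on UNIV (\<lambda>s. U s x)"
  using assms unfolding unitary_group_def unitary_op_def by auto

text \<open>Continuity at 0 spreads to every point through the group law, and U (- s) supplies
  preimages under U s.\<close>

lemma unitary_groupI:
  assumes bU: "\<And>s. bounded_clinear (U s)" and Un: "\<And>s x. norm (U s x) = norm x"
    and Uplus: "\<And>s r x. U (s + r) x = U s (U r x)" and U0: "\<And>x. U 0 x = x"
    and Ucont0: "\<And>x. ((\<lambda>s. U s x) \<longlongrightarrow> x) (at 0)"
  shows "unitary_group U"
proof -
  have Ucont: "continuous_on UNIV (\<lambda>s. U s x)" for x
  proof (rule continuous_at_imp_continuous_on, intro ballI)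
    fix r :: real
    have "((\<lambda>h. U r (U h x)) \<longlongrightarrow> U r x) (at 0)"
      by (rule bounded_clinear_tendsto[OF bU Ucont0])
    then have "((\<lambda>h. U (r + h) x) \<longlongrightarrow> U r x) (at 0)" by (simp add: Uplus)
    then show "isCont (\<lambda>s. U s x) r" by (simp add: isCont_def LIM_offset_zero_iff[of r])
  qed
  show ?thesis
    unfolding unitary_group_def unitary_op_def
  proof (intro conjI allI)
    show "surj (U s)" for s
      unfolding surj_def using Uplus[of s "- s"] U0 by (metis add.right_inverse)
    show "U (s + r) = U s \<circ> U r" for s r by (auto simp: Uplus)
  qed (auto simp: bU Ucont isometry_cinner[OF bU Un])
qed

lemma unitary_group_norm: "unitary_group U \<Longrightarrow> norm (U s x) = norm x"
  by (metis cinner_self norm_ge_zero of_real_eq_iff power2_eq_imp_eq unitary_group_simps(3))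

text \<open>By the group law \<open>U 0\<close> is idempotent, and an idempotent linear isometry is
  the identity.\<close>

lemma unitary_group_zero: "unitary_group U \<Longrightarrow> U 0 x = x"
proof -
  assume U: "unitary_group U"
  have "U 0 (U 0 x - x) = 0"
    using unitary_group_simps(4)[OF U, of 0 0 x]
    by (simp add: bounded_clinear_diff[OF unitary_group_simps(1)[OF U]])
  then show ?thesis using unitary_group_norm[OF U, of 0 "U 0 x - x"] by simp
qed

lemma unitary_group_inverse:
  assumes U: "unitary_group U"
  shows "U s (U (- s) x) = x" "U (- s) (U s x) = x"
  using unitary_group_simps(4)[OF U, of s "- s" x] unitary_group_simps(4)[OF U, of "- s" s x]
    unitary_group_zero[OF U, of x] by auto

lemma unitary_group_adjoint:
  assumes U: "unitary_group U"
  shows "cinner (U s x) y = cinner x (U (- s) y)"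
  using unitary_group_simps(3)[OF U, of s x "U (- s) y"] unitary_group_inverse(1)[OF U] by simp

lemma unitary_group_derivative:
  assumes U: "unitary_group U" and xy: "(x, y) \<in> generator U"
  shows "((\<lambda>s. U s x) has_vector_derivative U r (\<i> *\<^sub>C y)) (at r)"
proof -
  have "((\<lambda>s. U s x) \<circ> (\<lambda>s. s - r) has_vector_derivative 1 *\<^sub>R (\<i> *\<^sub>C y)) (at r)"
  proof (rule vector_diff_chain_at)
    show "((\<lambda>s. s - r) has_vector_derivative 1) (at r)" by (auto intro!: derivative_eq_intros)
    show "((\<lambda>s. U s x) has_vector_derivative \<i> *\<^sub>C y) (at (r - r))"
      using xy by (simp add: generator_def)
  qed
  from bounded_linear.has_vector_derivative[OF bounded_clinear_bl[OF unitary_group_simps(1)[OF U]] this, of r]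
  show ?thesis by (simp add: o_def flip: unitary_group_simps(4)[OF U])
qed

lemma generator_invariant:
  assumes U: "unitary_group U" and xy: "(x, y) \<in> generator U"
  shows "(U r x, U r y) \<in> generator U"
proof -
  have bc: "bounded_clinear (U r)" by (rule unitary_group_simps(1)[OF U])
  have "((\<lambda>s. U r (U s x)) has_vector_derivative U r (\<i> *\<^sub>C y)) (at 0)"
    using bounded_linear.has_vector_derivative[OF bounded_clinear_bl[OF bc]] xy
    by (simp add: generator_def)
  moreover have "U r (U s x) = U s (U r x)" for s
    using unitary_group_simps(4)[OF U, of r s x] unitary_group_simps(4)[OF U, of s r x]
    by (simp add: add.commute)
  ultimately show ?thesis by (simp add: generator_def bounded_clinear_scaleC[OF bc])
qed

text \<open>Differentiate the constant function <U_s x, U_s u> at 0.\<close>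

lemma generator_symmetric:
  assumes U: "unitary_group U" and "(x, y) \<in> generator U" "(u, v) \<in> generator U"
  shows "cinner x v = cinner y u"
proof -
  have "((\<lambda>s. cinner (U s x) (U s u)) has_vector_derivative
      (cinner (U 0 x) (\<i> *\<^sub>C v) + cinner (\<i> *\<^sub>C y) (U 0 u))) (at 0)"
    by (rule bounded_bilinear.has_vector_derivative[OF bounded_bilinear_cinner])
      (use assms in \<open>auto simp: generator_def\<close>)
  moreover have "((\<lambda>s. cinner (U s x) (U s u)) has_vector_derivative 0) (at 0)"
    by (simp add: unitary_group_simps(3)[OF U])
  ultimately have "cinner (U 0 x) (\<i> *\<^sub>C v) + cinner (\<i> *\<^sub>C y) (U 0 u) = 0"
    by (rule vector_derivative_unique_at)
  then show ?thesis by (simp add: unitary_group_zero[OF U] cinner_scaleC_left cinner_scaleC_right)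
qed

text \<open>For \<open>x\<close> and \<open>u\<close> in the domain of the smaller generator the
  function <U_s x, W_s u> has derivative 0, so it equals <x, u> = <W_s x, W_s u>. Thus U_s x - W_s x
  is orthogonal to W_s u for a dense set of \<open>u\<close>, and \<open>W s\<close> is
  onto.\<close>

lemma unitary_group_unique:
  fixes U W :: "real \<Rightarrow> 'a::chilbert_space \<Rightarrow> 'a"
  assumes U: "unitary_group U" and W: "unitary_group W"
    and sub: "generator W \<subseteq> generator U" and dense: "closure (Domain (generator W)) = UNIV"
  shows "U = W"
proof (intro ext)
  have const: "cinner (U s x) (W s u) = cinner x u"
    if xu: "(x, y) \<in> generator W" "(u, v) \<in> generator W" for x y u v s
  proof -
    have xU: "(x, y) \<in> generator U" using xu sub by blast
    have "((\<lambda>s. cinner (U s x) (W s u)) has_vector_derivative 0) (at r within UNIV)" for r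
    proof -
      have "cinner (U r x) (W r v) = cinner (U r y) (W r u)"
        using generator_symmetric[OF U generator_invariant[OF U xU]]
          generator_invariant[OF W xu(2)] sub by blast
      then have "cinner (U r x) (W r (\<i> *\<^sub>C v)) + cinner (U r (\<i> *\<^sub>C y)) (W r u) = 0"
        by (simp add: bounded_clinear_scaleC unitary_group_simps(1) U W cinner_scaleC_left cinner_scaleC_right)
      moreover have "((\<lambda>s. cinner (U s x) (W s u)) has_vector_derivative
          cinner (U r x) (W r (\<i> *\<^sub>C v)) + cinner (U r (\<i> *\<^sub>C y)) (W r u)) (at r)"
        by (intro bounded_bilinear.has_vector_derivative[OF bounded_bilinear_cinner]
          unitary_group_derivative U W xU xu)
      ultimately show ?thesis by simp
    qed
    then obtain c where "\<And>s. s \<in> UNIV \<Longrightarrow> cinner (U s x) (W s u) = c"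
      using has_vector_derivative_zero_constant[of UNIV "\<lambda>s. cinner (U s x) (W s u)"] by auto
    from this[of s] this[of 0] show ?thesis by (simp add: unitary_group_zero U W)
  qed
  fix s x
  \<comment> \<open>A constant sequence: the density principle for contractions extends the equality
    from the domain to the whole space.\<close>
  have "(\<lambda>n. U s x) \<longlonglongrightarrow> W s x"
  proof (rule contractions_tendsto[where T = "\<lambda>n. U s" and T' = "W s", OF _ _ _ _ dense])
    fix x assume "x \<in> Domain (generator W)"
    then obtain y where xy: "(x, y) \<in> generator W" by blast
    have *: "cinner (U s x - W s x) (W s u) = 0" if "u \<in> Domain (generator W)" for u
      using that const[OF xy] by (auto simp: cinner_diff_left unitary_group_simps(3)[OF W])
    have "continuous_on UNIV (\<lambda>u. cinner (U s x - W s x) (W s u))"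
      by (intro continuous_intros bounded_clinear_continuous_on unitary_group_simps(1) W)
    then have "closed {u. cinner (U s x - W s x) (W s u) = 0}"
      by (intro closed_Collect_eq) auto
    then have "UNIV \<subseteq> {u. cinner (U s x - W s x) (W s u) = 0}"
      unfolding dense[symmetric] by (intro closure_minimal) (use * in auto)
    then have **: "cinner (U s x - W s x) (W s u) = 0" for u by blast
    obtain u where "W s u = U s x - W s x"
      using unitary_group_simps(2)[OF W] by (metis surjD)
    with **[of u] have "cinner (U s x - W s x) (U s x - W s x) = 0" by simp
    then have "U s x = W s x" by (simp add: cinner_eq_zero_iff)
    then show "(\<lambda>n. U s x) \<longlonglongrightarrow> W s x" by simp
  qed (auto simp: unitary_group_norm U W intro!: bounded_linear.linear bounded_clinear_bl unitary_group_simps(1))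
  then show "U s x = W s x" by (simp add: LIMSEQ_const_iff)
qed

lemma has_vector_derivative_at_0:
  "(f has_vector_derivative D) (at 0) \<longleftrightarrow> ((\<lambda>s. (1 / s) *\<^sub>R (f s - f 0)) \<longlongrightarrow> D) (at 0)"
  for f :: "real \<Rightarrow> 'a::real_normed_vector"
proof -
  have "norm ((1 / s) *\<^sub>R (f s - f 0) - D) = norm (f (0 + s) - f 0 - s *\<^sub>R D) / norm s" if "s \<noteq> 0" for s :: real
  proof -
    have "(1 / s) *\<^sub>R (f s - f 0) - D = (1 / s) *\<^sub>R (f s - f 0 - s *\<^sub>R D)"
      using that by (simp add: scaleR_diff_right)
    then show ?thesis by (simp add: divide_inverse mult.commute)
  qed
  then have ev: "\<forall>\<^sub>F s in at 0. norm ((1 / s) *\<^sub>R (f s - f 0) - D) = norm (f (0 + s) - f 0 - s *\<^sub>R D) / norm s"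
    by (simp add: eventually_at_filter)
  have "((\<lambda>s. (1 / s) *\<^sub>R (f s - f 0)) \<longlongrightarrow> D) (at 0) \<longleftrightarrow>
      ((\<lambda>s. norm ((1 / s) *\<^sub>R (f s - f 0) - D)) \<longlongrightarrow> 0) (at 0)"
    by (simp add: tendsto_norm_zero_iff LIM_zero_iff)
  also have "\<dots> \<longleftrightarrow> ((\<lambda>s. norm (f (0 + s) - f 0 - s *\<^sub>R D) / norm s) \<longlongrightarrow> 0) (at 0)"
    by (rule tendsto_cong[OF ev])
  also have "\<dots> \<longleftrightarrow> (f has_vector_derivative D) (at 0)"
    unfolding has_vector_derivative_def has_derivative_at by (simp add: bounded_linear_scaleR_left)
  finally show ?thesis by simp
qed

text \<open>With the resolvents $R_l = (1 - i l B)^{-1}$, the bounded skew-adjoint operators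
  $A_n = (R_\tau - R_{-\tau}) / 2\tau$ for $\tau = 1/(n+1)$ commute and converge to \<open>iB\<close> on its domain, so that
  the isometries $e^{s A_n}$ converge strongly.\<close>

lemma stone_exists:
  fixes B :: "('a::chilbert_space \<times> 'a) set"
  assumes B: "self_adjoint B"
  shows "\<exists>U. unitary_group U \<and> generator U = B"
proof -
  have "\<forall>l v. \<exists>x y. l \<noteq> 0 \<longrightarrow> (x, y) \<in> B \<and> x - (\<i> * complex_of_real l) *\<^sub>C y = v"
    using resolvent_exists[OF B] by blast
  then obtain R S where RS: "\<And>l v. l \<noteq> 0 \<Longrightarrow> (R l v, S l v) \<in> B"
      "\<And>l v. l \<noteq> 0 \<Longrightarrow> R l v - (\<i> * complex_of_real l) *\<^sub>C S l v = v"
    by metis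
  have pyth: "(norm (x - (\<i> * complex_of_real l) *\<^sub>C y))\<^sup>2 = (norm x)\<^sup>2 + l\<^sup>2 * (norm y)\<^sup>2"
    if "(x, y) \<in> B" for x y l
    by (rule symmetric_pythagoras) (rule self_adjoint_symmetric[OF B that that])
  \<comment> \<open>Pythagoras for the difference of two solutions shows that 1 - i l B is
    injective. Each property of \<open>R l\<close> below is obtained by exhibiting a solution and
    applying this.\<close>
  have uniq: "R l v = x" if "l \<noteq> 0" "(x, y) \<in> B" "x - (\<i> * complex_of_real l) *\<^sub>C y = v" for l x y v
  proof -
    have "(R l v - x, S l v - y) \<in> B" by (rule self_adjoint_diff[OF B RS(1)[OF that(1)] that(2)])
    moreover have "(R l v - x) - (\<i> * complex_of_real l) *\<^sub>C (S l v - y) =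
        (R l v - (\<i> * complex_of_real l) *\<^sub>C S l v) - (x - (\<i> * complex_of_real l) *\<^sub>C y)"
      by (simp add: scaleC_diff_right)
    ultimately have "0 = (norm (R l v - x))\<^sup>2 + l\<^sup>2 * (norm (S l v - y))\<^sup>2"
      using pyth[of "R l v - x" "S l v - y" l] RS(2)[OF that(1)] that(3) by simp
    then have "(norm (R l v - x))\<^sup>2 = 0"
      using sum_power2_eq_zero_iff[of "norm (R l v - x)" "l * norm (S l v - y)"]
      by (simp add: power_mult_distrib)
    then show ?thesis by simp
  qed
  have Radd: "R l (v + w) = R l v + R l w" if "l \<noteq> 0" for l v w
    using RS(2)[OF that, of v] RS(2)[OF that, of w]
    by (intro uniq[OF that self_adjoint_add[OF B RS(1)[OF that] RS(1)[OF that]]])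
      (simp add: scaleC_add_right algebra_simps)
  have Rsc: "R l (c *\<^sub>C v) = c *\<^sub>C R l v" if "l \<noteq> 0" for l c v
  proof (rule uniq[OF that self_adjoint_scaleC[OF B RS(1)[OF that]]])
    have "c *\<^sub>C R l v - (\<i> * complex_of_real l) *\<^sub>C c *\<^sub>C S l v
        = c *\<^sub>C (R l v - (\<i> * complex_of_real l) *\<^sub>C S l v)"
      by (simp add: scaleC_diff_right scaleC_scaleC mult.commute)
    then show "c *\<^sub>C R l v - (\<i> * complex_of_real l) *\<^sub>C c *\<^sub>C S l v = c *\<^sub>C v"
      by (simp add: RS(2)[OF that])
  qed
  have Rn: "norm (R l v) \<le> norm v" if "l \<noteq> 0" for l v
  proof -
    have "(norm v)\<^sup>2 = (norm (R l v))\<^sup>2 + l\<^sup>2 * (norm (S l v))\<^sup>2"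
      using pyth[OF RS(1)[OF that], of v l] RS(2)[OF that, of v] by simp
    then have "(norm (R l v))\<^sup>2 \<le> (norm v)\<^sup>2" by simp
    then show ?thesis by (rule power2_le_imp_le) simp
  qed
  have bR: "bounded_clinear (R l)" if "l \<noteq> 0" for l
    by (rule bounded_clinearI[where K = 1]) (auto simp: Radd Rsc Rn that)
  have Radj: "cinner (R l u) v = cinner u (R (- l) v)" if "l \<noteq> 0" for l u v
  proof -
    have l': "- l \<noteq> 0" using that by simp
    have s: "cinner (R l u) (S (- l) v) = cinner (S l u) (R (- l) v)"
      by (rule self_adjoint_symmetric[OF B RS(1)[OF that] RS(1)[OF l']])
    have "cinner (R l u) v = cinner (R l u) (R (- l) v) + \<i> * complex_of_real l * cinner (R l u) (S (- l) v)"
      using arg_cong[OF RS(2)[OF l', of v], of "cinner (R l u)"]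
      by (simp add: cinner_add_right cinner_scaleC_right)
    also have "\<dots> = cinner (R l u - (\<i> * complex_of_real l) *\<^sub>C S l u) (R (- l) v)"
      by (simp add: s cinner_diff_left cinner_scaleC_left)
    finally show ?thesis by (simp add: RS(2)[OF that])
  qed
  have Rcomm: "R l (R m v) = R m (R l v)" if l: "l \<noteq> 0" and m: "m \<noteq> 0" for l m v
  proof -
    define q where "q = R m v"
    define p where "p = R l q"
    let ?l = "\<i> * complex_of_real l" and ?m = "\<i> * complex_of_real m"
    have pB: "(p, S l q) \<in> B" "p - ?l *\<^sub>C S l q = q"
      unfolding p_def by (rule RS[OF l])+
    have qB: "(q, S m v) \<in> B" "q - ?m *\<^sub>C S m v = v"
      unfolding q_def by (rule RS[OF m])+
    \<comment> \<open>\<open>S l q\<close> is B p, and \<open>z\<close> will be B (B p): as B p is a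
      multiple of p - q, it lies in the domain of \<open>B\<close> again.\<close>
    define z where "z = (1 / ?l) *\<^sub>C (S l q - S m v)"
    have "S l q = (1 / ?l) *\<^sub>C (p - q)"
    proof -
      have "p - q = ?l *\<^sub>C S l q" using pB(2) by (simp add: algebra_simps)
      then show ?thesis using l by (simp add: scaleC_scaleC)
    qed
    then have zB: "(S l q, z) \<in> B"
      using self_adjoint_scaleC[OF B self_adjoint_diff[OF B pB(1) qB(1)], of "1 / ?l"]
      by (simp add: z_def)
    have lz: "?l *\<^sub>C z = S l q - S m v" using l by (simp add: z_def scaleC_scaleC)
    \<comment> \<open>The vector (1 - i m B) p solves (1 - i l B) r = v, so it is
      \<open>R l v\<close>, and \<open>R m\<close> maps it to \<open>p\<close>.\<close>
    define r where "r = p - ?m *\<^sub>C S l q"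
    have "(r, S l q - ?m *\<^sub>C z) \<in> B"
      unfolding r_def by (rule self_adjoint_diff[OF B pB(1) self_adjoint_scaleC[OF B zB]])
    moreover have "r - ?l *\<^sub>C (S l q - ?m *\<^sub>C z) = v"
    proof -
      have "?l *\<^sub>C ?m *\<^sub>C z = ?m *\<^sub>C (S l q - S m v)"
        unfolding lz[symmetric] by (simp add: scaleC_scaleC mult.commute)
      then have "r - ?l *\<^sub>C (S l q - ?m *\<^sub>C z) = (p - ?l *\<^sub>C S l q) - ?m *\<^sub>C S m v"
        by (simp add: r_def scaleC_diff_right)
      then show ?thesis using pB(2) qB(2) by simp
    qed
    ultimately have "R l v = r" by (rule uniq[OF l])
    then have "R m (R l v) = p"
      using uniq[OF m pB(1)] by (simp add: r_def)
    then show ?thesis by (simp add: p_def q_def)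
  qed
  define \<tau> :: "nat \<Rightarrow> real" where "\<tau> n = 1 / (real n + 1)" for n
  have l0: "\<tau> n \<noteq> 0" "- \<tau> n \<noteq> 0" for n by (auto simp: \<tau>_def)
  have llim: "\<tau> \<longlonglongrightarrow> 0" unfolding \<tau>_def using LIMSEQ_inverse_real_of_nat by (simp add: inverse_eq_divide add.commute)
  \<comment> \<open>Formally i B (1 + \<tau>^2 B^2)^(-1). The adjoint of \<open>R l\<close> is
    \<open>R (- l)\<close>, so the combination of both signs is exactly skew-adjoint.\<close>
  define A where "A n v = (1 / (2 * \<tau> n)) *\<^sub>R (R (\<tau> n) v - R (- \<tau> n) v)" for n v
  have bA: "bounded_clinear (A n)" for n
    unfolding A_def by (intro bounded_clinear_rmult bounded_clinear_minus bR l0)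
  have blA: "bounded_linear (A n)" for n by (rule bounded_clinear_bl[OF bA])
  have skew: "inner (A n v) v = 0" for n v
  proof -
    have "cinner (R (- \<tau> n) v) v = cnj (cinner (R (\<tau> n) v) v)"
      using Radj[OF l0(2), of n v v] cinner_commute[of v "R (\<tau> n) v"] by simp
    then have "Re (cinner (A n v) v) = 0"
      by (simp add: A_def cinner_scaleR_left cinner_diff_left)
    then show ?thesis by (simp add: Re_cinner)
  qed
  have Acomm: "A n (A m v) = A m (A n v)" for n m v
    by (simp add: A_def bounded_clinear_scaleR[OF bR] bounded_clinear_diff[OF bR] l0 Rcomm[OF l0(1) l0(1), of n m]
      Rcomm[OF l0(1) l0(2), of n m] Rcomm[OF l0(2) l0(1), of n m] Rcomm[OF l0(2) l0(2), of n m]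
      algebra_simps)
  have dense: "closure (Domain B) = UNIV" using B by (simp add: self_adjoint_def)
  have Rx: "R l x - x = (\<i> * complex_of_real l) *\<^sub>C R l y" if "(x, y) \<in> B" "l \<noteq> 0" for x y l
    using uniq[OF that(2,1) refl]
    by (simp add: bounded_clinear_diff[OF bR[OF that(2)]] bounded_clinear_scaleC[OF bR[OF that(2)]] algebra_simps)
  have Rlim: "(\<lambda>n. R (f n) y) \<longlonglongrightarrow> y" if f: "\<And>n. f n \<noteq> 0" "f \<longlonglongrightarrow> 0" for f :: "nat \<Rightarrow> real" and y
  proof (rule contractions_tendsto[where T' = "\<lambda>y. y", OF _ _ _ _ dense])
    fix x assume "x \<in> Domain B"
    then obtain z where z: "(x, z) \<in> B" by blast
    have "(\<lambda>n. R (f n) x - x) \<longlonglongrightarrow> 0"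
    proof (rule Lim_null_comparison)
      show "\<forall>\<^sub>F n in sequentially. norm (R (f n) x - x) \<le> \<bar>f n\<bar> * norm z"
        using Rn[OF f(1), of _ z] by (auto simp: Rx[OF z f(1)] norm_scaleC norm_mult mult_left_mono)
      show "(\<lambda>n. \<bar>f n\<bar> * norm z) \<longlonglongrightarrow> 0"
        using tendsto_mult_left_zero[OF tendsto_rabs_zero[OF f(2)]] by blast
    qed
    then show "(\<lambda>n. R (f n) x) \<longlonglongrightarrow> x" by (rule LIM_zero_cancel)
  qed (auto simp: Rn f bounded_clinear_bl[OF bR] bounded_linear.linear linear_id[unfolded id_def])
  have Ay: "A n x = (1/2) *\<^sub>R (\<i> *\<^sub>C (R (\<tau> n) y + R (- \<tau> n) y))" if xy: "(x, y) \<in> B" for n x y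
  proof -
    have "R (\<tau> n) x - R (- \<tau> n) x = (R (\<tau> n) x - x) - (R (- \<tau> n) x - x)" by simp
    also have "\<dots> = \<tau> n *\<^sub>R (\<i> *\<^sub>C (R (\<tau> n) y + R (- \<tau> n) y))"
      unfolding Rx[OF xy l0(1)] Rx[OF xy l0(2)]
      by (simp add: scaleC_add_right scaleC_scaleC mult.commute[of "\<i>"] flip: scaleC_of_real)
    finally show ?thesis using l0(1)[of n] by (simp add: A_def)
  qed
  have Alim: "(\<lambda>n. A n x) \<longlonglongrightarrow> \<i> *\<^sub>C y" if xy: "(x, y) \<in> B" for x y
  proof -
    have "(\<lambda>n. (1/2) *\<^sub>R (\<i> *\<^sub>C (R (\<tau> n) y + R (- \<tau> n) y))) \<longlonglongrightarrow> (1/2) *\<^sub>R (\<i> *\<^sub>C (y + y))"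
      using tendsto_minus[OF llim] by (intro tendsto_intros Rlim l0 llim) auto
    moreover have "(1/2) *\<^sub>R (\<i> *\<^sub>C (y + y)) = \<i> *\<^sub>C y"
      by (simp add: scaleC_scaleR flip: scaleR_2)
    ultimately show ?thesis by (simp add: Ay[OF xy])
  qed
  define E where "E n = opexp (A n)" for n
  have iso: "norm (E n s x) = norm x" for n s x
    unfolding E_def using opexp_isometry[of "A n"] blA skew by blast
  have linE: "linear (E n s)" for n s
    unfolding E_def by (rule bounded_linear.linear[OF opexp_bounded_linear])
  have Ediff: "norm (E n s x - E m s x) \<le> \<bar>s\<bar> * norm (A n x - A m x)" for n m s x
    unfolding E_def using opexp_diff_bound[of "A n" "A m"] blA skew Acomm by blast
  have "Cauchy (\<lambda>n. E n s x)" for s x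
  proof (rule contractions_Cauchy[OF linE _ dense])
    fix x assume "x \<in> Domain B"
    then obtain y where "(x, y) \<in> B" by blast
    then have "Cauchy (\<lambda>n. \<bar>s\<bar> *\<^sub>R A n x)"
      by (intro LIMSEQ_imp_Cauchy[OF tendsto_scaleR[OF tendsto_const Alim]])
    then show "Cauchy (\<lambda>n. E n s x)"
      by (rule Cauchy_dist_le) (simp add: dist_norm Ediff flip: scaleR_diff_right)
  qed (simp add: iso)
  then have "\<forall>s x. \<exists>y. (\<lambda>n. E n s x) \<longlonglongrightarrow> y" using Cauchy_convergent unfolding convergent_def by blast
  then obtain U where EU: "\<And>s x. (\<lambda>n. E n s x) \<longlonglongrightarrow> U s x" by metis
  have Un: "norm (U s x) = norm x" for s x
    using LIMSEQ_unique[OF tendsto_norm[OF EU[of s x]]] iso by simp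
  have Uadd: "U s (x + y) = U s x + U s y" for s x y
    using tendsto_add[OF EU[of s x] EU[of s y]] EU[of s "x + y"]
    by (simp add: linear_add[OF linE] LIMSEQ_unique)
  have Usc: "U s (c *\<^sub>C x) = c *\<^sub>C U s x" for s c x
  proof (rule LIMSEQ_unique[OF EU])
    have "E n s (c *\<^sub>C x) = c *\<^sub>C E n s x" for n
      unfolding E_def by (rule bounded_clinear_scaleC[OF opexp_bounded_clinear[OF bA]])
    then show "(\<lambda>n. E n s (c *\<^sub>C x)) \<longlonglongrightarrow> c *\<^sub>C U s x" by (simp, intro tendsto_intros EU)
  qed
  have bU: "bounded_clinear (U s)" for s
    by (rule bounded_clinearI[where K = 1]) (auto simp: Uadd Usc Un)
  have Uplus: "U (s + r) x = U s (U r x)" for s r x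
  proof (rule LIMSEQ_unique[OF EU])
    \<comment> \<open>All \<open>E n s\<close> are isometries, so a null sequence stays null even
      though the operator changes with \<open>n\<close>.\<close>
    have "(\<lambda>n. E n s (E n r x - U r x)) \<longlonglongrightarrow> 0"
      using EU[of r x] by (subst tendsto_norm_zero_iff[symmetric]) (simp add: iso tendsto_norm_zero LIM_zero)
    from tendsto_add[OF this EU[of s "U r x"]]
    show "(\<lambda>n. E n (s + r) x) \<longlonglongrightarrow> U s (U r x)"
      by (simp add: linear_diff[OF linE]) (simp add: E_def opexp_plus)
  qed
  have U0: "U 0 x = x" for x
    using EU[of 0 x] by (simp add: E_def LIMSEQ_const_iff)
  \<comment> \<open>The limit m \<rightarrow> \<infinity> in \<open>Ediff\<close>. The error is
    proportional to |s|, so it survives division by \<open>s\<close>, and the derivative at 0 can be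
    compared with that of a single \<open>E n\<close>.\<close>
  have Unear: "norm (U s x - E n s x) \<le> \<bar>s\<bar> * norm (\<i> *\<^sub>C y - A n x)" if xy: "(x, y) \<in> B" for s x y n
  proof (rule tendsto_le[OF sequentially_bot])
    show "(\<lambda>m. norm (E m s x - E n s x)) \<longlonglongrightarrow> norm (U s x - E n s x)"
      by (intro tendsto_intros EU)
    show "(\<lambda>m. \<bar>s\<bar> * norm (A m x - A n x)) \<longlonglongrightarrow> \<bar>s\<bar> * norm (\<i> *\<^sub>C y - A n x)"
      by (intro tendsto_intros Alim xy)
  qed (simp add: Ediff)
  have Ulip: "norm (U s x - x) \<le> \<bar>s\<bar> * norm y" if xy: "(x, y) \<in> B" for s x y
  proof (rule tendsto_le[OF sequentially_bot])
    show "(\<lambda>m. norm (E m s x - x)) \<longlonglongrightarrow> norm (U s x - x)"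
      by (intro tendsto_intros EU)
    have "(\<lambda>m. \<bar>s\<bar> * norm (A m x)) \<longlonglongrightarrow> \<bar>s\<bar> * norm (\<i> *\<^sub>C y)"
      by (intro tendsto_intros Alim xy)
    then show "(\<lambda>m. \<bar>s\<bar> * norm (A m x)) \<longlonglongrightarrow> \<bar>s\<bar> * norm y" by (simp add: norm_scaleC)
    show "\<forall>\<^sub>F m in sequentially. norm (E m s x - x) \<le> \<bar>s\<bar> * norm (A m x)"
      unfolding E_def using opexp_near_id[OF blA skew] by simp
  qed
  have Ucont0: "((\<lambda>s. U s x) \<longlongrightarrow> x) (at 0)" for x
  proof (rule contractions_tendsto[where T = U and T' = "\<lambda>x. x", OF _ _ _ _ dense])
    fix x assume "x \<in> Domain B"
    then obtain y where y: "(x, y) \<in> B" by blast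
    have "((\<lambda>s. U s x - x) \<longlongrightarrow> 0) (at 0)"
    proof (rule Lim_null_comparison)
      show "\<forall>\<^sub>F s in at 0. norm (U s x - x) \<le> \<bar>s\<bar> * norm y" using Ulip[OF y] by simp
      have "((\<lambda>s. \<bar>s\<bar> * norm y) \<longlongrightarrow> \<bar>0\<bar> * norm y) (at 0)" by (intro tendsto_intros)
      then show "((\<lambda>s. \<bar>s\<bar> * norm y) \<longlongrightarrow> 0) (at 0)" by simp
    qed
    then show "((\<lambda>s. U s x) \<longlongrightarrow> x) (at 0)" by (rule LIM_zero_cancel)
  qed (auto simp: Un bounded_clinear_bl[OF bU] bounded_linear.linear linear_id[unfolded id_def])
  have UG: "unitary_group U"
    by (rule unitary_groupI[OF bU Un Uplus U0 Ucont0])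
  have BG: "B \<subseteq> generator U"
  proof (clarify)
    fix x y assume xy: "(x, y) \<in> B"
    have "((\<lambda>s. norm ((1 / s) *\<^sub>R (U s x - x) - \<i> *\<^sub>C y)) \<longlongrightarrow> 0) (at 0)"
    proof (rule tendstoI)
      fix e :: real assume e: "e > 0"
      obtain n where n: "norm (A n x - \<i> *\<^sub>C y) < e / 3"
        using LIMSEQ_D[OF Alim[OF xy], of "e/3"] e by auto
      have "((\<lambda>s. E n s x) has_vector_derivative opexp (A n) 0 (A n x)) (at 0)"
        unfolding E_def by (rule opexp_derivative[OF blA])
      then have "((\<lambda>s. (1 / s) *\<^sub>R (E n s x - x)) \<longlongrightarrow> A n x) (at 0)"
        by (simp add: has_vector_derivative_at_0 E_def)
      then have "\<forall>\<^sub>F s in at 0. dist ((1 / s) *\<^sub>R (E n s x - x)) (A n x) < e / 3"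
        using e by (intro tendstoD) auto
      moreover have "\<forall>\<^sub>F s in at (0::real). s \<noteq> 0" by (simp add: eventually_at_filter)
      ultimately show "\<forall>\<^sub>F s in at 0. dist (norm ((1 / s) *\<^sub>R (U s x - x) - \<i> *\<^sub>C y)) 0 < e"
      proof eventually_elim
        case (elim s)
        have "norm ((1 / s) *\<^sub>R (U s x - E n s x)) \<le> norm (\<i> *\<^sub>C y - A n x)"
        proof -
          have "norm ((1 / s) *\<^sub>R z) = norm z / \<bar>s\<bar>" for z :: 'a by simp
          then show ?thesis
            using Unear[OF xy, of s n] elim(2) by (simp only:) (simp add: field_simps)
        qed
        moreover have "norm (\<i> *\<^sub>C y - A n x) < e / 3" using n by (simp add: norm_minus_commute)
        moreover have "norm (((1 / s) *\<^sub>R (E n s x - x) - A n x) + (A n x - \<i> *\<^sub>C y)) < e / 3 + e / 3"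
          using elim(1) n by (intro norm_triangle_lt add_strict_mono) (simp add: dist_norm)
        moreover have "norm ((1 / s) *\<^sub>R (U s x - x) - \<i> *\<^sub>C y) \<le> norm ((1 / s) *\<^sub>R (U s x - E n s x)) +
            norm (((1 / s) *\<^sub>R (E n s x - x) - A n x) + (A n x - \<i> *\<^sub>C y))"
        proof -
          have "(1 / s) *\<^sub>R (U s x - x) - \<i> *\<^sub>C y = (1 / s) *\<^sub>R (U s x - E n s x) +
              (((1 / s) *\<^sub>R (E n s x - x) - A n x) + (A n x - \<i> *\<^sub>C y))"
            by (simp add: scaleR_diff_right)
          then show ?thesis by (simp only: norm_triangle_ineq)
        qed
        ultimately have "norm ((1 / s) *\<^sub>R (U s x - x) - \<i> *\<^sub>C y) < e" by linarith
        then show ?case by simp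
      qed
    qed
    then have "((\<lambda>s. (1 / s) *\<^sub>R (U s x - x)) \<longlongrightarrow> \<i> *\<^sub>C y) (at 0)"
      by (simp add: tendsto_norm_zero_iff LIM_zero_iff)
    then show "(x, y) \<in> generator U"
      by (simp add: generator_def has_vector_derivative_at_0 U0)
  qed
  \<comment> \<open>A self-adjoint operator has no proper symmetric extension.\<close>
  have "generator U \<subseteq> B"
  proof (clarify)
    fix x y assume xy: "(x, y) \<in> generator U"
    show "(x, y) \<in> B"
    proof (rule self_adjoint_mem[OF B])
      fix u v assume "(u, v) \<in> B"
      then show "cinner x v = cinner y u" using generator_symmetric[OF UG xy] BG by blast
    qed
  qed
  with UG BG show ?thesis by blast
qed

text \<open>Uniqueness compares \<open>W\<close> with the group that Stone's theorem gives for
  \<open>A\<close>. For a candidate group it is therefore enough that its generator is densely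
  defined and contained in \<open>A\<close>.\<close>

lemma exp_i_eqI:
  fixes A :: "('a::chilbert_space \<times> 'a) set"
  assumes A: "self_adjoint A" and W: "unitary_group W" "generator W \<subseteq> A" "closure (Domain (generator W)) = UNIV"
  shows "exp_i A = W"
proof -
  obtain U where U: "unitary_group U" "generator U = A" using stone_exists[OF A] by blast
  have "U = W" by (rule unitary_group_unique[OF U(1) W(1)]) (use U W in auto)
  have "exp_i A = U"
    unfolding exp_i_def
  proof (rule the_equality)
    fix V assume V: "unitary_group V \<and> generator V = A"
    have "U = V"
      by (rule unitary_group_unique[OF U(1)]) (use U V A in \<open>auto simp: self_adjoint_def\<close>)
    then show "V = U" by simp
  qed (use U in auto)
  with \<open>U = W\<close> show ?thesis by simp
qed

lemma exp_i_group:
  fixes A :: "('a::chilbert_space \<times> 'a) set"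
  assumes A: "self_adjoint A"
  shows "unitary_group (exp_i A)" "generator (exp_i A) = A"
proof -
  obtain U where U: "unitary_group U" "generator U = A" using stone_exists[OF A] by blast
  have "exp_i A = U"
    by (rule exp_i_eqI[OF A U(1)]) (use U A in \<open>auto simp: self_adjoint_def\<close>)
  with U show "unitary_group (exp_i A)" "generator (exp_i A) = A" by auto
qed

section \<open>Vector-valued wave functions\<close>

lemma continuous_measurable_lebesgue:
  "continuous_on UNIV f \<Longrightarrow> f \<in> borel_measurable (lebesgue :: real measure)"
  for f :: "real \<Rightarrow> 'b::{topological_space}"
  by (simp add: borel_measurable_continuous_onI measurable_completion)

lemma borel_measurable_cnj [measurable (raw)]:
  "f \<in> borel_measurable M \<Longrightarrow> (\<lambda>x. cnj (f x)) \<in> borel_measurable M"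
  by (rule borel_measurable_continuous_on[of cnj]) (auto intro!: continuous_intros)

text \<open>Initial segments of an enumeration are cofinal among the finite subsets. One sequence
  serves all families \<open>u\<close>, so unordered sums turn into sequential limits, to which
  dominated convergence applies.\<close>

lemma countable_has_sum_sequence:
  assumes H: "countable H"
  obtains F :: "nat \<Rightarrow> 'h set" where "\<And>n. finite (F n)" "\<And>n. F n \<subseteq> H"
    "\<And>u s. (u has_sum (s :: complex)) H \<Longrightarrow> (\<lambda>n. sum u (F n)) \<longlonglongrightarrow> s"
proof -
  define F where "F n = {h\<in>H. to_nat_on H h < n}" for n
  have inj: "inj_on (to_nat_on H) H" using H by (rule inj_on_to_nat_on)
  have Ffin: "finite (F n)" for n
  proof -
    have "F n = to_nat_on H -` {..<n} \<inter> H" by (auto simp: F_def)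
    then show ?thesis using finite_vimage_IntI[OF finite_lessThan inj] by metis
  qed
  have FH: "F n \<subseteq> H" for n by (auto simp: F_def)
  have lim: "filterlim F (finite_subsets_at_top H) sequentially"
    unfolding filterlim_finite_subsets_at_top
  proof (intro allI impI, elim conjE)
    fix X assume X: "finite X" "X \<subseteq> H"
    define N where "N = Suc (Max (to_nat_on H ` X))"
    have "finite (F n) \<and> X \<subseteq> F n \<and> F n \<subseteq> H" if "n \<ge> N" for n
    proof -
      have "to_nat_on H h < n" if "h \<in> X" for h
      proof -
        have "to_nat_on H h \<le> Max (to_nat_on H ` X)" using X(1) that by (intro Max_ge) auto
        then show ?thesis using \<open>n \<ge> N\<close> by (simp add: N_def)
      qed
      then show ?thesis using Ffin FH X by (auto simp: F_def)
    qed
    then show "\<forall>\<^sub>F n in sequentially. finite (F n) \<and> X \<subseteq> F n \<and> F n \<subseteq> H"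
      unfolding eventually_sequentially by blast
  qed
  have along: "(\<lambda>n. sum u (F n)) \<longlonglongrightarrow> s" if "(u has_sum s) H" for u :: "'h \<Rightarrow> complex" and s
    using filterlim_compose[OF that[unfolded has_sum_def] lim] .
  show ?thesis by (rule that[OF Ffin FH along])
qed

text \<open>Dominated convergence along an exhausting sequence of finite sets. The bound on all
  finite sums of absolute values also makes the integrals absolutely summable, so the sequential
  limit is their unordered sum.\<close>

lemma has_sum_integral:
  fixes f :: "'h \<Rightarrow> 'm \<Rightarrow> complex"
  assumes H: "countable H" and f: "\<And>h. h \<in> H \<Longrightarrow> integrable M (f h)"
    and S: "\<And>x. x \<in> space M \<Longrightarrow> ((\<lambda>h. f h x) has_sum S x) H"
    and g: "integrable M g" "\<And>x F. x \<in> space M \<Longrightarrow> finite F \<Longrightarrow> F \<subseteq> H \<Longrightarrow> (\<Sum>h\<in>F. cmod (f h x)) \<le> g x"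
  shows "integrable M S" "((\<lambda>h. \<integral>x. f h x \<partial>M) has_sum (\<integral>x. S x \<partial>M)) H"
proof -
  obtain F where Ffin: "\<And>n. finite (F n)" and FH: "\<And>n. F n \<subseteq> H"
    and along: "\<And>u s. (u has_sum (s :: complex)) H \<Longrightarrow> (\<lambda>n. sum u (F n)) \<longlonglongrightarrow> s"
    using countable_has_sum_sequence[OF H] by blast
  have ptw: "(\<lambda>n. \<Sum>h\<in>F n. f h x) \<longlonglongrightarrow> S x" if "x \<in> space M" for x
    using along[OF S[OF that]] .
  have fint: "integrable M (\<lambda>x. \<Sum>h\<in>F n. f h x)" for n
    using f FH by (intro Bochner_Integration.integrable_sum) auto
  have Smeas: "S \<in> borel_measurable M"
    by (rule borel_measurable_LIMSEQ_metric[of "\<lambda>n x. \<Sum>h\<in>F n. f h x"])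
      (use fint ptw in auto)
  have dom: "cmod (\<Sum>h\<in>F n. f h x) \<le> g x" if "x \<in> space M" for n x
    using g(2)[OF that Ffin FH] norm_sum[of "\<lambda>h. f h x" "F n"] by (meson order_trans)
  show "integrable M S"
    by (rule integrable_dominated_convergence[where s = "\<lambda>n x. \<Sum>h\<in>F n. f h x" and w = g])
      (use Smeas fint ptw g(1) dom in auto)
  have conv: "(\<lambda>n. \<integral>x. (\<Sum>h\<in>F n. f h x) \<partial>M) \<longlonglongrightarrow> (\<integral>x. S x \<partial>M)"
    by (rule integral_dominated_convergence[where w = g])
      (use Smeas fint ptw g(1) dom in auto)
  have "(\<lambda>h. norm (\<integral>x. f h x \<partial>M)) summable_on H"
  proof (rule nonneg_bdd_above_summable_on)
    have "(\<Sum>h\<in>X. norm (\<integral>x. f h x \<partial>M)) \<le> (\<integral>x. g x \<partial>M)" if X: "X \<subseteq> H" "finite X" for X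
    proof -
      have "(\<Sum>h\<in>X. norm (\<integral>x. f h x \<partial>M)) \<le> (\<Sum>h\<in>X. \<integral>x. norm (f h x) \<partial>M)"
        by (intro sum_mono integral_norm_bound)
      also have "\<dots> = (\<integral>x. (\<Sum>h\<in>X. norm (f h x)) \<partial>M)"
        using f X by (intro Bochner_Integration.integral_sum[symmetric]) auto
      also have "\<dots> \<le> (\<integral>x. g x \<partial>M)"
        using f X g by (intro integral_mono Bochner_Integration.integrable_sum) auto
      finally show ?thesis .
    qed
    then show "bdd_above (sum (\<lambda>h. norm (\<integral>x. f h x \<partial>M)) ` {X. X \<subseteq> H \<and> finite X})"
      by (intro bdd_aboveI2) auto
  qed simp
  then have "(\<lambda>h. \<integral>x. f h x \<partial>M) summable_on H" by (rule abs_summable_summable)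
  then obtain T where T: "((\<lambda>h. \<integral>x. f h x \<partial>M) has_sum T) H"
    unfolding summable_on_def by blast
  have "(\<Sum>h\<in>F n. \<integral>x. f h x \<partial>M) = (\<integral>x. (\<Sum>h\<in>F n. f h x) \<partial>M)" for n
    using f FH by (intro Bochner_Integration.integral_sum[symmetric]) auto
  then have "(\<lambda>n. \<Sum>h\<in>F n. \<integral>x. f h x \<partial>M) \<longlonglongrightarrow> (\<integral>x. S x \<partial>M)" using conv by simp
  with along[OF T] have "T = (\<integral>x. S x \<partial>M)" by (rule LIMSEQ_unique)
  with T show "((\<lambda>h. \<integral>x. f h x \<partial>M) has_sum (\<integral>x. S x \<partial>M)) H" by simp
qed

lemma cinner_some_basis:
  fixes e :: "'a::complex_inner"
  shows
  "e \<in> some_basis \<Longrightarrow> e' \<in> some_basis \<Longrightarrow> cinner e e' = (if e = e' then 1 else 0)"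
  using orthonormal_some_basis[where 'a = 'a] unfolding orthonormal_def by blast

lemma countable_coefficients: "countable {h\<in>some_basis. cinner h x \<noteq> 0}"
  using summable_countable_real[OF bessel_summable[OF orthonormal_some_basis, of x]] by simp

text \<open>A coefficient that is nonzero at one point is nonzero at a nearby rational point, and
  each point has only countably many nonzero coefficients. This stands in for separability: a
  continuous curve lives in a separable subspace.\<close>

lemma countable_coefficients_continuous:
  fixes w :: "real \<Rightarrow> 'a::complex_inner"
  assumes w: "continuous_on UNIV w"
  shows "countable {h\<in>some_basis. \<exists>x. cinner h (w x) \<noteq> 0}"
proof (rule countable_subset)
  show "countable (\<Union>q\<in>\<rat>. {h\<in>some_basis. cinner h (w q) \<noteq> 0})"
    by (intro countable_UN countable_rat countable_coefficients)
  show "{h\<in>some_basis. \<exists>x. cinner h (w x) \<noteq> 0} \<subseteq> (\<Union>q\<in>\<rat>. {h\<in>some_basis. cinner h (w q) \<noteq> 0})"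
  proof
    fix h assume "h \<in> {h\<in>some_basis. \<exists>x. cinner h (w x) \<noteq> 0}"
    then obtain x where h: "h \<in> some_basis" "cinner h (w x) \<noteq> 0" by blast
    have "open {x. cinner h (w x) \<noteq> 0}"
      by (intro open_Collect_neq continuous_intros w)
    then obtain e where e: "e > 0" "\<And>y. dist y x < e \<Longrightarrow> cinner h (w y) \<noteq> 0"
      using h(2) unfolding open_dist by blast
    obtain q where "q \<in> \<rat>" "x < q" "q < x + e"
      using Rats_dense_in_real[of x "x + e"] e(1) by auto
    then have "cinner h (w q) \<noteq> 0" by (intro e(2)) (simp add: dist_real_def)
    then show "h \<in> (\<Union>q\<in>\<rat>. {h\<in>some_basis. cinner h (w q) \<noteq> 0})" using h(1) \<open>q \<in> \<rat>\<close> by blast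
  qed
qed

text \<open>Parseval at every point, with the Cauchy-Schwarz and Bessel bound as dominating
  function. Directions outside the countable set met by \<open>w'\<close> contribute 0, which allows
  the sum to range over a basis of any cardinality.\<close>

lemma parseval_integral:
  fixes w w' :: "real \<Rightarrow> 'a::chilbert_space"
  assumes w: "continuous_on UNIV w" and w': "continuous_on UNIV w'"
    and G: "G \<in> borel_measurable lebesgue" "integrable lebesgue (\<lambda>x. cmod (G x) * (norm (w x) * norm (w' x)))"
  shows "((\<lambda>h. \<integral>x. G x * (cinner (w x) h * cinner h (w' x)) \<partial>lebesgue) has_sum
      (\<integral>x. G x * cinner (w x) (w' x) \<partial>lebesgue)) some_basis"
proof -
  define H where "H = {h\<in>some_basis. \<exists>x. cinner h (w' x) \<noteq> 0}"
  have H: "countable H" "H \<subseteq> some_basis"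
    unfolding H_def by (rule countable_coefficients_continuous[OF w']) auto
  have out: "cinner h (w' x) = 0" if "h \<in> some_basis - H" for h x
    using that by (auto simp: H_def)
  have meas: "(\<lambda>x. cinner (w x) h) \<in> borel_measurable lebesgue" "(\<lambda>x. cinner h (w' x)) \<in> borel_measurable lebesgue" for h
    by (intro continuous_measurable_lebesgue continuous_intros w w')+
  have bd: "(\<Sum>h\<in>F. cmod (G x * (cinner (w x) h * cinner h (w' x)))) \<le> cmod (G x) * (norm (w x) * norm (w' x))"
    if F: "finite F" "F \<subseteq> some_basis" for F x
  proof -
    have "(\<Sum>h\<in>F. cmod (G x * (cinner (w x) h * cinner h (w' x))))
        = cmod (G x) * (\<Sum>h\<in>F. cmod (cinner (w x) h * cinner h (w' x)))"
      by (simp add: norm_mult sum_distrib_left)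
    also have "\<dots> \<le> cmod (G x) * (norm (w' x) * norm (w x))"
      by (intro mult_left_mono rank_one_partial_trace orthonormal_subset[OF orthonormal_some_basis] F) simp
    finally show ?thesis by (simp add: mult.commute)
  qed
  have "((\<lambda>h. \<integral>x. G x * (cinner (w x) h * cinner h (w' x)) \<partial>lebesgue) has_sum
      (\<integral>x. G x * cinner (w x) (w' x) \<partial>lebesgue)) H"
  proof (rule has_sum_integral(2)[OF H(1)])
    show "integrable lebesgue (\<lambda>x. G x * (cinner (w x) h * cinner h (w' x)))" if "h \<in> H" for h
    proof (rule Bochner_Integration.integrable_bound[OF G(2)])
      show "AE x in lebesgue. norm (G x * (cinner (w x) h * cinner h (w' x)))
          \<le> norm (cmod (G x) * (norm (w x) * norm (w' x)))"
        using bd[of "{h}"] that H(2) by auto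
    qed (use meas G(1) in measurable)
    show "((\<lambda>h. G x * (cinner (w x) h * cinner h (w' x))) has_sum G x * cinner (w x) (w' x)) H" for x
    proof (rule has_sum_cmult_right)
      have "((\<lambda>h. cinner (w x) h * cinner h (w' x)) has_sum cinner (w x) (w' x)) some_basis \<longleftrightarrow>
          ((\<lambda>h. cinner (w x) h * cinner h (w' x)) has_sum cinner (w x) (w' x)) H"
        by (rule has_sum_cong_neutral) (use out H(2) in auto)
      with parseval show "((\<lambda>h. cinner (w x) h * cinner h (w' x)) has_sum cinner (w x) (w' x)) H" by blast
    qed
    show "(\<Sum>h\<in>F. cmod (G x * (cinner (w x) h * cinner h (w' x)))) \<le> cmod (G x) * (norm (w x) * norm (w' x))"
      if "finite F" "F \<subseteq> H" for F x
      using bd that H(2) by blast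
  qed (rule G(2))
  moreover have "((\<lambda>h. \<integral>x. G x * (cinner (w x) h * cinner h (w' x)) \<partial>lebesgue) has_sum
      (\<integral>x. G x * cinner (w x) (w' x) \<partial>lebesgue)) some_basis \<longleftrightarrow>
      ((\<lambda>h. \<integral>x. G x * (cinner (w x) h * cinner h (w' x)) \<partial>lebesgue) has_sum
      (\<integral>x. G x * cinner (w x) (w' x) \<partial>lebesgue)) H"
    by (rule has_sum_cong_neutral) (use out H(2) in auto)
  ultimately show ?thesis by blast
qed

section \<open>Multiplication on the space of wave functions\<close>

definition l2_mult :: "(real \<Rightarrow> complex) \<Rightarrow> l2 \<Rightarrow> l2" where
  "l2_mult g f = l2_of (\<lambda>x. g x * l2_fun f x)"

lemma l2_fun_mult:
  "square_integrable (\<lambda>x. g x * l2_fun f x) \<Longrightarrow> AE x in lebesgue. l2_fun (l2_mult g f) x = g x * l2_fun f x"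
  unfolding l2_mult_def by (rule l2_fun_l2_of)

lemma cinner_l2_mult:
  assumes "square_integrable (\<lambda>x. a x * l2_fun f x)" "square_integrable (\<lambda>x. b x * l2_fun g x)"
  shows "cinner (l2_mult a f) (l2_mult b g)
    = (\<integral>x. (cnj (l2_fun f x) * l2_fun g x) * (cnj (a x) * b x) \<partial>lebesgue)"
proof -
  have m: "(\<lambda>x. a x * l2_fun f x) \<in> borel_measurable lebesgue" "(\<lambda>x. b x * l2_fun g x) \<in> borel_measurable lebesgue"
    using assms by (auto simp: square_integrable_def)
  have "cinner (l2_mult a f) (l2_mult b g) = (\<integral>x. cnj (a x * l2_fun f x) * (b x * l2_fun g x) \<partial>lebesgue)"
    unfolding cinner_l2_def
  proof (rule integral_cong_AE)
    show "(\<lambda>x. cnj (a x * l2_fun f x) * (b x * l2_fun g x)) \<in> borel_measurable lebesgue"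
      by (intro borel_measurable_times borel_measurable_cnj m)
    show "AE x in lebesgue. cnj (l2_fun (l2_mult a f) x) * l2_fun (l2_mult b g) x
        = cnj (a x * l2_fun f x) * (b x * l2_fun g x)"
      using l2_fun_mult[OF assms(1)] l2_fun_mult[OF assms(2)] by eventually_elim simp
  qed (use cinner_l2_integrable in \<open>rule borel_measurable_integrable\<close>)
  then show ?thesis by (simp add: mult_ac)
qed

lemma l2_mult_one [simp]: "l2_mult (\<lambda>x. 1) f = f"
  by (simp add: l2_mult_def l2_of_l2_fun)

text \<open>Continuity makes the coefficients of \<open>w\<close> measurable and all but countably
  many of them zero; integrability makes x \<mapsto> f(x) w(x) a square-integrable field. Unbounded
  fields such as \<open>x *\<^sub>R y\<close> occur when the evolution is differentiated.\<close>

definition admissible :: "l2 \<Rightarrow> (real \<Rightarrow> 'a::complex_inner) \<Rightarrow> bool" where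
  "admissible f w \<longleftrightarrow> continuous_on UNIV w \<and> integrable lebesgue (\<lambda>x. (norm (w x) * cmod (l2_fun f x))\<^sup>2)"

lemma l2_fun_integrable: "integrable lebesgue (\<lambda>x. (cmod (l2_fun f x))\<^sup>2)"
  using l2_fun_square_integrable[of f] by (simp add: square_integrable_def)

lemma admissible_bounded:
  assumes w: "continuous_on UNIV w" and bound: "\<And>x. norm (w x) \<le> C"
  shows "admissible f w"
  unfolding admissible_def
proof (intro conjI w)
  have [measurable]: "(\<lambda>x. norm (w x)) \<in> borel_measurable lebesgue"
    by (intro continuous_measurable_lebesgue continuous_intros w)
  show "integrable lebesgue (\<lambda>x. (norm (w x) * cmod (l2_fun f x))\<^sup>2)"
  proof (rule Bochner_Integration.integrable_bound)
    show "integrable lebesgue (\<lambda>x. C\<^sup>2 * (cmod (l2_fun f x))\<^sup>2)" using l2_fun_integrable by simp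
    have "(norm (w x))\<^sup>2 * (cmod (l2_fun f x))\<^sup>2 \<le> C\<^sup>2 * (cmod (l2_fun f x))\<^sup>2" for x
      by (intro mult_right_mono power_mono bound) auto
    then show "AE x in lebesgue. norm ((norm (w x) * cmod (l2_fun f x))\<^sup>2) \<le> norm (C\<^sup>2 * (cmod (l2_fun f x))\<^sup>2)"
      by (simp add: power_mult_distrib)
  qed measurable
qed

lemma admissible_const: "admissible f (\<lambda>x. b)"
  by (rule admissible_bounded[of _ "norm b"]) auto

lemma admissible_diff:
  assumes "admissible f w" "admissible f w'"
  shows "admissible f (\<lambda>x. w x - w' x)"
  unfolding admissible_def
proof
  have w: "continuous_on UNIV w" "continuous_on UNIV w'" using assms by (auto simp: admissible_def)
  then show "continuous_on UNIV (\<lambda>x. w x - w' x)" by (intro continuous_intros)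
  have [measurable]: "(\<lambda>x. norm (w x - w' x)) \<in> borel_measurable lebesgue"
    by (intro continuous_measurable_lebesgue continuous_intros w)
  show "integrable lebesgue (\<lambda>x. (norm (w x - w' x) * cmod (l2_fun f x))\<^sup>2)"
  proof (rule Bochner_Integration.integrable_bound)
    show "integrable lebesgue (\<lambda>x. 2 * (norm (w x) * cmod (l2_fun f x))\<^sup>2 + 2 * (norm (w' x) * cmod (l2_fun f x))\<^sup>2)"
      using assms by (simp add: admissible_def)
    have "(norm (w x - w' x) * c)\<^sup>2 \<le> 2 * (norm (w x) * c)\<^sup>2 + 2 * (norm (w' x) * c)\<^sup>2" for x c
    proof -
      have "(norm (w x - w' x))\<^sup>2 \<le> (norm (w x) + norm (w' x))\<^sup>2"
        by (intro power_mono norm_triangle_ineq4) simp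
      also have "\<dots> \<le> 2 * (norm (w x))\<^sup>2 + 2 * (norm (w' x))\<^sup>2"
        using sum_squares_bound[of "norm (w x)" "norm (w' x)"] by (simp add: power2_sum)
      finally have "(norm (w x - w' x))\<^sup>2 * c\<^sup>2 \<le> (2 * (norm (w x))\<^sup>2 + 2 * (norm (w' x))\<^sup>2) * c\<^sup>2"
        by (intro mult_right_mono) auto
      then show ?thesis by (simp add: power_mult_distrib algebra_simps)
    qed
    then show "AE x in lebesgue. norm ((norm (w x - w' x) * cmod (l2_fun f x))\<^sup>2)
        \<le> norm (2 * (norm (w x) * cmod (l2_fun f x))\<^sup>2 + 2 * (norm (w' x) * cmod (l2_fun f x))\<^sup>2)"
      by simp
  qed measurable
qed

lemma admissible_cong_norm:
  assumes "admissible f w" "continuous_on UNIV w'" "\<And>x. norm (w' x) \<le> norm (w x)"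
  shows "admissible f w'"
  unfolding admissible_def
proof (intro conjI assms(2))
  have [measurable]: "(\<lambda>x. norm (w' x)) \<in> borel_measurable lebesgue"
    by (intro continuous_measurable_lebesgue continuous_intros assms)
  show "integrable lebesgue (\<lambda>x. (norm (w' x) * cmod (l2_fun f x))\<^sup>2)"
  proof (rule Bochner_Integration.integrable_bound)
    show "integrable lebesgue (\<lambda>x. (norm (w x) * cmod (l2_fun f x))\<^sup>2)"
      using assms by (simp add: admissible_def)
    show "AE x in lebesgue. norm ((norm (w' x) * cmod (l2_fun f x))\<^sup>2) \<le> norm ((norm (w x) * cmod (l2_fun f x))\<^sup>2)"
      by (auto intro!: power_mono mult_right_mono assms)
  qed measurable
qed

lemma admissible_square_integrable:
  assumes "admissible f w"
  shows "square_integrable (\<lambda>x. cinner h (w x) * l2_fun f x)"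
  unfolding square_integrable_def
proof
  have w: "continuous_on UNIV w" using assms by (simp add: admissible_def)
  have [measurable]: "(\<lambda>x. cinner h (w x)) \<in> borel_measurable lebesgue"
    by (intro continuous_measurable_lebesgue continuous_intros w)
  show "(\<lambda>x. cinner h (w x) * l2_fun f x) \<in> borel_measurable lebesgue" by measurable
  show "integrable lebesgue (\<lambda>x. (cmod (cinner h (w x) * l2_fun f x))\<^sup>2)"
  proof (rule Bochner_Integration.integrable_bound)
    show "integrable lebesgue (\<lambda>x. (norm h)\<^sup>2 * (norm (w x) * cmod (l2_fun f x))\<^sup>2)"
      using assms by (simp add: admissible_def)
    have "(cmod (cinner h (w x) * l2_fun f x))\<^sup>2 \<le> (norm h * norm (w x) * cmod (l2_fun f x))\<^sup>2" for x
      unfolding norm_mult by (intro power_mono mult_right_mono cmod_cinner_le) auto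
    then show "AE x in lebesgue. norm ((cmod (cinner h (w x) * l2_fun f x))\<^sup>2)
        \<le> norm ((norm h)\<^sup>2 * (norm (w x) * cmod (l2_fun f x))\<^sup>2)"
      by (simp add: power_mult_distrib mult.assoc)
  qed measurable
qed

lemma admissible_product_integrable:
  assumes "admissible f w" "admissible g w'"
  shows "integrable lebesgue (\<lambda>x. cmod (cnj (l2_fun f x) * l2_fun g x) * (norm (w x) * norm (w' x)))"
proof (rule Bochner_Integration.integrable_bound)
  have [measurable]: "(\<lambda>x. norm (w x)) \<in> borel_measurable lebesgue" "(\<lambda>x. norm (w' x)) \<in> borel_measurable lebesgue"
    using assms unfolding admissible_def by (auto intro!: continuous_measurable_lebesgue continuous_intros)
  show "(\<lambda>x. cmod (cnj (l2_fun f x) * l2_fun g x) * (norm (w x) * norm (w' x))) \<in> borel_measurable lebesgue"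
    by measurable
  show "integrable lebesgue (\<lambda>x. (norm (w x) * cmod (l2_fun f x))\<^sup>2 + (norm (w' x) * cmod (l2_fun g x))\<^sup>2)"
    using assms by (simp add: admissible_def)
  have "cmod a * cmod b * (s * r) \<le> (s * cmod a)\<^sup>2 + (r * cmod b)\<^sup>2" if "s \<ge> 0" "r \<ge> 0" for a b s r
  proof -
    have "0 \<le> cmod a * cmod b * (s * r)" using that by simp
    then show ?thesis using sum_squares_bound[of "s * cmod a" "r * cmod b"] by (simp add: mult_ac)
  qed
  then show "AE x in lebesgue. norm (cmod (cnj (l2_fun f x) * l2_fun g x) * (norm (w x) * norm (w' x)))
      \<le> norm ((norm (w x) * cmod (l2_fun f x))\<^sup>2 + (norm (w' x) * cmod (l2_fun g x))\<^sup>2)"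
    by (simp add: norm_mult)
qed

section \<open>Waves in the tensor product\<close>

locale hilbert_tensor_product =
  fixes ten :: "l2 \<Rightarrow> 'e::chilbert_space \<Rightarrow> 'k::chilbert_space"
  assumes ten: "hilbert_tensor ten"
begin

lemma ten_add_left: "ten (x + x') y = ten x y + ten x' y"
  and ten_add_right: "ten x (y + y') = ten x y + ten x y'"
  and ten_scaleC_left: "ten (c *\<^sub>C x) y = c *\<^sub>C ten x y"
  and ten_scaleC_right: "ten x (c *\<^sub>C y) = c *\<^sub>C ten x y"
  and cinner_ten: "cinner (ten x y) (ten x' y') = cinner x x' * cinner y y'"
  and ten_dense: "closure (span {ten x y |x y. True}) = UNIV"
  using ten unfolding hilbert_tensor_def by blast+

lemma norm_ten: "norm (ten f b) = norm f * norm b"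
proof -
  have "complex_of_real ((norm (ten f b))\<^sup>2) = complex_of_real ((norm f * norm b)\<^sup>2)"
    using cinner_ten[of f b f b] unfolding cinner_self by (simp add: power_mult_distrib)
  then have "(norm (ten f b))\<^sup>2 = (norm f * norm b)\<^sup>2" by (simp only: of_real_eq_iff)
  then show ?thesis by (rule power2_eq_imp_eq) auto
qed

lemma ten_left_clinear: "bounded_clinear (\<lambda>f. ten f b)"
  by (rule bounded_clinearI[where K = "norm b"]) (simp_all add: ten_add_left ten_scaleC_left norm_ten mult.commute)

lemma ten_right_clinear: "bounded_clinear (\<lambda>b. ten f b)"
  by (rule bounded_clinearI[where K = "norm f"]) (simp_all add: ten_add_right ten_scaleC_right norm_ten)

lemma ten_eqI:
  assumes "\<And>x y. cinner (ten x y) u = cinner (ten x y) v"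
  shows "u = v"
proof -
  have "z \<in> {z. cinner z (u - v) = 0}" if "z \<in> span {ten x y |x y. True}" for z
    using that by (induction rule: span_induct_alt)
      (auto simp: cinner_add_left cinner_scaleR_left cinner_diff_right assms)
  then have "closure (span {ten x y |x y. True}) \<subseteq> {z. cinner z (u - v) = 0}"
    by (intro closure_minimal closed_Collect_eq continuous_intros) auto
  then have "cinner (u - v) (u - v) = 0" unfolding ten_dense by blast
  then show ?thesis by (simp add: cinner_eq_zero_iff)
qed

lemma ten_op_eqI:
  assumes "bounded_clinear C" "bounded_clinear D" "\<And>x y. C (ten x y) = D (ten x y)"
  shows "C = D"
proof
  fix v
  have "z \<in> {z. C z = D z}" if "z \<in> span {ten x y |x y. True}" for z
    using that by (induction rule: span_induct_alt)
      (auto simp: bounded_clinear_add bounded_clinear_scaleR bounded_clinear_zero assms)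
  then have "closure (span {ten x y |x y. True}) \<subseteq> {z. C z = D z}"
    by (intro closure_minimal closed_Collect_eq bounded_clinear_continuous_on assms) auto
  then show "C v = D v" unfolding ten_dense by blast
qed

text \<open>The field x \<mapsto> f(x) w(x) with values in the environment space, seen as a vector
  of the tensor product. The tensor product is an abstract model without underlying functions, so
  the field is assembled from its coefficients in a basis.\<close>

definition wave :: "l2 \<Rightarrow> (real \<Rightarrow> 'e) \<Rightarrow> 'k" where
  "wave f w = (\<Sum>\<^sub>\<infinity>h\<in>some_basis. ten (l2_mult (\<lambda>x. cinner h (w x)) f) h)"

text \<open>The summands are mutually orthogonal, and by Parseval under the integral their squared
  norms add up to the integral of |f|^2 |w|^2.\<close>

lemma wave_has_sum:
  assumes "admissible f w"
  shows "((\<lambda>h. ten (l2_mult (\<lambda>x. cinner h (w x)) f) h) has_sum wave f w) some_basis"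
proof -
  let ?m = "\<lambda>h. l2_mult (\<lambda>x. cinner h (w x)) f"
  have w: "continuous_on UNIV w" using assms by (simp add: admissible_def)
  have "(\<lambda>h. ten (?m h) h) summable_on some_basis"
  proof (rule summable_on_orthogonal)
    show "cinner (ten (?m h) h) (ten (?m h') h') = 0" if "h \<in> some_basis" "h' \<in> some_basis" "h \<noteq> h'" for h h'
    proof -
      have "cinner h h' = 0" using that by (simp add: cinner_some_basis)
      then show ?thesis by (simp add: cinner_ten)
    qed
    have eq: "complex_of_real ((norm (ten (?m h) h))\<^sup>2) =
        (\<integral>x. (cnj (l2_fun f x) * l2_fun f x) * (cinner (w x) h * cinner h (w x)) \<partial>lebesgue)"
      if "h \<in> some_basis" for h
    proof -
      have "cinner h h = 1" using that by (simp add: cinner_some_basis)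
      then have "complex_of_real ((norm (ten (?m h) h))\<^sup>2) = cinner (?m h) (?m h)"
        unfolding cinner_self[symmetric] cinner_ten by simp
      also have "\<dots> = (\<integral>x. (cnj (l2_fun f x) * l2_fun f x) * (cinner (w x) h * cinner h (w x)) \<partial>lebesgue)"
        unfolding cinner_l2_mult[OF admissible_square_integrable[OF assms] admissible_square_integrable[OF assms]]
        by (simp flip: cinner_commute)
      finally show ?thesis .
    qed
    have "(\<lambda>h. \<integral>x. (cnj (l2_fun f x) * l2_fun f x) * (cinner (w x) h * cinner h (w x)) \<partial>lebesgue) summable_on some_basis"
      using parseval_integral[OF w w _ admissible_product_integrable[OF assms assms]]
      by (intro has_sum_imp_summable) auto
    then have "(\<lambda>h. complex_of_real ((norm (ten (?m h) h))\<^sup>2)) summable_on some_basis"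
      by (subst summable_on_cong[OF eq]) auto
    then show "(\<lambda>h. (norm (ten (?m h) h))\<^sup>2) summable_on some_basis"
      using summable_on_Re[of "\<lambda>h. complex_of_real ((norm (ten (?m h) h))\<^sup>2)" some_basis]
      by (simp only: Re_complex_of_real)
  qed
  then show ?thesis unfolding wave_def by (rule has_sum_infsum)
qed

text \<open>The right-hand side does not mention the basis. Together with \<open>ten_eqI\<close>
  this is the working characterisation of a wave.\<close>

lemma cinner_ten_wave:
  assumes "admissible f w"
  shows "cinner (ten g c) (wave f w) = (\<integral>x. (cnj (l2_fun g x) * l2_fun f x) * cinner c (w x) \<partial>lebesgue)"
proof (rule has_sum_unique)
  have w: "continuous_on UNIV w" using assms by (simp add: admissible_def)
  show "((\<lambda>h. cinner (ten g c) (ten (l2_mult (\<lambda>x. cinner h (w x)) f) h)) has_sum cinner (ten g c) (wave f w)) some_basis"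
    by (rule has_sum_cinner_right) (rule wave_has_sum[OF assms])
  have "cinner (ten g c) (ten (l2_mult (\<lambda>x. cinner h (w x)) f) h)
      = (\<integral>x. (cnj (l2_fun g x) * l2_fun f x) * (cinner c h * cinner h (w x)) \<partial>lebesgue)" for h
  proof -
    have "cinner g (l2_mult (\<lambda>x. cinner h (w x)) f)
        = (\<integral>x. (cnj (l2_fun g x) * l2_fun f x) * cinner h (w x) \<partial>lebesgue)"
      using cinner_l2_mult[OF _ admissible_square_integrable[OF assms], of "\<lambda>x. 1" g] l2_fun_square_integrable[of g]
      by simp
    then show ?thesis
      unfolding cinner_ten by (simp add: mult_ac flip: integral_mult_right_zero)
  qed
  then show "((\<lambda>h. cinner (ten g c) (ten (l2_mult (\<lambda>x. cinner h (w x)) f) h)) has_sum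
      (\<integral>x. (cnj (l2_fun g x) * l2_fun f x) * cinner c (w x) \<partial>lebesgue)) some_basis"
    using parseval_integral[OF continuous_on_const w _ admissible_product_integrable[OF admissible_const assms]]
    by simp
qed

lemma cinner_wave_wave:
  assumes f: "admissible f w" and g: "admissible g w'"
  shows "cinner (wave f w) (wave g w') = (\<integral>x. (cnj (l2_fun f x) * l2_fun g x) * cinner (w x) (w' x) \<partial>lebesgue)"
proof (rule has_sum_unique)
  have w: "continuous_on UNIV w" "continuous_on UNIV w'" using assms by (auto simp: admissible_def)
  show "((\<lambda>h. cinner (wave f w) (ten (l2_mult (\<lambda>x. cinner h (w' x)) g) h)) has_sum cinner (wave f w) (wave g w')) some_basis"
    by (rule has_sum_cinner_right) (rule wave_has_sum[OF g])
  have "cinner (wave f w) (ten (l2_mult (\<lambda>x. cinner h (w' x)) g) h)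
      = (\<integral>x. (cnj (l2_fun f x) * l2_fun g x) * (cinner (w x) h * cinner h (w' x)) \<partial>lebesgue)" (is "?L = _") for h
  proof -
    let ?m = "l2_mult (\<lambda>x. cinner h (w' x)) g"
    have [measurable]: "(\<lambda>x. cinner h (w x)) \<in> borel_measurable lebesgue" "(\<lambda>x. cinner h (w' x)) \<in> borel_measurable lebesgue"
      by (intro continuous_measurable_lebesgue continuous_intros w)+
    have "?L = cnj (cinner (ten ?m h) (wave f w))" by (rule cinner_commute)
    also have "\<dots> = (\<integral>x. cnj ((cnj (l2_fun ?m x) * l2_fun f x) * cinner h (w x)) \<partial>lebesgue)"
      unfolding cinner_ten_wave[OF f] by (rule Bochner_Integration.integral_cnj[symmetric])
    also have "\<dots> = (\<integral>x. (cnj (l2_fun f x) * l2_fun g x) * (cnj (cinner h (w x)) * cinner h (w' x)) \<partial>lebesgue)"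
    proof (rule integral_cong_AE)
      show "AE x in lebesgue. cnj ((cnj (l2_fun ?m x) * l2_fun f x) * cinner h (w x))
          = (cnj (l2_fun f x) * l2_fun g x) * (cnj (cinner h (w x)) * cinner h (w' x))"
        using l2_fun_mult[OF admissible_square_integrable[OF g], of h] by eventually_elim simp
    qed measurable
    finally show ?thesis by (simp flip: cinner_commute)
  qed
  then show "((\<lambda>h. cinner (wave f w) (ten (l2_mult (\<lambda>x. cinner h (w' x)) g) h)) has_sum
      (\<integral>x. (cnj (l2_fun f x) * l2_fun g x) * cinner (w x) (w' x) \<partial>lebesgue)) some_basis"
    using parseval_integral[OF w _ admissible_product_integrable[OF f g]] by simp
qed

lemma norm_wave:
  assumes "admissible f w"
  shows "(norm (wave f w))\<^sup>2 = (\<integral>x. (cmod (l2_fun f x))\<^sup>2 * (norm (w x))\<^sup>2 \<partial>lebesgue)"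
proof -
  have "complex_of_real ((norm (wave f w))\<^sup>2) = (\<integral>x. (cnj (l2_fun f x) * l2_fun f x) * cinner (w x) (w x) \<partial>lebesgue)"
    unfolding cinner_self[symmetric] by (rule cinner_wave_wave[OF assms assms])
  also have "\<dots> = (\<integral>x. complex_of_real ((cmod (l2_fun f x))\<^sup>2 * (norm (w x))\<^sup>2) \<partial>lebesgue)"
    by (simp add: cinner_self complex_norm_square mult.commute flip: of_real_power)
  also have "\<dots> = complex_of_real (\<integral>x. (cmod (l2_fun f x))\<^sup>2 * (norm (w x))\<^sup>2 \<partial>lebesgue)"
    by (rule integral_complex_of_real)
  finally show ?thesis by (simp only: of_real_eq_iff)
qed

lemma wave_const: "wave f (\<lambda>x. b) = ten f b"
  by (rule ten_eqI) (simp add: cinner_ten_wave admissible_const cinner_ten cinner_l2_def)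

lemma wave_diff:
  assumes "admissible f w" "admissible f w'"
  shows "wave f (\<lambda>x. w x - w' x) = wave f w - wave f w'"
proof (rule ten_eqI)
  fix g :: l2 and c :: 'e
  have int: "integrable lebesgue (\<lambda>x. (cnj (l2_fun g x) * l2_fun f x) * cinner c (v x))" if v: "admissible f v" for v
  proof (rule Bochner_Integration.integrable_bound[OF admissible_product_integrable[OF admissible_const[of g c] v]])
    have [measurable]: "(\<lambda>x. cinner c (v x)) \<in> borel_measurable lebesgue"
      using v unfolding admissible_def by (intro continuous_measurable_lebesgue continuous_intros) auto
    show "(\<lambda>x. (cnj (l2_fun g x) * l2_fun f x) * cinner c (v x)) \<in> borel_measurable lebesgue" by measurable
    show "AE x in lebesgue. norm ((cnj (l2_fun g x) * l2_fun f x) * cinner c (v x))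
        \<le> norm (cmod (cnj (l2_fun g x) * l2_fun f x) * (norm c * norm (v x)))"
      using cmod_cinner_le[of c] by (auto simp: norm_mult intro!: mult_left_mono)
  qed
  show "cinner (ten g c) (wave f (\<lambda>x. w x - w' x)) = cinner (ten g c) (wave f w - wave f w')"
    unfolding cinner_diff_right cinner_ten_wave[OF admissible_diff[OF assms]] cinner_ten_wave[OF assms(1)] cinner_ten_wave[OF assms(2)]
    by (simp add: cinner_diff_right right_diff_distrib int assms)
qed

end

section \<open>The evolution generated by position coupling\<close>

definition bounded_multiplier :: "(real \<Rightarrow> complex) \<Rightarrow> bool" where
  "bounded_multiplier k \<longleftrightarrow> k \<in> borel_measurable lebesgue \<and> (\<exists>K. \<forall>x. cmod (k x) \<le> K)"

lemma bounded_multiplier_square_integrable: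
  assumes "bounded_multiplier k" "square_integrable f"
  shows "square_integrable (\<lambda>x. k x * f x)"
proof -
  obtain K where K: "\<And>x. cmod (k x) \<le> K" and [measurable]: "k \<in> borel_measurable lebesgue"
    using assms by (auto simp: bounded_multiplier_def)
  have [measurable]: "f \<in> borel_measurable lebesgue" using assms by (simp add: square_integrable_def)
  have "integrable lebesgue (\<lambda>x. (cmod (k x * f x))\<^sup>2)"
  proof (rule Bochner_Integration.integrable_bound)
    show "integrable lebesgue (\<lambda>x. K\<^sup>2 * (cmod (f x))\<^sup>2)" using assms by (simp add: square_integrable_def)
    have "(cmod (k x * f x))\<^sup>2 \<le> K\<^sup>2 * (cmod (f x))\<^sup>2" for x
      unfolding norm_mult power_mult_distrib by (intro mult_right_mono power_mono K) auto
    then show "AE x in lebesgue. norm ((cmod (k x * f x))\<^sup>2) \<le> norm (K\<^sup>2 * (cmod (f x))\<^sup>2)" by simp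
  qed measurable
  then show ?thesis by (simp add: square_integrable_def)
qed

lemma l2_fun_bounded_mult:
  "bounded_multiplier k \<Longrightarrow> AE x in lebesgue. l2_fun (l2_mult k f) x = k x * l2_fun f x"
  by (intro l2_fun_mult bounded_multiplier_square_integrable l2_fun_square_integrable)

lemma norm_l2_mult_le:
  assumes k: "bounded_multiplier k" and K: "\<And>x. cmod (k x) \<le> K" "K \<ge> 0"
  shows "norm (l2_mult k f) \<le> K * norm f"
proof (rule power2_le_imp_le)
  have [measurable]: "k \<in> borel_measurable lebesgue" using k by (simp add: bounded_multiplier_def)
  have "(norm (l2_mult k f))\<^sup>2 = (\<integral>x. (cmod (k x * l2_fun f x))\<^sup>2 \<partial>lebesgue)"
    unfolding norm_l2_power2
  proof (rule integral_cong_AE)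
    show "AE x in lebesgue. (cmod (l2_fun (l2_mult k f) x))\<^sup>2 = (cmod (k x * l2_fun f x))\<^sup>2"
      using l2_fun_bounded_mult[OF k, of f] by eventually_elim simp
  qed measurable
  also have "\<dots> \<le> (\<integral>x. K\<^sup>2 * (cmod (l2_fun f x))\<^sup>2 \<partial>lebesgue)"
  proof (rule integral_mono)
    show "integrable lebesgue (\<lambda>x. (cmod (k x * l2_fun f x))\<^sup>2)"
      using bounded_multiplier_square_integrable[OF k l2_fun_square_integrable]
      by (simp add: square_integrable_def)
    show "(cmod (k x * l2_fun f x))\<^sup>2 \<le> K\<^sup>2 * (cmod (l2_fun f x))\<^sup>2" for x
      unfolding norm_mult power_mult_distrib by (intro mult_right_mono power_mono K) auto
  qed (use l2_fun_integrable in simp)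
  finally show "(norm (l2_mult k f))\<^sup>2 \<le> (K * norm f)\<^sup>2"
    by (simp add: norm_l2_power2 power_mult_distrib)
qed (use K in simp)

lemma l2_eqI_mult:
  assumes "AE x in lebesgue. l2_fun f x = g x" "AE x in lebesgue. l2_fun f' x = g x"
  shows "f = f'"
  unfolding l2_eq_iff using assms by eventually_elim simp

text \<open>Strong continuity alone controls a fixed vector; the variation of \<open>w\<close> is
  controlled because the group acts by isometries, uniformly in its parameter.\<close>

lemma unitary_action_continuous:
  fixes U :: "real \<Rightarrow> 'a::chilbert_space \<Rightarrow> 'a"
  assumes U: "unitary_group U" and w: "continuous_on UNIV w"
  shows "continuous_on UNIV (\<lambda>x. U (s * x) (w x))"
proof (rule continuous_at_imp_continuous_on, intro ballI)
  fix x :: real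
  have "((\<lambda>y. U (s * y) (w y - w x)) \<longlongrightarrow> 0) (at x)"
  proof (subst tendsto_norm_zero_iff[symmetric])
    have "(w \<longlongrightarrow> w x) (at x)" using w by (simp add: continuous_on_def)
    then have "((\<lambda>y. norm (w y - w x)) \<longlongrightarrow> 0) (at x)"
      by (intro tendsto_norm_zero LIM_zero)
    then show "((\<lambda>y. norm (U (s * y) (w y - w x))) \<longlongrightarrow> 0) (at x)"
      by (simp add: unitary_group_norm[OF U])
  qed
  moreover have "((\<lambda>y. U (s * y) (w x)) \<longlongrightarrow> U (s * x) (w x)) (at x)"
  proof -
    have "continuous_on UNIV (\<lambda>y. U (s * y) (w x))"
      by (rule continuous_on_compose2[OF unitary_group_simps(5)[OF U]]) (auto intro!: continuous_intros)
    then show ?thesis by (simp add: continuous_on_def)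
  qed
  ultimately have "((\<lambda>y. U (s * y) (w y - w x) + U (s * y) (w x)) \<longlongrightarrow> 0 + U (s * x) (w x)) (at x)"
    by (rule tendsto_add)
  then show "isCont (\<lambda>x. U (s * x) (w x)) x"
    by (simp add: isCont_def bounded_clinear_diff[OF unitary_group_simps(1)[OF U]])
qed

lemma unitary_group_lipschitz:
  assumes U: "unitary_group U" and xy: "(x, y) \<in> generator U"
  shows "norm (U s x - x) \<le> \<bar>s\<bar> * norm y"
  using norm_diff_le_derivative_bound[of "\<lambda>s. U s x" "\<lambda>r. U r (\<i> *\<^sub>C y)" "norm y" s]
    unitary_group_derivative[OF U xy]
  by (simp add: unitary_group_norm[OF U] unitary_group_zero[OF U] norm_scaleC)

text \<open>Von Neumann's criterion. The case l = -1 makes the range of 1 + i T dense, so every pair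
  (x, y) of the adjoint is matched by a pair (u, v) of the closure with u + i v = x + i y. The
  difference x - u is then an eigenvector of the adjoint with eigenvalue i, which the case l = 1
  excludes.\<close>

lemma essentially_self_adjoint:
  fixes T :: "('a::chilbert_space \<times> 'a) set"
  assumes T: "subspace T" "\<And>c x y. (x, y) \<in> T \<Longrightarrow> (c *\<^sub>C x, c *\<^sub>C y) \<in> T"
    and sym: "\<And>x y u v. (x, y) \<in> T \<Longrightarrow> (u, v) \<in> T \<Longrightarrow> cinner x v = cinner y u"
    and dense: "closure (Domain T) = UNIV"
    and defect: "\<And>l \<eta>. l = 1 \<or> l = -1 \<Longrightarrow>
      (\<And>x y. (x, y) \<in> T \<Longrightarrow> cinner (x - (\<i> * complex_of_real l) *\<^sub>C y) \<eta> = 0) \<Longrightarrow> \<eta> = 0"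
  shows "self_adjoint (closure T)" "adjoint_graph T = closure T"
proof -
  have seq: "\<exists>f g. (\<forall>n. (f n, g n) \<in> T) \<and> f \<longlonglongrightarrow> x \<and> g \<longlonglongrightarrow> y" if xy: "(x, y) \<in> closure T" for x y
  proof -
    obtain p where p: "\<forall>n. p n \<in> T" "p \<longlonglongrightarrow> (x, y)"
      using xy unfolding closure_sequential by blast
    show ?thesis
      using p tendsto_fst[OF p(2)] tendsto_snd[OF p(2)]
      by (intro exI[of _ "\<lambda>n. fst (p n)"] exI[of _ "\<lambda>n. snd (p n)"]) auto
  qed
  have adj_closure: "adjoint_graph (closure T) = adjoint_graph T"
  proof
    show "adjoint_graph (closure T) \<subseteq> adjoint_graph T"
      unfolding adjoint_graph_def using closure_subset[of T] by blast
    show "adjoint_graph T \<subseteq> adjoint_graph (closure T)"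
    proof (clarify)
      fix x y assume xy: "(x, y) \<in> adjoint_graph T"
      have "cinner x v = cinner y u" if "(u, v) \<in> closure T" for u v
      proof -
        obtain f g where fg: "\<forall>n. (f n, g n) \<in> T" "f \<longlonglongrightarrow> u" "g \<longlonglongrightarrow> v" using seq[OF \<open>(u, v) \<in> closure T\<close>] by blast
        have "cinner x (g n) = cinner y (f n)" for n
          using xy fg(1) unfolding adjoint_graph_def by blast
        moreover have "(\<lambda>n. cinner x (g n)) \<longlonglongrightarrow> cinner x v" "(\<lambda>n. cinner y (f n)) \<longlonglongrightarrow> cinner y u"
          by (intro tendsto_intros fg)+
        ultimately show ?thesis using LIMSEQ_unique by simp
      qed
      then show "(x, y) \<in> adjoint_graph (closure T)" unfolding adjoint_graph_def by blast
    qed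
  qed
  have sub: "closure T \<subseteq> adjoint_graph T"
  proof (clarify)
    fix x y assume "(x, y) \<in> closure T"
    then obtain f g where fg: "\<forall>n. (f n, g n) \<in> T" "f \<longlonglongrightarrow> x" "g \<longlonglongrightarrow> y" using seq by blast
    have "(f n, g n) \<in> adjoint_graph T" for n
      using fg(1) sym unfolding adjoint_graph_def by blast
    then show "(x, y) \<in> adjoint_graph T" by (rule adjoint_graph_closed[OF _ fg(2,3)])
  qed
  define M where "M = {x + \<i> *\<^sub>C y |x y. (x, y) \<in> T}"
  have csM: "csubspace M"
    unfolding csubspace_def subspace_def
  proof (intro conjI allI ballI)
    show "0 \<in> M" unfolding M_def using subspace_0[OF T(1)] by (intro CollectI exI[of _ 0]) (simp add: zero_prod_def)
  next
    fix p q assume "p \<in> M" "q \<in> M"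
    then obtain x y u v where xy: "(x, y) \<in> T" "(u, v) \<in> T" "p = x + \<i> *\<^sub>C y" "q = u + \<i> *\<^sub>C v"
      unfolding M_def by blast
    have "(x + u, y + v) \<in> T" using subspace_add[OF T(1) xy(1,2)] by simp
    moreover have "p + q = (x + u) + \<i> *\<^sub>C (y + v)" by (simp add: xy scaleC_add_right)
    ultimately show "p + q \<in> M" unfolding M_def by blast
  next
    fix c p assume "p \<in> M"
    then obtain x y where xy: "(x, y) \<in> T" "p = x + \<i> *\<^sub>C y" unfolding M_def by blast
    have "c *\<^sub>C p = c *\<^sub>C x + \<i> *\<^sub>C (c *\<^sub>C y)"
      by (simp add: xy scaleC_add_right scaleC_scaleC mult.commute)
    then show "c *\<^sub>C p \<in> M" unfolding M_def using T(2)[OF xy(1)] by blast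
  next
    fix r :: real and p assume "p \<in> M"
    then obtain x y where xy: "(x, y) \<in> T" "p = x + \<i> *\<^sub>C y" unfolding M_def by blast
    have "r *\<^sub>R p = r *\<^sub>R x + \<i> *\<^sub>C (r *\<^sub>R y)" by (simp add: xy scaleR_add_right scaleC_scaleR)
    moreover have "(r *\<^sub>R x, r *\<^sub>R y) \<in> T" using subspace_scale[OF T(1) xy(1), of r] by simp
    ultimately show "r *\<^sub>R p \<in> M" unfolding M_def by blast
  qed
  have Mdense: "closure M = UNIV"
  proof (rule csubspace_denseI[OF csM])
    fix \<eta> assume M: "\<And>m. m \<in> M \<Longrightarrow> cinner m \<eta> = 0"
    show "\<eta> = 0"
    proof (rule defect[of "-1"])
      fix x y assume "(x, y) \<in> T"
      then have "x + \<i> *\<^sub>C y \<in> M" unfolding M_def by blast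
      then show "cinner (x - (\<i> * complex_of_real (-1)) *\<^sub>C y) \<eta> = 0" using M by simp
    qed simp
  qed
  have "adjoint_graph T \<subseteq> closure T"
  proof (clarify)
    fix x y assume xy: "(x, y) \<in> adjoint_graph T"
    have "x + \<i> *\<^sub>C y \<in> closure M" using Mdense by simp
    then obtain m where m: "\<forall>n. m n \<in> M" "m \<longlonglongrightarrow> x + \<i> *\<^sub>C y" unfolding closure_sequential by blast
    then have "\<forall>n. \<exists>p q. (p, q) \<in> T \<and> m n = p + \<i> *\<^sub>C q" unfolding M_def by blast
    then obtain p q where pq: "\<And>n. (p n, q n) \<in> T" "\<And>n. m n = p n + \<i> *\<^sub>C q n" by metis
    have d: "(norm (m j - m k))\<^sup>2 = (norm (p j - p k))\<^sup>2 + (norm (q j - q k))\<^sup>2" for j k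
    proof -
      have "(p j - p k, q j - q k) \<in> T" using subspace_diff[OF T(1) pq(1) pq(1), of j k] by simp
      then have "cinner (p j - p k) (q j - q k) = cinner (q j - q k) (p j - p k)" using sym by blast
      from symmetric_pythagoras[OF this, of "-1"] show ?thesis
        by (simp add: pq(2) scaleC_diff_right algebra_simps)
    qed
    have cm: "Cauchy m" using m(2) LIMSEQ_imp_Cauchy by blast
    have "Cauchy p"
      by (rule Cauchy_dist_le[OF cm], unfold dist_norm, rule power2_le_imp_le) (simp_all add: d)
    then obtain u where u: "p \<longlonglongrightarrow> u" using Cauchy_convergent convergent_def by blast
    have "Cauchy q"
      by (rule Cauchy_dist_le[OF cm], unfold dist_norm, rule power2_le_imp_le) (simp_all add: d)
    then obtain v where v: "q \<longlonglongrightarrow> v" using Cauchy_convergent convergent_def by blast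
    have uv: "(u, v) \<in> closure T"
      unfolding closure_sequential
      using pq(1) tendsto_Pair[OF u v] by (intro exI[of _ "\<lambda>n. (p n, q n)"]) simp
    have "m \<longlonglongrightarrow> u + \<i> *\<^sub>C v" unfolding pq(2) by (intro tendsto_intros u v)
    then have eq: "u + \<i> *\<^sub>C v = x + \<i> *\<^sub>C y" using m(2) LIMSEQ_unique by blast
    define \<xi> where "\<xi> = x - u"
    have e: "\<i> *\<^sub>C u - v = \<i> *\<^sub>C x - y"
      using arg_cong[OF eq, of "scaleC \<i>"] by (simp add: scaleC_add_right scaleC_scaleC)
    have "y - v = (\<i> *\<^sub>C x - \<i> *\<^sub>C u) - ((\<i> *\<^sub>C x - y) - (\<i> *\<^sub>C u - v))" by simp
    then have \<zeta>: "y - v = \<i> *\<^sub>C \<xi>" unfolding e by (simp add: \<xi>_def scaleC_diff_right)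
    have "\<xi> = 0"
    proof (rule defect[of 1])
      fix a b assume ab: "(a, b) \<in> T"
      have "cinner x b = cinner y a" "cinner u b = cinner v a"
        using xy uv sub ab unfolding adjoint_graph_def by blast+
      then have "cinner \<xi> b = cinner (\<i> *\<^sub>C \<xi>) a" unfolding \<zeta>[symmetric] by (simp add: \<xi>_def cinner_diff_left)
      then have "cinner \<xi> (a - (\<i> * complex_of_real 1) *\<^sub>C b) = 0"
        by (simp add: cinner_diff_right cinner_scaleC_left cinner_scaleC_right)
      then show "cinner (a - (\<i> * complex_of_real 1) *\<^sub>C b) \<xi> = 0"
        by (metis cinner_commute complex_cnj_zero)
    qed simp
    then have "x = u" "y = v" using \<zeta> by (simp_all add: \<xi>_def)
    then show "(x, y) \<in> closure T" using uv by simp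
  qed
  then show eq: "adjoint_graph T = closure T" using sub by blast
  have "Domain T \<subseteq> Domain (closure T)" using closure_subset[of T] by blast
  then have "closure (Domain (closure T)) = UNIV" using dense closure_mono by blast
  then show "self_adjoint (closure T)" unfolding self_adjoint_def adj_closure eq by simp
qed

section \<open>Operators acting fibrewise on waves\<close>

context hilbert_tensor_product
begin

lemma wave_scaleC:
  assumes "admissible f w"
  shows "wave f (\<lambda>x. c *\<^sub>C w x) = c *\<^sub>C wave f w"
proof (rule ten_eqI)
  fix g b
  have w: "continuous_on UNIV w" using assms by (simp add: admissible_def)
  have adm: "admissible f (\<lambda>x. c *\<^sub>C w x)"
    unfolding admissible_def
  proof
    show "continuous_on UNIV (\<lambda>x. c *\<^sub>C w x)" by (intro continuous_intros w)
    have "integrable lebesgue (\<lambda>x. (cmod c)\<^sup>2 * (norm (w x) * cmod (l2_fun f x))\<^sup>2)"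
      using assms by (simp add: admissible_def)
    then show "integrable lebesgue (\<lambda>x. (norm (c *\<^sub>C w x) * cmod (l2_fun f x))\<^sup>2)"
      by (simp add: norm_scaleC power_mult_distrib mult.assoc)
  qed
  show "cinner (ten g b) (wave f (\<lambda>x. c *\<^sub>C w x)) = cinner (ten g b) (c *\<^sub>C wave f w)"
    unfolding cinner_scaleC_right cinner_ten_wave[OF adm] cinner_ten_wave[OF assms]
    by (simp add: cinner_scaleC_right mult.left_commute flip: integral_mult_right_zero)
qed

text \<open>The action on simple tensors determines the action on waves: expand the wave in a basis,
  apply \<open>C\<close> term by term, test against a simple tensor and move \<open>V\<close> to the
  other side as \<open>V'\<close>, so that Parseval sums the series again. The multiplier is 1 for
  the evolution and an indicator for the measurement.\<close>

lemma fibrewise_wave: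
  assumes C: "bounded_clinear C" and Cten: "\<And>f b. C (ten f b) = wave (l2_mult k f) (\<lambda>x. V x b)"
    and k: "bounded_multiplier k"
    and V: "\<And>f b. admissible f (\<lambda>x. V x b)"
    and V': "\<And>c. continuous_on UNIV (\<lambda>x. V' x c)" "\<And>x c. norm (V' x c) \<le> norm c"
    and adj: "\<And>x b c. cinner c (V x b) = cinner (V' x c) b"
    and w: "admissible f w" "admissible (l2_mult k f) (\<lambda>x. V x (w x))"
  shows "C (wave f w) = wave (l2_mult k f) (\<lambda>x. V x (w x))"
proof (rule ten_eqI, rule has_sum_unique)
  fix g :: l2 and c :: 'e
  let ?m = "\<lambda>h. l2_mult (\<lambda>x. cinner h (w x)) f"
  let ?G = "\<lambda>x. cnj (l2_fun g x) * l2_fun (l2_mult k f) x"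
  have wc: "continuous_on UNIV w" using w by (simp add: admissible_def)
  have [measurable]: "k \<in> borel_measurable lebesgue" using k by (simp add: bounded_multiplier_def)
  show "((\<lambda>h. cinner (ten g c) (C (ten (?m h) h))) has_sum cinner (ten g c) (C (wave f w))) some_basis"
    by (intro has_sum_cinner_right bounded_clinear_has_sum[OF C] wave_has_sum w)
  have [measurable]: "(\<lambda>x. cinner (V' x c) h) \<in> borel_measurable lebesgue" for h
    by (intro continuous_measurable_lebesgue continuous_intros V')
  have [measurable]: "(\<lambda>x. cinner h (w x)) \<in> borel_measurable lebesgue" for h
    by (intro continuous_measurable_lebesgue continuous_intros wc)
  have eq: "cinner (ten g c) (C (ten (?m h) h)) = (\<integral>x. ?G x * (cinner (V' x c) h * cinner h (w x)) \<partial>lebesgue)" for h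
    unfolding Cten cinner_ten_wave[OF V] adj
  proof (rule integral_cong_AE)
    show "AE x in lebesgue. (cnj (l2_fun g x) * l2_fun (l2_mult k (?m h)) x) * cinner (V' x c) h =
        ?G x * (cinner (V' x c) h * cinner h (w x))"
      using l2_fun_bounded_mult[OF k, of "?m h"] l2_fun_mult[OF admissible_square_integrable[OF w(1)], of h]
        l2_fun_bounded_mult[OF k, of f]
      by eventually_elim simp
  qed measurable
  have kw: "admissible (l2_mult k f) w"
    unfolding admissible_def
  proof (intro conjI wc)
    obtain K where K: "\<And>x. cmod (k x) \<le> K" using k by (auto simp: bounded_multiplier_def)
    have [measurable]: "(\<lambda>x. norm (w x)) \<in> borel_measurable lebesgue"
      by (intro continuous_measurable_lebesgue continuous_intros wc)
    show "integrable lebesgue (\<lambda>x. (norm (w x) * cmod (l2_fun (l2_mult k f) x))\<^sup>2)"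
    proof (rule Bochner_Integration.integrable_bound)
      show "integrable lebesgue (\<lambda>x. K\<^sup>2 * (norm (w x) * cmod (l2_fun f x))\<^sup>2)"
        using w(1) by (simp add: admissible_def)
      show "AE x in lebesgue. norm ((norm (w x) * cmod (l2_fun (l2_mult k f) x))\<^sup>2)
          \<le> norm (K\<^sup>2 * (norm (w x) * cmod (l2_fun f x))\<^sup>2)"
        using l2_fun_bounded_mult[OF k, of f]
      proof eventually_elim
        case (elim x)
        have "(norm (w x) * (cmod (k x) * cmod (l2_fun f x)))\<^sup>2 \<le> (norm (w x) * (K * cmod (l2_fun f x)))\<^sup>2"
          by (intro power_mono mult_left_mono mult_right_mono K) auto
        then show ?case by (simp add: elim norm_mult power_mult_distrib mult_ac)
      qed
    qed measurable
  qed
  have "((\<lambda>h. \<integral>x. ?G x * (cinner (V' x c) h * cinner h (w x)) \<partial>lebesgue) has_sum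
      (\<integral>x. ?G x * cinner (V' x c) (w x) \<partial>lebesgue)) some_basis"
  proof (rule parseval_integral[OF V'(1) wc])
    show "integrable lebesgue (\<lambda>x. cmod (?G x) * (norm (V' x c) * norm (w x)))"
      by (rule admissible_product_integrable[OF admissible_bounded[OF V'(1) V'(2)] kw])
  qed measurable
  then show "((\<lambda>h. cinner (ten g c) (C (ten (?m h) h))) has_sum
      cinner (ten g c) (wave (l2_mult k f) (\<lambda>x. V x (w x)))) some_basis"
    unfolding eq cinner_ten_wave[OF w(2)] adj .
qed

definition ten_map :: "(l2 \<Rightarrow> 'e \<Rightarrow> 'k) \<Rightarrow> 'k \<Rightarrow> 'k" where
  "ten_map b = (SOME V. bounded_clinear V \<and> (\<forall>x. norm (V x) = norm x) \<and> (\<forall>f y. V (ten f y) = b f y))"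

lemma ten_map:
  assumes gram: "\<And>f y f' y'. cinner (b f y) (b f' y') = cinner f f' * cinner y y'"
    and sc: "\<And>c f y. b f (c *\<^sub>C y) = c *\<^sub>C b f y"
  shows "bounded_clinear (ten_map b)" "norm (ten_map b x) = norm x" "ten_map b (ten f y) = b f y"
proof -
  have "{ten x y |x y. True} = range (\<lambda>(f, y). ten f y)" by auto
  then have d: "closure (span (range (\<lambda>(f, y). ten f y))) = UNIV" using ten_dense by simp
  have g: "cinner ((\<lambda>(f, y). ten f y) p) ((\<lambda>(f, y). ten f y) q) = cinner ((\<lambda>(f, y). b f y) p) ((\<lambda>(f, y). b f y) q)" for p q
    by (auto simp: cinner_ten gram split: prod.split)
  have s: "\<exists>q. (\<lambda>(f, y). ten f y) q = c *\<^sub>C (\<lambda>(f, y). ten f y) p \<and> (\<lambda>(f, y). b f y) q = c *\<^sub>C (\<lambda>(f, y). b f y) p" for c p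
    by (intro exI[of _ "(fst p, c *\<^sub>C snd p)"]) (auto simp: ten_scaleC_right sc split: prod.split)
  have "\<exists>V. bounded_clinear V \<and> (\<forall>x. norm (V x) \<le> norm x) \<and> (\<forall>p. V ((\<lambda>(f, y). ten f y) p) = (\<lambda>(f, y). b f y) p) \<and>
    (closure (span (range (\<lambda>(f, y). ten f y))) = UNIV \<longrightarrow> (\<forall>x. norm (V x) = norm x))"
    by (rule contraction_from_gram[OF g s])
  then have "\<exists>V. bounded_clinear V \<and> (\<forall>x. norm (V x) = norm x) \<and> (\<forall>f y. V (ten f y) = b f y)"
    using d by auto
  then have "bounded_clinear (ten_map b) \<and> (\<forall>x. norm (ten_map b x) = norm x) \<and> (\<forall>f y. ten_map b (ten f y) = b f y)"
    unfolding ten_map_def by (rule someI_ex)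
  then show "bounded_clinear (ten_map b)" "norm (ten_map b x) = norm x" "ten_map b (ten f y) = b f y" by auto
qed

lemma tensor_op_eqI:
  assumes "bounded_clinear C" "\<And>x y. C (ten x y) = ten (S x) (T y)"
  shows "tensor_op ten S T = C"
  unfolding tensor_op_def
  by (rule the_equality) (use assms in \<open>auto intro!: ten_op_eqI\<close>)

text \<open>For a projection \<open>P\<close> the reflection $2P - 1$ is unitary; tensor products of unitaries are
  obtained from their Gram matrices.\<close>

lemma tensor_op_projections:
  assumes P: "projection_op P" and Q: "projection_op Q"
  shows "bounded_clinear (tensor_op ten P Q)" "tensor_op ten P Q (ten x y) = ten (P x) (Q y)"
proof -
  have refl: "cinner (2 *\<^sub>R R x - x) (2 *\<^sub>R R y - y) = cinner x y"
      "2 *\<^sub>R R (c *\<^sub>C x) - c *\<^sub>C x = c *\<^sub>C (2 *\<^sub>R R x - x)"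
    if R: "projection_op R" for R :: "'z::chilbert_space \<Rightarrow> 'z" and x y c
  proof -
    have "cinner (R x) (R y) = cinner x (R y)" "cinner (R x) y = cinner x (R y)"
      using R unfolding projection_op_def by (metis comp_apply)+
    then show "cinner (2 *\<^sub>R R x - x) (2 *\<^sub>R R y - y) = cinner x y"
      by (simp add: cinner_diff_left cinner_diff_right cinner_scaleR_left cinner_scaleR_right)
    show "2 *\<^sub>R R (c *\<^sub>C x) - c *\<^sub>C x = c *\<^sub>C (2 *\<^sub>R R x - x)"
      using R by (simp add: projection_op_def bounded_clinear_def scaleC_diff_right scaleC_scaleR)
  qed
  define u where "u x = 2 *\<^sub>R P x - x" for x
  define v where "v y = 2 *\<^sub>R Q y - y" for y
  have P_eq: "P x = (1/2) *\<^sub>R (x + u x)" and Q_eq: "Q y = (1/2) *\<^sub>R (y + v y)" for x y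
    by (simp_all add: u_def v_def)
  have U: "bounded_clinear (ten_map (\<lambda>f y. ten (u f) y))" "ten_map (\<lambda>f y. ten (u f) y) (ten f y) = ten (u f) y" for f y
    by (rule ten_map; simp add: cinner_ten u_def refl[OF P] ten_scaleC_right)+
  have V: "bounded_clinear (ten_map (\<lambda>f y. ten f (v y)))" "ten_map (\<lambda>f y. ten f (v y)) (ten f y) = ten f (v y)" for f y
    by (rule ten_map; simp add: cinner_ten v_def refl[OF Q] ten_scaleC_right)+
  have UV: "bounded_clinear (ten_map (\<lambda>f y. ten (u f) (v y)))" "ten_map (\<lambda>f y. ten (u f) (v y)) (ten f y) = ten (u f) (v y)" for f y
    by (rule ten_map; simp add: cinner_ten u_def v_def refl[OF P] refl[OF Q] ten_scaleC_right)+
  \<comment> \<open>P = (1 + u) / 2 and Q = (1 + v) / 2, so P \<otimes> Q is a quarter of the four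
    products 1, u \<otimes> 1, 1 \<otimes> v and u \<otimes> v.\<close>
  define C where "C z = (1/4) *\<^sub>R ((z + ten_map (\<lambda>f y. ten (u f) y) z) +
    (ten_map (\<lambda>f y. ten f (v y)) z + ten_map (\<lambda>f y. ten (u f) (v y)) z))" for z
  have bC: "bounded_clinear C"
    unfolding C_def by (intro bounded_clinear_rmult bounded_clinear_plus bounded_clinear_id U V UV)
  have scl: "ten (r *\<^sub>R a) b = r *\<^sub>R ten a b" "ten a (r *\<^sub>R b) = r *\<^sub>R ten a b" for r a b
    using ten_scaleC_left[of "complex_of_real r" a b] ten_scaleC_right[of a "complex_of_real r" b]
    by (simp_all add: scaleC_of_real)
  have Cten: "C (ten x y) = ten (P x) (Q y)" for x y
    unfolding C_def U V UV P_eq Q_eq scl ten_add_left ten_add_right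
    by (simp add: algebra_simps)
  have "tensor_op ten P Q = C" by (rule tensor_op_eqI[OF bC Cten])
  then show "bounded_clinear (tensor_op ten P Q)" "tensor_op ten P Q (ten x y) = ten (P x) (Q y)"
    using bC Cten by auto
qed


end

lemma id_measurable_lebesgue [measurable]: "(\<lambda>x::real. x) \<in> borel_measurable lebesgue"
  by (rule continuous_measurable_lebesgue) (rule continuous_on_id)

text \<open>The radius |a| / 3 keeps \<open>x\<close> at distance at least 2|a| / 3 from 0, so |1 -
  a / x| \<le> 1/2; this is the factor by which a vector in the defect space shrinks.\<close>

definition cell :: "real \<Rightarrow> real set" where
  "cell a = {x. \<bar>x - a\<bar> \<le> \<bar>a\<bar> / 3}"

lemma cell_ratio:
  assumes "a \<noteq> 0" "x \<in> cell a"
  shows "x \<noteq> 0" "\<bar>1 - a / x\<bar> \<le> 1 / 2" "\<bar>1 / x\<bar> \<le> 3 / (2 * \<bar>a\<bar>)"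
proof -
  have h: "\<bar>x - a\<bar> \<le> \<bar>a\<bar> / 3" "\<bar>a\<bar> > 0" using assms by (auto simp: cell_def)
  then have x: "\<bar>x\<bar> \<ge> 2 * \<bar>a\<bar> / 3" by linarith
  then show x0: "x \<noteq> 0" using h(2) by auto
  have "\<bar>1 - a / x\<bar> = \<bar>x - a\<bar> / \<bar>x\<bar>" using x0 by (simp add: field_simps flip: abs_divide)
  also have "\<dots> \<le> 1 / 2" using h x x0 by (simp add: field_simps)
  finally show "\<bar>1 - a / x\<bar> \<le> 1 / 2" .
  have "1 / \<bar>x\<bar> \<le> 1 / (2 * \<bar>a\<bar> / 3)" using x h(2) by (intro divide_left_mono) auto
  then show "\<bar>1 / x\<bar> \<le> 3 / (2 * \<bar>a\<bar>)" by simp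
qed

lemma cell_measurable [measurable]: "cell a \<in> sets lebesgue"
proof -
  have "cell a = {a - \<bar>a\<bar> / 3..a + \<bar>a\<bar> / 3}" unfolding cell_def by (intro set_eqI iffI; simp only: mem_Collect_eq atLeastAtMost_iff abs_le_iff; linarith)
  then show ?thesis by simp
qed

lemma cell_cover: "x \<noteq> 0 \<Longrightarrow> \<exists>q\<in>\<rat> - {0}. x \<in> cell q"
proof -
  assume x: "x \<noteq> 0"
  \<comment> \<open>With |x - q| < |x| / 5 one has |q| > 4|x| / 5, so the distance is below |q| /
    4.\<close>
  have "x - \<bar>x\<bar> / 5 < x + \<bar>x\<bar> / 5" using x by simp
  then obtain q where q: "q \<in> \<rat>" "x - \<bar>x\<bar> / 5 < q" "q < x + \<bar>x\<bar> / 5"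
    using Rats_dense_in_real by blast
  then have "\<bar>x - q\<bar> < \<bar>x\<bar> / 5" unfolding abs_less_iff by linarith
  moreover have "\<bar>x\<bar> \<le> \<bar>q\<bar> + \<bar>x - q\<bar>" by linarith
  ultimately have "\<bar>x - q\<bar> \<le> \<bar>q\<bar> / 3" "q \<noteq> 0" using x by linarith+
  then show ?thesis using q(1) unfolding cell_def by blast
qed

lemma bounded_multiplier_indicator:
  assumes "A \<in> sets lebesgue" "m \<in> borel_measurable lebesgue" "\<And>x. x \<in> A \<Longrightarrow> cmod (m x) \<le> K" "K \<ge> 0"
  shows "bounded_multiplier (\<lambda>x. indicator A x * m x)" "cmod (indicator A x * m x) \<le> K"
proof -
  have [measurable]: "A \<in> sets lebesgue" "m \<in> borel_measurable lebesgue" by fact+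
  show *: "cmod (indicator A x * m x) \<le> K" for x
    using assms(3,4) by (auto simp: indicator_def)
  have "(\<lambda>x. indicator A x * m x) \<in> borel_measurable lebesgue" by measurable
  with * show "bounded_multiplier (\<lambda>x. indicator A x * m x)" unfolding bounded_multiplier_def by blast
qed

section \<open>The coupling and its essential self-adjointness\<close>

locale tensor_evolution = hilbert_tensor_product ten
  for ten :: "l2 \<Rightarrow> 'e::chilbert_space \<Rightarrow> 'k::chilbert_space" +
  fixes B :: "('e \<times> 'e) set"
  assumes B: "self_adjoint B"
begin

abbreviation U where "U \<equiv> exp_i B"

lemma UG: "unitary_group U" and Ugen: "generator U = B"
  by (rule exp_i_group[OF B])+

text \<open>For fixed \<open>b\<close> the inner products with \<eta> are represented by some
  \<open>h\<close> in the space of wave functions. Testing on the part of \<open>h\<close> in a cell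
  shows that \<open>h\<close> vanishes there, and countably many cells cover all of the line except
  the null set {0}.\<close>

lemma ten_cells_eq_0:
  assumes "\<And>a f b. a \<noteq> 0 \<Longrightarrow> cinner (ten (l2_mult (indicator (cell a)) f) b) \<eta> = 0"
  shows "\<eta> = 0"
proof (rule ten_eqI)
  fix f :: l2 and b :: 'e
  define F where "F g = cnj (cinner (ten g b) \<eta>)" for g
  have "F = (\<lambda>g. cinner \<eta> (ten g b))" by (simp add: F_def fun_eq_iff flip: cinner_commute)
  then have "bounded_linear F"
    using bounded_linear_compose[OF cinner_bl_right bounded_clinear_bl[OF ten_left_clinear]] by simp
  moreover have "F (c *\<^sub>C x) = c * F x" for c x by (simp add: F_def ten_scaleC_left cinner_scaleC_left)
  ultimately obtain h where h: "\<forall>g. F g = cinner h g" using riesz_representation by blast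
  have "AE x in lebesgue. x \<in> cell a \<longrightarrow> l2_fun h x = 0" if "a \<noteq> 0" for a
  proof -
    have k: "bounded_multiplier (indicator (cell a))"
      using bounded_multiplier_indicator(1)[of "cell a" "\<lambda>x. 1" 1] by simp
    have "cinner h (l2_mult (indicator (cell a)) h) = 0"
      using h assms[OF that, of h b] by (simp add: F_def flip: h[rule_format])
    moreover have "cinner h (l2_mult (indicator (cell a)) h) =
        (\<integral>x. complex_of_real (indicator (cell a) x * (cmod (l2_fun h x))\<^sup>2) \<partial>lebesgue)"
    proof -
      have "cinner (l2_mult (\<lambda>x. 1) h) (l2_mult (indicator (cell a)) h) =
        (\<integral>x. (cnj (l2_fun h x) * l2_fun h x) * (cnj 1 * indicator (cell a) x) \<partial>lebesgue)"
        by (rule cinner_l2_mult) (use bounded_multiplier_square_integrable[OF k] l2_fun_square_integrable in auto)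
      also have "\<dots> = (\<integral>x. complex_of_real (indicator (cell a) x * (cmod (l2_fun h x))\<^sup>2) \<partial>lebesgue)"
        by (rule Bochner_Integration.integral_cong) (auto simp: indicator_def complex_norm_square mult.commute simp flip: of_real_power)
      finally show ?thesis by simp
    qed
    ultimately have "(\<integral>x. indicator (cell a) x * (cmod (l2_fun h x))\<^sup>2 \<partial>lebesgue) = 0"
      by (metis integral_complex_of_real of_real_eq_0_iff)
    moreover have "integrable lebesgue (\<lambda>x. indicator (cell a) x * (cmod (l2_fun h x))\<^sup>2)"
      using integrable_mult_indicator[OF cell_measurable l2_fun_integrable, of a h] by simp
    ultimately have "AE x in lebesgue. indicator (cell a) x * (cmod (l2_fun h x))\<^sup>2 = 0"
      by (subst (asm) integral_nonneg_eq_0_iff_AE) auto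
    then show ?thesis by eventually_elim (auto simp: indicator_def)
  qed
  then have "AE x in lebesgue. \<forall>q\<in>\<rat> - {0}. x \<in> cell q \<longrightarrow> l2_fun h x = 0"
    by (subst AE_ball_countable) (auto intro: countable_subset[OF _ countable_rat])
  moreover have "AE x in lebesgue. x \<noteq> (0::real)"
    by (rule AE_I'[of "{0}"]) (auto simp: null_sets_def)
  ultimately have "AE x in lebesgue. l2_fun h x = l2_fun 0 x"
    using l2_fun_zero by eventually_elim (use cell_cover in force)
  then have "h = 0" by (simp add: l2_eq_iff)
  then have "F f = 0" using h by simp
  then show "cinner (ten f b) \<eta> = cinner (ten f b) 0" by (simp add: F_def)
qed

definition coupling :: "('k \<times> 'k) set" where
  "coupling = span {(ten x y, ten x' y') |x x' y y'. (x, x') \<in> position_op \<and> (y, y') \<in> B}"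

lemma coupling_base: "(x, x') \<in> position_op \<Longrightarrow> (y, y') \<in> B \<Longrightarrow> (ten x y, ten x' y') \<in> coupling"
  unfolding coupling_def by (rule span_base) blast

lemma tensor_graph_coupling: "tensor_graph ten position_op B = closure coupling"
  by (simp add: tensor_graph_def coupling_def)

lemma position_op_scaleC:
  assumes "(x, x') \<in> position_op"
  shows "(c *\<^sub>C x, c *\<^sub>C x') \<in> position_op"
proof -
  have "AE t in lebesgue. l2_fun x' t = complex_of_real t * l2_fun x t"
    using assms by (simp add: position_op_def)
  then have "AE t in lebesgue. l2_fun (c *\<^sub>C x') t = complex_of_real t * l2_fun (c *\<^sub>C x) t"
    using l2_fun_scaleC[of c x] l2_fun_scaleC[of c x'] by eventually_elim simp
  then show ?thesis by (simp add: position_op_def)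
qed

lemma coupling_scaleC: "(x, y) \<in> coupling \<Longrightarrow> (c *\<^sub>C x, c *\<^sub>C y) \<in> coupling"
proof -
  have "(c *\<^sub>C fst p, c *\<^sub>C snd p) \<in> coupling" if "p \<in> coupling" for p
    using that[unfolded coupling_def]
  proof (induction rule: span_induct_alt)
    case base then show ?case unfolding coupling_def by (simp add: span_zero flip: zero_prod_def)
  next
    case (step r s q)
    then obtain x x' y y' where s: "s = (ten x y, ten x' y')" "(x, x') \<in> position_op" "(y, y') \<in> B" by blast
    have "(ten (c *\<^sub>C x) y, ten (c *\<^sub>C x') y') \<in> coupling"
      by (rule coupling_base[OF position_op_scaleC[OF s(2)] s(3)])
    then have "r *\<^sub>R (ten (c *\<^sub>C x) y, ten (c *\<^sub>C x') y') + (c *\<^sub>C fst q, c *\<^sub>C snd q) \<in> coupling"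
      using step(2) unfolding coupling_def by (intro span_add span_scale)
    then show ?case by (simp add: s(1) ten_scaleC_left scaleC_add_right scaleC_scaleR)
  qed
  from this[of "(x, y)"] show "(x, y) \<in> coupling \<Longrightarrow> (c *\<^sub>C x, c *\<^sub>C y) \<in> coupling" by simp
qed

text \<open>On a cell 1 / x is bounded, so a wave function cut off to a cell has a preimage under
  the position operator.\<close>

lemma position_cell:
  assumes a: "a \<noteq> 0"
  shows "(l2_mult (\<lambda>x. indicator (cell a) x * complex_of_real (1 / x)) f, l2_mult (indicator (cell a)) f) \<in> position_op"
proof -
  have inv: "(\<lambda>x. complex_of_real (1 / x)) \<in> borel_measurable lebesgue" by measurable
  have k: "bounded_multiplier (\<lambda>x. indicator (cell a) x * complex_of_real (1 / x))"
    by (rule bounded_multiplier_indicator(1)[where K = "3 / (2 * \<bar>a\<bar>)"])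
      (use cell_ratio(3)[OF a] inv in \<open>auto simp: norm_divide\<close>)
  have k': "bounded_multiplier (indicator (cell a))"
    using bounded_multiplier_indicator(1)[of "cell a" "\<lambda>x. 1" 1] by simp
  have "AE x in lebesgue. l2_fun (l2_mult (indicator (cell a)) f) x =
      complex_of_real x * l2_fun (l2_mult (\<lambda>x. indicator (cell a) x * complex_of_real (1 / x)) f) x"
    using l2_fun_bounded_mult[OF k, of f] l2_fun_bounded_mult[OF k', of f]
  proof eventually_elim
    case (elim x)
    then show ?case using cell_ratio(1)[OF a, of x] by (cases "x \<in> cell a") (simp_all only: elim, simp_all)
  qed
  then show ?thesis unfolding position_op_def by blast
qed

text \<open>Cut off to a cell, every wave function lies in the domain of the position operator; in
  the other factor the domain of \<open>B\<close> is dense.\<close>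

lemma coupling_dense: "closure (Domain coupling) = UNIV"
proof (rule csubspace_denseI)
  have "subspace coupling" by (simp add: coupling_def)
  then have "subspace (fst ` coupling)" by (rule linear_subspace_image[rotated]) (simp add: linear_fst)
  moreover have "fst ` coupling = Domain coupling" by force
  moreover have "c *\<^sub>C x \<in> Domain coupling" if "x \<in> Domain coupling" for c x
    using that coupling_scaleC by blast
  ultimately show "csubspace (Domain coupling)" unfolding csubspace_def by simp
next
  fix \<eta> assume \<eta>: "\<And>m. m \<in> Domain coupling \<Longrightarrow> cinner m \<eta> = 0"
  show "\<eta> = 0"
  proof (rule ten_cells_eq_0)
    fix a :: real and f :: l2 and b :: 'e assume a: "a \<noteq> 0"
    define F where "F = l2_mult (indicator (cell a)) f"
    have kx: "bounded_multiplier (\<lambda>x. indicator (cell a) x * complex_of_real x)"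
    proof (rule bounded_multiplier_indicator(1)[where K = "2 * \<bar>a\<bar>"])
      show "cmod (complex_of_real x) \<le> 2 * \<bar>a\<bar>" if "x \<in> cell a" for x
        using that unfolding cell_def norm_of_real mem_Collect_eq by linarith
    qed auto
    have k: "bounded_multiplier (indicator (cell a))"
      using bounded_multiplier_indicator(1)[of "cell a" "\<lambda>x. 1" 1] by simp
    have "AE x in lebesgue. l2_fun (l2_mult (\<lambda>x. indicator (cell a) x * complex_of_real x) f) x =
        complex_of_real x * l2_fun F x"
      unfolding F_def
      using l2_fun_bounded_mult[OF kx, of f] l2_fun_bounded_mult[OF k, of f]
      by eventually_elim simp
    then have "(F, l2_mult (\<lambda>x. indicator (cell a) x * complex_of_real x) f) \<in> position_op"
      unfolding position_op_def by blast
    then have z: "cinner (ten F y) \<eta> = 0" if "y \<in> Domain B" for y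
      using that \<eta> coupling_base by blast
    have "closure (Domain B) \<subseteq> {y. cinner (ten F y) \<eta> = 0}"
      by (intro closure_minimal closed_Collect_eq continuous_intros bounded_clinear_continuous_on[OF ten_right_clinear])
        (use z in auto)
    then show "cinner (ten (l2_mult (indicator (cell a)) f) b) \<eta> = 0"
      using B unfolding self_adjoint_def F_def by blast
  qed
qed

text \<open>On the spectral cell where the position is close to \<open>a\<close>, the coupling $X \otimes B$ is a
  relative perturbation of $a \cdot 1 \otimes B$ of size at most $1/2$, so that a vector orthogonal to
  the range of $X \otimes B \pm i$ is halved again and again.\<close>

lemma coupling_defect:
  assumes l: "l = 1 \<or> l = -1"
    and orth: "\<And>x y. (x, y) \<in> coupling \<Longrightarrow> cinner (x - (\<i> * complex_of_real l) *\<^sub>C y) \<eta> = 0"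
  shows "\<eta> = 0"
proof (rule ten_cells_eq_0)
  fix a :: real and f :: l2 and c :: 'e assume a: "a \<noteq> 0"
  let ?k = "indicator (cell a) :: real \<Rightarrow> complex"
  let ?m = "\<lambda>x. ?k x * complex_of_real (1 - a / x)"
  have k: "bounded_multiplier ?k"
    using bounded_multiplier_indicator(1)[of "cell a" "\<lambda>x. 1" 1] by simp
  have meas: "(\<lambda>x. complex_of_real (1 - a / x)) \<in> borel_measurable lebesgue"
    by measurable
  have bound: "cmod (complex_of_real (1 - a / x)) \<le> 1 / 2" if "x \<in> cell a" for x
    unfolding norm_of_real by (rule cell_ratio(2)[OF a that])
  note m = bounded_multiplier_indicator[OF cell_measurable meas bound, of a]
  have m: "bounded_multiplier ?m" "cmod (?m x) \<le> 1 / 2" for x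
    using m by auto
  have inv: "(\<lambda>x. complex_of_real (1 / x)) \<in> borel_measurable lebesgue" by measurable
  have kinv: "bounded_multiplier (\<lambda>x. ?k x * complex_of_real (1 / x))"
    by (rule bounded_multiplier_indicator(1)[where K = "3 / (2 * \<bar>a\<bar>)"])
      (use cell_ratio(3)[OF a] inv in \<open>auto simp: norm_divide\<close>)
  \<comment> \<open>Take b = (1 - i l a B)^(-1) c, which is no longer than \<open>c\<close>, and
    test the orthogonality on the pair for f/x on the cell and \<open>b\<close>. This trades the
    wave function for its product with 1 - a / x, and \<open>c\<close> for \<open>b\<close>, without
    changing the inner product with \<eta>.\<close>
  have step: "\<exists>b. norm b \<le> norm c \<and> cinner (ten (l2_mult ?k f) c) \<eta> = cinner (ten (l2_mult ?k (l2_mult ?m f)) b) \<eta>"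
    for f c
  proof -
    have "l * a \<noteq> 0" using l a by auto
    then obtain b b' where b: "(b, b') \<in> B" "b - (\<i> * complex_of_real (l * a)) *\<^sub>C b' = c"
      using resolvent_exists[OF B] by blast
    have "(norm c)\<^sup>2 = (norm b)\<^sup>2 + (l * a)\<^sup>2 * (norm b')\<^sup>2"
      using symmetric_pythagoras[OF self_adjoint_symmetric[OF B b(1) b(1)], of "l * a"] b(2) by simp
    then have "(norm b)\<^sup>2 \<le> (norm c)\<^sup>2" by simp
    then have nb: "norm b \<le> norm c" by (rule power2_le_imp_le) simp
    let ?F = "l2_mult ?k f" and ?G = "l2_mult (\<lambda>x. ?k x * complex_of_real (1 / x)) f"
    have "(ten ?G b, ten ?F b') \<in> coupling" by (rule coupling_base[OF position_cell[OF a] b(1)])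
    then have 1: "cinner (ten ?G b) \<eta> = - (\<i> * complex_of_real l) * cinner (ten ?F b') \<eta>"
      using orth[of "ten ?G b" "ten ?F b'"] by (simp add: cinner_diff_left cinner_scaleC_left eq_neg_iff_add_eq_0)
    have 2: "l2_mult ?k (l2_mult ?m f) = ?F - a *\<^sub>R ?G"
    proof (rule l2_eqI_mult)
      show "AE x in lebesgue. l2_fun (l2_mult ?k (l2_mult ?m f)) x = ?m x * l2_fun f x"
        using l2_fun_bounded_mult[OF k, of "l2_mult ?m f"] l2_fun_bounded_mult[OF m(1), of f]
        by eventually_elim (simp add: indicator_def)
      show "AE x in lebesgue. l2_fun (?F - a *\<^sub>R ?G) x = ?m x * l2_fun f x"
        using l2_fun_bounded_mult[OF k, of f] l2_fun_bounded_mult[OF kinv, of f]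
          l2_fun_minus[of ?F "a *\<^sub>R ?G"] l2_fun_scaleR[of a ?G]
        by eventually_elim (simp add: algebra_simps)
    qed
    have "cinner (ten ?F c) \<eta> = cinner (ten ?F b) \<eta> + \<i> * complex_of_real l * complex_of_real a * cinner (ten ?F b') \<eta>"
    proof -
      have "ten ?F c = ten ?F b - (\<i> * complex_of_real (l * a)) *\<^sub>C ten ?F b'"
        unfolding b(2)[symmetric]
        using ten_add_right[of ?F "b - (\<i> * complex_of_real (l * a)) *\<^sub>C b'" "(\<i> * complex_of_real (l * a)) *\<^sub>C b'"]
        by (simp add: ten_scaleC_right)
      then show ?thesis by (simp add: cinner_diff_left cinner_scaleC_left)
    qed
    also have "\<dots> = cinner (ten ?F b) \<eta> - complex_of_real a * cinner (ten ?G b) \<eta>"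
      unfolding 1 by (simp add: algebra_simps)
    also have "\<dots> = cinner (ten (?F - a *\<^sub>R ?G) b) \<eta>"
    proof -
      have "ten (?F - a *\<^sub>R ?G) b = ten ?F b - complex_of_real a *\<^sub>C ten ?G b"
        using ten_add_left[of "?F - a *\<^sub>R ?G" "a *\<^sub>R ?G" b] ten_scaleC_left[of "complex_of_real a" ?G b]
        by (simp add: scaleC_of_real)
      then show ?thesis by (simp add: cinner_diff_left cinner_scaleC_left)
    qed
    finally show ?thesis using nb unfolding 2 by blast
  qed
  have ten_norm: "cmod (cinner (ten g b) \<eta>) \<le> norm g * norm b * norm \<eta>" for g b
    using cmod_cinner_le[of "ten g b" \<eta>] by (simp add: norm_ten)
  have main: "cmod (cinner (ten (l2_mult ?k f) c) \<eta>) \<le> (1/2) ^ n * (norm f * norm c * norm \<eta>)" for n f c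
  proof (induction n arbitrary: f c)
    case 0
    have "norm (l2_mult ?k f) \<le> 1 * norm f" by (rule norm_l2_mult_le[OF k]) (auto simp: indicator_def)
    then have "norm (l2_mult ?k f) * norm c * norm \<eta> \<le> norm f * norm c * norm \<eta>"
      by (intro mult_right_mono) auto
    then show ?case using ten_norm[of "l2_mult ?k f" c] by simp
  next
    case (Suc n)
    obtain b where b: "norm b \<le> norm c"
      "cinner (ten (l2_mult ?k f) c) \<eta> = cinner (ten (l2_mult ?k (l2_mult ?m f)) b) \<eta>" using step by blast
    have "norm (l2_mult ?m f) \<le> (1/2) * norm f" by (rule norm_l2_mult_le[OF m(1) m(2)]) simp
    then have "norm (l2_mult ?m f) * norm b * norm \<eta> \<le> (1/2) * norm f * norm c * norm \<eta>"
      using b(1) by (intro mult_right_mono mult_mono) auto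
    then have "(1/2) ^ n * (norm (l2_mult ?m f) * norm b * norm \<eta>) \<le> (1/2) ^ n * ((1/2) * norm f * norm c * norm \<eta>)"
      by (intro mult_left_mono) auto
    then show ?case unfolding b(2) using Suc[of "l2_mult ?m f" b] by (simp add: mult_ac)
  qed
  have "(\<lambda>n. (1/2) ^ n * (norm f * norm c * norm \<eta>)) \<longlonglongrightarrow> 0"
    by (intro tendsto_mult_left_zero LIMSEQ_power_zero) simp
  then have "cmod (cinner (ten (l2_mult ?k f) c) \<eta>) \<le> 0"
    using main by (intro LIMSEQ_le_const) auto
  then show "cinner (ten (l2_mult ?k f) c) \<eta> = 0" by simp
qed

section \<open>The fibrewise unitary group and its generator\<close>

definition W :: "real \<Rightarrow> 'k \<Rightarrow> 'k" where
  "W s = ten_map (\<lambda>f b. wave f (\<lambda>x. U (s * x) b))"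

lemma U_continuous: "continuous_on UNIV w \<Longrightarrow> continuous_on UNIV (\<lambda>x. U (s * x) (w x))"
  by (rule unitary_action_continuous[OF UG])

lemma U_admissible: "admissible f w \<Longrightarrow> admissible f (\<lambda>x. U (s * x) (w x))"
  by (rule admissible_cong_norm) (auto simp: unitary_group_norm[OF UG] admissible_def intro: U_continuous)

lemmas U_admissible_const = U_admissible[OF admissible_const]

text \<open>Each fibre map is unitary, so the waves assigned to simple tensors have the Gram matrix
  of the simple tensors.\<close>

lemma W: "bounded_clinear (W s)" "norm (W s v) = norm v" "W s (ten f b) = wave f (\<lambda>x. U (s * x) b)"
proof -
  have g: "cinner (wave f (\<lambda>x. U (s * x) y)) (wave f' (\<lambda>x. U (s * x) y')) = cinner f f' * cinner y y'" for f y f' y'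
    unfolding cinner_wave_wave[OF U_admissible_const U_admissible_const] unitary_group_simps(3)[OF UG]
    by (simp add: cinner_l2_def)
  have sc: "wave f (\<lambda>x. U (s * x) (c *\<^sub>C y)) = c *\<^sub>C wave f (\<lambda>x. U (s * x) y)" for c f y
    by (simp add: bounded_clinear_scaleC[OF unitary_group_simps(1)[OF UG]] wave_scaleC[OF U_admissible_const])
  show "bounded_clinear (W s)" "norm (W s v) = norm v" "W s (ten f b) = wave f (\<lambda>x. U (s * x) b)"
    unfolding W_def by (rule ten_map[OF g sc])+
qed

lemma W_wave:
  assumes "admissible f w"
  shows "W s (wave f w) = wave f (\<lambda>x. U (s * x) (w x))"
proof -
  have "W s (wave f w) = wave (l2_mult (\<lambda>x. 1) f) (\<lambda>x. U (s * x) (w x))"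
  proof (rule fibrewise_wave[where C = "W s" and k = "\<lambda>x. 1" and V = "\<lambda>x. U (s * x)" and V' = "\<lambda>x. U (- s * x)"])
    show "bounded_multiplier (\<lambda>x. 1)" by (auto simp: bounded_multiplier_def)
    show "cinner c (U (s * x) b) = cinner (U (- s * x) c) b" for x b c
      using unitary_group_adjoint[OF UG, of "- s * x" c b] by simp
    show "continuous_on UNIV (\<lambda>x. U (- s * x) c)" for c by (rule U_continuous) simp
  qed (simp_all add: W U_admissible_const U_admissible[OF assms] assms unitary_group_norm[OF UG])
  then show ?thesis by simp
qed

lemma W_plus: "W (s + r) v = W s (W r v)"
proof -
  have "W (s + r) = (\<lambda>v. W s (W r v))"
  proof (rule ten_op_eqI)
    show "bounded_clinear (\<lambda>v. W s (W r v))" by (rule bounded_clinear_comp[OF W(1) W(1)])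
    show "W (s + r) (ten x y) = W s (W r (ten x y))" for x y
      by (simp add: W(3) W_wave[OF U_admissible_const] distrib_right unitary_group_simps(4)[OF UG])
  qed (rule W(1))
  then show ?thesis by simp
qed

lemma W_zero: "W 0 v = v"
proof -
  have "W 0 = (\<lambda>v. v)"
    by (rule ten_op_eqI[OF W(1) bounded_clinear_id]) (simp add: W(3) unitary_group_zero[OF UG] wave_const)
  then show ?thesis by simp
qed

text \<open>The difference quotient minus its expected limit is itself a wave, with field
  \<open>v s\<close>. The field tends to 0 pointwise and is bounded by 2 |x| |b'|, while x f(x) is
  square integrable because \<open>f\<close> lies in the domain of the position operator; dominated
  convergence gives the limit in norm.\<close>

lemma W_derivative:
  assumes f: "(f, f') \<in> position_op" and b: "(b, b') \<in> B"
  shows "(ten f b, ten f' b') \<in> generator W"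
proof -
  have bg: "(b, b') \<in> generator U" using b by (simp add: Ugen)
  have ff: "AE x in lebesgue. l2_fun f' x = complex_of_real x * l2_fun f x"
    using f by (simp add: position_op_def)
  have xf: "integrable lebesgue (\<lambda>x. (\<bar>x\<bar> * cmod (l2_fun f x))\<^sup>2)"
  proof (rule integrable_cong_AE_imp[OF l2_fun_integrable[of f']])
    show "AE x in lebesgue. (cmod (l2_fun f' x))\<^sup>2 = (\<bar>x\<bar> * cmod (l2_fun f x))\<^sup>2"
      using ff by eventually_elim (simp add: norm_mult)
  qed measurable
  have adm: "admissible f (\<lambda>x. x *\<^sub>R y)" for y :: 'e
    unfolding admissible_def
  proof
    have "integrable lebesgue (\<lambda>x. (norm y)\<^sup>2 * (\<bar>x\<bar> * cmod (l2_fun f x))\<^sup>2)" using xf by simp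
    then show "integrable lebesgue (\<lambda>x. (norm (x *\<^sub>R y) * cmod (l2_fun f x))\<^sup>2)"
      by (simp add: power_mult_distrib mult_ac)
  qed (intro continuous_intros)
  have ten': "ten f' y = wave f (\<lambda>x. x *\<^sub>R y)" for y
  proof (rule ten_eqI)
    fix g c
    show "cinner (ten g c) (ten f' y) = cinner (ten g c) (wave f (\<lambda>x. x *\<^sub>R y))"
      unfolding wave_const[symmetric, of f' y] cinner_ten_wave[OF adm] cinner_ten_wave[OF admissible_const]
    proof (rule integral_cong_AE)
      show "AE x in lebesgue. (cnj (l2_fun g x) * l2_fun f' x) * cinner c y
          = (cnj (l2_fun g x) * l2_fun f x) * cinner c (x *\<^sub>R y)"
        using ff by eventually_elim (simp add: cinner_scaleR_right)
      have [measurable]: "(\<lambda>x. cinner c (x *\<^sub>R y)) \<in> borel_measurable lebesgue"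
        by (intro continuous_measurable_lebesgue continuous_intros)
      show "(\<lambda>x. (cnj (l2_fun g x) * l2_fun f x) * cinner c (x *\<^sub>R y)) \<in> borel_measurable lebesgue"
        by measurable
    qed measurable
  qed
  define v where "v s x = (1 / s) *\<^sub>R (U (s * x) b - b) - x *\<^sub>R (\<i> *\<^sub>C b')" for s x
  have vb: "norm (v s x) \<le> 2 * \<bar>x\<bar> * norm b'" if "s \<noteq> 0" for s x
  proof -
    have "norm ((1 / s) *\<^sub>R (U (s * x) b - b)) = norm (U (s * x) b - b) / \<bar>s\<bar>" by simp
    also have "\<dots> \<le> (\<bar>s * x\<bar> * norm b') / \<bar>s\<bar>"
      by (intro divide_right_mono unitary_group_lipschitz[OF UG bg]) simp
    also have "\<dots> = \<bar>x\<bar> * norm b'" using that by (simp add: abs_mult)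
    finally show ?thesis
      unfolding v_def using norm_triangle_ineq4[of "(1 / s) *\<^sub>R (U (s * x) b - b)" "x *\<^sub>R (\<i> *\<^sub>C b')"]
      by (simp add: norm_scaleC)
  qed
  have vc: "continuous_on UNIV (v s)" for s
    unfolding v_def by (intro continuous_intros U_continuous)
  have vlim: "((\<lambda>s. v s x) \<longlongrightarrow> 0) (at 0)" for x
  proof -
    have "((\<lambda>r. U r b) \<circ> (\<lambda>s. s * x) has_vector_derivative x *\<^sub>R (\<i> *\<^sub>C b')) (at 0)"
    proof (rule vector_diff_chain_at)
      show "((\<lambda>s. s * x) has_vector_derivative x) (at 0)" by (auto intro!: derivative_eq_intros)
      show "((\<lambda>r. U r b) has_vector_derivative \<i> *\<^sub>C b') (at (0 * x))" using bg by (simp add: generator_def)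
    qed
    then have "((\<lambda>s. (1 / s) *\<^sub>R (U (s * x) b - b)) \<longlongrightarrow> x *\<^sub>R (\<i> *\<^sub>C b')) (at 0)"
      unfolding has_vector_derivative_at_0 by (simp add: unitary_group_zero[OF UG])
    then show ?thesis unfolding v_def by (rule LIM_zero)
  qed
  have va: "admissible f (v s)" for s
  proof -
    have "admissible f (\<lambda>x. complex_of_real (1 / s) *\<^sub>C (U (s * x) b - b))"
    proof (rule admissible_bounded)
      show "continuous_on UNIV (\<lambda>x. complex_of_real (1 / s) *\<^sub>C (U (s * x) b - b))"
        by (intro continuous_intros U_continuous)
      show "norm (complex_of_real (1 / s) *\<^sub>C (U (s * x) b - b)) \<le> \<bar>1 / s\<bar> * (norm b + norm b)" for x
        unfolding norm_scaleC norm_of_real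
        using norm_triangle_ineq4[of "U (s * x) b" b]
        by (intro mult_left_mono) (auto simp: unitary_group_norm[OF UG])
    qed
    from admissible_diff[OF this adm, of "\<i> *\<^sub>C b'"] show ?thesis
      unfolding v_def scaleC_of_real .
  qed
  have eq: "(1 / s) *\<^sub>R (W s (ten f b) - ten f b) - \<i> *\<^sub>C ten f' b' = wave f (v s)" for s
  proof -
    have d: "admissible f (\<lambda>x. U (s * x) b - b)" by (rule admissible_diff[OF U_admissible_const admissible_const])
    have 1: "wave f (\<lambda>x. complex_of_real (1 / s) *\<^sub>C (U (s * x) b - b)) = (1 / s) *\<^sub>R (W s (ten f b) - ten f b)"
    proof -
      have "wave f (\<lambda>x. complex_of_real (1 / s) *\<^sub>C (U (s * x) b - b))
          = complex_of_real (1 / s) *\<^sub>C wave f (\<lambda>x. U (s * x) b - b)"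
        by (rule wave_scaleC[OF d])
      also have "wave f (\<lambda>x. U (s * x) b - b) = W s (ten f b) - ten f b"
        by (simp only: wave_diff[OF U_admissible_const admissible_const] wave_const W(3))
      finally show ?thesis by (simp only: scaleC_of_real)
    qed
    have d': "admissible f (\<lambda>x. complex_of_real (1 / s) *\<^sub>C (U (s * x) b - b))"
      unfolding scaleC_of_real
      by (rule admissible_bounded[where C = "\<bar>1 / s\<bar> * (norm b + norm b)"])
        (use norm_triangle_ineq4[of "U (s * _) b" b] in \<open>auto intro!: continuous_intros U_continuous divide_right_mono
          simp: unitary_group_norm[OF UG]\<close>)
    have "wave f (\<lambda>x. complex_of_real (1 / s) *\<^sub>C (U (s * x) b - b) - x *\<^sub>R (\<i> *\<^sub>C b'))
        = (1 / s) *\<^sub>R (W s (ten f b) - ten f b) - ten f' (\<i> *\<^sub>C b')"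
      unfolding wave_diff[OF d' adm] 1 ten' ..
    then show ?thesis unfolding v_def scaleC_of_real ten_scaleC_right by simp
  qed
  have "((\<lambda>s. (norm (wave f (v s)))\<^sup>2) \<longlongrightarrow> 0) (at 0)"
    \<comment> \<open>Dominated convergence is applied along sequences tending to 0.\<close>
    unfolding tendsto_at_iff_sequentially
  proof (intro allI impI)
    fix \<sigma> :: "nat \<Rightarrow> real" assume \<sigma>: "\<forall>i. \<sigma> i \<in> UNIV - {0}" "\<sigma> \<longlonglongrightarrow> 0"
    have "(\<lambda>n. \<integral>x. (cmod (l2_fun f x))\<^sup>2 * (norm (v (\<sigma> n) x))\<^sup>2 \<partial>lebesgue) \<longlonglongrightarrow> (\<integral>x. (0::real) \<partial>(lebesgue :: real measure))"
    proof (rule integral_dominated_convergence)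
      show "integrable lebesgue (\<lambda>x. 4 * (norm b')\<^sup>2 * (\<bar>x\<bar> * cmod (l2_fun f x))\<^sup>2)" using xf by simp
      have "filterlim \<sigma> (at 0) sequentially" using \<sigma> by (simp add: filterlim_at)
      then have "(\<lambda>n. v (\<sigma> n) x) \<longlonglongrightarrow> 0" for x by (rule filterlim_compose[OF vlim])
      then have "(\<lambda>n. (cmod (l2_fun f x))\<^sup>2 * (norm (v (\<sigma> n) x))\<^sup>2) \<longlonglongrightarrow> (cmod (l2_fun f x))\<^sup>2 * (norm (0::'e))\<^sup>2" for x
        by (intro tendsto_intros)
      then show "AE x in lebesgue. (\<lambda>n. (cmod (l2_fun f x))\<^sup>2 * (norm (v (\<sigma> n) x))\<^sup>2) \<longlonglongrightarrow> 0" by simp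
      have "(cmod (l2_fun f x))\<^sup>2 * (norm (v (\<sigma> n) x))\<^sup>2 \<le> (cmod (l2_fun f x))\<^sup>2 * (2 * \<bar>x\<bar> * norm b')\<^sup>2" for n x
        using vb[of "\<sigma> n" x] \<sigma>(1) by (intro mult_left_mono power_mono) auto
      then show "AE x in lebesgue. norm ((cmod (l2_fun f x))\<^sup>2 * (norm (v (\<sigma> n) x))\<^sup>2)
          \<le> 4 * (norm b')\<^sup>2 * (\<bar>x\<bar> * cmod (l2_fun f x))\<^sup>2" for n
        by (simp add: power_mult_distrib mult_ac)
      have "(\<lambda>x. norm (v s x)) \<in> borel_measurable lebesgue" for s
        by (intro continuous_measurable_lebesgue continuous_intros vc)
      then show "(\<lambda>x. (cmod (l2_fun f x))\<^sup>2 * (norm (v (\<sigma> n) x))\<^sup>2) \<in> borel_measurable lebesgue" for n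
        by measurable
    qed simp
    then show "((\<lambda>s. (norm (wave f (v s)))\<^sup>2) \<circ> \<sigma>) \<longlonglongrightarrow> 0"
      by (simp add: o_def norm_wave[OF va])
  qed
  then have "((\<lambda>s. sqrt ((norm (wave f (v s)))\<^sup>2)) \<longlongrightarrow> sqrt 0) (at 0)" by (rule tendsto_real_sqrt)
  then have "((\<lambda>s. wave f (v s)) \<longlongrightarrow> 0) (at 0)" by (simp add: tendsto_norm_zero_iff)
  then have "((\<lambda>s. (1 / s) *\<^sub>R (W s (ten f b) - ten f b)) \<longlongrightarrow> \<i> *\<^sub>C ten f' b') (at 0)"
    unfolding eq[symmetric] by (rule LIM_zero_cancel)
  then show ?thesis by (simp add: generator_def has_vector_derivative_at_0 W_zero)
qed

lemma coupling_generator: "coupling \<subseteq> generator W"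
proof -
  have "p \<in> generator W" if "p \<in> coupling" for p
    using that[unfolded coupling_def]
  proof (induction rule: span_induct_alt)
    case base
    show ?case by (simp add: generator_def zero_prod_def bounded_clinear_zero[OF W(1)])
  next
    case (step r s q)
    then obtain x x' y y' where s: "s = (ten x y, ten x' y')" "(x, x') \<in> position_op" "(y, y') \<in> B" by blast
    have "((\<lambda>h. W h (ten x y)) has_vector_derivative \<i> *\<^sub>C ten x' y') (at 0)"
      using W_derivative[OF s(2,3)] by (simp add: generator_def)
    moreover have "((\<lambda>h. W h (fst q)) has_vector_derivative \<i> *\<^sub>C snd q) (at 0)"
      using step(2) by (cases q) (simp add: generator_def)
    ultimately have "((\<lambda>h. r *\<^sub>R W h (ten x y) + W h (fst q)) has_vector_derivative
        r *\<^sub>R (\<i> *\<^sub>C ten x' y') + \<i> *\<^sub>C snd q) (at 0)"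
      by (intro has_vector_derivative_add bounded_linear.has_vector_derivative[OF bounded_linear_scaleR_right])
    then have "(r *\<^sub>R ten x y + fst q, r *\<^sub>R ten x' y' + snd q) \<in> generator W"
      by (simp add: generator_def bounded_clinear_add[OF W(1)] bounded_clinear_scaleR[OF W(1)]
        scaleC_add_right scaleC_scaleR)
    then show ?case by (cases q) (simp add: s(1))
  qed
  then show ?thesis by blast
qed

lemma W_group: "unitary_group W"
proof (rule unitary_groupI[OF W(1,2) W_plus W_zero])
  fix v
  show "((\<lambda>s. W s v) \<longlongrightarrow> v) (at 0)"
  proof (rule contractions_tendsto[where T = W and T' = "\<lambda>x. x", OF _ _ _ _ coupling_dense])
    fix x assume "x \<in> Domain coupling"
    then obtain y where "(x, y) \<in> generator W" using coupling_generator by blast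
    then have "((\<lambda>s. W s x) has_vector_derivative \<i> *\<^sub>C y) (at 0)" by (simp add: generator_def)
    then have "isCont (\<lambda>s. W s x) 0" by (rule has_vector_derivative_continuous)
    then show "((\<lambda>s. W s x) \<longlongrightarrow> x) (at 0)" by (simp add: isCont_def W_zero)
  qed (auto simp: W(2) bounded_clinear_bl[OF W(1)] bounded_linear.linear linear_id[unfolded id_def])
qed

text \<open>The generator of \<open>W\<close> is symmetric and extends the coupling, so it is
  contained in the adjoint of the coupling, which is its closure. Uniqueness in Stone's theorem then
  identifies the groups.\<close>

lemma exp_coupling: "exp_i (tensor_graph ten position_op B) = W"
proof -
  have sym: "cinner x v = cinner y u" if "(x, y) \<in> coupling" "(u, v) \<in> coupling" for x y u v
    by (rule generator_symmetric[OF W_group]) (use that coupling_generator in auto)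
  have sa: "self_adjoint (closure coupling)" "adjoint_graph coupling = closure coupling"
    using essentially_self_adjoint[of coupling, OF _ coupling_scaleC sym coupling_dense coupling_defect]
    by (simp_all add: coupling_def)
  have "generator W \<subseteq> closure coupling"
  proof (clarify)
    fix x y assume xy: "(x, y) \<in> generator W"
    have "(x, y) \<in> adjoint_graph coupling"
      unfolding adjoint_graph_def using generator_symmetric[OF W_group xy] coupling_generator by blast
    then show "(x, y) \<in> closure coupling" by (simp add: sa(2))
  qed
  moreover have "closure (Domain (generator W)) = UNIV"
  proof -
    have "Domain coupling \<subseteq> Domain (generator W)" using coupling_generator by blast
    then show ?thesis using coupling_dense closure_mono by blast
  qed
  ultimately show ?thesis
    unfolding tensor_graph_coupling by (intro exp_i_eqI[OF sa(1) W_group])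
qed

end

section \<open>The decoherence map\<close>

lemma sigma_finite_lebesgue: "sigma_finite_measure (lebesgue :: real measure)"
proof
  let ?A = "range (\<lambda>n::nat. {- real n..real n})"
  have "\<exists>n. x \<in> {- real n..real n}" for x
  proof -
    obtain n :: nat where "\<bar>x\<bar> \<le> real n" using real_arch_simple by blast
    then show ?thesis by (intro exI[of _ n]) (simp add: abs_le_iff)
  qed
  then have "\<Union>?A = space lebesgue" by auto
  moreover have "\<forall>a\<in>?A. emeasure lebesgue a \<noteq> \<infinity>" by (auto simp: emeasure_completion)
  ultimately show "\<exists>A. countable A \<and> A \<subseteq> sets lebesgue \<and> \<Union>A = space lebesgue \<and> (\<forall>a\<in>A. emeasure (lebesgue :: real measure) a \<noteq> \<infinity>)"
    by (intro exI[of _ ?A]) auto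
qed

interpretation lebesgue: sigma_finite_measure "lebesgue :: real measure"
  by (rule sigma_finite_lebesgue)

interpretation lebesgue_pair: pair_sigma_finite "lebesgue :: real measure" "lebesgue :: real measure" ..

text \<open>Existence of a kernel makes the chosen \<open>kernel_of\<close> a kernel as well,
  possibly a different representative.\<close>

lemma ketbra_kernel: "is_kernel (ketbra \<psi> \<psi>) (\<lambda>x y. l2_fun \<psi> x * cnj (l2_fun \<psi> y))"
  unfolding is_kernel_def
proof (intro conjI allI)
  show meas: "(\<lambda>(x, y). l2_fun \<psi> x * cnj (l2_fun \<psi> y)) \<in> borel_measurable (lebesgue \<Otimes>\<^sub>M lebesgue)"
    by measurable
  show "integrable (lebesgue \<Otimes>\<^sub>M lebesgue) (\<lambda>(x, y). (cmod (l2_fun \<psi> x * cnj (l2_fun \<psi> y)))\<^sup>2)"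
  proof (rule lebesgue_pair.Fubini_integrable)
    show "(\<lambda>(x, y). (cmod (l2_fun \<psi> x * cnj (l2_fun \<psi> y)))\<^sup>2) \<in> borel_measurable (lebesgue \<Otimes>\<^sub>M lebesgue)"
      by measurable
    have "integrable lebesgue (\<lambda>x. (cmod (l2_fun \<psi> x))\<^sup>2 * (\<integral>y. (cmod (l2_fun \<psi> y))\<^sup>2 \<partial>lebesgue))"
      using l2_fun_integrable by simp
    then show "integrable lebesgue (\<lambda>x. \<integral>y. norm (case (x, y) of (x, y) \<Rightarrow> (cmod (l2_fun \<psi> x * cnj (l2_fun \<psi> y)))\<^sup>2) \<partial>lebesgue)"
      by (simp add: norm_mult power_mult_distrib)
    show "AE x in lebesgue. integrable lebesgue (\<lambda>y. case (x, y) of (x, y) \<Rightarrow> (cmod (l2_fun \<psi> x * cnj (l2_fun \<psi> y)))\<^sup>2)"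
      using l2_fun_integrable[of \<psi>] by (simp add: norm_mult power_mult_distrib)
  qed
  fix f
  show "AE x in lebesgue. l2_fun (ketbra \<psi> \<psi> f) x = (\<integral>y. l2_fun \<psi> x * cnj (l2_fun \<psi> y) * l2_fun f y \<partial>lebesgue)"
  proof -
    have "(\<integral>y. l2_fun \<psi> x * cnj (l2_fun \<psi> y) * l2_fun f y \<partial>lebesgue) = l2_fun \<psi> x * cinner \<psi> f" for x
      by (simp add: cinner_l2_def mult.assoc)
    then show ?thesis
      using l2_fun_scaleC[of "cinner \<psi> f" \<psi>] by (simp add: ketbra_def mult.commute)
  qed
qed

lemma is_kernel_kernel_of: "is_kernel (ketbra \<psi> \<psi>) (kernel_of (ketbra \<psi> \<psi>))"
  unfolding kernel_of_def by (rule someI[of "is_kernel (ketbra \<psi> \<psi>)"]) (rule ketbra_kernel)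

text \<open>With \<open>V\<close> the unitary group of \<open>B'\<close> and $R = \sqrt{\rho'}$, Parseval's identity gives the
  coefficients $c_{(h,e)}(x) = \langle e, V_{-t\gamma' x} R h\rangle$ for \<open>h\<close>, \<open>e\<close> in the basis; only countably many
  of them are nonzero.\<close>

lemma decoherence_factor_expansion:
  fixes B' :: "('f::chilbert_space \<times> 'f) set"
  assumes B': "self_adjoint B'" and \<rho>': "density_operator \<rho>'"
  shows "\<exists>(K :: ('f \<times> 'f) set) c. countable K \<and> (\<forall>k. continuous_on UNIV (c k)) \<and>
    (\<forall>x. ((\<lambda>k. (cmod (c k x))\<^sup>2) has_sum 1) K) \<and>
    (\<forall>x y. ((\<lambda>k. c k x * cnj (c k y)) has_sum decoherence_factor \<gamma>' B' \<rho>' t x y) K)"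
proof -
  define V where "V = exp_i B'"
  have V: "unitary_group V" unfolding V_def by (rule exp_i_group[OF B'])
  have pos: "positive_op \<rho>'" and tr: "op_trace \<rho>' = 1" using \<rho>' by (auto simp: density_operator_def)
  obtain R where R: "positive_op R" "\<forall>x. R (R x) = \<rho>' x" using positive_sqrt_exists[OF pos] by blast
  have bR: "bounded_clinear R" using R(1) by (simp add: positive_op_def)
  have RR: "cinner h (\<rho>' h) = complex_of_real ((norm (R h))\<^sup>2)" for h
    using R(2) positive_op_selfadjoint[OF R(1), of h "R h"] by (simp add: cinner_self)
  have sum1: "((\<lambda>h. (norm (R h))\<^sup>2) has_sum 1) some_basis"
  proof -
    have inf: "(\<Sum>\<^sub>\<infinity>h\<in>some_basis. complex_of_real ((norm (R h))\<^sup>2)) = 1"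
      using tr by (simp only: op_trace_def RR)
    \<comment> \<open>An infinite sum without a value defaults to 0, so trace 1 forces
      summability.\<close>
    then have "(\<lambda>h. complex_of_real ((norm (R h))\<^sup>2)) summable_on some_basis"
      using infsum_not_exists zero_neq_one by metis
    then have "((\<lambda>h. complex_of_real ((norm (R h))\<^sup>2)) has_sum complex_of_real 1) some_basis"
      using has_sum_infsum inf by fastforce
    then show ?thesis by (simp only: has_sum_of_real_iff)
  qed
  define w where "w h x = V (- (t * \<gamma>') * x) (R h)" for h x
  have wc: "continuous_on UNIV (w h)" for h
    unfolding w_def by (rule unitary_action_continuous[OF V]) simp
  have wn: "norm (w h x) = norm (R h)" for h x unfolding w_def by (rule unitary_group_norm[OF V])
  define c where "c k x = cinner (snd k) (w (fst k) x)" for k x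
  define K where "K = {k\<in>some_basis \<times> some_basis. \<exists>x. c k x \<noteq> 0}"
  have "countable K"
  proof (rule countable_subset)
    have "countable {h\<in>some_basis. (norm (R h))\<^sup>2 \<noteq> 0}"
      using summable_countable_real has_sum_imp_summable[OF sum1] by blast
    then show "countable (SIGMA h:{h\<in>some_basis. (norm (R h))\<^sup>2 \<noteq> 0}. {g\<in>some_basis. \<exists>x. cinner g (w h x) \<noteq> 0})"
      by (intro countable_SIGMA countable_coefficients_continuous wc)
    show "K \<subseteq> (SIGMA h:{h\<in>some_basis. (norm (R h))\<^sup>2 \<noteq> 0}. {g\<in>some_basis. \<exists>x. cinner g (w h x) \<noteq> 0})"
    proof
      fix k assume "k \<in> K"
      then obtain h g x where k: "k = (h, g)" "h \<in> some_basis" "g \<in> some_basis" "cinner g (w h x) \<noteq> 0"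
        unfolding K_def c_def by auto
      have "w h x \<noteq> 0" using k(4) by auto
      then have "norm (R h) \<noteq> 0" using wn[of h x] by auto
      then show "k \<in> (SIGMA h:{h\<in>some_basis. (norm (R h))\<^sup>2 \<noteq> 0}. {g\<in>some_basis. \<exists>x. cinner g (w h x) \<noteq> 0})"
        using k by auto
    qed
  qed
  moreover have "continuous_on UNIV (c k)" for k
    unfolding c_def by (intro continuous_intros wc)
  moreover have sq: "((\<lambda>k. (cmod (c k x))\<^sup>2) has_sum 1) (some_basis \<times> some_basis)" for x
  proof (rule has_sum_SigmaI[OF _ sum1])
    show inner: "((\<lambda>g. (cmod (c (h, g) x))\<^sup>2) has_sum (norm (R h))\<^sup>2) some_basis" for h
      using parseval_norm[of "w h x"] by (simp add: c_def wn)
    show "(\<lambda>k. (cmod (c k x))\<^sup>2) summable_on some_basis \<times> some_basis"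
      by (rule summable_on_SigmaI[OF inner]) (use has_sum_imp_summable[OF sum1] in auto)
  qed
  moreover have "((\<lambda>k. (cmod (c k x))\<^sup>2) has_sum 1) K \<longleftrightarrow> ((\<lambda>k. (cmod (c k x))\<^sup>2) has_sum 1) (some_basis \<times> some_basis)" for x
    by (rule has_sum_cong_neutral) (auto simp: K_def)
  moreover have "((\<lambda>k. c k x * cnj (c k y)) has_sum decoherence_factor \<gamma>' B' \<rho>' t x y) K" for x y
  proof -
    define s where "s = - (t * \<gamma>' * (x - y))"
    have nuc: "((\<lambda>h. cinner (R h) (V s (R h))) has_sum op_trace (V s \<circ> \<rho>')) some_basis"
    proof (rule nuclear_trace)
      fix v
      have "((\<lambda>h. V s (R (cinner h (R v) *\<^sub>C h))) has_sum V s (R (R v))) some_basis"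
        by (intro bounded_clinear_has_sum[OF unitary_group_simps(1)[OF V]] bounded_clinear_has_sum[OF bR] basis_expansion)
      then show "((\<lambda>h. cinner (R h) v *\<^sub>C V s (R h)) has_sum (V s \<circ> \<rho>') v) some_basis"
        using R(2) by (simp add: bounded_clinear_scaleC[OF bR] bounded_clinear_scaleC[OF unitary_group_simps(1)[OF V]]
          positive_op_selfadjoint[OF R(1)])
    next
      show "(\<lambda>h. norm (V s (R h)) * norm (R h)) summable_on some_basis"
        using has_sum_imp_summable[OF sum1] by (simp add: unitary_group_norm[OF V] power2_eq_square)
    qed
    \<comment> \<open>The parameter s = - t \<gamma>' (x - y) splits by the group law, and the
      factor belonging to \<open>y\<close> moves to the other side of the inner product. This
      separates the variables.\<close>
    have shift: "cinner (R h) (V s (R h)) = cinner (w h y) (w h x)" for h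
    proof -
      have "cinner (w h y) (w h x) = cinner (R h) (V (t * \<gamma>' * y) (V (- (t * \<gamma>') * x) (R h)))"
        unfolding w_def by (subst unitary_group_adjoint[OF V]) simp
      also have "\<dots> = cinner (R h) (V s (R h))"
        unfolding unitary_group_simps(4)[OF V, symmetric] by (simp add: s_def algebra_simps)
      finally show ?thesis by simp
    qed
    have "((\<lambda>k. c k x * cnj (c k y)) has_sum op_trace (V s \<circ> \<rho>')) (some_basis \<times> some_basis)"
    proof (rule has_sum_SigmaI[OF _ nuc])
      show "((\<lambda>g. c (h, g) x * cnj (c (h, g) y)) has_sum cinner (R h) (V s (R h))) some_basis" for h
      proof -
        have "c (h, g) x * cnj (c (h, g) y) = cinner (w h y) g * cinner g (w h x)" for g
          unfolding c_def by (simp add: mult.commute flip: cinner_commute)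
        then show ?thesis using parseval[of "w h y" "w h x"] shift by simp
      qed
      have "(\<lambda>k. norm (c k x * cnj (c k y))) summable_on some_basis \<times> some_basis"
      proof (rule summable_on_comparison_test)
        show "(\<lambda>k. (cmod (c k x))\<^sup>2 + (cmod (c k y))\<^sup>2) summable_on some_basis \<times> some_basis"
          by (intro summable_on_add has_sum_imp_summable[OF sq])
        have "cmod a * cmod b \<le> (cmod a)\<^sup>2 + (cmod b)\<^sup>2" for a b
        proof -
          have "0 \<le> cmod a * cmod b" by simp
          then show ?thesis using sum_squares_bound[of "cmod a" "cmod b"] by linarith
        qed
        then show "norm (c k x * cnj (c k y)) \<le> (cmod (c k x))\<^sup>2 + (cmod (c k y))\<^sup>2" for k
          by (simp add: norm_mult)
      qed simp
      then show "(\<lambda>k. c k x * cnj (c k y)) summable_on some_basis \<times> some_basis"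
        by (rule abs_summable_summable)
    qed
    moreover have "((\<lambda>k. c k x * cnj (c k y)) has_sum z) K \<longleftrightarrow>
        ((\<lambda>k. c k x * cnj (c k y)) has_sum z) (some_basis \<times> some_basis)" for z
      by (rule has_sum_cong_neutral) (auto simp: K_def)
    ultimately show ?thesis by (simp add: decoherence_factor_def s_def V_def)
  qed
  ultimately show ?thesis by (intro exI[of _ K] exI[of _ c]) blast
qed

lemma countable_sum_measurable:
  fixes f :: "'h \<Rightarrow> 'm \<Rightarrow> complex"
  assumes "countable H" "\<And>h. h \<in> H \<Longrightarrow> f h \<in> borel_measurable M"
    and "\<And>x. x \<in> space M \<Longrightarrow> ((\<lambda>h. f h x) has_sum S x) H"
  shows "S \<in> borel_measurable M"
proof -
  obtain F where F: "\<And>n. finite (F n)" "\<And>n. F n \<subseteq> H"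
      "\<And>u s. (u has_sum (s :: complex)) H \<Longrightarrow> (\<lambda>n. sum u (F n)) \<longlonglongrightarrow> s"
    using countable_has_sum_sequence[OF assms(1)] by blast
  show ?thesis
  proof (rule borel_measurable_LIMSEQ_metric)
    show "(\<lambda>x. \<Sum>h\<in>F n. f h x) \<in> borel_measurable M" for n
      using F(2) assms(2) by (intro borel_measurable_sum) blast
    show "(\<lambda>n. \<Sum>h\<in>F n. f h x) \<longlonglongrightarrow> S x" if "x \<in> space M" for x
      by (rule F(3)[OF assms(3)[OF that]])
  qed
qed

text \<open>All that the estimate uses of the decohering environment: \<Gamma> is a countable sum of
  products, with diagonal equal to 1. Its operator and its state return only in the final
  instantiation.\<close>

locale decoherence_expansion =
  fixes K :: "'k set" and c :: "'k \<Rightarrow> real \<Rightarrow> complex" and \<Gamma> :: "real \<Rightarrow> real \<Rightarrow> complex"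
    and \<psi> :: l2
  assumes K: "countable K" and c: "\<And>k. continuous_on UNIV (c k)"
    and c1: "\<And>x. ((\<lambda>k. (cmod (c k x))\<^sup>2) has_sum 1) K"
    and \<Gamma>: "\<And>x y. ((\<lambda>k. c k x * cnj (c k y)) has_sum \<Gamma> x y) K"
begin

lemma c_meas [measurable]: "c k \<in> borel_measurable lebesgue"
  by (rule continuous_measurable_lebesgue[OF c])

lemma c_le: "k \<in> K \<Longrightarrow> cmod (c k x) \<le> 1"
proof -
  assume "k \<in> K"
  then have "(\<Sum>k\<in>{k}. (cmod (c k x))\<^sup>2) \<le> 1" by (intro finite_sum_le_has_sum[OF c1]) auto
  then show ?thesis by (simp add: power_le_one_iff)
qed

lemma c_bounded_sum: "finite F \<Longrightarrow> F \<subseteq> K \<Longrightarrow> (\<Sum>k\<in>F. (cmod (c k x))\<^sup>2) \<le> 1"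
  by (rule finite_sum_le_has_sum[OF c1]) auto

lemma c_multiplier: "k \<in> K \<Longrightarrow> bounded_multiplier (c k)"
  unfolding bounded_multiplier_def using c_le by auto

definition \<phi> :: "'k \<Rightarrow> l2" where "\<phi> k = l2_mult (c k) \<psi>"

lemma phi_fun: "k \<in> K \<Longrightarrow> AE x in lebesgue. l2_fun (\<phi> k) x = c k x * l2_fun \<psi> x"
  unfolding \<phi>_def by (rule l2_fun_bounded_mult[OF c_multiplier])

text \<open>Since the |c_k|^2 add up to 1 at every point, decoherence leaves position densities
  unchanged. This is why the outcome probabilities and the conditional states can be formed from
  \<psi> alone.\<close>

lemma phi_density_has_sum:
  assumes [measurable]: "G \<in> borel_measurable lebesgue" and G: "\<And>x. 0 \<le> G x" "\<And>x. G x \<le> 1"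
  shows "((\<lambda>k. \<integral>x. (cmod (l2_fun (\<phi> k) x))\<^sup>2 * G x \<partial>lebesgue) has_sum (\<integral>x. (cmod (l2_fun \<psi> x))\<^sup>2 * G x \<partial>lebesgue)) K"
proof -
  define f where "f k x = complex_of_real ((cmod (c k x))\<^sup>2 * ((cmod (l2_fun \<psi> x))\<^sup>2 * G x))" for k x
  have "((\<lambda>k. \<integral>x. f k x \<partial>lebesgue) has_sum (\<integral>x. complex_of_real ((cmod (l2_fun \<psi> x))\<^sup>2 * G x) \<partial>lebesgue)) K"
  proof (rule has_sum_integral(2)[OF K])
    have le: "(cmod (c k x))\<^sup>2 * ((cmod (l2_fun \<psi> x))\<^sup>2 * G x) \<le> (cmod (l2_fun \<psi> x))\<^sup>2" if "k \<in> K" for k x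
    proof -
      have "(cmod (c k x))\<^sup>2 \<le> 1" using c_le[OF that, of x] by (simp add: power_le_one_iff)
      then have "(cmod (c k x))\<^sup>2 * ((cmod (l2_fun \<psi> x))\<^sup>2 * G x) \<le> 1 * ((cmod (l2_fun \<psi> x))\<^sup>2 * 1)"
        using G by (intro mult_mono) auto
      then show ?thesis by simp
    qed
    show "integrable lebesgue (f k)" if "k \<in> K" for k
    proof (rule Bochner_Integration.integrable_bound[OF l2_fun_integrable[of \<psi>]])
      show "f k \<in> borel_measurable lebesgue" unfolding f_def by measurable
      show "AE x in lebesgue. norm (f k x) \<le> norm ((cmod (l2_fun \<psi> x))\<^sup>2)"
        unfolding f_def norm_of_real using le[OF that] G by (auto simp: abs_mult)
    qed
    show "((\<lambda>k. f k x) has_sum complex_of_real ((cmod (l2_fun \<psi> x))\<^sup>2 * G x)) K" for x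
      unfolding f_def has_sum_of_real_iff using has_sum_cmult_left[OF c1[of x], of "(cmod (l2_fun \<psi> x))\<^sup>2 * G x"] by simp
    show "(\<Sum>k\<in>F. cmod (f k x)) \<le> (cmod (l2_fun \<psi> x))\<^sup>2 * G x" if F: "finite F" "F \<subseteq> K" for x F
    proof -
      have "(\<Sum>k\<in>F. cmod (f k x)) = (\<Sum>k\<in>F. (cmod (c k x))\<^sup>2) * ((cmod (l2_fun \<psi> x))\<^sup>2 * G x)"
        unfolding f_def norm_of_real sum_distrib_right using G by (intro sum.cong) (auto simp: abs_mult)
      also have "\<dots> \<le> 1 * ((cmod (l2_fun \<psi> x))\<^sup>2 * G x)"
        using G by (intro mult_right_mono c_bounded_sum F) auto
      finally show ?thesis by simp
    qed
    show "integrable lebesgue (\<lambda>x. (cmod (l2_fun \<psi> x))\<^sup>2 * G x)"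
    proof (rule Bochner_Integration.integrable_bound[OF l2_fun_integrable[of \<psi>]])
      show "AE x in lebesgue. norm ((cmod (l2_fun \<psi> x))\<^sup>2 * G x) \<le> norm ((cmod (l2_fun \<psi> x))\<^sup>2)"
        using G by (auto simp: abs_mult mult_left_le)
    qed measurable
  qed
  moreover have "(\<integral>x. f k x \<partial>lebesgue) = complex_of_real (\<integral>x. (cmod (l2_fun (\<phi> k) x))\<^sup>2 * G x \<partial>lebesgue)" if "k \<in> K" for k
  proof -
    have "(\<integral>x. (cmod (l2_fun (\<phi> k) x))\<^sup>2 * G x \<partial>lebesgue) = (\<integral>x. (cmod (c k x))\<^sup>2 * ((cmod (l2_fun \<psi> x))\<^sup>2 * G x) \<partial>lebesgue)"
    proof (rule integral_cong_AE)
      show "AE x in lebesgue. (cmod (l2_fun (\<phi> k) x))\<^sup>2 * G x = (cmod (c k x))\<^sup>2 * ((cmod (l2_fun \<psi> x))\<^sup>2 * G x)"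
        using phi_fun[OF that] by eventually_elim (simp add: norm_mult power_mult_distrib)
    qed measurable
    then show ?thesis unfolding f_def integral_complex_of_real by simp
  qed
  ultimately have "((\<lambda>k. complex_of_real (\<integral>x. (cmod (l2_fun (\<phi> k) x))\<^sup>2 * G x \<partial>lebesgue)) has_sum
      complex_of_real (\<integral>x. (cmod (l2_fun \<psi> x))\<^sup>2 * G x \<partial>lebesgue)) K"
    unfolding integral_complex_of_real by (subst (asm) has_sum_cong) auto
  then show ?thesis by (simp only: has_sum_of_real_iff)
qed

lemma phi_norm_has_sum: "((\<lambda>k. (norm (\<phi> k))\<^sup>2) has_sum (norm \<psi>)\<^sup>2) K"
  using phi_density_has_sum[of "\<lambda>x. 1"] by (simp add: norm_l2_power2)

lemma coefficients_sum:
  assumes "finite F" "F \<subseteq> K"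
  shows "(\<Sum>k\<in>F. (cmod (cinner (\<phi> k) f))\<^sup>2) \<le> (norm \<psi>)\<^sup>2 * (norm f)\<^sup>2"
proof -
  have "(\<Sum>k\<in>F. (cmod (cinner (\<phi> k) f))\<^sup>2) \<le> (\<Sum>k\<in>F. (norm (\<phi> k) * norm f)\<^sup>2)"
    by (intro sum_mono power_mono cmod_cinner_le) auto
  also have "\<dots> = (\<Sum>k\<in>F. (norm (\<phi> k))\<^sup>2) * (norm f)\<^sup>2"
    by (simp add: power_mult_distrib sum_distrib_right)
  also have "\<dots> \<le> (norm \<psi>)\<^sup>2 * (norm f)\<^sup>2"
    using assms by (intro mult_right_mono finite_sum_le_has_sum[OF phi_norm_has_sum]) auto
  finally show ?thesis .
qed

text \<open>Any kernel \<open>k\<close> of $|\psi\rangle\langle\psi|$ satisfies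
  $\int k(x,y) \overline{c_i(y)} f(y)\,dy = \psi(x) \langle \psi, \overline{c_i} f\rangle$ almost everywhere, which
  is why the choice of the kernel does not matter.\<close>

lemma decohered_has_sum:
  "((\<lambda>k. cinner (\<phi> k) f *\<^sub>C \<phi> k) has_sum
    integral_op (\<lambda>x y. kernel_of (ketbra \<psi> \<psi>) x y * \<Gamma> x y) f) K"
proof -
  define k' where "k' = kernel_of (ketbra \<psi> \<psi>)"
  have ker: "is_kernel (ketbra \<psi> \<psi>) k'" unfolding k'_def by (rule is_kernel_kernel_of)
  have k'_meas [measurable]: "(\<lambda>(x, y). k' x y) \<in> borel_measurable (lebesgue \<Otimes>\<^sub>M lebesgue)"
    and k'_int: "integrable (lebesgue \<Otimes>\<^sub>M lebesgue) (\<lambda>(x, y). (cmod (k' x y))\<^sup>2)"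
    and k'_ae: "\<And>f. AE x in lebesgue. l2_fun (ketbra \<psi> \<psi> f) x = (\<integral>y. k' x y * l2_fun f y \<partial>lebesgue)"
    using ker by (auto simp: is_kernel_def)
  have sec [measurable]: "k' x \<in> borel_measurable lebesgue" for x
    using measurable_Pair2[OF k'_meas, of x] by simp
  \<comment> \<open>Joint measurability is inherited from the countable expansion.\<close>
  have \<Gamma>_meas [measurable]: "(\<lambda>(x, y). \<Gamma> x y) \<in> borel_measurable (lebesgue \<Otimes>\<^sub>M lebesgue)"
  proof (rule countable_sum_measurable[OF K])
    show "(\<lambda>(x, y). c k x * cnj (c k y)) \<in> borel_measurable (lebesgue \<Otimes>\<^sub>M lebesgue)" for k
      by measurable
    show "((\<lambda>k. case p of (x, y) \<Rightarrow> c k x * cnj (c k y)) has_sum (case p of (x, y) \<Rightarrow> \<Gamma> x y)) K" for p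
      using \<Gamma> by (cases p) simp
  qed
  define D where "D x = (\<integral>y. k' x y * \<Gamma> x y * l2_fun f y \<partial>lebesgue)" for x
  have [measurable]: "D \<in> borel_measurable lebesgue"
    unfolding D_def by measurable
  define a where "a k = cinner (\<phi> k) f" for k
  have cc: "cmod u * cmod v \<le> (cmod u)\<^sup>2 + (cmod v)\<^sup>2" for u v
  proof -
    have "0 \<le> cmod u * cmod v" by simp
    then show ?thesis using sum_squares_bound[of "cmod u" "cmod v"] by linarith
  qed
  have cnj_mult: "bounded_multiplier (\<lambda>x. cnj (c k x))" if "k \<in> K" for k
    unfolding bounded_multiplier_def using c_le[OF that] by auto
  \<comment> \<open>The exceptional null set depends on \<open>k\<close>; countability of
    \<open>K\<close> merges these into one.\<close>
  have row: "AE x in lebesgue. \<forall>k\<in>K. (\<integral>y. k' x y * (cnj (c k y) * l2_fun f y) \<partial>lebesgue) = a k * l2_fun \<psi> x"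
  proof (subst AE_ball_countable[OF K], intro ballI)
    fix k assume k: "k \<in> K"
    define h where "h = l2_mult (\<lambda>x. cnj (c k x)) f"
    have hf: "AE y in lebesgue. l2_fun h y = cnj (c k y) * l2_fun f y"
      unfolding h_def by (rule l2_fun_bounded_mult[OF cnj_mult[OF k]])
    have int_eq: "(\<integral>y. k' x y * l2_fun h y \<partial>lebesgue) = (\<integral>y. k' x y * (cnj (c k y) * l2_fun f y) \<partial>lebesgue)" for x
    proof (rule integral_cong_AE)
      show "AE y in lebesgue. k' x y * l2_fun h y = k' x y * (cnj (c k y) * l2_fun f y)"
        using hf by eventually_elim simp
    qed measurable
    have ah: "cinner \<psi> h = a k"
    proof -
      have "cinner \<psi> h = (\<integral>y. (cnj (l2_fun \<psi> y) * l2_fun f y) * cnj (c k y) \<partial>lebesgue)"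
        using cinner_l2_mult[of "\<lambda>x. 1" \<psi> "\<lambda>x. cnj (c k x)" f]
          bounded_multiplier_square_integrable[OF cnj_mult[OF k] l2_fun_square_integrable] l2_fun_square_integrable
        by (simp add: h_def)
      also have "\<dots> = a k"
        using cinner_l2_mult[of "c k" \<psi> "\<lambda>x. 1" f]
          bounded_multiplier_square_integrable[OF c_multiplier[OF k] l2_fun_square_integrable] l2_fun_square_integrable
        by (simp add: a_def \<phi>_def)
      finally show ?thesis .
    qed
    show "AE x in lebesgue. (\<integral>y. k' x y * (cnj (c k y) * l2_fun f y) \<partial>lebesgue) = a k * l2_fun \<psi> x"
      using k'_ae[of h] l2_fun_scaleC[of "a k" \<psi>] by eventually_elim (simp add: ketbra_def ah int_eq)
  qed
  have sq: "AE x in lebesgue. integrable lebesgue (\<lambda>y. (cmod (k' x y))\<^sup>2)"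
    using lebesgue_pair.AE_integrable_fst'[OF k'_int] by simp
  have Dsum: "AE x in lebesgue. ((\<lambda>k. c k x * (a k * l2_fun \<psi> x)) has_sum D x) K"
    using row sq
  proof eventually_elim
    case (elim x)
    have kf: "integrable lebesgue (\<lambda>y. k' x y * l2_fun f y)"
      using square_integrable_mult[of "\<lambda>y. cnj (k' x y)" "l2_fun f"] elim(2) l2_fun_square_integrable[of f]
      by (simp add: square_integrable_def)
    have le: "(\<Sum>k\<in>F. cmod (k' x y * (c k x * cnj (c k y)) * l2_fun f y)) \<le> 2 * cmod (k' x y * l2_fun f y)"
      if F: "finite F" "F \<subseteq> K" for F y
    proof -
      have "(\<Sum>k\<in>F. cmod (k' x y * (c k x * cnj (c k y)) * l2_fun f y))
          = (\<Sum>k\<in>F. cmod (c k x) * cmod (c k y)) * cmod (k' x y * l2_fun f y)"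
        unfolding sum_distrib_right by (intro sum.cong refl) (simp add: norm_mult mult_ac)
      also have "\<dots> \<le> (\<Sum>k\<in>F. (cmod (c k x))\<^sup>2 + (cmod (c k y))\<^sup>2) * cmod (k' x y * l2_fun f y)"
        by (intro mult_right_mono sum_mono cc) simp
      also have "\<dots> \<le> 2 * cmod (k' x y * l2_fun f y)"
        using c_bounded_sum[OF F, of x] c_bounded_sum[OF F, of y]
        by (intro mult_right_mono) (auto simp: sum.distrib)
      finally show ?thesis .
    qed
    have "((\<lambda>k. \<integral>y. k' x y * (c k x * cnj (c k y)) * l2_fun f y \<partial>lebesgue) has_sum D x) K"
      unfolding D_def
    proof (rule has_sum_integral(2)[OF K])
      show "integrable lebesgue (\<lambda>y. k' x y * (c k x * cnj (c k y)) * l2_fun f y)" if "k \<in> K" for k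
      proof (rule Bochner_Integration.integrable_bound)
        show "integrable lebesgue (\<lambda>y. 2 * cmod (k' x y * l2_fun f y))" using kf by simp
        show "AE y in lebesgue. norm (k' x y * (c k x * cnj (c k y)) * l2_fun f y) \<le> norm (2 * cmod (k' x y * l2_fun f y))"
          using le[of "{k}"] that by simp
      qed measurable
      show "((\<lambda>k. k' x y * (c k x * cnj (c k y)) * l2_fun f y) has_sum k' x y * \<Gamma> x y * l2_fun f y) K" for y
        by (intro has_sum_cmult_left has_sum_cmult_right \<Gamma>)
      show "integrable lebesgue (\<lambda>y. 2 * cmod (k' x y * l2_fun f y))" using kf by simp
    qed (rule le)
    moreover have "(\<integral>y. k' x y * (c k x * cnj (c k y)) * l2_fun f y \<partial>lebesgue) = c k x * (a k * l2_fun \<psi> x)"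
      if "k \<in> K" for k
    proof -
      have "(\<integral>y. k' x y * (c k x * cnj (c k y)) * l2_fun f y \<partial>lebesgue)
          = (\<integral>y. c k x * (k' x y * (cnj (c k y) * l2_fun f y)) \<partial>lebesgue)"
        by (simp add: mult_ac)
      also have "\<dots> = c k x * (a k * l2_fun \<psi> x)"
        using elim(1) that by simp
      finally show ?thesis .
    qed
    ultimately show ?case by (subst (asm) has_sum_cong) auto
  qed
  \<comment> \<open>From |a||c| \<le> |a|^2 + |c|^2: the first squares sum to at most |\<psi>|^2
    |f|^2, the second to at most 1.\<close>
  define M where "M = (norm \<psi>)\<^sup>2 * (norm f)\<^sup>2 + 1"
  have M: "(\<Sum>k\<in>F. cmod (a k) * cmod (c k x)) \<le> M" if F: "finite F" "F \<subseteq> K" for F x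
  proof -
    have "(\<Sum>k\<in>F. cmod (a k) * cmod (c k x)) \<le> (\<Sum>k\<in>F. (cmod (a k))\<^sup>2 + (cmod (c k x))\<^sup>2)"
      by (intro sum_mono cc)
    also have "\<dots> \<le> M" unfolding M_def sum.distrib a_def
      by (intro add_mono coefficients_sum c_bounded_sum F)
    finally show ?thesis .
  qed
  have D_le: "AE x in lebesgue. cmod (D x) \<le> M * cmod (l2_fun \<psi> x)"
    using Dsum
  proof eventually_elim
    case (elim x)
    have "cmod (\<Sum>k\<in>F. c k x * (a k * l2_fun \<psi> x)) \<le> M * cmod (l2_fun \<psi> x)" if F: "finite F" "F \<subseteq> K" for F
    proof -
      have "cmod (\<Sum>k\<in>F. c k x * (a k * l2_fun \<psi> x)) \<le> (\<Sum>k\<in>F. cmod (c k x * (a k * l2_fun \<psi> x)))"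
        by (rule norm_sum)
      also have "\<dots> = (\<Sum>k\<in>F. cmod (a k) * cmod (c k x)) * cmod (l2_fun \<psi> x)"
        unfolding sum_distrib_right by (intro sum.cong refl) (simp add: norm_mult mult_ac)
      also have "\<dots> \<le> M * cmod (l2_fun \<psi> x)" by (intro mult_right_mono M F) simp
      finally show ?thesis .
    qed
    then have "\<forall>\<^sub>F F in finite_subsets_at_top K. cmod (\<Sum>k\<in>F. c k x * (a k * l2_fun \<psi> x)) \<le> M * cmod (l2_fun \<psi> x)"
      by (intro eventually_finite_subsets_at_top_weakI)
    then show ?case
      using elim unfolding has_sum_def
      by (intro tendsto_upperbound[OF tendsto_norm]) auto
  qed
  have D_sq: "square_integrable D"
    unfolding square_integrable_def
  proof
    show "integrable lebesgue (\<lambda>x. (cmod (D x))\<^sup>2)"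
    proof (rule Bochner_Integration.integrable_bound)
      show "integrable lebesgue (\<lambda>x. M\<^sup>2 * (cmod (l2_fun \<psi> x))\<^sup>2)" using l2_fun_integrable by simp
      show "AE x in lebesgue. norm ((cmod (D x))\<^sup>2) \<le> norm (M\<^sup>2 * (cmod (l2_fun \<psi> x))\<^sup>2)"
        using D_le
      proof eventually_elim
        case (elim x)
        then have "(cmod (D x))\<^sup>2 \<le> (M * cmod (l2_fun \<psi> x))\<^sup>2" by (intro power_mono) auto
        then show ?case by (simp add: power_mult_distrib)
      qed
    qed measurable
  qed measurable
  have res: "integral_op (\<lambda>x y. k' x y * \<Gamma> x y) f = l2_of D"
    by (simp add: integral_op_def D_def[abs_def])
  have "(\<lambda>k. norm (a k *\<^sub>C \<phi> k)) summable_on K"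
  proof (rule summable_on_comparison_test)
    show "(\<lambda>k. norm f * (norm (\<phi> k))\<^sup>2) summable_on K"
      by (rule summable_on_cmult_right[OF has_sum_imp_summable[OF phi_norm_has_sum]])
    show "norm (a k *\<^sub>C \<phi> k) \<le> norm f * (norm (\<phi> k))\<^sup>2" for k
      using mult_right_mono[OF cmod_cinner_le[of "\<phi> k" f] norm_ge_zero[of "\<phi> k"]]
      by (simp add: a_def norm_scaleC power2_eq_square mult_ac)
  qed simp
  then obtain S where S: "((\<lambda>k. a k *\<^sub>C \<phi> k) has_sum S) K"
    using abs_summable_summable[of "\<lambda>k. a k *\<^sub>C \<phi> k" K] unfolding summable_on_def by blast
  \<comment> \<open>The norm limit \<open>S\<close> and the pointwise limit \<open>D\<close> are
    compared weakly, by pairing both with an arbitrary \<open>g\<close>.\<close>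
  have "S = l2_of D"
  proof (rule cinner_right_eqI, rule has_sum_unique)
    fix g
    show "((\<lambda>k. cinner g (a k *\<^sub>C \<phi> k)) has_sum cinner g S) K" by (rule has_sum_cinner_right[OF S])
    have gpsi: "integrable lebesgue (\<lambda>x. M * cmod (cnj (l2_fun g x) * l2_fun \<psi> x))"
      using cinner_l2_integrable[of g \<psi>] by simp
    \<comment> \<open>The exchange of sum and integral asks for the sum at every point, so the
      exceptional null set is cut out by an indicator.\<close>
    obtain N where N: "N \<in> null_sets lebesgue" "{x. \<not> ((\<lambda>k. c k x * (a k * l2_fun \<psi> x)) has_sum D x) K} \<subseteq> N"
      using Dsum by (auto simp: eventually_ae_filter)
    have N_meas [measurable]: "N \<in> sets lebesgue" using N(1) by blast
    have ae: "AE x in lebesgue. x \<notin> N" using N(1) by (rule AE_not_in)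
    have le: "(\<Sum>k\<in>F. cmod (indicator (- N) x * (cnj (l2_fun g x) * (c k x * (a k * l2_fun \<psi> x)))))
        \<le> M * cmod (cnj (l2_fun g x) * l2_fun \<psi> x)" if F: "finite F" "F \<subseteq> K" for F x
    proof -
      have "(\<Sum>k\<in>F. cmod (indicator (- N) x * (cnj (l2_fun g x) * (c k x * (a k * l2_fun \<psi> x)))))
          \<le> (\<Sum>k\<in>F. cmod (cnj (l2_fun g x) * (c k x * (a k * l2_fun \<psi> x))))"
        by (intro sum_mono) (auto simp: indicator_def)
      also have "\<dots> = (\<Sum>k\<in>F. cmod (a k) * cmod (c k x)) * cmod (cnj (l2_fun g x) * l2_fun \<psi> x)"
        unfolding sum_distrib_right by (intro sum.cong refl) (simp add: norm_mult mult_ac)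
      also have "\<dots> \<le> M * cmod (cnj (l2_fun g x) * l2_fun \<psi> x)" by (intro mult_right_mono M F) simp
      finally show ?thesis .
    qed
    have "((\<lambda>k. \<integral>x. indicator (- N) x * (cnj (l2_fun g x) * (c k x * (a k * l2_fun \<psi> x))) \<partial>lebesgue) has_sum
        (\<integral>x. indicator (- N) x * (cnj (l2_fun g x) * D x) \<partial>lebesgue)) K"
    proof (rule has_sum_integral(2)[OF K])
      show "integrable lebesgue (\<lambda>x. indicator (- N) x * (cnj (l2_fun g x) * (c k x * (a k * l2_fun \<psi> x))))"
        if "k \<in> K" for k
      proof (rule Bochner_Integration.integrable_bound[OF gpsi])
        have "- N \<in> sets lebesgue" using N_meas by (simp add: Compl_in_sets_lebesgue)
        then have [measurable]: "indicator (- N) \<in> borel_measurable lebesgue" by simp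
        show "(\<lambda>x. indicator (- N) x * (cnj (l2_fun g x) * (c k x * (a k * l2_fun \<psi> x)))) \<in> borel_measurable lebesgue"
          using \<open>- N \<in> sets lebesgue\<close> by measurable
        have "M \<ge> 0" by (simp add: M_def)
        then show "AE x in lebesgue. norm (indicator (- N) x * (cnj (l2_fun g x) * (c k x * (a k * l2_fun \<psi> x))))
            \<le> norm (M * cmod (cnj (l2_fun g x) * l2_fun \<psi> x))"
          using le[of "{k}"] that by simp
      qed
      show "((\<lambda>k. indicator (- N) x * (cnj (l2_fun g x) * (c k x * (a k * l2_fun \<psi> x)))) has_sum
          indicator (- N) x * (cnj (l2_fun g x) * D x)) K" for x
        using N(2) by (cases "x \<in> N") (auto intro!: has_sum_cmult_right)
      show "integrable lebesgue (\<lambda>x. M * cmod (cnj (l2_fun g x) * l2_fun \<psi> x))" by (rule gpsi)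
    qed (rule le)
    moreover have "(\<integral>x. indicator (- N) x * (cnj (l2_fun g x) * (c k x * (a k * l2_fun \<psi> x))) \<partial>lebesgue)
        = cinner g (a k *\<^sub>C \<phi> k)" if "k \<in> K" for k
    proof -
      have [measurable]: "- N \<in> sets lebesgue" using N_meas by (simp add: Compl_in_sets_lebesgue)
      have "(\<integral>x. indicator (- N) x * (cnj (l2_fun g x) * (c k x * (a k * l2_fun \<psi> x))) \<partial>lebesgue)
          = (\<integral>x. cnj (l2_fun g x) * l2_fun (a k *\<^sub>C \<phi> k) x \<partial>lebesgue)"
      proof (rule integral_cong_AE)
        show "AE x in lebesgue. indicator (- N) x * (cnj (l2_fun g x) * (c k x * (a k * l2_fun \<psi> x)))
            = cnj (l2_fun g x) * l2_fun (a k *\<^sub>C \<phi> k) x"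
          using ae phi_fun[OF that] l2_fun_scaleC[of "a k" "\<phi> k"] by eventually_elim simp
      qed measurable
      then show ?thesis by (simp add: cinner_l2_def)
    qed
    moreover have "(\<integral>x. indicator (- N) x * (cnj (l2_fun g x) * D x) \<partial>lebesgue) = cinner g (l2_of D)"
    proof -
      have [measurable]: "- N \<in> sets lebesgue" using N_meas by (simp add: Compl_in_sets_lebesgue)
      show ?thesis
        unfolding cinner_l2_def
      proof (rule integral_cong_AE)
        show "AE x in lebesgue. indicator (- N) x * (cnj (l2_fun g x) * D x) = cnj (l2_fun g x) * l2_fun (l2_of D) x"
          using ae l2_fun_l2_of[OF D_sq] by eventually_elim simp
      qed measurable
    qed
    ultimately show "((\<lambda>k. cinner g (a k *\<^sub>C \<phi> k)) has_sum cinner g (l2_of D)) K"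
      by (subst (asm) has_sum_cong) auto
  qed
  with S show ?thesis unfolding a_def k'_def[symmetric] res by simp
qed

end

section \<open>The distance between the two post-measurement states\<close>

lemma nuclear_operator:
  fixes a b :: "'k \<Rightarrow> 'a::chilbert_space"
  assumes ab: "(\<lambda>k. norm (a k) * norm (b k)) summable_on K"
  obtains T where "bounded_clinear T" "\<And>v. ((\<lambda>k. cinner (b k) v *\<^sub>C a k) has_sum T v) K"
proof -
  have le: "norm (cinner (b k) v *\<^sub>C a k) \<le> norm v * (norm (a k) * norm (b k))" for k v
    using mult_right_mono[OF cmod_cinner_le[of "b k" v] norm_ge_zero[of "a k"]]
    by (simp add: norm_scaleC mult_ac)
  have sm: "(\<lambda>k. norm (cinner (b k) v *\<^sub>C a k)) summable_on K" for v
    by (rule summable_on_comparison_test[OF summable_on_cmult_right[OF ab, of "norm v"] le]) simp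
  define T where "T v = (\<Sum>\<^sub>\<infinity>k\<in>K. cinner (b k) v *\<^sub>C a k)" for v
  have T: "((\<lambda>k. cinner (b k) v *\<^sub>C a k) has_sum T v) K" for v
    unfolding T_def by (rule has_sum_infsum) (rule abs_summable_summable[OF sm])
  have "bounded_clinear T"
  proof (rule bounded_clinearI)
    show "T (x + y) = T x + T y" for x y
      using has_sum_unique[OF T[of "x + y"]] has_sum_add[OF T[of x] T[of y]]
      by (simp add: cinner_add_right scaleC_add_left)
    show "T (c *\<^sub>C x) = c *\<^sub>C T x" for c x
      using has_sum_unique[OF T[of "c *\<^sub>C x"]] has_sum_bounded_linear[OF scaleC_bl_right T[of x], of c]
      by (simp add: cinner_scaleC_right scaleC_scaleC)
    show "norm (T x) \<le> (\<Sum>\<^sub>\<infinity>k\<in>K. norm (a k) * norm (b k)) * norm x" for x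
    proof -
      have "norm (T x) \<le> (\<Sum>\<^sub>\<infinity>k\<in>K. norm (cinner (b k) x *\<^sub>C a k))"
        unfolding T_def by (rule norm_infsum_bound) (rule sm)
      also have "\<dots> \<le> (\<Sum>\<^sub>\<infinity>k\<in>K. norm x * (norm (a k) * norm (b k)))"
        by (rule infsum_mono[OF sm summable_on_cmult_right[OF ab]]) (rule le)
      also have "\<dots> = norm x * (\<Sum>\<^sub>\<infinity>k\<in>K. norm (a k) * norm (b k))"
        by (rule infsum_cmult_right) (rule ab)
      finally show ?thesis by (simp add: mult.commute)
    qed
  qed
  with T that show ?thesis by blast
qed

lemma nuclear_bounded:
  fixes a b :: "'k \<Rightarrow> 'a::chilbert_space"
  assumes "(\<lambda>k. norm (a k) * norm (b k)) summable_on K"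
    and T: "\<And>v. ((\<lambda>k. cinner (b k) v *\<^sub>C a k) has_sum T v) K"
  shows "bounded_clinear T"
proof -
  obtain T' where T': "bounded_clinear T'" "\<And>v. ((\<lambda>k. cinner (b k) v *\<^sub>C a k) has_sum T' v) K"
    using nuclear_operator[OF assms(1)] by blast
  have "T = T'" using has_sum_unique[OF T T'(2)] by blast
  with T'(1) show ?thesis by simp
qed

lemma nuclear_selfadjoint:
  fixes a :: "'k \<Rightarrow> 'a::chilbert_space"
  assumes T: "\<And>v. ((\<lambda>k. cinner (a k) v *\<^sub>C a k) has_sum T v) K"
  shows "cinner (T u) v = cinner u (T v)"
proof (rule has_sum_unique)
  show "((\<lambda>k. cinner (cinner (a k) u *\<^sub>C a k) v) has_sum cinner (T u) v) K"
    by (rule has_sum_cinner_left[OF T])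
  have "cinner (cinner (a k) u *\<^sub>C a k) v = cinner u (cinner (a k) v *\<^sub>C a k)" for k
    by (simp add: cinner_scaleC_left cinner_scaleC_right mult.commute flip: cinner_commute)
  then show "((\<lambda>k. cinner (cinner (a k) u *\<^sub>C a k) v) has_sum cinner u (T v)) K"
    using has_sum_cinner_right[OF T, of u v] by simp
qed

lemma has_sum_cauchy_schwarz:
  fixes x y :: "'k \<Rightarrow> real"
  assumes x: "\<And>k. 0 \<le> x k" "((\<lambda>k. (x k)\<^sup>2) has_sum s) K" and y: "\<And>k. 0 \<le> y k" "((\<lambda>k. (y k)\<^sup>2) has_sum r) K"
  obtains z where "((\<lambda>k. x k * y k) has_sum z) K" "z \<le> sqrt s * sqrt r"
proof -
  have fin: "(\<Sum>k\<in>F. x k * y k) \<le> sqrt s * sqrt r" if F: "finite F" "F \<subseteq> K" for F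
  proof -
    have "(\<Sum>k\<in>F. x k * y k) = (\<Sum>k\<in>F. \<bar>x k\<bar> * \<bar>y k\<bar>)" using x(1) y(1) by simp
    also have "\<dots> \<le> L2_set x F * L2_set y F" by (rule L2_set_mult_ineq)
    also have "\<dots> \<le> sqrt s * sqrt r"
      unfolding L2_set_def
      using finite_sum_le_has_sum[OF x(2), of F] finite_sum_le_has_sum[OF y(2), of F] F
        has_sum_nonneg[OF x(2)]
      by (intro mult_mono real_sqrt_le_mono) (simp_all add: sum_nonneg)
    finally show ?thesis .
  qed
  have "(\<lambda>k. x k * y k) summable_on K"
  proof (rule nonneg_bdd_above_summable_on)
    show "bdd_above (sum (\<lambda>k. x k * y k) ` {F. F \<subseteq> K \<and> finite F})"
      by (rule bdd_aboveI2) (use fin in auto)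
  qed (use x(1) y(1) in simp)
  then have sm: "((\<lambda>k. x k * y k) has_sum (\<Sum>\<^sub>\<infinity>k\<in>K. x k * y k)) K" by (rule has_sum_infsum)
  moreover have "(\<Sum>\<^sub>\<infinity>k\<in>K. x k * y k) \<le> sqrt s * sqrt r"
    by (rule has_sum_le_finite_sums[OF sm]) (use fin in auto)
  ultimately show ?thesis using that by blast
qed

text \<open>Gentle measurement:
  $|a\rangle\langle a| - |b\rangle\langle b|/N
    = |a-b\rangle\langle a| + |b\rangle\langle a-b| + (1-1/N) |b\rangle\langle b|$.\<close>

lemma trace_norm_ensemble_distance:
  fixes a b :: "'k \<Rightarrow> 'a::chilbert_space"
  assumes D: "\<And>v. ((\<lambda>k. cinner (a k) v *\<^sub>C a k) has_sum D v) K"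
    and J: "\<And>v. ((\<lambda>k. cinner (b k) v *\<^sub>C b k) has_sum J v) K"
    and a: "((\<lambda>k. (norm (a k))\<^sup>2) has_sum 1) K" and b: "((\<lambda>k. (norm (b k))\<^sup>2) has_sum N) K"
    and ab: "((\<lambda>k. (norm (a k - b k))\<^sup>2) has_sum (1 - N)) K"
    and N: "0 < N" "N \<le> 1"
  shows "trace_norm (\<lambda>v. D v - (1 / N) *\<^sub>R J v) \<le> ennreal (3 * sqrt (1 - N))"
proof (rule trace_norm_le)
  have sa: "(\<lambda>k. norm (a k) * norm (a k)) summable_on K" and sb: "(\<lambda>k. norm (b k) * norm (b k)) summable_on K"
    using has_sum_imp_summable[OF a] has_sum_imp_summable[OF b] by (simp_all add: power2_eq_square)
  have bD: "bounded_clinear D" by (rule nuclear_bounded[OF sa D])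
  have bJ: "bounded_clinear J" by (rule nuclear_bounded[OF sb J])
  show "bounded_clinear (\<lambda>v. D v - (1 / N) *\<^sub>R J v)"
    by (rule bounded_clinear_minus[OF bD bounded_clinear_rmult[OF bJ]])
  show "cinner (D u - (1 / N) *\<^sub>R J u) v = cinner u (D v - (1 / N) *\<^sub>R J v)" for u v
    by (simp add: cinner_diff_left cinner_diff_right cinner_scaleR_left cinner_scaleR_right
      nuclear_selfadjoint[OF D] nuclear_selfadjoint[OF J])
next
  fix V :: "'a \<Rightarrow> 'a" and F :: "'a set"
  assume V: "bounded_clinear V" "\<And>x. norm (V x) \<le> norm x" and F: "finite F" "F \<subseteq> some_basis"
  define e where "e = 1 - N"
  have e: "0 \<le> e" "e \<le> 1" using N by (auto simp: e_def)
  define r where "r = 1 / N - 1"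
  have r: "0 \<le> r" using N by (simp add: r_def)
  obtain z1 where z1: "((\<lambda>k. norm (a k - b k) * norm (a k)) has_sum z1) K" "z1 \<le> sqrt e * sqrt 1"
    using has_sum_cauchy_schwarz[OF norm_ge_zero ab norm_ge_zero a] unfolding e_def by blast
  obtain z2 where z2: "((\<lambda>k. norm (b k) * norm (a k - b k)) has_sum z2) K" "z2 \<le> sqrt N * sqrt e"
    using has_sum_cauchy_schwarz[OF norm_ge_zero b norm_ge_zero ab] unfolding e_def by blast
  have z3: "((\<lambda>k. r * (norm (b k))\<^sup>2) has_sum r * N) K" by (rule has_sum_cmult_right[OF b])
  \<comment> \<open>The last two terms of the identity share the ket \<open>b k\<close>; together
    they are |b><d| with r = 1/N - 1 \<ge> 0. The remaining term |a-b><a| is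
    \<open>T1\<close>.\<close>
  define d where "d k = (a k - b k) - r *\<^sub>R b k" for k
  have nd: "norm (b k) * norm (d k) \<le> norm (b k) * norm (a k - b k) + r * (norm (b k))\<^sup>2" for k
  proof -
    have "norm (d k) \<le> norm (a k - b k) + r * norm (b k)"
      unfolding d_def using norm_triangle_ineq4[of "a k - b k" "r *\<^sub>R b k"] r by simp
    from mult_left_mono[OF this norm_ge_zero[of "b k"]] show ?thesis
      by (simp add: algebra_simps power2_eq_square)
  qed
  have sz: "((\<lambda>k. norm (b k) * norm (a k - b k) + r * (norm (b k))\<^sup>2) has_sum (z2 + r * N)) K"
    by (rule has_sum_add[OF z2(1) z3])
  have "(\<lambda>k. norm (b k) * norm (d k)) summable_on K"
    by (rule summable_on_comparison_test[OF has_sum_imp_summable[OF sz]]) (use nd in auto)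
  then obtain z4 where z4: "((\<lambda>k. norm (b k) * norm (d k)) has_sum z4) K" unfolding summable_on_def by blast
  have z4_le: "z4 \<le> z2 + r * N" by (rule has_sum_mono[OF z4 sz nd])
  obtain T1 where T1: "\<And>v. ((\<lambda>k. cinner (a k) v *\<^sub>C (a k - b k)) has_sum T1 v) K"
    using nuclear_operator[OF has_sum_imp_summable[OF z1(1)]] by blast
  define T2 where "T2 v = D v - (1 / N) *\<^sub>R J v - T1 v" for v
  have T2: "((\<lambda>k. cinner (d k) v *\<^sub>C b k) has_sum T2 v) K" for v
  proof -
    have "((\<lambda>k. cinner (a k) v *\<^sub>C a k + (- (1 / N)) *\<^sub>R (cinner (b k) v *\<^sub>C b k) + (-1) *\<^sub>R (cinner (a k) v *\<^sub>C (a k - b k)))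
        has_sum (D v + (- (1 / N)) *\<^sub>R J v + (-1) *\<^sub>R T1 v)) K"
      by (intro has_sum_add has_sum_scaleR D J T1)
    moreover have "cinner (a k) v *\<^sub>C a k + (- (1 / N)) *\<^sub>R (cinner (b k) v *\<^sub>C b k) + (-1) *\<^sub>R (cinner (a k) v *\<^sub>C (a k - b k))
        = cinner (d k) v *\<^sub>C b k" for k
    proof -
      have "cinner (d k) v = cinner (a k) v - complex_of_real (1 / N) * cinner (b k) v"
        by (simp add: d_def r_def cinner_diff_left cinner_scaleR_left algebra_simps)
      then have "cinner (d k) v *\<^sub>C b k = cinner (a k) v *\<^sub>C b k - complex_of_real (1 / N) *\<^sub>C (cinner (b k) v *\<^sub>C b k)"
        using scaleC_add_left[of "cinner (a k) v" "- (complex_of_real (1 / N) * cinner (b k) v)" "b k"]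
        by (simp add: scaleC_scaleC)
      then show ?thesis by (simp only: scaleC_of_real scaleC_diff_right scaleR_minus_left) simp
    qed
    ultimately show ?thesis by (simp add: T2_def)
  qed
  have "(\<Sum>x\<in>F. cmod (cinner x (V (D x - (1 / N) *\<^sub>R J x)))) = (\<Sum>x\<in>F. cmod (cinner x (V (T1 x)) + cinner x (V (T2 x))))"
  proof (rule sum.cong[OF refl])
    fix x
    have "D x - (1 / N) *\<^sub>R J x = T1 x + T2 x" by (simp add: T2_def)
    then show "cmod (cinner x (V (D x - (1 / N) *\<^sub>R J x))) = cmod (cinner x (V (T1 x)) + cinner x (V (T2 x)))"
      by (simp only: bounded_clinear_add[OF V(1)] cinner_add_right)
  qed
  also have "\<dots> \<le> (\<Sum>x\<in>F. cmod (cinner x (V (T1 x)))) + (\<Sum>x\<in>F. cmod (cinner x (V (T2 x))))"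
    unfolding sum.distrib[symmetric] by (intro sum_mono norm_triangle_ineq)
  also have "\<dots> \<le> z1 + z4"
    by (intro add_mono nuclear_partial_trace[OF T1 z1(1) V F] nuclear_partial_trace[OF T2 z4 V F])
  \<comment> \<open>The three contributions are sqrt e, sqrt (N e) and r N = e, each at most sqrt e
    because \<open>N\<close> and \<open>e\<close> lie in [0, 1].\<close>
  also have "\<dots> \<le> 3 * sqrt e"
  proof -
    have "sqrt N * sqrt e \<le> 1 * sqrt e" using N e by (intro mult_right_mono) auto
    moreover have "r * N = e" using N by (simp add: r_def e_def field_simps)
    moreover have "e \<le> sqrt e"
    proof (rule real_le_rsqrt)
      show "e\<^sup>2 \<le> e" using e mult_left_le[of e e] by (simp add: power2_eq_square)
    qed
    ultimately show ?thesis using z1(2) z2(2) z4_le by simp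
  qed
  finally show "(\<Sum>x\<in>F. cmod (cinner x (V (D x - (1 / N) *\<^sub>R J x)))) \<le> 3 * sqrt (1 - N)" by (simp add: e_def)
qed

section \<open>Projections on the two factors\<close>

lemma position_proj_mult: "position_proj \<Delta> = l2_mult (indicator \<Delta>)"
  by (auto simp: position_proj_def l2_mult_def)

lemma indicator_multiplier: "\<Delta> \<in> sets lebesgue \<Longrightarrow> bounded_multiplier (indicator \<Delta>)"
  using bounded_multiplier_indicator(1)[of \<Delta> "\<lambda>x. 1" 1] by simp

lemma projection_op_position:
  assumes \<Delta>: "\<Delta> \<in> sets lebesgue"
  shows "projection_op (position_proj \<Delta>)"
proof -
  note m = indicator_multiplier[OF \<Delta>]
  note ae = l2_fun_bounded_mult[OF m]
  have add: "l2_mult (indicator \<Delta>) (f + g) = l2_mult (indicator \<Delta>) f + l2_mult (indicator \<Delta>) g" for f g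
    unfolding l2_eq_iff
    using ae[of "f + g"] ae[of f] ae[of g] l2_fun_plus[of f g]
      l2_fun_plus[of "l2_mult (indicator \<Delta>) f" "l2_mult (indicator \<Delta>) g"]
    by eventually_elim (simp add: distrib_left)
  have scale: "l2_mult (indicator \<Delta>) (c *\<^sub>C f) = c *\<^sub>C l2_mult (indicator \<Delta>) f" for c f
    unfolding l2_eq_iff
    using ae[of "c *\<^sub>C f"] ae[of f] l2_fun_scaleC[of c f] l2_fun_scaleC[of c "l2_mult (indicator \<Delta>) f"]
    by eventually_elim simp
  have idem: "l2_mult (indicator \<Delta>) (l2_mult (indicator \<Delta>) f) = l2_mult (indicator \<Delta>) f" for f
    unfolding l2_eq_iff
    using ae[of f] ae[of "l2_mult (indicator \<Delta>) f"] by eventually_elim (simp add: indicator_def)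
  have sq: "square_integrable (\<lambda>x. indicator \<Delta> x * l2_fun f x)" for f
    by (rule bounded_multiplier_square_integrable[OF m l2_fun_square_integrable])
  have adj: "cinner (l2_mult (indicator \<Delta>) f) g = cinner f (l2_mult (indicator \<Delta>) g)" for f g
  proof -
    have "cinner (l2_mult (indicator \<Delta>) f) (l2_mult (\<lambda>x. 1) g) =
        (\<integral>x. (cnj (l2_fun f x) * l2_fun g x) * (cnj (indicator \<Delta> x) * 1) \<partial>lebesgue)"
      using sq l2_fun_square_integrable by (intro cinner_l2_mult) auto
    also have "\<dots> = (\<integral>x. (cnj (l2_fun f x) * l2_fun g x) * (cnj 1 * indicator \<Delta> x) \<partial>lebesgue)"
      by (intro Bochner_Integration.integral_cong refl) (simp add: indicator_def)
    also have "\<dots> = cinner (l2_mult (\<lambda>x. 1) f) (l2_mult (indicator \<Delta>) g)"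
      using sq l2_fun_square_integrable by (intro cinner_l2_mult[symmetric]) auto
    finally show ?thesis by simp
  qed
  have "bounded_clinear (l2_mult (indicator \<Delta>))"
  proof (rule bounded_clinearI[where K = 1])
    show "norm (l2_mult (indicator \<Delta>) f) \<le> 1 * norm f" for f
      by (rule norm_l2_mult_le[OF m]) (auto simp: indicator_def)
  qed (rule add scale)+
  then show ?thesis
    unfolding projection_op_def position_proj_mult using idem adj by auto
qed

lemma projection_op_id: "projection_op id"
  using bounded_clinear_id by (simp add: projection_op_def id_def comp_def)

lemma projection_op_0: "projection_op (\<lambda>x. 0)"
  by (simp add: projection_op_def bounded_clinear_0 comp_def)

lemma projection_pythagoras:
  assumes "projection_op P"
  shows "(norm (x - P x))\<^sup>2 = (norm x)\<^sup>2 - (norm (P x))\<^sup>2"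
proof -
  have "cinner x (P x) = cinner (P x) (P x)" using assms unfolding projection_op_def by (metis comp_apply)
  then have "Re (cinner x (P x)) = (norm (P x))\<^sup>2" by (simp add: cinner_self)
  then show ?thesis by (simp add: norm_diff_power2_cinner)
qed

context hilbert_tensor_product
begin

lemma ten_closed_subspace:
  assumes "closed S" "subspace S" "\<And>x y. ten x y \<in> S"
  shows "v \<in> S"
proof -
  have "span {ten x y |x y. True} \<subseteq> S" using assms(2,3) by (intro span_minimal) auto
  then have "closure (span {ten x y |x y. True}) \<subseteq> S" using assms(1) by (rule closure_minimal)
  then show ?thesis unfolding ten_dense by blast
qed

text \<open>Symmetry is computed on pairs of simple tensors and extended by density in one argument
  at a time.\<close>

lemma tensor_op_selfadjoint:
  assumes P: "projection_op P" and Q: "projection_op Q"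
  shows "cinner (tensor_op ten P Q u) v = cinner u (tensor_op ten P Q v)"
proof -
  let ?C = "tensor_op ten P Q"
  note C = tensor_op_projections[OF P Q]
  have cont: "continuous_on UNIV ?C" by (rule bounded_clinear_continuous_on[OF C(1)])
  have simple: "cinner (?C (ten x y)) (ten x' y') = cinner (ten x y) (?C (ten x' y'))" for x y x' y'
    using P Q by (simp add: C(2) cinner_ten projection_op_def)
  have left: "cinner (?C (ten x y)) v = cinner (ten x y) (?C v)" for x y v
  proof -
    have "v \<in> {v. cinner (?C (ten x y)) v = cinner (ten x y) (?C v)}"
    proof (rule ten_closed_subspace)
      show "closed {v. cinner (?C (ten x y)) v = cinner (ten x y) (?C v)}"
        by (intro closed_Collect_eq continuous_intros cont)
      show "subspace {v. cinner (?C (ten x y)) v = cinner (ten x y) (?C v)}"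
        by (auto simp: subspace_def cinner_add_right cinner_scaleR_right bounded_clinear_add[OF C(1)]
          bounded_clinear_scaleR[OF C(1)] bounded_clinear_zero[OF C(1)])
    qed (use simple in auto)
    then show ?thesis by blast
  qed
  have "u \<in> {u. cinner (?C u) v = cinner u (?C v)}"
  proof (rule ten_closed_subspace)
    show "closed {u. cinner (?C u) v = cinner u (?C v)}"
      by (intro closed_Collect_eq continuous_intros cont)
    show "subspace {u. cinner (?C u) v = cinner u (?C v)}"
      by (auto simp: subspace_def cinner_add_left cinner_scaleR_left bounded_clinear_add[OF C(1)]
        bounded_clinear_scaleR[OF C(1)] bounded_clinear_zero[OF C(1)])
  qed (use left in auto)
  then show ?thesis by blast
qed

lemma projection_norm_le:
  assumes "projection_op P"
  shows "norm (P x) \<le> norm x"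
proof -
  have "(norm (P x))\<^sup>2 \<le> (norm x)\<^sup>2" using projection_pythagoras[OF assms, of x] by (metis diff_ge_0_iff_ge zero_le_power2)
  then show ?thesis by (rule power2_le_imp_le) simp
qed

lemma tensor_op_wave:
  assumes \<Delta>: "\<Delta> \<in> sets lebesgue" and Q: "projection_op Q"
    and w: "continuous_on UNIV w" "\<And>x. norm (w x) \<le> C"
  shows "tensor_op ten (position_proj \<Delta>) Q (wave f w) = wave (position_proj \<Delta> f) (\<lambda>x. Q (w x))"
  unfolding position_proj_mult
proof (rule fibrewise_wave[where V = "\<lambda>x. Q" and V' = "\<lambda>x. Q"])
  note P = projection_op_position[OF \<Delta>, unfolded position_proj_mult]
  have bQ: "bounded_clinear Q" and adj: "\<And>x y. cinner (Q x) y = cinner x (Q y)"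
    using Q by (auto simp: projection_op_def)
  show "bounded_clinear (tensor_op ten (l2_mult (indicator \<Delta>)) Q)" by (rule tensor_op_projections(1)[OF P Q])
  show "tensor_op ten (l2_mult (indicator \<Delta>)) Q (ten f b) = wave (l2_mult (indicator \<Delta>) f) (\<lambda>x. Q b)" for f b
    by (simp add: tensor_op_projections(2)[OF P Q] wave_const)
  show "bounded_multiplier (indicator \<Delta>)" by (rule indicator_multiplier[OF \<Delta>])
  show "admissible f (\<lambda>x. Q b)" for f :: l2 and b by (rule admissible_const)
  show "norm (Q c) \<le> norm c" for c by (rule projection_norm_le[OF Q])
  show "cinner c (Q b) = cinner (Q c) b" for b c by (rule adj[symmetric])
  show "admissible f w" by (rule admissible_bounded[OF w])
  show "admissible (l2_mult (indicator \<Delta>) f) (\<lambda>x. Q (w x))"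
  proof (rule admissible_bounded)
    show "continuous_on UNIV (\<lambda>x. Q (w x))"
      by (rule continuous_on_compose2[OF bounded_clinear_continuous_on[OF bQ, of UNIV] w(1)]) auto
    show "norm (Q (w x)) \<le> C" for x using projection_norm_le[OF Q, of "w x"] w(2)[of x] by simp
  qed
qed simp

end

section \<open>The measured state as an ensemble\<close>

locale measured_evolution =
  tensor_evolution ten B + decoherence_expansion K c \<Gamma> \<psi>
  for ten :: "l2 \<Rightarrow> 'e::chilbert_space \<Rightarrow> 'k::chilbert_space" and B
    and K :: "'m set" and c \<Gamma> \<psi> +
  fixes \<gamma> t :: real and \<psi>E :: 'e and I :: "'i set" and \<Delta> :: "'i \<Rightarrow> real set"
  assumes psi: "norm \<psi> = 1" and psiE: "norm \<psi>E = 1"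
    and I: "countable I" and Delta: "\<And>i. i \<in> I \<Longrightarrow> \<Delta> i \<in> sets lebesgue"
    and disj: "disjoint_family_on \<Delta> I" and cover: "(\<Union>i\<in>I. \<Delta> i) = UNIV"
begin

definition w :: "real \<Rightarrow> 'e" where "w x = U (- (t * \<gamma>) * x) \<psi>E"

lemma w_cont: "continuous_on UNIV w"
  unfolding w_def by (rule U_continuous) simp

lemma w_norm: "norm (w x) = 1"
  by (simp add: w_def unitary_group_norm[OF UG] psiE)

definition state :: "'k \<Rightarrow> 'k" where
  "state = evolution ten \<gamma> B t
    (tensor_op ten (integral_op (\<lambda>x y. kernel_of (ketbra \<psi> \<psi>) x y * \<Gamma> x y)) (ketbra \<psi>E \<psi>E))"

lemma phi_summable: "(\<lambda>k. norm (\<phi> k) * norm (\<phi> k)) summable_on K"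
  using has_sum_imp_summable[OF phi_norm_has_sum] by (simp add: power2_eq_square)

text \<open>The nuclear operator built from the vectors \<phi> k \<otimes> \<psi>E has the values
  required on simple tensors, so it is the definite description \<open>tensor_op\<close>.
  Conjugation by \<open>W\<close> then turns each vector into a wave.\<close>

lemma state_has_sum:
  "((\<lambda>k. cinner (wave (\<phi> k) w) v *\<^sub>C wave (\<phi> k) w) has_sum state v) K"
proof -
  let ?a = "\<lambda>k. ten (\<phi> k) \<psi>E"
  have "(\<lambda>k. norm (?a k) * norm (?a k)) summable_on K"
    using phi_summable by (simp add: norm_ten psiE)
  then obtain C where C: "bounded_clinear C" "\<And>v. ((\<lambda>k. cinner (?a k) v *\<^sub>C ?a k) has_sum C v) K"
    using nuclear_operator[of ?a ?a] by blast
  have "tensor_op ten (integral_op (\<lambda>x y. kernel_of (ketbra \<psi> \<psi>) x y * \<Gamma> x y)) (ketbra \<psi>E \<psi>E) = C"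
  proof (rule tensor_op_eqI[OF C(1)])
    fix x :: l2 and y :: 'e
    have "((\<lambda>k. ten (cinner (\<phi> k) x *\<^sub>C \<phi> k) (ketbra \<psi>E \<psi>E y)) has_sum
        ten (integral_op (\<lambda>x y. kernel_of (ketbra \<psi> \<psi>) x y * \<Gamma> x y) x) (ketbra \<psi>E \<psi>E y)) K"
      by (rule bounded_clinear_has_sum[OF ten_left_clinear decohered_has_sum])
    moreover have "ten (cinner (\<phi> k) x *\<^sub>C \<phi> k) (ketbra \<psi>E \<psi>E y) = cinner (?a k) (ten x y) *\<^sub>C ?a k" for k
      by (simp add: ketbra_def ten_scaleC_left ten_scaleC_right cinner_ten scaleC_scaleC mult.commute)
    ultimately show "C (ten x y) = ten (integral_op (\<lambda>x y. kernel_of (ketbra \<psi> \<psi>) x y * \<Gamma> x y) x) (ketbra \<psi>E \<psi>E y)"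
      using has_sum_unique[OF C(2)] by simp
  qed
  then have st: "state v = W (- (t * \<gamma>)) (C (W (t * \<gamma>) v))"
    by (simp add: state_def evolution_def exp_coupling)
  have d: "W (- (t * \<gamma>)) (?a k) = wave (\<phi> k) w" for k
    by (simp add: W(3) w_def[abs_def])
  have "((\<lambda>k. W (- (t * \<gamma>)) (cinner (?a k) (W (t * \<gamma>) v) *\<^sub>C ?a k)) has_sum state v) K"
    unfolding st by (rule bounded_clinear_has_sum[OF W(1) C(2)])
  moreover have "cinner (?a k) (W (t * \<gamma>) v) = cinner (wave (\<phi> k) w) v" for k
    using unitary_group_adjoint[OF W_group, of "- (t * \<gamma>)" "?a k" v] by (simp add: d)
  ultimately show ?thesis by (simp add: bounded_clinear_scaleC[OF W(1)] d)
qed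

text \<open>The vector left by outcome \<open>i\<close> in the \<open>k\<close>-th member of the
  ensemble. R = id gives the first state, R = P the second, and R = id - P the difference of the two
  families.\<close>

definition branch :: "('i \<Rightarrow> 'e \<Rightarrow> 'e) \<Rightarrow> 'i \<times> 'm \<Rightarrow> 'k" where
  "branch R = (\<lambda>(i, k). wave (position_proj (\<Delta> i) (\<phi> k)) (\<lambda>x. R i (w x)))"

text \<open>The total squared norm of the branches of outcome \<open>i\<close>. For R = P it is the
  outcome probability times the trace of P_i \<Lambda>_i P_i, with the normalisation of the
  conditional state multiplied out, so it makes sense for probability 0 too.\<close>

definition weight :: "('i \<Rightarrow> 'e \<Rightarrow> 'e) \<Rightarrow> 'i \<Rightarrow> real" where
  "weight R i = (\<integral>x. (cmod (l2_fun \<psi> x))\<^sup>2 * (indicator (\<Delta> i) x * (norm (R i (w x)))\<^sup>2) \<partial>lebesgue)"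

text \<open>Wide enough to cover id - P, not only families of projections.\<close>

definition fibre_contraction :: "('i \<Rightarrow> 'e \<Rightarrow> 'e) \<Rightarrow> bool" where
  "fibre_contraction R \<longleftrightarrow> (\<forall>i\<in>I. continuous_on UNIV (\<lambda>x. R i (w x)) \<and> (\<forall>x. norm (R i (w x)) \<le> 1))"

lemma fibre_contraction_projection:
  assumes "\<forall>i\<in>I. projection_op (P i)"
  shows "fibre_contraction P"
  unfolding fibre_contraction_def
proof (intro ballI conjI allI)
  fix i x assume i: "i \<in> I"
  have "bounded_clinear (P i)" using assms[rule_format, OF i] by (simp add: projection_op_def)
  then show "continuous_on UNIV (\<lambda>x. P i (w x))"
    by (intro continuous_on_compose2[OF bounded_clinear_continuous_on[of "P i" UNIV] w_cont]) auto
  show "norm (P i (w x)) \<le> 1" using projection_norm_le[OF assms[rule_format, OF i], of "w x"] by (simp add: w_norm)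
qed

lemma fibre_admissible: "fibre_contraction R \<Longrightarrow> i \<in> I \<Longrightarrow> admissible f (\<lambda>x. R i (w x))"
  unfolding fibre_contraction_def by (intro admissible_bounded[where C = 1]) auto

lemma fibre_measurable:
  "fibre_contraction R \<Longrightarrow> i \<in> I \<Longrightarrow> (\<lambda>x. norm (R i (w x))) \<in> borel_measurable lebesgue"
  unfolding fibre_contraction_def by (intro continuous_measurable_lebesgue continuous_intros) auto

lemma branch_norm_has_sum:
  assumes R: "fibre_contraction R" and i: "i \<in> I"
  shows "((\<lambda>k. (norm (branch R (i, k)))\<^sup>2) has_sum weight R i) K"
proof -
  have [measurable]: "(\<lambda>x. norm (R i (w x))) \<in> borel_measurable lebesgue" "\<Delta> i \<in> sets lebesgue"
    by (rule fibre_measurable[OF R i], rule Delta[OF i])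
  let ?G = "\<lambda>x. indicator (\<Delta> i) x * (norm (R i (w x)))\<^sup>2"
  have G: "0 \<le> ?G x" "?G x \<le> 1" for x
    using R i by (auto simp: fibre_contraction_def indicator_def power_le_one)
  have "((\<lambda>k. \<integral>x. (cmod (l2_fun (\<phi> k) x))\<^sup>2 * ?G x \<partial>lebesgue) has_sum weight R i) K"
    unfolding weight_def by (rule phi_density_has_sum[OF _ G]) measurable
  moreover have "(norm (branch R (i, k)))\<^sup>2 = (\<integral>x. (cmod (l2_fun (\<phi> k) x))\<^sup>2 * ?G x \<partial>lebesgue)" for k
  proof -
    have "(norm (branch R (i, k)))\<^sup>2 =
        (\<integral>x. (cmod (l2_fun (position_proj (\<Delta> i) (\<phi> k)) x))\<^sup>2 * (norm (R i (w x)))\<^sup>2 \<partial>lebesgue)"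
      unfolding branch_def by (simp add: norm_wave[OF fibre_admissible[OF R i]])
    also have "\<dots> = (\<integral>x. (cmod (l2_fun (\<phi> k) x))\<^sup>2 * ?G x \<partial>lebesgue)"
    proof (rule integral_cong_AE)
      show "AE x in lebesgue. (cmod (l2_fun (position_proj (\<Delta> i) (\<phi> k)) x))\<^sup>2 * (norm (R i (w x)))\<^sup>2
          = (cmod (l2_fun (\<phi> k) x))\<^sup>2 * ?G x"
        unfolding position_proj_mult
        using l2_fun_bounded_mult[OF indicator_multiplier[OF Delta[OF i]], of "\<phi> k"]
        by eventually_elim (simp add: indicator_def)
    qed measurable
    finally show ?thesis .
  qed
  ultimately show ?thesis by simp
qed

lemma branch_norm_has_sum_all:
  assumes R: "fibre_contraction R" and S: "(weight R has_sum S) I"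
  shows "((\<lambda>p. (norm (branch R p))\<^sup>2) has_sum S) (I \<times> K)"
proof (rule has_sum_SigmaI[OF branch_norm_has_sum[OF R] S])
  show "(\<lambda>p. (norm (branch R p))\<^sup>2) summable_on I \<times> K"
    by (rule summable_on_SigmaI[OF branch_norm_has_sum[OF R] has_sum_imp_summable[OF S]]) auto
qed

lemma weight_eq: "weight R i = (LINT x:\<Delta> i|lebesgue. (cmod (l2_fun \<psi> x))\<^sup>2 * (norm (R i (w x)))\<^sup>2)"
  unfolding weight_def set_lebesgue_integral_def
  by (intro Bochner_Integration.integral_cong refl) (simp add: indicator_def)

lemma weight_id: "weight (\<lambda>i. id) i = outcome_prob \<psi> (\<Delta> i)"
  by (simp add: weight_eq outcome_prob_def w_norm)

lemma weight_integrable: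
  assumes R: "fibre_contraction R" and i: "i \<in> I"
  shows "integrable lebesgue (\<lambda>x. (cmod (l2_fun \<psi> x))\<^sup>2 * (indicator (\<Delta> i) x * (norm (R i (w x)))\<^sup>2))"
proof (rule Bochner_Integration.integrable_bound[OF l2_fun_integrable[of \<psi>]])
  have [measurable]: "(\<lambda>x. norm (R i (w x))) \<in> borel_measurable lebesgue" "\<Delta> i \<in> sets lebesgue"
    by (rule fibre_measurable[OF R i], rule Delta[OF i])
  show "(\<lambda>x. (cmod (l2_fun \<psi> x))\<^sup>2 * (indicator (\<Delta> i) x * (norm (R i (w x)))\<^sup>2)) \<in> borel_measurable lebesgue"
    by measurable
  have "indicator (\<Delta> i) x * (norm (R i (w x)))\<^sup>2 \<le> 1" for x
    using R i by (auto simp: fibre_contraction_def indicator_def power_le_one)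
  then have "(cmod (l2_fun \<psi> x))\<^sup>2 * (indicator (\<Delta> i) x * (norm (R i (w x)))\<^sup>2) \<le> (cmod (l2_fun \<psi> x))\<^sup>2 * 1" for x
    by (intro mult_left_mono) auto
  then show "AE x in lebesgue. norm ((cmod (l2_fun \<psi> x))\<^sup>2 * (indicator (\<Delta> i) x * (norm (R i (w x)))\<^sup>2))
      \<le> norm ((cmod (l2_fun \<psi> x))\<^sup>2)"
    by simp
qed

lemma weight_nonneg: "0 \<le> weight R i"
  unfolding weight_def by (intro Bochner_Integration.integral_nonneg) auto

lemma fibre_contraction_id: "fibre_contraction (\<lambda>i. id)"
  by (rule fibre_contraction_projection) (simp add: projection_op_id)

lemma weight_le:
  assumes R: "fibre_contraction R" and i: "i \<in> I"
  shows "weight R i \<le> outcome_prob \<psi> (\<Delta> i)"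
  unfolding weight_id[symmetric]
  unfolding weight_def
proof (rule integral_mono[OF weight_integrable[OF R i]])
  show "integrable lebesgue (\<lambda>x. (cmod (l2_fun \<psi> x))\<^sup>2 * (indicator (\<Delta> i) x * (norm (id (w x)))\<^sup>2))"
    using weight_integrable[OF fibre_contraction_id i] by simp
  have "(norm (R i (w x)))\<^sup>2 \<le> (norm (id (w x)))\<^sup>2" for x
    using R i by (simp add: fibre_contraction_def w_norm power_le_one)
  then show "(cmod (l2_fun \<psi> x))\<^sup>2 * (indicator (\<Delta> i) x * (norm (R i (w x)))\<^sup>2)
      \<le> (cmod (l2_fun \<psi> x))\<^sup>2 * (indicator (\<Delta> i) x * (norm (id (w x)))\<^sup>2)" for x
    by (intro mult_left_mono) (auto simp: indicator_def)
qed

lemma outcome_prob_has_sum: "((\<lambda>i. outcome_prob \<psi> (\<Delta> i)) has_sum 1) I"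
proof -
  define f where "f i x = complex_of_real (indicator (\<Delta> i) x * (cmod (l2_fun \<psi> x))\<^sup>2)" for i x
  have one: "((\<lambda>i. indicator (\<Delta> i) x :: real) has_sum 1) I" for x
  proof -
    obtain j where j: "j \<in> I" "x \<in> \<Delta> j" using cover by blast
    have "indicator (\<Delta> i) x = (0 :: real)" if "i \<in> I" "i \<noteq> j" for i
    proof -
      have "x \<notin> \<Delta> i" using disj j that unfolding disjoint_family_on_def by blast
      then show ?thesis by simp
    qed
    then show ?thesis
      by (intro has_sum_finite_neutralI[of "{j}"]) (use j in auto)
  qed
  have "((\<lambda>i. \<integral>x. f i x \<partial>lebesgue) has_sum (\<integral>x. complex_of_real ((cmod (l2_fun \<psi> x))\<^sup>2) \<partial>lebesgue)) I"
  proof (rule has_sum_integral(2)[OF I])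
    show "integrable lebesgue (f i)" if "i \<in> I" for i
      unfolding f_def
      using integrable_mult_indicator[OF Delta[OF that] l2_fun_integrable[of \<psi>]]
      by (intro integrable_of_real) simp
    show "((\<lambda>i. f i x) has_sum complex_of_real ((cmod (l2_fun \<psi> x))\<^sup>2)) I" for x
      unfolding f_def has_sum_of_real_iff
      using has_sum_cmult_left[OF one[of x], of "(cmod (l2_fun \<psi> x))\<^sup>2"] by simp
    show "(\<Sum>i\<in>F. cmod (f i x)) \<le> (cmod (l2_fun \<psi> x))\<^sup>2" if F: "finite F" "F \<subseteq> I" for F x
    proof -
      have "(\<Sum>i\<in>F. cmod (f i x)) = (\<Sum>i\<in>F. indicator (\<Delta> i) x) * (cmod (l2_fun \<psi> x))\<^sup>2"
        unfolding f_def norm_of_real sum_distrib_right by (intro sum.cong refl) (simp add: abs_mult)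
      also have "\<dots> \<le> 1 * (cmod (l2_fun \<psi> x))\<^sup>2"
        using F by (intro mult_right_mono finite_sum_le_has_sum[OF one]) auto
      finally show ?thesis by simp
    qed
  qed (rule l2_fun_integrable)
  moreover have "(\<integral>x. f i x \<partial>lebesgue) = complex_of_real (outcome_prob \<psi> (\<Delta> i))" for i
    unfolding f_def integral_complex_of_real outcome_prob_def set_lebesgue_integral_def by simp
  moreover have "(\<integral>x. complex_of_real ((cmod (l2_fun \<psi> x))\<^sup>2) \<partial>lebesgue) = complex_of_real 1"
    unfolding integral_complex_of_real using psi by (simp flip: norm_l2_power2)
  ultimately show ?thesis by (simp only: has_sum_of_real_iff)
qed

definition total_weight :: "('i \<Rightarrow> 'e \<Rightarrow> 'e) \<Rightarrow> real" where
  "total_weight P = (\<Sum>\<^sub>\<infinity>i\<in>I. weight P i)"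

lemma total_weight:
  assumes P: "fibre_contraction P"
  shows "(weight P has_sum total_weight P) I" "0 \<le> total_weight P" "total_weight P \<le> 1"
proof -
  have "weight P summable_on I"
    by (rule summable_on_comparison_test[OF has_sum_imp_summable[OF outcome_prob_has_sum] weight_le[OF P] weight_nonneg])
  then show s: "(weight P has_sum total_weight P) I" unfolding total_weight_def by (rule has_sum_infsum)
  show "0 \<le> total_weight P" by (rule has_sum_nonneg[OF s weight_nonneg])
  show "total_weight P \<le> 1" by (rule has_sum_mono[OF s outcome_prob_has_sum weight_le[OF P]])
qed

text \<open>The self-adjoint projection moves into the bra, so each row is again a sum of |b><b|.
  The family over all pairs is nuclear, and its sum may therefore be iterated as the definition of
  \<open>pinching\<close> demands.\<close>

lemma pinching_has_sum:
  assumes P: "\<forall>i\<in>I. projection_op (P i)"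
  shows "((\<lambda>p. cinner (branch P p) v *\<^sub>C branch P p) has_sum
    pinching I (\<lambda>i. tensor_op ten (position_proj (\<Delta> i)) (P i)) state v) (I \<times> K)"
proof -
  let ?Q = "\<lambda>i. tensor_op ten (position_proj (\<Delta> i)) (P i)"
  note F = fibre_contraction_projection[OF P]
  have row: "((\<lambda>k. cinner (branch P (i, k)) v *\<^sub>C branch P (i, k)) has_sum ?Q i (state (?Q i v))) K" if i: "i \<in> I" for i
  proof -
    note Q = tensor_op_projections[OF projection_op_position[OF Delta[OF i]] P[rule_format, OF i]]
    have b: "?Q i (wave (\<phi> k) w) = branch P (i, k)" for k
      unfolding branch_def using tensor_op_wave[OF Delta[OF i] P[rule_format, OF i] w_cont, of 1 "\<phi> k"] by (simp add: w_norm)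
    have "((\<lambda>k. ?Q i (cinner (wave (\<phi> k) w) (?Q i v) *\<^sub>C wave (\<phi> k) w)) has_sum ?Q i (state (?Q i v))) K"
      by (rule bounded_clinear_has_sum[OF Q(1) state_has_sum])
    moreover have "cinner (wave (\<phi> k) w) (?Q i v) = cinner (branch P (i, k)) v" for k
      using tensor_op_selfadjoint[OF projection_op_position[OF Delta[OF i]] P[rule_format, OF i], of "wave (\<phi> k) w" v]
      by (simp add: b)
    ultimately show ?thesis by (simp add: bounded_clinear_scaleC[OF Q(1)] b)
  qed
  have "(\<lambda>p. norm (branch P p) * norm (branch P p)) summable_on I \<times> K"
    using has_sum_imp_summable[OF branch_norm_has_sum_all[OF F total_weight(1)[OF F]]]
    by (simp add: power2_eq_square)
  then obtain T where T: "\<And>v. ((\<lambda>p. cinner (branch P p) v *\<^sub>C branch P p) has_sum T v) (I \<times> K)"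
    using nuclear_operator[of "branch P" "branch P" "I \<times> K"] by blast
  have "((\<lambda>i. ?Q i (state (?Q i v))) has_sum T v) I"
    by (rule has_sum_SigmaD[OF T row])
  then have "pinching I ?Q state v = T v" unfolding pinching_def by (rule infsumI)
  with T show ?thesis by simp
qed

text \<open>The trace of a sum of |b><b| is the sum of the squared norms.\<close>

lemma post_norm_eq:
  assumes P: "\<forall>i\<in>I. projection_op (P i)"
  shows "post_norm ten I \<Delta> P state = total_weight P"
proof -
  note F = fibre_contraction_projection[OF P]
  note s = branch_norm_has_sum_all[OF F total_weight(1)[OF F]]
  have "((\<lambda>p. cinner (branch P p) (branch P p)) has_sum op_trace (joint_post_state ten I \<Delta> P state)) (I \<times> K)"
  proof (rule nuclear_trace)
    show "((\<lambda>p. cinner (branch P p) v *\<^sub>C branch P p) has_sum joint_post_state ten I \<Delta> P state v) (I \<times> K)" for v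
      unfolding joint_post_state_def by (rule pinching_has_sum[OF P])
    show "(\<lambda>p. norm (branch P p) * norm (branch P p)) summable_on I \<times> K"
      using has_sum_imp_summable[OF s] by (simp add: power2_eq_square)
  qed
  moreover have "((\<lambda>p. cinner (branch P p) (branch P p)) has_sum complex_of_real (total_weight P)) (I \<times> K)"
    unfolding cinner_self has_sum_of_real_iff by (rule s)
  ultimately have "op_trace (joint_post_state ten I \<Delta> P state) = complex_of_real (total_weight P)"
    by (rule has_sum_unique)
  then show ?thesis by (simp add: post_norm_def)
qed

lemma trace_distance_le:
  assumes P: "\<forall>i\<in>I. projection_op (P i)" and N: "total_weight P > 0"
  shows "trace_norm (\<lambda>v. pinching I (\<lambda>i. tensor_op ten (position_proj (\<Delta> i)) id) state v -
    (1 / post_norm ten I \<Delta> P state) *\<^sub>R joint_post_state ten I \<Delta> P state v)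
    \<le> ennreal (3 * sqrt (1 - total_weight P))"
  unfolding post_norm_eq[OF P] joint_post_state_def
proof (rule trace_norm_ensemble_distance)
  note F = fibre_contraction_projection[OF P]
  let ?D = "\<lambda>i x. id x - P i x"
  show "((\<lambda>p. cinner (branch (\<lambda>i. id) p) v *\<^sub>C branch (\<lambda>i. id) p) has_sum
      pinching I (\<lambda>i. tensor_op ten (position_proj (\<Delta> i)) id) state v) (I \<times> K)" for v
    by (rule pinching_has_sum) (simp add: projection_op_id)
  show "((\<lambda>p. cinner (branch P p) v *\<^sub>C branch P p) has_sum
      pinching I (\<lambda>i. tensor_op ten (position_proj (\<Delta> i)) (P i)) state v) (I \<times> K)" for v
    by (rule pinching_has_sum[OF P])
  show "((\<lambda>p. (norm (branch (\<lambda>i. id) p))\<^sup>2) has_sum 1) (I \<times> K)"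
    by (rule branch_norm_has_sum_all[OF fibre_contraction_id]) (simp add: weight_id[abs_def] outcome_prob_has_sum)
  show "((\<lambda>p. (norm (branch P p))\<^sup>2) has_sum total_weight P) (I \<times> K)"
    by (rule branch_norm_has_sum_all[OF F total_weight(1)[OF F]])
  have FD: "fibre_contraction ?D"
    unfolding fibre_contraction_def
  proof (intro ballI conjI allI)
    fix i x assume i: "i \<in> I"
    show "continuous_on UNIV (\<lambda>x. id (w x) - P i (w x))"
      using F i w_cont by (auto simp: fibre_contraction_def intro!: continuous_intros)
    have "(norm (w x - P i (w x)))\<^sup>2 \<le> 1\<^sup>2"
      unfolding projection_pythagoras[OF P[rule_format, OF i]] by (simp add: w_norm)
    then show "norm (id (w x) - P i (w x)) \<le> 1" by (simp add: power2_le_imp_le)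
  qed
  \<comment> \<open>Pythagoras for the projection in every fibre; summed over the outcomes, the two
    ensembles differ by exactly 1 - N in squared norm.\<close>
  have wD: "weight ?D i = outcome_prob \<psi> (\<Delta> i) - weight P i" if i: "i \<in> I" for i
  proof -
    have "weight ?D i = (\<integral>x. (cmod (l2_fun \<psi> x))\<^sup>2 * (indicator (\<Delta> i) x * (norm (id (w x)))\<^sup>2) -
        (cmod (l2_fun \<psi> x))\<^sup>2 * (indicator (\<Delta> i) x * (norm (P i (w x)))\<^sup>2) \<partial>lebesgue)"
      unfolding weight_def
      by (intro Bochner_Integration.integral_cong refl)
        (simp add: projection_pythagoras[OF P[rule_format, OF i]] right_diff_distrib)
    also have "\<dots> = weight (\<lambda>i. id) i - weight P i"
      unfolding weight_def
      by (rule Bochner_Integration.integral_diff[OF weight_integrable[OF fibre_contraction_id i] weight_integrable[OF F i]])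
    finally show ?thesis by (simp add: weight_id)
  qed
  have "((\<lambda>i. outcome_prob \<psi> (\<Delta> i) - weight P i) has_sum (1 - total_weight P)) I"
    using has_sum_add[OF outcome_prob_has_sum has_sum_cmult_right[OF total_weight(1)[OF F], where c = "-1"]] by simp
  then have "(weight ?D has_sum (1 - total_weight P)) I"
    by (subst has_sum_cong[OF wD])
  then have "((\<lambda>p. (norm (branch ?D p))\<^sup>2) has_sum (1 - total_weight P)) (I \<times> K)"
    by (rule branch_norm_has_sum_all[OF FD])
  moreover have "branch ?D p = branch (\<lambda>i. id) p - branch P p" if "p \<in> I \<times> K" for p
    using that wave_diff[OF fibre_admissible[OF fibre_contraction_id] fibre_admissible[OF F]]
    by (auto simp: branch_def)
  ultimately show "((\<lambda>p. (norm (branch (\<lambda>i. id) p - branch P p))\<^sup>2) has_sum (1 - total_weight P)) (I \<times> K)"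
    by (subst (asm) has_sum_cong) auto
  show "0 < total_weight P" "total_weight P \<le> 1" using N total_weight[OF F] by auto
qed

text \<open>The weak integral is a bounded sesquilinear form, so it defines the unique operator that
  \<open>env_channel\<close> describes. In the trace, P_i moves onto w(x), and Parseval under the
  integral sums over the basis. Positive probability makes the normalisation by its square root
  legitimate.\<close>

lemma env_channel_trace:
  assumes i: "i \<in> I" and p: "outcome_prob \<psi> (\<Delta> i) > 0" and P: "projection_op (P i)"
  shows "op_trace (P i \<circ> env_channel \<gamma> B t (cond_state \<psi> (\<Delta> i)) (ketbra \<psi>E \<psi>E) \<circ> P i)
    = complex_of_real (weight P i / outcome_prob \<psi> (\<Delta> i))"
proof -
  define \<xi> where "\<xi> = cond_state \<psi> (\<Delta> i)"
  define r where "r = outcome_prob \<psi> (\<Delta> i)"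
  define G where "G x = complex_of_real ((cmod (l2_fun \<xi> x))\<^sup>2)" for x
  have [measurable]: "\<Delta> i \<in> sets lebesgue" by (rule Delta[OF i])
  have [measurable]: "G \<in> borel_measurable lebesgue" unfolding G_def by measurable
  have Gint: "integrable lebesgue (\<lambda>x. cmod (G x))"
    unfolding G_def norm_of_real using l2_fun_integrable[of \<xi>] by simp
  have m: "bounded_multiplier (\<lambda>x. indicator (\<Delta> i) x * complex_of_real (1 / sqrt r))"
    by (rule bounded_multiplier_indicator(1)[OF Delta[OF i], where K = "\<bar>1 / sqrt r\<bar>"])
       (auto simp: norm_divide)
  have "\<xi> = l2_mult (\<lambda>x. indicator (\<Delta> i) x * complex_of_real (1 / sqrt r)) \<psi>"
    unfolding \<xi>_def cond_state_def l2_mult_def r_def by (rule arg_cong[of _ _ l2_of]) auto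
  note \<xi> = this
  have \<xi>_ae: "AE x in lebesgue. G x = complex_of_real (indicator (\<Delta> i) x * (cmod (l2_fun \<psi> x))\<^sup>2 / r)"
    using l2_fun_bounded_mult[OF m, of \<psi>, folded \<xi>]
  proof eventually_elim
    case (elim x)
    have "(1 / sqrt r)\<^sup>2 = 1 / r" using p by (simp add: r_def power_divide)
    moreover have "cmod (l2_fun \<xi> x) = indicator (\<Delta> i) x * (1 / sqrt r) * cmod (l2_fun \<psi> x)"
      using elim p by (simp add: norm_mult norm_divide r_def indicator_def)
    ultimately show ?case
      unfolding G_def by (simp only: power_mult_distrib) (simp add: indicator_def)
  qed
  define b where "b u v = (\<integral>x. G x * (cinner u (w x) * cinner (w x) v) \<partial>lebesgue)" for u v
  have cw [measurable]: "(\<lambda>x. cinner u (w x)) \<in> borel_measurable lebesgue" "(\<lambda>x. cinner (w x) u) \<in> borel_measurable lebesgue" for u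
    by (intro continuous_measurable_lebesgue continuous_intros w_cont)+
  have ble: "cmod (G x * (cinner u (w x) * cinner (w x) v)) \<le> cmod (G x) * (norm u * norm v)" for x u v
  proof -
    have "cmod (cinner u (w x)) \<le> norm u" "cmod (cinner (w x) v) \<le> norm v"
      using cmod_cinner_le[of u "w x"] cmod_cinner_le[of "w x" v] by (simp_all add: w_norm)
    then show ?thesis unfolding norm_mult by (intro mult_left_mono mult_mono) auto
  qed
  have bint: "integrable lebesgue (\<lambda>x. G x * (cinner u (w x) * cinner (w x) v))" for u v
  proof (rule Bochner_Integration.integrable_bound)
    show "integrable lebesgue (\<lambda>x. cmod (G x) * (norm u * norm v))" using Gint by simp
    show "AE x in lebesgue. norm (G x * (cinner u (w x) * cinner (w x) v)) \<le> norm (cmod (G x) * (norm u * norm v))"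
      using ble by simp
  qed measurable
  have "\<exists>L. bounded_clinear L \<and> (\<forall>u v. cinner u (L v) = b u v)"
  proof (rule sesquilinear_operator)
    show "b (u + u') v = b u v + b u' v" for u u' v
      unfolding b_def by (simp add: cinner_add_left distrib_right distrib_left bint)
    show "b u (v + v') = b u v + b u v'" for u v v'
      unfolding b_def by (simp add: cinner_add_right distrib_left bint)
    show "b (c *\<^sub>C u) v = cnj c * b u v" for c u v
      unfolding b_def by (simp add: cinner_scaleC_left mult_ac flip: integral_mult_right_zero)
    show "b u (c *\<^sub>C v) = c * b u v" for c u v
      unfolding b_def by (simp add: cinner_scaleC_right mult_ac flip: integral_mult_right_zero)
    show "cmod (b u v) \<le> (\<integral>x. cmod (G x) \<partial>lebesgue) * norm u * norm v" for u v
    proof -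
      have "cmod (b u v) \<le> (\<integral>x. cmod (G x * (cinner u (w x) * cinner (w x) v)) \<partial>lebesgue)"
        unfolding b_def by (rule integral_norm_bound)
      also have "\<dots> \<le> (\<integral>x. cmod (G x) * (norm u * norm v) \<partial>lebesgue)"
        using bint Gint by (intro integral_mono ble) auto
      finally show ?thesis by (simp add: mult.assoc)
    qed
  qed
  then obtain L where L: "bounded_clinear L" "\<And>u v. cinner u (L v) = b u v" by blast
  have "env_channel \<gamma> B t \<xi> (ketbra \<psi>E \<psi>E) = L"
    unfolding env_channel_def
  proof (rule the_equality)
    have eq: "cinner u (U (- (t * \<gamma> * x)) (ketbra \<psi>E \<psi>E (U (t * \<gamma> * x) v))) = cinner u (w x) * cinner (w x) v" for u x v
    proof -
      have "cinner (w x) v = cinner \<psi>E (U (t * \<gamma> * x) v)"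
        unfolding w_def by (subst unitary_group_adjoint[OF UG]) simp
      then show ?thesis
        by (simp add: ketbra_def bounded_clinear_scaleC[OF unitary_group_simps(1)[OF UG]] cinner_scaleC_right w_def mult.commute)
    qed
    show "bounded_clinear L \<and> (\<forall>u v. cinner u (L v) = (\<integral>x. complex_of_real ((cmod (l2_fun \<xi> x))\<^sup>2) *
        cinner u (U (- (t * \<gamma> * x)) (ketbra \<psi>E \<psi>E (U (t * \<gamma> * x) v))) \<partial>lebesgue))"
      using L unfolding eq b_def G_def by blast
    fix L' assume L': "bounded_clinear L' \<and> (\<forall>u v. cinner u (L' v) = (\<integral>x. complex_of_real ((cmod (l2_fun \<xi> x))\<^sup>2) *
        cinner u (U (- (t * \<gamma> * x)) (ketbra \<psi>E \<psi>E (U (t * \<gamma> * x) v))) \<partial>lebesgue))"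
    have "L' v = L v" for v
      by (rule cinner_right_eqI) (use L' L(2) in \<open>simp add: eq b_def G_def\<close>)
    then show "L' = L" by blast
  qed
  have bP: "bounded_clinear (P i)" and adj: "\<And>x y. cinner (P i x) y = cinner x (P i y)"
    using P by (auto simp: projection_op_def)
  have Pw: "continuous_on UNIV (\<lambda>x. P i (w x))"
    by (rule continuous_on_compose2[OF bounded_clinear_continuous_on[OF bP, of UNIV] w_cont]) auto
  have Pn: "norm (P i (w x)) \<le> 1" for x using projection_norm_le[OF P, of "w x"] by (simp add: w_norm)
  have [measurable]: "(\<lambda>x. norm (P i (w x))) \<in> borel_measurable lebesgue"
    by (intro continuous_measurable_lebesgue continuous_intros Pw)
  have "((\<lambda>h. \<integral>x. G x * (cinner (P i (w x)) h * cinner h (P i (w x))) \<partial>lebesgue) has_sum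
      (\<integral>x. G x * cinner (P i (w x)) (P i (w x)) \<partial>lebesgue)) some_basis"
  proof (rule parseval_integral[OF Pw Pw])
    show "integrable lebesgue (\<lambda>x. cmod (G x) * (norm (P i (w x)) * norm (P i (w x))))"
    proof (rule Bochner_Integration.integrable_bound[OF Gint])
      have "cmod (G x) * (norm (P i (w x)) * norm (P i (w x))) \<le> cmod (G x) * (1 * 1)" for x
        by (intro mult_left_mono mult_mono Pn) auto
      then show "AE x in lebesgue. norm (cmod (G x) * (norm (P i (w x)) * norm (P i (w x)))) \<le> norm (cmod (G x))"
        by simp
    qed measurable
  qed measurable
  moreover have "cinner h ((P i \<circ> env_channel \<gamma> B t \<xi> (ketbra \<psi>E \<psi>E) \<circ> P i) h)
      = (\<integral>x. G x * (cinner (P i (w x)) h * cinner h (P i (w x))) \<partial>lebesgue)" for h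
  proof -
    have "cinner h ((P i \<circ> env_channel \<gamma> B t \<xi> (ketbra \<psi>E \<psi>E) \<circ> P i) h) = b (P i h) (P i h)"
      unfolding \<open>env_channel \<gamma> B t \<xi> (ketbra \<psi>E \<psi>E) = L\<close> by (simp flip: L(2) adj)
    then show ?thesis unfolding b_def by (simp add: adj mult.commute)
  qed
  ultimately have "op_trace (P i \<circ> env_channel \<gamma> B t \<xi> (ketbra \<psi>E \<psi>E) \<circ> P i)
      = (\<integral>x. G x * cinner (P i (w x)) (P i (w x)) \<partial>lebesgue)"
    unfolding op_trace_def by (intro infsumI) simp
  also have "\<dots> = (\<integral>x. complex_of_real ((cmod (l2_fun \<psi> x))\<^sup>2 * (indicator (\<Delta> i) x * (norm (P i (w x)))\<^sup>2) / r) \<partial>lebesgue)"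
  proof (rule integral_cong_AE)
    show "AE x in lebesgue. G x * cinner (P i (w x)) (P i (w x))
        = complex_of_real ((cmod (l2_fun \<psi> x))\<^sup>2 * (indicator (\<Delta> i) x * (norm (P i (w x)))\<^sup>2) / r)"
      using \<xi>_ae by eventually_elim (simp add: cinner_self)
    show "(\<lambda>x. G x * cinner (P i (w x)) (P i (w x))) \<in> borel_measurable lebesgue"
      unfolding cinner_self by measurable
  qed measurable
  also have "\<dots> = complex_of_real (weight P i / r)"
    unfolding integral_complex_of_real weight_def by simp
  finally show ?thesis by (simp add: \<xi>_def r_def)
qed

text \<open>Each positive outcome contributes its probability minus its weight. At probability 0
  this difference vanishes as well, since the weight lies between 0 and the probability, so the
  omitted outcomes can be restored.\<close>

lemma total_error:
  assumes P: "\<forall>i\<in>I. projection_op (P i)"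
  shows "(\<Sum>\<^sub>\<infinity>i\<in>{i\<in>I. outcome_prob \<psi> (\<Delta> i) > 0}. outcome_prob \<psi> (\<Delta> i) *
    (1 - Re (op_trace (P i \<circ> env_channel \<gamma> B t (cond_state \<psi> (\<Delta> i)) (ketbra \<psi>E \<psi>E) \<circ> P i))))
    = 1 - total_weight P"
proof (rule infsumI)
  note F = fibre_contraction_projection[OF P]
  let ?I = "{i\<in>I. outcome_prob \<psi> (\<Delta> i) > 0}"
  have "((\<lambda>i. outcome_prob \<psi> (\<Delta> i) - weight P i) has_sum (1 - total_weight P)) I"
    using has_sum_add[OF outcome_prob_has_sum has_sum_cmult_right[OF total_weight(1)[OF F], where c = "-1"]] by simp
  moreover have "((\<lambda>i. outcome_prob \<psi> (\<Delta> i) *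
      (1 - Re (op_trace (P i \<circ> env_channel \<gamma> B t (cond_state \<psi> (\<Delta> i)) (ketbra \<psi>E \<psi>E) \<circ> P i)))) has_sum (1 - total_weight P)) ?I
    \<longleftrightarrow> ((\<lambda>i. outcome_prob \<psi> (\<Delta> i) - weight P i) has_sum (1 - total_weight P)) I"
  proof (rule has_sum_cong_neutral)
    fix i assume "i \<in> I - ?I"
    then show "outcome_prob \<psi> (\<Delta> i) - weight P i = 0"
      using weight_le[OF F, of i] weight_nonneg[of P i] by auto
  next
    fix i assume i: "i \<in> ?I \<inter> I"
    then show "outcome_prob \<psi> (\<Delta> i) *
      (1 - Re (op_trace (P i \<circ> env_channel \<gamma> B t (cond_state \<psi> (\<Delta> i)) (ketbra \<psi>E \<psi>E) \<circ> P i)))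
      = outcome_prob \<psi> (\<Delta> i) - weight P i"
      using P by (simp add: env_channel_trace right_diff_distrib)
  qed auto
  ultimately show "((\<lambda>i. outcome_prob \<psi> (\<Delta> i) *
      (1 - Re (op_trace (P i \<circ> env_channel \<gamma> B t (cond_state \<psi> (\<Delta> i)) (ketbra \<psi>E \<psi>E) \<circ> P i)))) has_sum (1 - total_weight P)) ?I"
    by blast
qed

text \<open>The identity is assigned to one outcome of positive probability and 0 to the others.
  This keeps the infimum on the left over a nonempty set, which is what a measurement with N = 0 on
  the right is compared with.\<close>

lemma trivial_pvm:
  obtains P where "pvm I P" "total_weight P > 0"
proof -
  obtain j where j: "j \<in> I" "outcome_prob \<psi> (\<Delta> j) > 0"
  proof (rule ccontr)
    assume "\<not> thesis"
    then have "outcome_prob \<psi> (\<Delta> i) \<le> 0" if "i \<in> I" for i using that \<open>\<And>j. j \<in> I \<Longrightarrow> 0 < outcome_prob \<psi> (\<Delta> j) \<Longrightarrow> thesis\<close> by force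
    then have "(1 :: real) \<le> 0" using has_sum_mono[OF outcome_prob_has_sum has_sum_0, of "\<lambda>_. 0"] by simp
    then show False by simp
  qed
  define P :: "'i \<Rightarrow> 'e \<Rightarrow> 'e" where "P i = (if i = j then id else (\<lambda>x. 0))" for i
  have pr: "projection_op (P i)" for i by (simp add: P_def projection_op_id projection_op_0)
  have "((\<lambda>i. P i x) has_sum x) I" for x
    by (rule has_sum_finite_neutralI[of "{j}"]) (use j in \<open>auto simp: P_def\<close>)
  then have "pvm I P" unfolding pvm_def using pr by (auto simp: P_def)
  moreover have "weight P j \<le> total_weight P"
  proof -
    have "(\<Sum>i\<in>{j}. weight P i) \<le> total_weight P"
      by (rule finite_sum_le_has_sum[OF total_weight(1)]) (use j fibre_contraction_projection pr weight_nonneg in auto)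
    then show ?thesis by simp
  qed
  moreover have "weight P j = outcome_prob \<psi> (\<Delta> j)"
    unfolding weight_id[symmetric] by (simp add: weight_def P_def)
  ultimately show ?thesis using that j(2) by auto
qed

lemma infimum_bound:
  shows
    "(INF P\<in>{P. pvm I P \<and> post_norm ten I \<Delta> P state > 0}.
        ennreal (1 / 2) * trace_norm (\<lambda>v.
          pinching I (\<lambda>i. tensor_op ten (position_proj (\<Delta> i)) id) state v -
          (1 / post_norm ten I \<Delta> P state) *\<^sub>R joint_post_state ten I \<Delta> P state v))
     \<le> 4 * (INF P\<in>{P. pvm I P}. ennreal (sqrt (
          \<Sum>\<^sub>\<infinity>i\<in>{i\<in>I. outcome_prob \<psi> (\<Delta> i) > 0}. outcome_prob \<psi> (\<Delta> i) *
            (1 - Re (op_trace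
              (P i \<circ> env_channel \<gamma> B t (cond_state \<psi> (\<Delta> i)) (ketbra \<psi>E \<psi>E) \<circ> P i))))))"
    (is "?X \<le> 4 * (INF P\<in>{P. pvm I P}. ?f P)")
proof -
  have pr: "\<forall>i\<in>I. projection_op (P i)" if "pvm I P" for P :: "'i \<Rightarrow> 'e \<Rightarrow> 'e"
    using that by (simp add: pvm_def)
  have X: "?X \<le> 4 * ennreal (sqrt (1 - total_weight P))" if P: "pvm I P" and N: "total_weight P > 0" for P
  proof -
    have "?X \<le> ennreal (1 / 2) * trace_norm (\<lambda>v.
          pinching I (\<lambda>i. tensor_op ten (position_proj (\<Delta> i)) id) state v -
          (1 / post_norm ten I \<Delta> P state) *\<^sub>R joint_post_state ten I \<Delta> P state v)"
      by (rule INF_lower) (use P N post_norm_eq[OF pr[OF P]] in simp)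
    also have "\<dots> \<le> ennreal (1 / 2) * ennreal (3 * sqrt (1 - total_weight P))"
      by (intro mult_left_mono trace_distance_le[OF pr[OF P] N]) auto
    also have "\<dots> = ennreal (3 / 2 * sqrt (1 - total_weight P))"
      by (simp only: ennreal_mult'[symmetric]) simp
    also have "\<dots> \<le> ennreal (4 * sqrt (1 - total_weight P))"
      using total_weight(3)[OF fibre_contraction_projection[OF pr[OF P]]] by (intro ennreal_leI mult_right_mono) auto
    also have "\<dots> = 4 * ennreal (sqrt (1 - total_weight P))"
      by (simp add: ennreal_mult')
    finally show ?thesis .
  qed
  \<comment> \<open>Dividing by 4 puts the bound into the form of a lower bound for the infimum over
    all measurements.\<close>
  have "?X / 4 \<le> ?f P" if P: "pvm I P" for P
  proof -
    note tw = total_weight[OF fibre_contraction_projection[OF pr[OF P]]]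
    have "?X \<le> 4 * ennreal (sqrt (1 - total_weight P))"
    proof (cases "total_weight P > 0")
      case True
      with X[OF P] show ?thesis by blast
    next
      case False
      then have 0: "total_weight P = 0" using tw by simp
      obtain P0 where P0: "pvm I P0" "total_weight P0 > 0" by (rule trivial_pvm)
      have "?X \<le> 4 * ennreal (sqrt (1 - total_weight P0))" by (rule X[OF P0])
      also have "\<dots> \<le> 4 * ennreal (sqrt (1 - total_weight P))"
        using P0(2) by (intro mult_left_mono ennreal_leI real_sqrt_le_mono) (simp_all add: 0)
      finally show ?thesis .
    qed
    also have "4 * ennreal (sqrt (1 - total_weight P)) = ?f P * 4"
      by (simp add: total_error[OF pr[OF P]] mult.commute)
    finally have "?X / 4 \<le> ?f P * 4 / 4" by (rule divide_right_mono_ennreal)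
    then show ?thesis by (simp add: mult_divide_eq_ennreal)
  qed
  then have "?X / 4 \<le> (INF P\<in>{P. pvm I P}. ?f P)" by (intro INF_greatest) auto
  then have "4 * (?X / 4) \<le> 4 * (INF P\<in>{P. pvm I P}. ?f P)" by (rule mult_left_mono) simp
  moreover have "4 * (?X / 4) = ?X"
    by (simp add: ennreal_times_divide mult_divide_eq_ennreal mult.commute[of 4])
  ultimately show ?thesis by simp
qed

end

theorem theorem3:
  fixes ten :: "l2 \<Rightarrow> 'e::chilbert_space \<Rightarrow> 'k::chilbert_space"
    and B :: "('e \<times> 'e) set"
    and B' :: "('f::chilbert_space \<times> 'f) set"
    and \<gamma> \<gamma>' t :: real
    and \<rho>' :: "'f \<Rightarrow> 'f"
    and \<psi>S :: l2 and \<psi>E :: 'e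
    and I :: "'i set" and \<Delta> :: "'i \<Rightarrow> real set"
    and \<rho> :: "'k \<Rightarrow> 'k"
  assumes "hilbert_tensor ten"
    and "self_adjoint B" and "self_adjoint B'"
    and "density_operator \<rho>'"
    and "norm \<psi>S = 1" and "norm \<psi>E = 1"
    and "t > 0"
    and "countable I"
    and "\<And>i. i \<in> I \<Longrightarrow> \<Delta> i \<in> sets lebesgue"
    and "disjoint_family_on \<Delta> I" and "(\<Union>i\<in>I. \<Delta> i) = UNIV"
    and \<rho>_def: "\<rho> = total_state ten \<gamma> B \<gamma>' B' \<rho>' (ketbra \<psi>S \<psi>S) (ketbra \<psi>E \<psi>E) t"
  shows
    "(INF P\<in>{P. pvm I P \<and> post_norm ten I \<Delta> P \<rho> > 0}.
        ennreal (1 / 2) * trace_norm (\<lambda>v.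
          pinching I (\<lambda>i. tensor_op ten (position_proj (\<Delta> i)) id) \<rho> v -
          (1 / post_norm ten I \<Delta> P \<rho>) *\<^sub>R joint_post_state ten I \<Delta> P \<rho> v))
     \<le> 4 * (INF P\<in>{P. pvm I P}. ennreal (sqrt (
          \<Sum>\<^sub>\<infinity>i\<in>{i\<in>I. outcome_prob \<psi>S (\<Delta> i) > 0}. outcome_prob \<psi>S (\<Delta> i) *
            (1 - Re (op_trace
              (P i \<circ> env_channel \<gamma> B t (cond_state \<psi>S (\<Delta> i)) (ketbra \<psi>E \<psi>E) \<circ> P i))))))"
proof -
  obtain K :: "('f \<times> 'f) set" and c where Kc: "countable K" "\<forall>k. continuous_on UNIV (c k)"
    "\<forall>x. ((\<lambda>k. (cmod (c k x))\<^sup>2) has_sum 1) K"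
    "\<forall>x y. ((\<lambda>k. c k x * cnj (c k y)) has_sum decoherence_factor \<gamma>' B' \<rho>' t x y) K"
    using decoherence_factor_expansion[OF assms(3,4), of \<gamma>' t] by blast
  interpret measured_evolution ten B K c "decoherence_factor \<gamma>' B' \<rho>' t" \<psi>S \<gamma> t \<psi>E I \<Delta>
    by unfold_locales (use assms Kc in auto)
  have "\<rho> = state"
    unfolding \<rho>_def state_def total_state_def decoherence_map_def ..
  then show ?thesis using infimum_bound by simp
qed

end
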